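(* Fix $g\ge 3$. The space $H_g^{(2),\mathrm{tr}}$ of 2-edge-connected hyperelliptic tropical curves of genus $g$ is a stacky fan which is pure of dimension $2g-1$. Its maximal cells correspond to ladders of genus $g$ (i.e. the maximal cells are exactly the cells whose constrained type has underlying graph a ladder of genus $g$).
   Context: A combinatorial type is a pair $(G,w)$ with $G$ a finite connected multigraph (loops allowed) and $w:V(G)\to\mathbb{Z}_{\ge0}$ such that every vertex with $w(v)=0$ has valence at least $3$; its genus is $|E(G)|-|V(G)|+1+\sum_v w(v)$. A constrained type is a triple $(G,w,r)$ with $r$ an equivalence relation on $E(G)$ (meaning $r$-equivalent edges must have equal length); $N_r$ is its set of classes. Contracting along a union $S$ of $r$-classes means contracting the edges of $S$ (contracting a loop at $v$ deletes it and adds $1$ to $w(v)$; contracting a nonloop edge $v_1v_2$ deletes it and identifies $v_1,v_2$ into a vertex of weight $w(v_1)+w(v_2)$) and restricting $r$. An automorphism of $(G,w,r)$ is a graph automorphism preserving $w$ and $r$. $G^w$ is $G$ with $w(v)$ loops added at each $v$; $G^w_-$ is the loopless graph obtained by adding a vertex in the interior of each loop of $G^w$. A morphism of loopless graphs $\phi:G\to G'$ is a map $V(G)\cup E(G)\to V(G')\cup E(G')$ with $\phi(V(G))\subseteq V(G')$ such that an edge $xy$ sent to a vertex has $\phi(x)=\phi(y)$ equal to that vertex, and an edge sent to an edge is sent to an edge between $\phi(x),\phi(y)$. It is harmonic if for each vertex $x$ the number $m_\phi(x)$ of edges at $x$ mapped to $e'$ is the same for all edges $e'$ incident to $\phi(x)$;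 nondegenerate if $m_\phi(x)>0$ for all $x$; its degree is the number of edges mapped to any fixed edge of $G'$. A constrained type $(G,w,r)$ is 2-edge-connected hyperelliptic if (1) $G$ is 2-edge-connected, (2) $G^w_-$ has a nondegenerate harmonic morphism $\phi$ of degree $2$ to a tree, or $|V(G)|=2$, and (3) the relation $r$ is induced by the fibers of $\phi$ on the nonloop edges of $G$ and is trivial on the loops of $G$. Let $\mathcal{C}^{(2)}_g$ be the set of such types of genus $g$ (it is closed under contraction). Then $H_g^{(2),\mathrm{tr}}=\coprod_{(G,w,r)\in\mathcal{C}_g^{(2)}}\mathbb{R}^{N_r}_{\ge0}/\mathrm{Aut}(G,w,r)\big/\!\sim$, where a point of $\mathbb{R}^{N_r}_{\ge 0}$ is viewed as an $r$-compatible assignment of lengths to $E(G)$ and two points are identified if the tropical curves obtained by contracting all edges of length zero are isomorphic. It is a stacky fan with one cell $\mathbb{R}^{N_r}_{\ge0}/\mathrm{Aut}(G,w,r)$ for each type, of dimension $|N_r|$; a cell lies in (the closure of) another when its type is a contraction of the other's. The dimension of the stacky fan is the largest cell dimension, and it is pure if all maximal cells have the same dimension. Ladders: for a tree $T$ with at least two vertices and maximum degree $\le 3$, $L(T)$ is obtained by taking two disjoint copies of $T$ with corresponding vertices $v_i,v_i'$, adding two edges between $v_i$ and $v_i'$ when $\deg v_i=1$ and one edge when $\deg v_i=2$. A graph of the form $L(T)$ is a ladder.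
   Formalization: In condition (2), "|V(G)|=2" is read as |V(G^w_-)|=2, with r trivial (else 3 parallel edges plus g-2 loops at one end gives a maximal cell of dimension at most g+1); r relates only edges in a common fibre of φ over an edge of the tree. *)

theory Defs
  imports "HOL-Analysis.Analysis" "HOL-Algebra.Bij"
begin

section \<open>Multigraphs\<close>

text \<open>The set of ends of a loop is a singleton; that of any other edge has two elements.\<close>

record ('v, 'e) mgraph =
  verts :: "'v set"
  edges :: "'e set"
  ends :: "'e \<Rightarrow> 'v set"

definition finite_graph :: "('v, 'e) mgraph \<Rightarrow> bool" where
  "finite_graph G \<longleftrightarrow> finite (verts G) \<and> finite (edges G) \<and>
     (\<forall>e\<in>edges G. ends G e \<subseteq> verts G \<and> (card (ends G e) = 1 \<or> card (ends G e) = 2))"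

definition is_loop :: "('v, 'e) mgraph \<Rightarrow> 'e \<Rightarrow> bool" where
  "is_loop G e \<longleftrightarrow> card (ends G e) = 1"

definition valence :: "('v, 'e) mgraph \<Rightarrow> 'v \<Rightarrow> nat" where
  "valence G v = (\<Sum>e\<in>{e \<in> edges G. v \<in> ends G e}. if is_loop G e then 2 else 1)"

definition adjacency :: "('v, 'e) mgraph \<Rightarrow> ('v \<times> 'v) set" where
  "adjacency G = {(u, v). \<exists>e\<in>edges G. ends G e = {u, v}}"

definition connected_graph :: "('v, 'e) mgraph \<Rightarrow> bool" where
  "connected_graph G \<longleftrightarrow> verts G \<noteq> {} \<and> (\<forall>u\<in>verts G. \<forall>v\<in>verts G. (u, v) \<in> (adjacency G)\<^sup>*)"

definition delete_edge :: "('v, 'e) mgraph \<Rightarrow> 'e \<Rightarrow> ('v, 'e) mgraph" where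
  "delete_edge G e = G\<lparr>edges := edges G - {e}\<rparr>"

definition two_edge_connected :: "('v, 'e) mgraph \<Rightarrow> bool" where
  "two_edge_connected G \<longleftrightarrow> connected_graph G \<and> (\<forall>e\<in>edges G. connected_graph (delete_edge G e))"

text \<open>A cycle (possibly a loop or a pair of parallel edges) passes through an edge exactly if
  the ends of that edge remain joined by a path after its deletion.\<close>

definition acyclic_graph :: "('v, 'e) mgraph \<Rightarrow> bool" where
  "acyclic_graph G \<longleftrightarrow>
     (\<forall>e\<in>edges G. \<forall>u v. ends G e = {u, v} \<longrightarrow> (u, v) \<notin> (adjacency (delete_edge G e))\<^sup>*)"

definition tree_graph :: "('v, 'e) mgraph \<Rightarrow> bool" where
  "tree_graph T \<longleftrightarrow> finite_graph T \<and> connected_graph T \<and> acyclic_graph T"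

definition graph_genus :: "('v, 'e) mgraph \<Rightarrow> int" where
  "graph_genus G = int (card (edges G)) - int (card (verts G)) + 1"

definition graph_iso_via ::
    "('v \<Rightarrow> 'w) \<Rightarrow> ('e \<Rightarrow> 'd) \<Rightarrow> ('v, 'e) mgraph \<Rightarrow> ('w, 'd) mgraph \<Rightarrow> bool" where
  "graph_iso_via f h G G' \<longleftrightarrow> bij_betw f (verts G) (verts G') \<and> bij_betw h (edges G) (edges G') \<and>
     (\<forall>e\<in>edges G. ends G' (h e) = f ` ends G e)"

definition graph_iso :: "('v, 'e) mgraph \<Rightarrow> ('w, 'd) mgraph \<Rightarrow> bool" where
  "graph_iso G G' \<longleftrightarrow> (\<exists>f h. graph_iso_via f h G G')"


section \<open>Combinatorial types and constrained types\<close>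

text \<open>A constrained type \<open>(G, w, r)\<close>; the values of \<open>w\<close> off \<open>verts G\<close> and of \<open>ends G\<close> off
  \<open>edges G\<close> are irrelevant.\<close>

type_synonym ctype = "(nat, nat) mgraph \<times> (nat \<Rightarrow> nat) \<times> (nat \<times> nat) set"

definition combinatorial_type :: "('v, 'e) mgraph \<Rightarrow> ('v \<Rightarrow> nat) \<Rightarrow> bool" where
  "combinatorial_type G w \<longleftrightarrow> finite_graph G \<and> connected_graph G \<and>
     (\<forall>v\<in>verts G. w v = 0 \<longrightarrow> 3 \<le> valence G v)"

definition type_genus :: "('v, 'e) mgraph \<Rightarrow> ('v \<Rightarrow> nat) \<Rightarrow> int" where
  "type_genus G w = graph_genus G + (\<Sum>v\<in>verts G. int (w v))"

fun constrained_type :: "ctype \<Rightarrow> bool" where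
  "constrained_type (G, w, r) \<longleftrightarrow> combinatorial_type G w \<and> equiv (edges G) r"

fun ctype_iso_via :: "(nat \<Rightarrow> nat) \<Rightarrow> (nat \<Rightarrow> nat) \<Rightarrow> ctype \<Rightarrow> ctype \<Rightarrow> bool" where
  "ctype_iso_via f h (G, w, r) (G', w', r') \<longleftrightarrow> graph_iso_via f h G G' \<and>
     (\<forall>v\<in>verts G. w' (f v) = w v) \<and>
     (\<forall>d\<in>edges G. \<forall>e\<in>edges G. (h d, h e) \<in> r' \<longleftrightarrow> (d, e) \<in> r)"

definition ctype_iso :: "ctype \<Rightarrow> ctype \<Rightarrow> bool" where
  "ctype_iso t t' \<longleftrightarrow> (\<exists>f h. ctype_iso_via f h t t')"

fun edge_classes :: "ctype \<Rightarrow> nat set set" where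
  "edge_classes (G, w, r) = edges G // r"


section \<open>Harmonic morphisms\<close>

text \<open>The graph \<open>G\<^sup>w\<close>.\<close>

definition add_weight_loops ::
    "('v, 'e) mgraph \<Rightarrow> ('v \<Rightarrow> nat) \<Rightarrow> ('v, 'e + 'v \<times> nat) mgraph" where
  "add_weight_loops G w =
     \<lparr>verts = verts G,
      edges = Inl ` edges G \<union> Inr ` {(v, k). v \<in> verts G \<and> k < w v},
      ends = (\<lambda>x. case x of Inl e \<Rightarrow> ends G e | Inr (v, k) \<Rightarrow> {v})\<rparr>"

text \<open>A loop \<open>e\<close> is replaced by a new vertex \<open>Inr e\<close> and two edges \<open>(e, False)\<close>, \<open>(e, True)\<close>;
  a nonloop edge \<open>e\<close> persists as \<open>(e, False)\<close>.\<close>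

definition subdivide_loops :: "('v, 'e) mgraph \<Rightarrow> ('v + 'e, 'e \<times> bool) mgraph" where
  "subdivide_loops G =
     \<lparr>verts = Inl ` verts G \<union> Inr ` {e \<in> edges G. is_loop G e},
      edges = {(e, b). e \<in> edges G \<and> (b \<longrightarrow> is_loop G e)},
      ends = (\<lambda>(e, b). if is_loop G e then insert (Inr e) (Inl ` ends G e) else Inl ` ends G e)\<rparr>"

text \<open>The graph \<open>G\<^sup>w\<^sub>-\<close>.\<close>

abbreviation loopless_model ::
    "('v, 'e) mgraph \<Rightarrow> ('v \<Rightarrow> nat) \<Rightarrow> ('v + 'e + 'v \<times> nat, ('e + 'v \<times> nat) \<times> bool) mgraph" where
  "loopless_model G w \<equiv> subdivide_loops (add_weight_loops G w)"

text \<open>A morphism is given by its vertex part \<open>p\<close> and its edge part \<open>q\<close>, where \<open>q e = Inl y\<close> if \<open>e\<close>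
  is sent to the vertex \<open>y\<close> and \<open>q e = Inr e'\<close> if it is sent to the edge \<open>e'\<close>.\<close>

definition graph_morphism ::
    "('v, 'e) mgraph \<Rightarrow> ('w, 'd) mgraph \<Rightarrow> ('v \<Rightarrow> 'w) \<Rightarrow> ('e \<Rightarrow> 'w + 'd) \<Rightarrow> bool" where
  "graph_morphism G G' p q \<longleftrightarrow> p ` verts G \<subseteq> verts G' \<and>
     (\<forall>e\<in>edges G. case q e of
         Inl y \<Rightarrow> p ` ends G e = {y}
       | Inr e' \<Rightarrow> e' \<in> edges G' \<and> ends G' e' = p ` ends G e)"

definition local_count :: "('v, 'e) mgraph \<Rightarrow> ('e \<Rightarrow> 'w + 'd) \<Rightarrow> 'v \<Rightarrow> 'd \<Rightarrow> nat" where
  "local_count G q x e' = card {e \<in> edges G. x \<in> ends G e \<and> q e = Inr e'}"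

definition harmonic_morphism ::
    "('v, 'e) mgraph \<Rightarrow> ('w, 'd) mgraph \<Rightarrow> ('v \<Rightarrow> 'w) \<Rightarrow> ('e \<Rightarrow> 'w + 'd) \<Rightarrow> bool" where
  "harmonic_morphism G G' p q \<longleftrightarrow> graph_morphism G G' p q \<and>
     (\<forall>x\<in>verts G. \<forall>d\<in>edges G'. \<forall>e\<in>edges G'. p x \<in> ends G' d \<longrightarrow> p x \<in> ends G' e \<longrightarrow>
        local_count G q x d = local_count G q x e)"

text \<open>The number \<open>m\<^sub>\<phi>(x)\<close>; as usual it is \<open>0\<close> if no edge is incident to \<open>\<phi>(x)\<close>.\<close>

definition horizontal_mult ::
    "('v, 'e) mgraph \<Rightarrow> ('w, 'd) mgraph \<Rightarrow> ('v \<Rightarrow> 'w) \<Rightarrow> ('e \<Rightarrow> 'w + 'd) \<Rightarrow> 'v \<Rightarrow> nat" where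
  "horizontal_mult G G' p q x =
     (if \<exists>e'\<in>edges G'. p x \<in> ends G' e'
      then local_count G q x (SOME e'. e' \<in> edges G' \<and> p x \<in> ends G' e') else 0)"

definition nondegenerate ::
    "('v, 'e) mgraph \<Rightarrow> ('w, 'd) mgraph \<Rightarrow> ('v \<Rightarrow> 'w) \<Rightarrow> ('e \<Rightarrow> 'w + 'd) \<Rightarrow> bool" where
  "nondegenerate G G' p q \<longleftrightarrow> (\<forall>x\<in>verts G. 0 < horizontal_mult G G' p q x)"

definition has_degree :: "('v, 'e) mgraph \<Rightarrow> ('w, 'd) mgraph \<Rightarrow> ('e \<Rightarrow> 'w + 'd) \<Rightarrow> nat \<Rightarrow> bool" where
  "has_degree G G' q n \<longleftrightarrow> (\<forall>e'\<in>edges G'. card {e \<in> edges G. q e = Inr e'} = n)"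


section \<open>2-edge-connected hyperelliptic types\<close>

text \<open>Only fibres over edges of the tree identify edges: edges that are contracted to a
  vertex of the tree are related to themselves only.\<close>

definition fibre_relation ::
    "(nat, nat) mgraph \<Rightarrow> ((nat + nat \<times> nat) \<times> bool \<Rightarrow> 'w + 'd) \<Rightarrow> (nat \<times> nat) set" where
  "fibre_relation G q =
     {(d, e). d \<in> edges G \<and> e \<in> edges G \<and>
        (d = e \<or> (\<not> is_loop G d \<and> \<not> is_loop G e \<and>
                  (\<exists>e'. q (Inl d, False) = Inr e' \<and> q (Inl e, False) = Inr e')))}"

text \<open>The exceptional case of two vertices refers, as in the characterization of hyperelliptic
  metric graphs by their canonical loopless model, to the vertices of \<open>G\<^sup>w\<^sub>-\<close>.  Then \<open>G\<close> consists
  of parallel edges between two vertices of weight zero; the hyperelliptic involution flips each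
  of these edges, and \<open>r\<close> is trivial.\<close>

fun two_edge_connected_hyperelliptic :: "ctype \<Rightarrow> bool" where
  "two_edge_connected_hyperelliptic (G, w, r) \<longleftrightarrow>
     constrained_type (G, w, r) \<and> two_edge_connected G \<and>
     ((\<exists>(T :: (nat, nat) mgraph) p q. tree_graph T \<and>
          harmonic_morphism (loopless_model G w) T p q \<and>
          nondegenerate (loopless_model G w) T p q \<and>
          has_degree (loopless_model G w) T q 2 \<and>
          r = fibre_relation G q)
      \<or> (card (verts (loopless_model G w)) = 2 \<and> r = Id_on (edges G)))"

definition hyperelliptic_types :: "nat \<Rightarrow> ctype set" where
  "hyperelliptic_types g =
     {(G, w, r). two_edge_connected_hyperelliptic (G, w, r) \<and> type_genus G w = int g}"

text \<open>Types are considered up to isomorphism: \<open>R\<close> contains exactly one member of each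
  isomorphism class.\<close>

definition iso_representatives :: "ctype set \<Rightarrow> ctype set \<Rightarrow> bool" where
  "iso_representatives C R \<longleftrightarrow> R \<subseteq> C \<and> (\<forall>t\<in>C. \<exists>!s. s \<in> R \<and> ctype_iso t s)"


lemma ctype_iso_refl: "ctype_iso t t"
proof -
  obtain G w r where t: "t = (G, w, r)" by (cases t)
  have "ctype_iso_via id id t t" by (simp add: t graph_iso_via_def)
  then show ?thesis unfolding ctype_iso_def by blast
qed

lemma ctype_iso_trans:
  assumes "ctype_iso t t'" "ctype_iso t' t''" shows "ctype_iso t t''"
proof -
  obtain G w r where t: "t = (G, w, r)" by (cases t)
  obtain G' w' r' where t': "t' = (G', w', r')" by (cases t')
  obtain G'' w'' r'' where t'': "t'' = (G'', w'', r'')" by (cases t'')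
  obtain f h where 1: "ctype_iso_via f h t t'" using assms by (auto simp: ctype_iso_def)
  obtain f' h' where 2: "ctype_iso_via f' h' t' t''" using assms by (auto simp: ctype_iso_def)
  have V: "f v \<in> verts G'" if "v \<in> verts G" for v
    using 1 that by (auto simp: t t' graph_iso_via_def bij_betw_def)
  have E: "h e \<in> edges G'" if "e \<in> edges G" for e
    using 1 that by (auto simp: t t' graph_iso_via_def bij_betw_def)
  have "graph_iso_via (f' \<circ> f) (h' \<circ> h) G G''"
    using 1 2 E by (auto simp: t t' t'' graph_iso_via_def image_comp intro: bij_betw_trans)
  then have "ctype_iso_via (f' \<circ> f) (h' \<circ> h) t t''"
    using 1 2 V E by (simp add: t t' t'')
  then show ?thesis unfolding ctype_iso_def by blast
qed

lemma ctype_iso_sym: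
  assumes "ctype_iso t t'" "constrained_type t" shows "ctype_iso t' t"
proof -
  obtain G w r where t: "t = (G, w, r)" by (cases t)
  obtain G' w' r' where t': "t' = (G', w', r')" by (cases t')
  obtain f h where f: "bij_betw f (verts G) (verts G')" and h: "bij_betw h (edges G) (edges G')"
    and e: "\<And>e. e \<in> edges G \<Longrightarrow> ends G' (h e) = f ` ends G e"
    and w: "\<And>v. v \<in> verts G \<Longrightarrow> w' (f v) = w v"
    and r: "\<And>d e. d \<in> edges G \<Longrightarrow> e \<in> edges G \<Longrightarrow> (h d, h e) \<in> r' \<longleftrightarrow> (d, e) \<in> r"
    using assms(1) by (auto simp: ctype_iso_def t t' graph_iso_via_def)
  define f' h' where "f' = inv_into (verts G) f" and "h' = inv_into (edges G) h"
  have sub: "ends G e \<subseteq> verts G" if "e \<in> edges G" for e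
    using assms(2) that by (simp add: t combinatorial_type_def finite_graph_def)
  have V: "f' v \<in> verts G" "f (f' v) = v" if "v \<in> verts G'" for v
    using f that unfolding f'_def by (auto simp: bij_betw_def inv_into_into f_inv_into_f)
  have E: "h' d \<in> edges G" "h (h' d) = d" if "d \<in> edges G'" for d
    using h that unfolding h'_def by (auto simp: bij_betw_def inv_into_into f_inv_into_f)
  have "ends G (h' d) = f' ` ends G' d" if "d \<in> edges G'" for d
  proof -
    have "ends G' d = f ` ends G (h' d)" using e[OF E(1)[OF that]] E(2)[OF that] by simp
    moreover have "f' ` f ` ends G (h' d) = ends G (h' d)"
      unfolding f'_def using f sub[OF E(1)[OF that]] by (simp add: bij_betw_def)
    ultimately show ?thesis by simp
  qed
  then have "graph_iso_via f' h' G' G"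
    using bij_betw_inv_into[OF f] bij_betw_inv_into[OF h]
    by (simp add: graph_iso_via_def f'_def h'_def)
  moreover have "w (f' v) = w' v" if "v \<in> verts G'" for v
    using w[OF V(1)[OF that]] V(2)[OF that] by simp
  moreover have "(h' d, h' c) \<in> r \<longleftrightarrow> (d, c) \<in> r'" if "d \<in> edges G'" "c \<in> edges G'" for d c
    using r[OF E(1)[OF that(1)] E(1)[OF that(2)]] E(2)[OF that(1)] E(2)[OF that(2)] by simp
  ultimately have "ctype_iso_via f' h' t' t" by (simp add: t t')
  then show ?thesis unfolding ctype_iso_def by blast
qed

lemma iso_representatives_exist: "\<exists>R. iso_representatives (hyperelliptic_types g) R"
proof -
  let ?C = "hyperelliptic_types g"
  have ct: "constrained_type t" if "t \<in> ?C" for t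
    using that by (cases t) (simp add: hyperelliptic_types_def)
  define rep where "rep t = (SOME s. s \<in> ?C \<and> ctype_iso t s)" for t
  have rep: "rep t \<in> ?C \<and> ctype_iso t (rep t)" if "t \<in> ?C" for t
    unfolding rep_def by (rule someI[of _ t]) (simp add: that ctype_iso_refl)
  have eq: "rep t = rep s" if "t \<in> ?C" "s \<in> ?C" "ctype_iso t s" for t s
  proof -
    have "ctype_iso t u \<longleftrightarrow> ctype_iso s u" for u
      using ctype_iso_trans ctype_iso_sym[OF that(3) ct[OF that(1)]] that(3) by blast
    then show ?thesis by (simp add: rep_def)
  qed
  have "\<exists>!s. s \<in> rep ` ?C \<and> ctype_iso t s" if t: "t \<in> ?C" for t
  proof (rule ex1I[of _ "rep t"])
    show "rep t \<in> rep ` ?C \<and> ctype_iso t (rep t)" using rep t by blast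
    fix s assume s: "s \<in> rep ` ?C \<and> ctype_iso t s"
    then obtain u where u: "u \<in> ?C" "s = rep u" by blast
    have "s \<in> ?C" using u rep by simp
    have "rep s = rep u" using eq[OF u(1) \<open>s \<in> ?C\<close>] rep[OF u(1)] u(2) by simp
    moreover have "rep t = rep s" using eq[OF t \<open>s \<in> ?C\<close>] s by blast
    ultimately show "s = rep t" using u(2) by simp
  qed
  then have "iso_representatives ?C (rep ` ?C)"
    using rep by (auto simp: iso_representatives_def)
  then show ?thesis by blast
qed


section \<open>Tropical curves\<close>

text \<open>Contracting a nonloop edge of a weighted graph keeps the smaller of its two end vertices as
  the name of the merged vertex.\<close>

fun contract_edge ::
    "nat \<Rightarrow> (nat, nat) mgraph \<times> (nat \<Rightarrow> nat) \<Rightarrow> (nat, nat) mgraph \<times> (nat \<Rightarrow> nat)" where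
  "contract_edge e (G, w) =
     (let a = Min (ends G e); b = Max (ends G e) in
      if is_loop G e then (delete_edge G e, w(a := w a + 1))
      else (\<lparr>verts = verts G - {b}, edges = edges G - {e},
              ends = (\<lambda>d. (\<lambda>x. if x = b then a else x) ` ends G d)\<rparr>,
            w(a := w a + w b)))"

definition contract_edges ::
    "nat set \<Rightarrow> (nat, nat) mgraph \<times> (nat \<Rightarrow> nat) \<Rightarrow> (nat, nat) mgraph \<times> (nat \<Rightarrow> nat)" where
  "contract_edges S Gw = fold contract_edge (sorted_list_of_set S) Gw"

text \<open>A tropical curve: a weighted graph together with the lengths of its edges.\<close>

type_synonym tcurve = "((nat, nat) mgraph \<times> (nat \<Rightarrow> nat)) \<times> (nat \<Rightarrow> real)"

fun tcurve_iso :: "tcurve \<Rightarrow> tcurve \<Rightarrow> bool" where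
  "tcurve_iso ((G, w), l) ((G', w'), l') \<longleftrightarrow>
     (\<exists>f h. graph_iso_via f h G G' \<and> (\<forall>v\<in>verts G. w' (f v) = w v) \<and>
            (\<forall>e\<in>edges G. l' (h e) = l e))"

text \<open>A point \<open>x\<close> of the cone of \<open>(G, w, r)\<close> gives the edge \<open>e\<close> the length \<open>x (r `` {e})\<close>.\<close>

fun tcurve_of :: "ctype \<Rightarrow> (nat set \<Rightarrow> real) \<Rightarrow> tcurve" where
  "tcurve_of (G, w, r) x =
     (contract_edges {e \<in> edges G. x (r `` {e}) = 0} (G, w), \<lambda>e. x (r `` {e}))"


section \<open>Coordinate spaces, rational cones and integral linear groups\<close>

text \<open>For a finite set \<open>N\<close>, the space \<open>\<real>\<^sup>N\<close> is realized as the functions vanishing off \<open>N\<close>, with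
  the topology induced from the product topology on the function type.\<close>

definition coord_space :: "'n set \<Rightarrow> ('n \<Rightarrow> real) set" where
  "coord_space N = {x. \<forall>i. i \<notin> N \<longrightarrow> x i = 0}"

definition int_lattice :: "'n set \<Rightarrow> ('n \<Rightarrow> real) set" where
  "int_lattice N = {x \<in> coord_space N. \<forall>i. x i \<in> \<int>}"

definition lin_span :: "('n \<Rightarrow> real) set \<Rightarrow> ('n \<Rightarrow> real) set" where
  "lin_span F = {(\<lambda>i. \<Sum>b\<in>B. a b * b i) | a B. finite B \<and> B \<subseteq> F}"

definition linear_map_on :: "('n \<Rightarrow> real) set \<Rightarrow> (('n \<Rightarrow> real) \<Rightarrow> 'm \<Rightarrow> real) \<Rightarrow> bool" where
  "linear_map_on V L \<longleftrightarrow> (\<forall>x\<in>V. \<forall>y\<in>V. \<forall>a b.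
     L (\<lambda>i. a * x i + b * y i) = (\<lambda>j. a * L x j + b * L y j))"

text \<open>The empty set of generators yields the zero cone.\<close>

definition rational_open_cone :: "'n set \<Rightarrow> ('n \<Rightarrow> real) set \<Rightarrow> bool" where
  "rational_open_cone N S \<longleftrightarrow> (\<exists>B. finite B \<and> B \<subseteq> int_lattice N \<and>
     S = {(\<lambda>i. \<Sum>b\<in>B. a b * b i) | a. \<forall>b\<in>B. 0 < a b})"

definition cone_face :: "'n set \<Rightarrow> ('n \<Rightarrow> real) set \<Rightarrow> ('n \<Rightarrow> real) set \<Rightarrow> bool" where
  "cone_face N K F \<longleftrightarrow> (\<exists>a. (\<forall>x\<in>K. 0 \<le> (\<Sum>i\<in>N. a i * x i)) \<and>
     F = {x \<in> K. (\<Sum>i\<in>N. a i * x i) = 0})"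

text \<open>The elements of \<open>GL(\<int>\<^sup>N)\<close>, acting on \<open>\<real>\<^sup>N\<close>.\<close>

definition GL_int :: "'n set \<Rightarrow> (('n \<Rightarrow> real) \<Rightarrow> ('n \<Rightarrow> real)) set" where
  "GL_int N = {h \<in> Bij (coord_space N). linear_map_on (coord_space N) h \<and>
     h ` int_lattice N = int_lattice N}"

definition orbit_of :: "('a \<Rightarrow> 'a) set \<Rightarrow> 'a \<Rightarrow> 'a set" where
  "orbit_of \<Gamma> x = (\<lambda>h. h x) ` \<Gamma>"


section \<open>Quotient spaces\<close>

definition quotient_topology :: "'a topology \<Rightarrow> ('a \<Rightarrow> 'b) \<Rightarrow> 'b topology" where
  "quotient_topology X f = topology (\<lambda>U. U \<subseteq> f ` topspace X \<and> openin X {x \<in> topspace X. f x \<in> U})"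

lemma openin_quotient_topology:
  "openin (quotient_topology X f) U \<longleftrightarrow>
     U \<subseteq> f ` topspace X \<and> openin X {x \<in> topspace X. f x \<in> U}"
proof -
  have inter: "openin X {x \<in> topspace X. f x \<in> S \<inter> T}"
    if "openin X {x \<in> topspace X. f x \<in> S}" "openin X {x \<in> topspace X. f x \<in> T}" for S T
  proof -
    have "{x \<in> topspace X. f x \<in> S \<inter> T}
        = {x \<in> topspace X. f x \<in> S} \<inter> {x \<in> topspace X. f x \<in> T}" by auto
    then show ?thesis using openin_Int[OF that] by simp
  qed
  have union: "openin X {x \<in> topspace X. f x \<in> \<Union>\<K>}"
    if "\<And>K. K \<in> \<K> \<Longrightarrow> openin X {x \<in> topspace X. f x \<in> K}" for \<K>
  proof -
    have "{x \<in> topspace X. f x \<in> \<Union>\<K>} = \<Union>((\<lambda>K. {x \<in> topspace X. f x \<in> K}) ` \<K>)" by auto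
    moreover have "openin X (\<Union>((\<lambda>K. {x \<in> topspace X. f x \<in> K}) ` \<K>))"
      by (rule openin_Union) (use that in auto)
    ultimately show ?thesis by simp
  qed
  have "istopology (\<lambda>U. U \<subseteq> f ` topspace X \<and> openin X {x \<in> topspace X. f x \<in> U})"
    unfolding istopology_def
    by (intro conjI allI impI inter union Union_least) auto
  then show ?thesis by (simp add: quotient_topology_def)
qed

lemma topspace_quotient_topology: "topspace (quotient_topology X f) = f ` topspace X"
proof
  show "topspace (quotient_topology X f) \<subseteq> f ` topspace X"
    using openin_topspace[of "quotient_topology X f"] unfolding openin_quotient_topology
    by (rule conjunct1)
  have "{x \<in> topspace X. f x \<in> f ` topspace X} = topspace X" by auto
  then have "openin (quotient_topology X f) (f ` topspace X)"
    by (simp add: openin_quotient_topology)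
  then show "f ` topspace X \<subseteq> topspace (quotient_topology X f)" by (rule openin_subset)
qed

lemma quotient_map_quotient_topology: "quotient_map X (quotient_topology X f) f"
  unfolding quotient_map_def topspace_quotient_topology openin_quotient_topology by simp

definition orbit_space :: "'a::topological_space set \<Rightarrow> ('a \<Rightarrow> 'a) set \<Rightarrow> 'a set topology" where
  "orbit_space S \<Gamma> = quotient_topology (top_of_set S) (orbit_of \<Gamma>)"


section \<open>Stacky fans\<close>

text \<open>The cell with index \<open>i\<close> is given by the open cone \<open>cone \<D> i\<close> in \<open>\<real>\<^sup>N\<close>, \<open>N = coords \<D> i\<close>, the
  group \<open>grp \<D> i\<close> and the map \<open>chart \<D> i\<close> from the orbit space of the closed cone to the
  ambient space.\<close>

record ('i, 'n, 'p) fan_data =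
  index :: "'i set"
  coords :: "'i \<Rightarrow> 'n set"
  cone :: "'i \<Rightarrow> ('n \<Rightarrow> real) set"
  grp :: "'i \<Rightarrow> (('n \<Rightarrow> real) \<Rightarrow> ('n \<Rightarrow> real)) set"
  chart :: "'i \<Rightarrow> ('n \<Rightarrow> real) set \<Rightarrow> 'p"

definition chart_image :: "('i, 'n, 'p) fan_data \<Rightarrow> 'i \<Rightarrow> ('n \<Rightarrow> real) set \<Rightarrow> 'p set" where
  "chart_image \<D> i S = chart \<D> i ` orbit_of (grp \<D> i) ` S"

definition cell :: "('i, 'n, 'p) fan_data \<Rightarrow> 'i \<Rightarrow> 'p set" where
  "cell \<D> i = chart_image \<D> i (cone \<D> i)"

definition closed_cell :: "('i, 'n, 'p) fan_data \<Rightarrow> 'i \<Rightarrow> 'p set" where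
  "closed_cell \<D> i = chart_image \<D> i (closure (cone \<D> i))"

definition cell_dim :: "('i, 'n, 'p) fan_data \<Rightarrow> 'i \<Rightarrow> nat" where
  "cell_dim \<D> i = card (coords \<D> i)"

text \<open>Stacky fans in the sense of Brannetti--Melo--Viviani and Chan.  The equality of the
  dimensions of a face \<open>F\<close> and of the corresponding cone is contained in the
  bijectivity of the linear map \<open>L\<close>.\<close>

definition stacky_fan :: "'p topology \<Rightarrow> ('i, 'n, 'p) fan_data \<Rightarrow> bool" where
  "stacky_fan X \<D> \<longleftrightarrow>
     finite (index \<D>) \<and>
     (\<forall>i\<in>index \<D>.
        finite (coords \<D> i) \<and>
        rational_open_cone (coords \<D> i) (cone \<D> i) \<and>
        lin_span (cone \<D> i) = coord_space (coords \<D> i) \<and>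
        subgroup (grp \<D> i) (BijGroup (coord_space (coords \<D> i))) \<and>
        grp \<D> i \<subseteq> GL_int (coords \<D> i) \<and>
        (\<forall>h\<in>grp \<D> i. h ` cone \<D> i = cone \<D> i) \<and>
        continuous_map (orbit_space (closure (cone \<D> i)) (grp \<D> i)) X (chart \<D> i) \<and>
        homeomorphic_map (orbit_space (cone \<D> i) (grp \<D> i)) (subtopology X (cell \<D> i)) (chart \<D> i)) \<and>
     topspace X = (\<Union>i\<in>index \<D>. cell \<D> i) \<and>
     disjoint_family_on (cell \<D>) (index \<D>) \<and>
     (\<forall>i\<in>index \<D>. \<forall>F. cone_face (coords \<D> i) (closure (cone \<D> i)) F \<longrightarrow>
        (\<exists>l\<in>index \<D>. chart_image \<D> i F = closed_cell \<D> l \<and>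
           (\<exists>L. linear_map_on (lin_span F) L \<and>
                bij_betw L (lin_span F) (coord_space (coords \<D> l)) \<and>
                L ` F = closure (cone \<D> l) \<and>
                L ` (lin_span F \<inter> int_lattice (coords \<D> i)) = int_lattice (coords \<D> l) \<and>
                (\<forall>x\<in>F. chart \<D> i (orbit_of (grp \<D> i) x) = chart \<D> l (orbit_of (grp \<D> l) (L x)))))) \<and>
     (\<forall>i\<in>index \<D>. \<forall>j\<in>index \<D>. \<exists>J\<subseteq>index \<D>.
        closed_cell \<D> i \<inter> closed_cell \<D> j = (\<Union>l\<in>J. cell \<D> l))"

definition fan_dim :: "('i, 'n, 'p) fan_data \<Rightarrow> nat" where
  "fan_dim \<D> = Max (cell_dim \<D> ` index \<D>)"

definition maximal_cell :: "('i, 'n, 'p) fan_data \<Rightarrow> 'i \<Rightarrow> bool" where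
  "maximal_cell \<D> i \<longleftrightarrow> i \<in> index \<D> \<and>
     (\<forall>j\<in>index \<D>. cell \<D> i \<subseteq> closed_cell \<D> j \<longrightarrow> j = i)"

definition pure_of_dim :: "('i, 'n, 'p) fan_data \<Rightarrow> nat \<Rightarrow> bool" where
  "pure_of_dim \<D> d \<longleftrightarrow> fan_dim \<D> = d \<and> (\<forall>i. maximal_cell \<D> i \<longrightarrow> cell_dim \<D> i = d)"


section \<open>The space of 2-edge-connected hyperelliptic tropical curves\<close>

definition open_orthant :: "'n set \<Rightarrow> ('n \<Rightarrow> real) set" where
  "open_orthant N = {x \<in> coord_space N. \<forall>i\<in>N. 0 < x i}"

definition closed_orthant :: "'n set \<Rightarrow> ('n \<Rightarrow> real) set" where
  "closed_orthant N = {x \<in> coord_space N. \<forall>i\<in>N. 0 \<le> x i}"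

text \<open>The image of \<open>Aut(G, w, r)\<close> in \<open>GL(\<int>\<^sup>N)\<close>, where \<open>N\<close> is the set of edge classes.\<close>

definition aut_action :: "ctype \<Rightarrow> ((nat set \<Rightarrow> real) \<Rightarrow> (nat set \<Rightarrow> real)) set" where
  "aut_action t =
     {(\<lambda>x\<in>coord_space (edge_classes t). \<lambda>c. if c \<in> edge_classes t then x (h ` c) else 0)
      | f h. ctype_iso_via f h t t}"

type_synonym cell_point = "ctype \<times> (nat set \<Rightarrow> real) set"

definition cell_union :: "ctype set \<Rightarrow> cell_point topology" where
  "cell_union R =
     sum_topology (\<lambda>t. orbit_space (closed_orthant (edge_classes t)) (aut_action t)) R"

fun same_tcurve :: "cell_point \<Rightarrow> cell_point \<Rightarrow> bool" where
  "same_tcurve (t, A) (t', A') \<longleftrightarrow> (\<exists>x\<in>A. \<exists>x'\<in>A'. tcurve_iso (tcurve_of t x) (tcurve_of t' x'))"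

definition same_tcurve_class :: "ctype set \<Rightarrow> cell_point \<Rightarrow> cell_point set" where
  "same_tcurve_class R P = {Q \<in> topspace (cell_union R). same_tcurve P Q}"

definition H_trop :: "ctype set \<Rightarrow> cell_point set topology" where
  "H_trop R = quotient_topology (cell_union R) (same_tcurve_class R)"

definition H_fan :: "ctype set \<Rightarrow> (ctype, nat set, cell_point set) fan_data" where
  "H_fan R =
     \<lparr>index = R, coords = edge_classes, cone = (\<lambda>t. open_orthant (edge_classes t)),
      grp = aut_action, chart = (\<lambda>t A. same_tcurve_class R (t, A))\<rparr>"


section \<open>Ladders\<close>

text \<open>The edges \<open>Inl (e, b)\<close> are the two copies of the edge \<open>e\<close> of \<open>T\<close>; the edges \<open>Inr (v, b)\<close>
  join the two copies of the vertex \<open>v\<close>.\<close>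

definition ladder :: "('v, 'e) mgraph \<Rightarrow> ('v \<times> bool, 'e \<times> bool + 'v \<times> bool) mgraph" where
  "ladder T =
     \<lparr>verts = verts T \<times> UNIV,
      edges = Inl ` (edges T \<times> UNIV) \<union>
              Inr ` {(v, b). v \<in> verts T \<and> (valence T v = 1 \<or> (valence T v = 2 \<and> \<not> b))},
      ends = (\<lambda>x. case x of Inl (e, b) \<Rightarrow> (\<lambda>v. (v, b)) ` ends T e
                          | Inr (v, b) \<Rightarrow> {(v, False), (v, True)})\<rparr>"

definition is_ladder :: "('v, 'e) mgraph \<Rightarrow> bool" where
  "is_ladder G \<longleftrightarrow> (\<exists>T :: (nat, nat) mgraph. tree_graph T \<and> 2 \<le> card (verts T) \<and>
     (\<forall>v\<in>verts T. valence T v \<le> 3) \<and> graph_iso (ladder T) G)"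

end

theory Submission
  imports Defs
begin

text \<open>
  A hyperelliptic structure on a type of genus at least 3 amounts to an involution of the graph
  whose quotient is a tree once the loops and weights have been turned into branch points; the
  equivalent pairs of edges are then exactly the pairs that form 2-edge cuts, so the relation is
  determined by the graph. Contracting a union of orbits keeps the involution, and every type whose
  involution fixes a vertex, or which has a vertex of valence above 3, is such a contraction of a
  larger one. The types that admit no expansion are the cubic graphs with a fixed-point-free
  involution on vertices. Cutting the edges that join a vertex to its image leaves two copies of the
  quotient tree, so these are the ladders; counting orbits in the quotient tree gives
  \<open>2 g - 1\<close> classes of edges.
\<close>

section \<open>Cuts and connectivity\<close>

text \<open>Tropical curves forget the relation, so distinct cells could overlap unless a weighted
  graph determines it. This rests on one inequality. If at most two edges leave a vertex set A and A
  is not invariant, then the part C of A outside its mirror image has weight zero, spans a forest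
  and is left by at most two edges; valences of at least 3 would give 3|C| \<le> 2(|C| - 1) + 2.
  Hence such cuts are invariant. The quotient tree is seldom built: \<open>hyp_involution\<close>
  records only its Euler count, and tree properties come from comparing this equality with rank
  bounds for connected graphs. Expansions follow from local counts: a fixed vertex of weight w
  becomes an exchanged pair joined by w + 1 edges, whose contraction returns genus w; at a vertex of
  valence above 3, two edge ends move to a new vertex, and symmetrically at its image. The
  topological obstacle is that a chart must be a homeomorphism on its open cell. The glueing
  identifies faces in finitely many ways, each given by a continuous map, so images of closed sets
  are closed.\<close>

definition edge_cut :: "('v, 'e) mgraph \<Rightarrow> 'v set \<Rightarrow> 'e set" where
  "edge_cut G A = {e \<in> edges G. ends G e \<inter> A \<noteq> {} \<and> \<not> ends G e \<subseteq> A}"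

definition inner_edges :: "('v, 'e) mgraph \<Rightarrow> 'v set \<Rightarrow> 'e set" where
  "inner_edges G A = {e \<in> edges G. ends G e \<subseteq> A}"

lemma finite_graph_ends:
  assumes "finite_graph G" "e \<in> edges G"
  obtains x y where "ends G e = {x, y}" "x \<in> verts G" "y \<in> verts G"
proof -
  have "ends G e \<subseteq> verts G" "card (ends G e) = 1 \<or> card (ends G e) = 2"
    using assms by (auto simp: finite_graph_def)
  then show ?thesis
    by (metis card_1_singletonE card_2_iff insert_absorb2 insert_subset that)
qed

lemma finite_graph_ends_pair: "finite_graph G \<Longrightarrow> e \<in> edges G \<Longrightarrow> \<exists>x y. ends G e = {x, y}"
  by (metis finite_graph_ends)

lemma finite_graph_ends_ne: "finite_graph G \<Longrightarrow> e \<in> edges G \<Longrightarrow> ends G e \<noteq> {}"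
  by (metis finite_graph_ends insert_not_empty)

lemma finite_graph_ends_sub: "finite_graph G \<Longrightarrow> e \<in> edges G \<Longrightarrow> ends G e \<subseteq> verts G"
  by (auto simp: finite_graph_def)

lemma is_loop_iff: "is_loop G e \<longleftrightarrow> (\<exists>x. ends G e = {x})"
  by (auto simp: is_loop_def card_1_singleton_iff)

lemma finite_edge_cut: "finite_graph G \<Longrightarrow> finite (edge_cut G A)"
  by (auto simp: finite_graph_def edge_cut_def)

text \<open>Cuts replace walks because they pull back along vertex maps. For the converse, no edge
  leaves the set of vertices reachable from \<open>u\<close>.\<close>

lemma connected_graph_iff_edge_cut:
  assumes fg: "finite_graph G"
  shows "connected_graph G \<longleftrightarrow>
    verts G \<noteq> {} \<and> (\<forall>A\<subseteq>verts G. A \<noteq> {} \<longrightarrow> A \<noteq> verts G \<longrightarrow> edge_cut G A \<noteq> {})"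
proof
  assume c: "connected_graph G"
  have "edge_cut G A \<noteq> {}" if A: "A \<subseteq> verts G" "A \<noteq> {}" "A \<noteq> verts G" for A
  proof
    assume no: "edge_cut G A = {}"
    obtain a b where ab: "a \<in> A" "b \<in> verts G" "b \<notin> A" using A by blast
    have "(a, b) \<in> (adjacency G)\<^sup>*" using c ab A by (auto simp: connected_graph_def)
    then have "b \<in> A"
    proof (induction rule: rtrancl_induct)
      case (step y z)
      then obtain e where "e \<in> edges G" "ends G e = {y, z}" by (auto simp: adjacency_def)
      then show ?case using no step by (auto simp: edge_cut_def)
    qed (use ab in simp)
    then show False using ab by simp
  qed
  then show "verts G \<noteq> {} \<and> (\<forall>A\<subseteq>verts G. A \<noteq> {} \<longrightarrow> A \<noteq> verts G \<longrightarrow> edge_cut G A \<noteq> {})"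
    using c by (auto simp: connected_graph_def)
next
  assume R: "verts G \<noteq> {} \<and> (\<forall>A\<subseteq>verts G. A \<noteq> {} \<longrightarrow> A \<noteq> verts G \<longrightarrow> edge_cut G A \<noteq> {})"
  have "(u, v) \<in> (adjacency G)\<^sup>*" if uv: "u \<in> verts G" "v \<in> verts G" for u v
  proof -
    define A where "A = {x \<in> verts G. (u, x) \<in> (adjacency G)\<^sup>*}"
    have "edge_cut G A = {}"
    proof (rule ccontr)
      assume "edge_cut G A \<noteq> {}"
      then obtain e where e: "e \<in> edges G" "ends G e \<inter> A \<noteq> {}" "\<not> ends G e \<subseteq> A"
        by (auto simp: edge_cut_def)
      obtain x y where xy: "x \<in> ends G e" "x \<in> A" "y \<in> ends G e" "y \<notin> A" using e by blast
      have "ends G e = {x, y}"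
        using finite_graph_ends[OF fg e(1)] xy by (metis empty_iff insertE insert_commute)
      then have "(x, y) \<in> adjacency G" using e by (auto simp: adjacency_def)
      moreover have "y \<in> verts G" using finite_graph_ends_sub[OF fg e(1)] xy by auto
      ultimately show False using xy by (auto simp: A_def dest: rtrancl_into_rtrancl)
    qed
    moreover have "u \<in> A" using uv by (auto simp: A_def)
    moreover have "A \<subseteq> verts G" by (auto simp: A_def)
    ultimately have "A = verts G" using R by blast
    then show ?thesis using uv by (auto simp: A_def)
  qed
  then show "connected_graph G" using R by (auto simp: connected_graph_def)
qed

text \<open>A spanning tree grown vertex by vertex: \<open>X\<close> gains the far end of an edge
  that leaves it. Edges are abstract, with \<open>en\<close> giving their ends, so that the bound
  also applies to quotients whose edges are orbits.\<close>

lemma connecting_subset: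
  fixes en :: "'e \<Rightarrow> 'w set"
  assumes W: "finite W" "W \<noteq> {}" and F: "finite F" and en: "\<And>e. e \<in> F \<Longrightarrow> \<exists>a b. en e = {a, b}"
    and conn: "\<And>A. A \<subseteq> W \<Longrightarrow> A \<noteq> {} \<Longrightarrow> A \<noteq> W \<Longrightarrow> \<exists>e\<in>F. en e \<inter> A \<noteq> {} \<and> en e \<inter> (W - A) \<noteq> {}"
  obtains F' where "F' \<subseteq> F" "card F' + 1 = card W"
    "\<And>A. A \<subseteq> W \<Longrightarrow> A \<noteq> {} \<Longrightarrow> A \<noteq> W \<Longrightarrow> \<exists>e\<in>F'. en e \<inter> A \<noteq> {} \<and> en e \<inter> (W - A) \<noteq> {}"
proof -
  have "\<exists>X F'. X \<subseteq> W \<and> F' \<subseteq> F \<and> card X = Suc n \<and> card F' = n \<and> (\<forall>e\<in>F'. en e \<subseteq> X) \<and>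
      (\<forall>A\<subseteq>X. A \<noteq> {} \<longrightarrow> A \<noteq> X \<longrightarrow> (\<exists>e\<in>F'. en e \<inter> A \<noteq> {} \<and> en e \<inter> (X - A) \<noteq> {}))"
    if "Suc n \<le> card W" for n
    using that
  proof (induction n)
    case 0
    obtain x where "x \<in> W" using W by blast
    then show ?case by (intro exI[of _ "{x}"] exI[of _ "{}"]) auto
  next
    case (Suc n)
    then obtain X F' where X: "X \<subseteq> W" "F' \<subseteq> F" "card X = Suc n" "card F' = n" "\<And>e. e \<in> F' \<Longrightarrow> en e \<subseteq> X"
      and cr: "\<And>A. A \<subseteq> X \<Longrightarrow> A \<noteq> {} \<Longrightarrow> A \<noteq> X \<Longrightarrow> \<exists>e\<in>F'. en e \<inter> A \<noteq> {} \<and> en e \<inter> (X - A) \<noteq> {}"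
      by auto
    have fin: "finite X" "finite F'" using X(1,2) W F finite_subset by blast+
    have "X \<noteq> W" "X \<noteq> {}" using X Suc.prems by auto
    then obtain e where e: "e \<in> F" "en e \<inter> X \<noteq> {}" "en e \<inter> (W - X) \<noteq> {}"
      using conn[OF X(1)] by blast
    then obtain x y where xy: "x \<in> en e" "x \<in> X" "y \<in> en e" "y \<in> W" "y \<notin> X" by blast
    have ee: "en e = {x, y}" using en[OF e(1)] xy by auto
    have eF: "e \<notin> F'" using X(5)[of e] xy by auto
    have cross: "\<exists>d\<in>insert e F'. en d \<inter> A \<noteq> {} \<and> en d \<inter> (insert y X - A) \<noteq> {}"
      if A: "A \<subseteq> insert y X" "A \<noteq> {}" "A \<noteq> insert y X" for A
    proof (cases "A \<inter> X = {} \<or> A \<inter> X = X")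
      case True
      then have "x \<in> A \<longleftrightarrow> y \<notin> A" using A xy by auto
      then show ?thesis using ee xy by (intro bexI[of _ e]) auto
    next
      case False
      then obtain d where d: "d \<in> F'" "en d \<inter> (A \<inter> X) \<noteq> {}" "en d \<inter> (X - A \<inter> X) \<noteq> {}"
        using cr[of "A \<inter> X"] by blast
      then show ?thesis by (intro bexI[of _ d]) auto
    qed
    show ?case
    proof (intro exI[of _ "insert y X"] exI[of _ "insert e F'"] conjI ballI allI impI)
      show "en d \<subseteq> insert y X" if "d \<in> insert e F'" for d using that X(5) ee xy by auto
    qed (use X xy e fin eF cross in auto)
  qed
  from this[of "card W - 1"] obtain X F' where X: "X \<subseteq> W" "F' \<subseteq> F" "card X = card W" "card F' = card W - 1"
      and cr: "\<And>A. A \<subseteq> X \<Longrightarrow> A \<noteq> {} \<Longrightarrow> A \<noteq> X \<Longrightarrow> \<exists>e\<in>F'. en e \<inter> A \<noteq> {} \<and> en e \<inter> (X - A) \<noteq> {}"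
    using W by (auto simp: card_gt_0_iff)
  have "X = W" using card_subset_eq[OF W(1) X(1,3)] .
  moreover have "card F' + 1 = card W" using X(4) W by (simp add: card_gt_0_iff Suc_le_eq)
  ultimately show ?thesis using X(2) cr by (intro that[of F']) auto
qed

lemma card_le_card_connecting:
  fixes en :: "'e \<Rightarrow> 'w set"
  assumes W: "finite W" and F: "finite F" and en: "\<And>e. e \<in> F \<Longrightarrow> \<exists>a b. en e = {a, b}"
    and conn: "\<And>A. A \<subseteq> W \<Longrightarrow> A \<noteq> {} \<Longrightarrow> A \<noteq> W \<Longrightarrow> \<exists>e\<in>F. en e \<inter> A \<noteq> {} \<and> en e \<inter> (W - A) \<noteq> {}"
  shows "card W \<le> card F + 1"
proof (cases "W = {}")
  case False
  obtain F' where "F' \<subseteq> F" "card F' + 1 = card W"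
    by (rule connecting_subset[OF W False F en conn])
  then show ?thesis using card_mono[OF F \<open>F' \<subseteq> F\<close>] by simp
qed simp

text \<open>By \<open>sat\<close> every component of \<open>F\<close> is a union of classes of
  \<open>p\<close>, so there are at most as many components as values of \<open>p\<close>. Joining a
  representative of each class to that of the base class \<open>c0\<close> connects
  \<open>W\<close>, at the cost of one edge for every other class.\<close>

lemma card_le_card_connecting_classes:
  fixes en :: "'e \<Rightarrow> 'w set" and p :: "'w \<Rightarrow> 'c"
  assumes W: "finite W" and F: "finite F" and en: "\<And>e. e \<in> F \<Longrightarrow> \<exists>a b. en e = {a, b}"
    and sat: "\<And>A x y. A \<subseteq> W \<Longrightarrow> (\<And>e. e \<in> F \<Longrightarrow> en e \<inter> A = {} \<or> en e \<inter> (W - A) = {}) \<Longrightarrow>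
      x \<in> A \<Longrightarrow> y \<in> W \<Longrightarrow> p x = p y \<Longrightarrow> y \<in> A"
  shows "card W \<le> card F + card (p ` W)"
proof (cases "W = {}")
  case False
  then obtain w0 where w0: "w0 \<in> W" by blast
  define rep where "rep c = (SOME w. w \<in> W \<and> p w = c)" for c
  have rep: "rep c \<in> W" "p (rep c) = c" if "c \<in> p ` W" for c
  proof -
    have "\<exists>w. w \<in> W \<and> p w = c" using that by auto
    then have "rep c \<in> W \<and> p (rep c) = c" unfolding rep_def by (rule someI_ex)
    then show "rep c \<in> W" "p (rep c) = c" by auto
  qed
  define c0 where "c0 = p w0"
  define F' where "F' = Inl ` F \<union> Inr ` (p ` W - {c0})"
  define en' where "en' x = (case x of Inl e \<Rightarrow> en e | Inr c \<Rightarrow> {rep c, rep c0})" for x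
  have "card W \<le> card F' + 1"
  proof (rule card_le_card_connecting[where en = en'])
    show "finite F'" using W F by (auto simp: F'_def)
    show "\<exists>a b. en' e = {a, b}" if "e \<in> F'" for e
      by (cases e) (use that en in \<open>auto simp: F'_def en'_def\<close>)
    fix A assume A: "A \<subseteq> W" "A \<noteq> {}" "A \<noteq> W"
    show "\<exists>e\<in>F'. en' e \<inter> A \<noteq> {} \<and> en' e \<inter> (W - A) \<noteq> {}"
    proof (rule ccontr)
      assume no: "\<not> ?thesis"
      have no1: "en e \<inter> A = {} \<or> en e \<inter> (W - A) = {}" if "e \<in> F" for e
        using no that by (force simp: F'_def en'_def)
      have no2: "rep c \<in> A \<longleftrightarrow> rep c0 \<in> A" if "c \<in> p ` W" for c
      proof (cases "c = c0")
        case False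
        then have "Inr c \<in> F'" using that by (auto simp: F'_def)
        then have "\<not> (en' (Inr c) \<inter> A \<noteq> {} \<and> en' (Inr c) \<inter> (W - A) \<noteq> {})" using no by blast
        then show ?thesis using rep[OF that] rep[of c0] w0 by (auto simp: en'_def c0_def)
      qed simp
      have "x \<in> A \<longleftrightarrow> rep (p x) \<in> A" if "x \<in> W" for x
        using sat[OF A(1) no1, of x "rep (p x)"] sat[OF A(1) no1, of "rep (p x)" x] rep[of "p x"] that
        by auto
      then have "x \<in> A \<longleftrightarrow> rep c0 \<in> A" if "x \<in> W" for x using no2 that by auto
      then show False using A by blast
    qed
  qed (use W in auto)
  moreover have "card F' \<le> card F + card (p ` W - {c0})"
    unfolding F'_def using card_Un_le[of "Inl ` F" "Inr ` (p ` W - {c0})"] F W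
    by (auto simp: card_image intro: order_trans)
  moreover have "card (p ` W - {c0}) + 1 = card (p ` W)"
    using card_Suc_Diff1[of "p ` W" c0] W w0 by (simp add: c0_def)
  ultimately show ?thesis by linarith
qed simp

lemma sum_valence:
  assumes fg: "finite_graph G" and C: "C \<subseteq> verts G"
  shows "(\<Sum>x\<in>C. valence G x) = 2 * card (inner_edges G C) + card (edge_cut G C)"
proof -
  have fC: "finite C" and fE: "finite (edges G)" using fg C finite_subset by (auto simp: finite_graph_def)
  define m :: "'b \<Rightarrow> nat" where "m e = (if is_loop G e then 2 else 1)" for e
  have "(\<Sum>x\<in>C. valence G x) = (\<Sum>x\<in>C. \<Sum>e\<in>edges G. if x \<in> ends G e then m e else 0)"
    unfolding valence_def m_def by (intro sum.cong refl sum.inter_filter fE)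
  also have "\<dots> = (\<Sum>e\<in>edges G. \<Sum>x\<in>C. if x \<in> ends G e then m e else 0)" by (rule sum.swap)
  also have "\<dots> = (\<Sum>e\<in>edges G. 2 * (if e \<in> inner_edges G C then 1 else 0) + (if e \<in> edge_cut G C then 1 else 0))"
  proof (rule sum.cong[OF refl])
    fix e assume e: "e \<in> edges G"
    have "(\<Sum>x\<in>C. if x \<in> ends G e then m e else 0) = card {x \<in> C. x \<in> ends G e} * m e"
      by (subst sum.inter_filter[symmetric]) (use fC in auto)
    also have "\<dots> = 2 * (if e \<in> inner_edges G C then 1 else 0) + (if e \<in> edge_cut G C then 1 else 0)"
    proof -
      obtain x y where xy: "ends G e = {x, y}" using fg e finite_graph_ends by metis
      have S: "{z \<in> C. z \<in> ends G e} = (if x \<in> C then {x} else {}) \<union> (if y \<in> C then {y} else {})"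
        using xy by auto
      show ?thesis
        unfolding S using e xy by (cases "x = y") (auto simp: m_def is_loop_def inner_edges_def edge_cut_def)
    qed
    finally show "(\<Sum>x\<in>C. if x \<in> ends G e then m e else 0)
      = 2 * (if e \<in> inner_edges G C then 1 else 0) + (if e \<in> edge_cut G C then 1 else 0)" .
  qed
  also have "\<dots> = 2 * card {e \<in> edges G. e \<in> inner_edges G C} + card {e \<in> edges G. e \<in> edge_cut G C}"
    by (simp add: sum.distrib sum_distrib_left[symmetric] sum.inter_filter[OF fE, symmetric])
  also have "{e \<in> edges G. e \<in> inner_edges G C} = inner_edges G C" by (auto simp: inner_edges_def)
  also have "{e \<in> edges G. e \<in> edge_cut G C} = edge_cut G C" by (auto simp: edge_cut_def)
  finally show ?thesis .
qed

section \<open>Contractions\<close>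

text \<open>A contraction along \<open>S\<close> with vertex map \<open>p\<close>, whose remaining edges are renamed by \<open>h\<close>.
  The fibres of \<open>p\<close> are the components of the edge set \<open>S\<close>; the last clause says that each vertex gains
  the genus of the component contracted to it.  An isomorphism is a contraction along \<open>{}\<close>.\<close>

definition contracts ::
    "('v \<Rightarrow> 'u) \<Rightarrow> ('e \<Rightarrow> 'd) \<Rightarrow> 'e set \<Rightarrow> ('v, 'e) mgraph \<Rightarrow> ('v \<Rightarrow> nat) \<Rightarrow>
     ('u, 'd) mgraph \<Rightarrow> ('u \<Rightarrow> nat) \<Rightarrow> bool" where
  "contracts p h S G w G' w' \<longleftrightarrow> S \<subseteq> edges G \<and> verts G' = p ` verts G \<and>
     bij_betw h (edges G - S) (edges G') \<and>
     (\<forall>e\<in>edges G - S. ends G' (h e) = p ` ends G e) \<and>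
     (\<forall>e\<in>S. \<exists>v. p ` ends G e = {v}) \<and>
     (\<forall>A\<subseteq>verts G. S \<inter> edge_cut G A = {} \<longrightarrow> (\<forall>x\<in>A. \<forall>y\<in>verts G. p x = p y \<longrightarrow> y \<in> A)) \<and>
     (\<forall>v\<in>verts G'. w' v + card {x \<in> verts G. p x = v} =
        (\<Sum>x\<in>{x \<in> verts G. p x = v}. w x) + card {e \<in> S. p ` ends G e = {v}} + 1)"

lemma contractsD:
  assumes "contracts p h S G w G' w'"
  shows "S \<subseteq> edges G" "verts G' = p ` verts G" "bij_betw h (edges G - S) (edges G')"
    "\<And>e. e \<in> edges G \<Longrightarrow> e \<notin> S \<Longrightarrow> ends G' (h e) = p ` ends G e"
    "\<And>e. e \<in> S \<Longrightarrow> \<exists>v. p ` ends G e = {v}"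
    "\<And>A x y. A \<subseteq> verts G \<Longrightarrow> S \<inter> edge_cut G A = {} \<Longrightarrow> x \<in> A \<Longrightarrow> y \<in> verts G \<Longrightarrow> p x = p y \<Longrightarrow> y \<in> A"
    "\<And>v. v \<in> verts G' \<Longrightarrow> w' v + card {x \<in> verts G. p x = v} =
        (\<Sum>x\<in>{x \<in> verts G. p x = v}. w x) + card {e \<in> S. p ` ends G e = {v}} + 1"
proof -
  note a = assms[unfolded contracts_def]
  have b: "\<forall>e\<in>edges G - S. ends G' (h e) = p ` ends G e"
    "\<forall>e\<in>S. \<exists>v. p ` ends G e = {v}"
    "\<forall>A\<subseteq>verts G. S \<inter> edge_cut G A = {} \<longrightarrow> (\<forall>x\<in>A. \<forall>y\<in>verts G. p x = p y \<longrightarrow> y \<in> A)"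
    "\<forall>v\<in>verts G'. w' v + card {x \<in> verts G. p x = v} =
        (\<Sum>x\<in>{x \<in> verts G. p x = v}. w x) + card {e \<in> S. p ` ends G e = {v}} + 1"
    using a by - (elim conjE, assumption)+
  show "S \<subseteq> edges G" "verts G' = p ` verts G" "bij_betw h (edges G - S) (edges G')"
    using a by - (elim conjE, assumption)+
  show "ends G' (h e) = p ` ends G e" if "e \<in> edges G" "e \<notin> S" for e using b(1) that by simp
  show "\<exists>v. p ` ends G e = {v}" if "e \<in> S" for e using b(2) that by simp
  show "y \<in> A" if "A \<subseteq> verts G" "S \<inter> edge_cut G A = {}" "x \<in> A" "y \<in> verts G" "p x = p y" for A x y
    using b(3)[rule_format, OF that] .
  show "w' v + card {x \<in> verts G. p x = v} =
        (\<Sum>x\<in>{x \<in> verts G. p x = v}. w x) + card {e \<in> S. p ` ends G e = {v}} + 1" if "v \<in> verts G'" for v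
    using b(4)[rule_format, OF that] .
qed

lemma saturated_eq:
  assumes sub: "A \<subseteq> V" and sat: "\<And>x y. x \<in> A \<Longrightarrow> y \<in> V \<Longrightarrow> p x = p y \<Longrightarrow> y \<in> A"
  shows "{x \<in> V. p x \<in> p ` A} = A"
proof (intro subset_antisym subsetI)
  fix x assume "x \<in> {x \<in> V. p x \<in> p ` A}"
  then obtain a where "a \<in> A" "p a = p x" "x \<in> V" by (metis (mono_tags, lifting) imageE mem_Collect_eq)
  then show "x \<in> A" using sat by blast
qed (use sub in auto)

lemma contracts_edge:
  assumes "contracts p h S G w G' w'" "d \<in> edges G'"
  obtains e where "e \<in> edges G" "e \<notin> S" "d = h e"
  using contractsD(3)[OF assms(1)] assms(2) by (auto simp: bij_betw_def)

lemma contracts_finite_graph: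
  assumes c: "contracts p h S G w G' w'" and fg: "finite_graph G"
  shows "finite_graph G'"
proof -
  have "ends G' d \<subseteq> verts G' \<and> (card (ends G' d) = 1 \<or> card (ends G' d) = 2)" if d: "d \<in> edges G'" for d
  proof -
    obtain e where e: "e \<in> edges G" "e \<notin> S" "d = h e" using c d by (rule contracts_edge)
    obtain x y where xy: "ends G e = {x, y}" "x \<in> verts G" "y \<in> verts G" using fg e(1) by (rule finite_graph_ends)
    have "ends G' d = {p x, p y}" using contractsD(4)[OF c e(1,2)] e(3) xy by simp
    then show ?thesis using contractsD(2)[OF c] xy by (cases "p x = p y") auto
  qed
  moreover have "finite (verts G')" "finite (edges G')"
    using fg contractsD(2,3)[OF c] bij_betw_finite[OF contractsD(3)[OF c]] by (auto simp: finite_graph_def)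
  ultimately show ?thesis by (auto simp: finite_graph_def)
qed

text \<open>A contracted edge has a single image point, so it never crosses a preimage; the other
  edges keep their ends up to \<open>p\<close>.\<close>

lemma contracts_cut:
  assumes c: "contracts p h S G w G' w'" and fg: "finite_graph G" and B: "B \<subseteq> verts G'"
  shows "edge_cut G {x \<in> verts G. p x \<in> B} = {e \<in> edges G - S. h e \<in> edge_cut G' B}"
proof (intro subset_antisym subsetI)
  fix e assume e: "e \<in> edge_cut G {x \<in> verts G. p x \<in> B}"
  then have eE: "e \<in> edges G" by (auto simp: edge_cut_def)
  have sub: "ends G e \<subseteq> verts G" using finite_graph_ends_sub[OF fg eE] .
  obtain a b where ab: "a \<in> ends G e" "p a \<in> B" "b \<in> ends G e" "p b \<notin> B"
    using e sub by (auto simp: edge_cut_def)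
  have "e \<notin> S"
  proof
    assume "e \<in> S"
    then obtain v where "p ` ends G e = {v}" using contractsD(5)[OF c] by blast
    then show False using ab by (metis imageI singletonD)
  qed
  then have "ends G' (h e) = p ` ends G e" "h e \<in> edges G'"
    using contractsD(3,4)[OF c] eE by (auto simp: bij_betw_def)
  then show "e \<in> {e \<in> edges G - S. h e \<in> edge_cut G' B}"
    using ab eE \<open>e \<notin> S\<close> by (auto simp: edge_cut_def)
next
  fix e assume e: "e \<in> {e \<in> edges G - S. h e \<in> edge_cut G' B}"
  then have "ends G' (h e) = p ` ends G e" using contractsD(4)[OF c] by auto
  then show "e \<in> edge_cut G {x \<in> verts G. p x \<in> B}"
    using e finite_graph_ends_sub[OF fg, of e] by (auto simp: edge_cut_def)
qed

lemma contracts_inner: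
  assumes c: "contracts p h S G w G' w'" and fg: "finite_graph G" and B: "B \<subseteq> verts G'"
  shows "{e \<in> inner_edges G {x \<in> verts G. p x \<in> B}. e \<notin> S} = {e \<in> edges G - S. h e \<in> inner_edges G' B}"
proof -
  have "ends G e \<subseteq> {x \<in> verts G. p x \<in> B} \<longleftrightarrow> h e \<in> edges G' \<and> ends G' (h e) \<subseteq> B"
    if e: "e \<in> edges G" "e \<notin> S" for e
  proof -
    have "h e \<in> edges G'" using contractsD(3)[OF c] e unfolding bij_betw_def by blast
    moreover have "ends G' (h e) = p ` ends G e" using contractsD(4)[OF c e] .
    moreover have "ends G e \<subseteq> verts G" using finite_graph_ends_sub[OF fg e(1)] .
    ultimately show ?thesis by auto
  qed
  then show ?thesis unfolding inner_edges_def by blast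
qed

text \<open>Cuts of \<open>G'\<close> pull back to cuts of \<open>G\<close>. Conversely, a set
  without cut edges is a union of fibres, hence the preimage of its image.\<close>

lemma contracts_connected:
  assumes c: "contracts p h S G w G' w'" and fg: "finite_graph G"
  shows "connected_graph G \<longleftrightarrow> connected_graph G'"
proof -
  have fg': "finite_graph G'" using contracts_finite_graph[OF c fg] .
  have V': "verts G' = p ` verts G" using contractsD(2)[OF c] .
  show ?thesis unfolding connected_graph_iff_edge_cut[OF fg] connected_graph_iff_edge_cut[OF fg']
  proof (rule conj_cong, use V' in simp, rule iffI; intro allI impI)
    fix B assume all: "\<forall>A\<subseteq>verts G. A \<noteq> {} \<longrightarrow> A \<noteq> verts G \<longrightarrow> edge_cut G A \<noteq> {}"
      and B: "B \<subseteq> verts G'" "B \<noteq> {}" "B \<noteq> verts G'"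
    have "{x \<in> verts G. p x \<in> B} \<noteq> {}" "{x \<in> verts G. p x \<in> B} \<noteq> verts G"
      using B unfolding V' by blast+
    then have "edge_cut G {x \<in> verts G. p x \<in> B} \<noteq> {}"
      using all[rule_format, of "{x \<in> verts G. p x \<in> B}"] by auto
    then show "edge_cut G' B \<noteq> {}" using contracts_cut[OF c fg B(1)] by auto
  next
    fix A assume all: "\<forall>B\<subseteq>verts G'. B \<noteq> {} \<longrightarrow> B \<noteq> verts G' \<longrightarrow> edge_cut G' B \<noteq> {}"
      and A: "A \<subseteq> verts G" "A \<noteq> {}" "A \<noteq> verts G"
    show "edge_cut G A \<noteq> {}"
    proof
      assume no: "edge_cut G A = {}"
      then have sat: "y \<in> A" if "x \<in> A" "y \<in> verts G" "p x = p y" for x y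
        using contractsD(6)[OF c A(1) _ that] by auto
      have eq: "{x \<in> verts G. p x \<in> p ` A} = A" by (rule saturated_eq[OF A(1) sat])
      have "p ` A \<subseteq> verts G'" "p ` A \<noteq> {}" "p ` A \<noteq> verts G'" using A V' eq by auto
      then have "edge_cut G' (p ` A) \<noteq> {}" using all[rule_format, of "p ` A"] by simp
      then obtain d where d: "d \<in> edge_cut G' (p ` A)" by blast
      then have "d \<in> edges G'" by (auto simp: edge_cut_def)
      then obtain e where "e \<in> edges G" "e \<notin> S" "d = h e" using contracts_edge[OF c] by metis
      then have "e \<in> edge_cut G {x \<in> verts G. p x \<in> p ` A}"
        using d contracts_cut[OF c fg \<open>p ` A \<subseteq> verts G'\<close>] by auto
      then show False using no eq by auto
    qed
  qed
qed

text \<open>Summing the weight clause of \<open>contracts\<close> over the vertices of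
  \<open>G'\<close> counts every vertex, every weight and every contracted edge of \<open>G\<close>
  exactly once.\<close>

lemma contracts_genus:
  assumes c: "contracts p h S G w G' w'" and fg: "finite_graph G"
  shows "type_genus G' w' = type_genus G w"
proof -
  have fV: "finite (verts G)" and fE: "finite (edges G)" using fg by (auto simp: finite_graph_def)
  have fS: "finite S" by (rule finite_subset[OF contractsD(1)[OF c] fE])
  have V': "verts G' = p ` verts G" using contractsD(2)[OF c] .
  have "(\<Sum>v\<in>verts G'. w' v + card {x \<in> verts G. p x = v}) =
      (\<Sum>v\<in>verts G'. (\<Sum>x\<in>{x \<in> verts G. p x = v}. w x) + card {e \<in> S. p ` ends G e = {v}} + 1)"
    by (intro sum.cong refl contractsD(7)[OF c])
  moreover have "(\<Sum>v\<in>verts G'. card {x \<in> verts G. p x = v}) = card (verts G)"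
    using sum.group[OF fV, of "verts G'" p "\<lambda>_. 1::nat"] fV V' by simp
  moreover have "(\<Sum>v\<in>verts G'. \<Sum>x\<in>{x \<in> verts G. p x = v}. w x) = (\<Sum>x\<in>verts G. w x)"
    by (rule sum.group) (use fV V' in auto)
  moreover have "(\<Sum>v\<in>verts G'. card {e \<in> S. p ` ends G e = {v}}) = card S"
  proof -
    define u where "u e = (THE v. p ` ends G e = {v})" for e
    have u: "p ` ends G e = {v} \<longleftrightarrow> u e = v" if "e \<in> S" for e v
    proof -
      obtain y where "p ` ends G e = {y}" using contractsD(5)[OF c \<open>e \<in> S\<close>] by blast
      then show ?thesis by (simp add: u_def)
    qed
    have "u ` S \<subseteq> verts G'"
    proof
      fix v assume "v \<in> u ` S"
      then obtain e where e: "e \<in> S" "p ` ends G e = {v}" using u by blast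
      then have "ends G e \<subseteq> verts G" using finite_graph_ends_sub[OF fg] contractsD(1)[OF c] by blast
      then show "v \<in> verts G'" using e V' by (metis image_mono insert_subset)
    qed
    then have "(\<Sum>v\<in>verts G'. card {e \<in> S. u e = v}) = card S"
      using sum.group[OF fS, of "verts G'" u "\<lambda>_. 1::nat"] fV V' by simp
    moreover have "{e \<in> S. p ` ends G e = {v}} = {e \<in> S. u e = v}" for v using u by auto
    ultimately show ?thesis by simp
  qed
  moreover have "(\<Sum>v\<in>verts G'. 1::nat) = card (verts G')" by simp
  ultimately have "sum w' (verts G') + card (verts G) = sum w (verts G) + card S + card (verts G')"
    unfolding sum.distrib by linarith
  moreover have "card (edges G') + card S = card (edges G)"
    using bij_betw_same_card[OF contractsD(3)[OF c]] contractsD(1)[OF c] fE fS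
    using card_mono[of "edges G" S] by (simp add: card_Diff_subset)
  ultimately show ?thesis by (simp add: type_genus_def graph_genus_def flip: of_nat_sum)
qed

text \<open>The contracted edges inside a fibre connect it. In \<open>contracts_stable\<close> this
  bound forces a fibre over a vertex of weight zero to be a tree.\<close>

lemma contracts_fibre_rank:
  assumes c: "contracts p h S G w G' w'" and fg: "finite_graph G" and v: "v \<in> verts G'"
  shows "card {x \<in> verts G. p x = v} \<le> card {e \<in> S. p ` ends G e = {v}} + 1"
proof (rule card_le_card_connecting[where en = "ends G"])
  have fE: "finite (edges G)" using fg by (simp add: finite_graph_def)
  have fS: "finite S" by (rule finite_subset[OF contractsD(1)[OF c] fE])
  show "finite {x \<in> verts G. p x = v}" "finite {e \<in> S. p ` ends G e = {v}}"
    using fg fS by (auto simp: finite_graph_def)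
  show "\<exists>a b. ends G e = {a, b}" if "e \<in> {e \<in> S. p ` ends G e = {v}}" for e
    using finite_graph_ends_pair[OF fg, of e] contractsD(1)[OF c] that by auto
  fix A assume A: "A \<subseteq> {x \<in> verts G. p x = v}" "A \<noteq> {}" "A \<noteq> {x \<in> verts G. p x = v}"
  have "S \<inter> edge_cut G A \<noteq> {}"
  proof
    assume no: "S \<inter> edge_cut G A = {}"
    have "A \<subseteq> verts G" using A by auto
    from contractsD(6)[OF c this no] have "y \<in> A" if "x \<in> A" "y \<in> verts G" "p x = p y" for x y
      using that by simp
    moreover obtain x y where "x \<in> A" "y \<in> verts G" "p y = v" "y \<notin> A" using A by blast
    moreover have "p x = v" using A(1) \<open>x \<in> A\<close> by blast
    ultimately show False by simp
  qed
  then obtain e where e: "e \<in> S" "e \<in> edge_cut G A" by blast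
  then obtain a b where ab: "a \<in> ends G e" "a \<in> A" "b \<in> ends G e" "b \<notin> A" by (auto simp: edge_cut_def)
  obtain u where u: "p ` ends G e = {u}" using contractsD(5)[OF c e(1)] by blast
  have "p a = v" using ab A by auto
  moreover have "p a = u" "p b = u" using u ab by auto
  moreover have "b \<in> verts G"
    using ab finite_graph_ends_sub[OF fg] e contractsD(1)[OF c] by blast
  ultimately show "\<exists>e\<in>{e \<in> S. p ` ends G e = {v}}.
      ends G e \<inter> A \<noteq> {} \<and> ends G e \<inter> ({x \<in> verts G. p x = v} - A) \<noteq> {}"
    using ab e u by (intro bexI[of _ e]) auto
qed

lemma bij_betw_vimage:
  assumes "bij_betw h A B" "C \<subseteq> B" shows "bij_betw h {e \<in> A. h e \<in> C} C"
  using assms by (auto simp: bij_betw_def inj_on_def)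

text \<open>Both sides count edge ends at the fibre: its inner edges are the contracted ones and
  those that become loops at \<open>v\<close>, and the edges leaving it become the edges leaving
  \<open>v\<close>.\<close>

lemma contracts_valence:
  assumes c: "contracts p h S G w G' w'" and fg: "finite_graph G" and v: "v \<in> verts G'"
  shows "(\<Sum>x\<in>{x \<in> verts G. p x = v}. valence G x) = valence G' v + 2 * card {e \<in> S. p ` ends G e = {v}}"
proof -
  have fg': "finite_graph G'" using contracts_finite_graph[OF c fg] .
  have fE: "finite (edges G)" using fg by (auto simp: finite_graph_def)
  have fS: "finite S" by (rule finite_subset[OF contractsD(1)[OF c] fE])
  define C where "C = {x \<in> verts G. p x \<in> {v}}"
  define Sv where "Sv = {e \<in> S. p ` ends G e = {v}}"
  have C': "{x \<in> verts G. p x = v} = C" by (auto simp: C_def)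
  have Csub: "C \<subseteq> verts G" by (auto simp: C_def)
  have "card (inner_edges G C) = card Sv + card (inner_edges G' {v})"
  proof -
    have i: "Sv \<subseteq> inner_edges G C" using contractsD(1)[OF c] finite_graph_ends_sub[OF fg]
      by (auto simp: Sv_def inner_edges_def C_def)
    have "inner_edges G C \<inter> S = Sv"
    proof (rule subset_antisym)
      show "inner_edges G C \<inter> S \<subseteq> Sv"
      proof
        fix e assume e: "e \<in> inner_edges G C \<inter> S"
        then have "ends G e \<noteq> {}" "ends G e \<subseteq> C" "e \<in> S"
          using finite_graph_ends_ne[OF fg] by (auto simp: inner_edges_def)
        moreover have "p z = v" if "z \<in> C" for z using that by (simp add: C_def)
        ultimately show "e \<in> Sv" by (auto simp: Sv_def)
      qed
    qed (use i in \<open>auto simp: Sv_def\<close>)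
    then have "inner_edges G C = Sv \<union> {e \<in> inner_edges G C. e \<notin> S}" by auto
    also have "{e \<in> inner_edges G C. e \<notin> S} = {e \<in> edges G - S. h e \<in> inner_edges G' {v}}"
      unfolding C_def by (rule contracts_inner[OF c fg]) (use v in auto)
    finally have "card (inner_edges G C) = card Sv + card {e \<in> edges G - S. h e \<in> inner_edges G' {v}}"
      using fS fE by (subst card_Un_disjoint[symmetric]) (auto simp: Sv_def)
    moreover have "bij_betw h {e \<in> edges G - S. h e \<in> inner_edges G' {v}} (inner_edges G' {v})"
      by (rule bij_betw_vimage[OF contractsD(3)[OF c]]) (auto simp: inner_edges_def)
    ultimately show ?thesis using bij_betw_same_card by metis
  qed
  moreover have "card (edge_cut G C) = card (edge_cut G' {v})"
  proof -
    have "edge_cut G C = {e \<in> edges G - S. h e \<in> edge_cut G' {v}}"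
      unfolding C_def by (rule contracts_cut[OF c fg]) (use v in auto)
    moreover have "bij_betw h {e \<in> edges G - S. h e \<in> edge_cut G' {v}} (edge_cut G' {v})"
      by (rule bij_betw_vimage[OF contractsD(3)[OF c]]) (auto simp: edge_cut_def)
    ultimately show ?thesis using bij_betw_same_card by metis
  qed
  moreover have "valence G' v = 2 * card (inner_edges G' {v}) + card (edge_cut G' {v})"
    using sum_valence[OF fg', of "{v}"] v by simp
  ultimately show ?thesis unfolding C' sum_valence[OF fg Csub] Sv_def by simp
qed

text \<open>A fibre over a vertex of weight zero is a tree on k weightless vertices of valence at
  least 3, which leaves a valence of at least 3k - 2(k - 1) = k + 2 \<ge> 3.\<close>

lemma contracts_stable:
  assumes c: "contracts p h S G w G' w'" and ct: "combinatorial_type G w"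
  shows "combinatorial_type G' w'"
proof -
  have fg: "finite_graph G" and cg: "connected_graph G" using ct by (simp_all add: combinatorial_type_def)
  have st: "3 \<le> valence G x" if "x \<in> verts G" "w x = 0" for x
    using ct that by (simp add: combinatorial_type_def)
  have fg': "finite_graph G'" using contracts_finite_graph[OF c fg] .
  have fV: "finite (verts G)" using fg by (auto simp: finite_graph_def)
  have "3 \<le> valence G' v" if v: "v \<in> verts G'" and w0: "w' v = 0" for v
  proof -
    define C where "C = {x \<in> verts G. p x = v}"
    define Sv where "Sv = {e \<in> S. p ` ends G e = {v}}"
    have fC: "finite C" using fV by (auto simp: C_def)
    have "C \<noteq> {}" using v contractsD(2)[OF c] by (auto simp: C_def)
    then have C1: "1 \<le> card C" using fC by (simp add: Suc_le_eq card_gt_0_iff)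
    have "card C \<le> card Sv + 1" using contracts_fibre_rank[OF c fg v] C_def Sv_def by simp
    moreover have "card C = sum w C + card Sv + 1" using contractsD(7)[OF c v] w0 C_def Sv_def by simp
    ultimately have eqs: "sum w C = 0" "card C = card Sv + 1" by auto
    then have "3 \<le> valence G x" if "x \<in> C" for x using st fC that by (auto simp: C_def)
    then have "(\<Sum>x\<in>C. 3) \<le> (\<Sum>x\<in>C. valence G x)" by (rule sum_mono)
    then have "3 * card C \<le> valence G' v + 2 * card Sv"
      using contracts_valence[OF c fg v] by (simp add: C_def Sv_def)
    then show ?thesis using eqs C1 by linarith
  qed
  then show ?thesis using fg' contracts_connected[OF c fg] cg by (auto simp: combinatorial_type_def)
qed

lemma contracts_trans:
  assumes c1: "contracts p h S G w G1 w1" and c2: "contracts q k S' G1 w1 G2 w2" and fg: "finite_graph G"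
  shows "contracts (q \<circ> p) (k \<circ> h) (S \<union> {e \<in> edges G - S. h e \<in> S'}) G w G2 w2"
proof -
  let ?S = "S \<union> {e \<in> edges G - S. h e \<in> S'}"
  note D1 = contractsD[OF c1] and D2 = contractsD[OF c2]
  have fg1: "finite_graph G1" using contracts_finite_graph[OF c1 fg] .
  have fE: "finite (edges G)" and fV: "finite (verts G)" using fg by (auto simp: finite_graph_def)
  have fS: "finite S" by (rule finite_subset[OF D1(1) fE])
  have hE: "h e \<in> edges G1" if "e \<in> edges G" "e \<notin> S" for e using D1(3) that by (auto simp: bij_betw_def)
  have "bij_betw h (edges G - ?S) (edges G1 - S')"
    using D1(3) D2(1) by (auto simp: bij_betw_def inj_on_def)
  then have bij: "bij_betw (k \<circ> h) (edges G - ?S) (edges G2)"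
    using D2(3) by (rule bij_betw_trans)
  have sing: "\<exists>v. (q \<circ> p) ` ends G e = {v}" if e: "e \<in> ?S" for e
  proof (cases "e \<in> S")
    case True
    then obtain v where "p ` ends G e = {v}" using D1(5)[OF True] by blast
    then have "(q \<circ> p) ` ends G e = {q v}" by (metis image_comp image_empty image_insert)
    then show ?thesis by blast
  next
    case False
    then have "h e \<in> S'" "ends G1 (h e) = p ` ends G e" using e D1(4) by auto
    then show ?thesis using D2(5)[of "h e"] by (simp add: image_comp)
  qed
  have sat: "y \<in> A" if A: "A \<subseteq> verts G" "?S \<inter> edge_cut G A = {}" and xy: "x \<in> A" "y \<in> verts G" "(q \<circ> p) x = (q \<circ> p) y" for A x y
  proof -
    have s1: "b \<in> A" if "a \<in> A" "b \<in> verts G" "p a = p b" for a b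
      using D1(6)[OF A(1) _ that] A(2) by auto
    have eq: "{x \<in> verts G. p x \<in> p ` A} = A" by (rule saturated_eq[OF A(1) s1])
    have pA: "p ` A \<subseteq> verts G1" using A D1(2) by auto
    have "S' \<inter> edge_cut G1 (p ` A) = {}"
    proof (rule ccontr)
      assume "S' \<inter> edge_cut G1 (p ` A) \<noteq> {}"
      then obtain d where d: "d \<in> S'" "d \<in> edge_cut G1 (p ` A)" by blast
      obtain e where e: "e \<in> edges G" "e \<notin> S" "d = h e" using contracts_edge[OF c1, of d] d D2(1) by (metis subsetD)
      then have "e \<in> edge_cut G A" using contracts_cut[OF c1 fg pA] d eq by auto
      then show False using A(2) e d by auto
    qed
    from D2(6)[OF pA this, of "p x" "p y"] have "p y \<in> p ` A" using xy D1(2) by auto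
    then show ?thesis using eq xy by auto
  qed
  have weight: "w2 v + card {x \<in> verts G. (q \<circ> p) x = v} =
        (\<Sum>x\<in>{x \<in> verts G. (q \<circ> p) x = v}. w x) + card {e \<in> ?S. (q \<circ> p) ` ends G e = {v}} + 1"
    if v: "v \<in> verts G2" for v
  proof -
    define B where "B = {y \<in> verts G1. q y = v}"
    have fB: "finite B" using fg1 by (auto simp: B_def finite_graph_def)
    let ?C = "{x \<in> verts G. (q \<circ> p) x = v}"
    have fC: "finite ?C" using fV by auto
    have pC: "p ` ?C \<subseteq> B" using D1(2) by (auto simp: B_def)
    have fib: "{x \<in> ?C. p x = y} = {x \<in> verts G. p x = y}" if "y \<in> B" for y
      using that by (auto simp: B_def)
    have w1: "(\<Sum>y\<in>B. w1 y + card {x \<in> verts G. p x = y}) =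
      (\<Sum>y\<in>B. (\<Sum>x\<in>{x \<in> verts G. p x = y}. w x) + card {e \<in> S. p ` ends G e = {y}} + 1)"
      by (intro sum.cong refl D1(7)) (auto simp: B_def)
    have a: "(\<Sum>y\<in>B. card {x \<in> verts G. p x = y}) = card ?C"
      using sum.group[OF fC fB pC, of "\<lambda>_. 1::nat"] fib by simp
    have b: "(\<Sum>y\<in>B. \<Sum>x\<in>{x \<in> verts G. p x = y}. w x) = (\<Sum>x\<in>?C. w x)"
      using sum.group[OF fC fB pC, of w] fib by simp
    define u where "u e = (THE y. p ` ends G e = {y})" for e
    have u: "p ` ends G e = {y} \<longleftrightarrow> u e = y" if "e \<in> S" for e y
    proof -
      obtain z where "p ` ends G e = {z}" using D1(5)[OF \<open>e \<in> S\<close>] by blast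
      then show ?thesis by (simp add: u_def)
    qed
    let ?Sv = "{e \<in> S. (q \<circ> p) ` ends G e = {v}}"
    have uS: "p ` ends G e = {u e}" "u e \<in> verts G1" if "e \<in> S" for e
    proof -
      show *: "p ` ends G e = {u e}" using u that by blast
      have "ends G e \<subseteq> verts G" using finite_graph_ends_sub[OF fg] that D1(1) by blast
      then show "u e \<in> verts G1" using * D1(2) by (metis image_mono insert_subset)
    qed
    have qu: "(q \<circ> p) ` ends G e = {v} \<longleftrightarrow> q (u e) = v" if "e \<in> S" for e
      using uS[OF that] by (metis image_comp image_empty image_insert singleton_inject)
    have cS: "(\<Sum>y\<in>B. card {e \<in> S. p ` ends G e = {y}}) = card ?Sv"
    proof -
      have "u ` ?Sv \<subseteq> B" using uS qu by (auto simp: B_def)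
      moreover have "finite ?Sv" using fS by auto
      ultimately have "(\<Sum>y\<in>B. card {e \<in> ?Sv. u e = y}) = card ?Sv"
        using sum.group[of ?Sv B u "\<lambda>_. 1::nat"] fB by simp
      moreover have "{e \<in> ?Sv. u e = y} = {e \<in> S. p ` ends G e = {y}}" if "y \<in> B" for y
      proof -
        have "(q \<circ> p) ` ends G e = {v} \<and> u e = y \<longleftrightarrow> p ` ends G e = {y}" if "e \<in> S" for e
          unfolding u[OF that] qu[OF that] using \<open>y \<in> B\<close> by (auto simp: B_def)
        then show ?thesis by blast
      qed
      ultimately show ?thesis by simp
    qed
    \<comment> \<open>The weight clause of the first contraction summed over the intermediate fibre
      \<open>B\<close>. The clause of the second one at \<open>v\<close>, stated next, eliminates
      the intermediate weights.\<close>
    have tot: "sum w1 B + card ?C = (\<Sum>x\<in>?C. w x) + card ?Sv + card B"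
      using w1 a b cS card_eq_sum[of B] unfolding sum.distrib by linarith
    have two: "w2 v + card B = sum w1 B + card {e \<in> S'. q ` ends G1 e = {v}} + 1"
      using D2(7)[OF v] by (simp add: B_def)
    let ?N = "{e \<in> edges G - S. h e \<in> S' \<and> (q \<circ> p) ` ends G e = {v}}"
    have "bij_betw h ?N {e \<in> S'. q ` ends G1 e = {v}}"
    proof (rule bij_betw_imageI)
      show "inj_on h ?N" by (rule inj_on_subset[OF bij_betw_imp_inj_on[OF D1(3)]]) auto
      show "h ` ?N = {e \<in> S'. q ` ends G1 e = {v}}"
      proof (intro subset_antisym subsetI)
        fix d assume "d \<in> h ` ?N"
        then obtain e where e: "e \<in> edges G" "e \<notin> S" "h e \<in> S'" "(q \<circ> p) ` ends G e = {v}" "d = h e" by auto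
        then show "d \<in> {e \<in> S'. q ` ends G1 e = {v}}" using D1(4)[OF e(1,2)] by (simp add: image_comp)
      next
        fix d assume d: "d \<in> {e \<in> S'. q ` ends G1 e = {v}}"
        then obtain e where e: "e \<in> edges G" "e \<notin> S" "d = h e" using contracts_edge[OF c1, of d] D2(1) by (metis (mono_tags, lifting) mem_Collect_eq subsetD)
        then have "(q \<circ> p) ` ends G e = {v}" using d D1(4)[OF e(1,2)] by (simp add: image_comp)
        then show "d \<in> h ` ?N" using e d by auto
      qed
    qed
    then have "card ?N = card {e \<in> S'. q ` ends G1 e = {v}}" by (rule bij_betw_same_card)
    moreover have "{e \<in> ?S. (q \<circ> p) ` ends G e = {v}} = ?Sv \<union> ?N" by auto
    moreover have "card (?Sv \<union> ?N) = card ?Sv + card ?N"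
      by (rule card_Un_disjoint) (use fS fE in auto)
    ultimately show ?thesis using tot two by simp
  qed
  show ?thesis unfolding contracts_def
  proof (intro conjI)
    show "?S \<subseteq> edges G" using D1(1) by auto
    show "verts G2 = (q \<circ> p) ` verts G" using D1(2) D2(2) by auto
    show "\<forall>e\<in>edges G - ?S. ends G2 ((k \<circ> h) e) = (q \<circ> p) ` ends G e"
    proof
      fix e assume "e \<in> edges G - ?S"
      then have e: "e \<in> edges G" "e \<notin> S" "h e \<notin> S'" by auto
      show "ends G2 ((k \<circ> h) e) = (q \<circ> p) ` ends G e"
        using D1(4)[OF e(1,2)] D2(4)[OF hE[OF e(1,2)] e(3)] by (simp add: image_comp)
    qed
    show "\<forall>A\<subseteq>verts G. ?S \<inter> edge_cut G A = {} \<longrightarrow>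
        (\<forall>x\<in>A. \<forall>y\<in>verts G. (q \<circ> p) x = (q \<circ> p) y \<longrightarrow> y \<in> A)"
      by (intro allI impI ballI) (rule sat)
    show "\<forall>e\<in>?S. \<exists>v. (q \<circ> p) ` ends G e = {v}" by (intro ballI sing)
  qed (use bij in simp, intro ballI weight)
qed

text \<open>With nothing contracted, the saturation clause applied to \<open>{x}\<close> makes
  \<open>p\<close> injective, and the weight clause for one-point fibres says that weights are
  preserved.\<close>

lemma contracts_empty_iff:
  assumes fg: "finite_graph G"
  shows "contracts p h {} G w G' w' \<longleftrightarrow> graph_iso_via p h G G' \<and> (\<forall>v\<in>verts G. w' (p v) = w v)"
proof
  assume c: "contracts p h {} G w G' w'"
  note D = contractsD[OF c]
  have inj: "inj_on p (verts G)"
  proof (rule inj_onI)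
    fix x y assume xy: "x \<in> verts G" "y \<in> verts G" "p x = p y"
    show "x = y" using D(6)[of "{x}" x y] xy by auto
  qed
  have "w' (p v) = w v" if "v \<in> verts G" for v
  proof -
    have "{x \<in> verts G. p x = p v} = {v}" using inj that by (auto simp: inj_on_def)
    then show ?thesis using D(7)[of "p v"] D(2) that by simp
  qed
  then show "graph_iso_via p h G G' \<and> (\<forall>v\<in>verts G. w' (p v) = w v)"
    using D(2,3) D(4) inj by (simp add: graph_iso_via_def bij_betw_def)
next
  assume i: "graph_iso_via p h G G' \<and> (\<forall>v\<in>verts G. w' (p v) = w v)"
  then have inj: "inj_on p (verts G)" by (auto simp: graph_iso_via_def bij_betw_def)
  have "w' v + card {x \<in> verts G. p x = v} =
        (\<Sum>x\<in>{x \<in> verts G. p x = v}. w x) + card {e \<in> {}. p ` ends G e = {v}} + 1" if v: "v \<in> verts G'" for v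
  proof -
    obtain y where y: "y \<in> verts G" "v = p y" using i v unfolding graph_iso_via_def bij_betw_def by blast
    then have "{x \<in> verts G. p x = v} = {y}" using inj by (auto simp: inj_on_def)
    then show ?thesis using i y by simp
  qed
  moreover have "\<forall>A\<subseteq>verts G. {} \<inter> edge_cut G A = {} \<longrightarrow> (\<forall>x\<in>A. \<forall>y\<in>verts G. p x = p y \<longrightarrow> y \<in> A)"
    using inj by (metis inj_onD subsetD)
  moreover have "verts G' = p ` verts G" "bij_betw h (edges G - {}) (edges G')"
    "\<forall>e\<in>edges G - {}. ends G' (h e) = p ` ends G e"
    using i by (simp_all add: graph_iso_via_def bij_betw_def)
  ultimately show "contracts p h {} G w G' w'"
    unfolding contracts_def by (intro conjI ballI) (assumption | simp)+
qed

text \<open>Both vertex maps have the components of \<open>S\<close> as fibres, so the maps induced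
  between the two results are well defined and bijective, and the two weight clauses agree term by
  term.\<close>

lemma contracts_unique:
  assumes c1: "contracts p h S G w G1 w1" and c2: "contracts q k S G w G2 w2" and fg: "finite_graph G"
  obtains f g where "contracts f g {} G1 w1 G2 w2" "\<And>e. e \<in> edges G - S \<Longrightarrow> g (h e) = k e"
    "\<And>x. x \<in> verts G \<Longrightarrow> f (p x) = q x"
proof -
  note D1 = contractsD[OF c1] and D2 = contractsD[OF c2]
  \<comment> \<open>A fibre of \<open>q'\<close> is not crossed by any edge of \<open>S\<close>, so
    it is a union of fibres of \<open>p'\<close>. The same argument is used with the two
    contractions exchanged.\<close>
  have ker: "q' x = q' y" if c1: "contracts p' h' S G w G1' w1'" and c2: "contracts q' k' S G w G2' w2'"
      and xy: "x \<in> verts G" "y \<in> verts G" "p' x = p' y"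
    for p' h' q' k' x y and G1' :: "('z, 'y) mgraph" and w1' and G2' :: "('z1, 'y1) mgraph" and w2'
  proof -
    have "S \<inter> edge_cut G {z \<in> verts G. q' z = q' x} = {}"
    proof -
      have "e \<notin> edge_cut G {z \<in> verts G. q' z = q' x}" if "e \<in> S" for e
      proof -
        obtain v where "q' ` ends G e = {v}" using contractsD(5)[OF c2 \<open>e \<in> S\<close>] by blast
        moreover have "ends G e \<subseteq> verts G" using finite_graph_ends_sub[OF fg] contractsD(1)[OF c2] that by blast
        ultimately show ?thesis by (auto simp: edge_cut_def) (metis imageI singletonD)
      qed
      then show ?thesis by blast
    qed
    then show ?thesis using contractsD(6)[OF c1, of "{z \<in> verts G. q' z = q' x}" x y] xy by auto
  qed
  have ker12: "q x = q y" if "x \<in> verts G" "y \<in> verts G" "p x = p y" for x y using ker[OF c1 c2 that] .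
  have ker21: "p x = p y" if "x \<in> verts G" "y \<in> verts G" "q x = q y" for x y using ker[OF c2 c1 that] .
  define f where "f u = q (SOME x. x \<in> verts G \<and> p x = u)" for u
  define g where "g d = k (inv_into (edges G - S) h d)" for d
  have f: "f (p x) = q x" if "x \<in> verts G" for x
  proof -
    have "\<exists>y. y \<in> verts G \<and> p y = p x" using that by blast
    then have "(SOME y. y \<in> verts G \<and> p y = p x) \<in> verts G \<and> p (SOME y. y \<in> verts G \<and> p y = p x) = p x"
      by (rule someI_ex)
    then show ?thesis unfolding f_def using ker12 that by blast
  qed
  have g: "g (h e) = k e" if "e \<in> edges G - S" for e
    using D1(3) that by (simp add: g_def bij_betw_def)
  have fg1: "finite_graph G1" using contracts_finite_graph[OF c1 fg] .
  have "bij_betw f (verts G1) (verts G2)"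
  proof (rule bij_betw_imageI)
    show "inj_on f (verts G1)" unfolding D1(2)
    proof (rule inj_onI)
      fix a b assume "a \<in> p ` verts G" "b \<in> p ` verts G" and ab: "f a = f b"
      then obtain x y where "x \<in> verts G" "y \<in> verts G" "a = p x" "b = p y" by blast
      then show "a = b" using ab f[of x] f[of y] ker21[of x y] by simp
    qed
    show "f ` verts G1 = verts G2" unfolding D1(2) D2(2) image_image using f by (intro image_cong) auto
  qed
  moreover have "bij_betw g (edges G1) (edges G2)"
    unfolding g_def using bij_betw_trans[OF bij_betw_inv_into[OF D1(3)] D2(3)] by (simp add: comp_def)
  moreover have "ends G2 (g d) = f ` ends G1 d" if d: "d \<in> edges G1" for d
  proof -
    obtain e where e: "e \<in> edges G" "e \<notin> S" "d = h e" using c1 d by (rule contracts_edge)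
    have "f ` p ` ends G e = q ` ends G e"
      unfolding image_image using f finite_graph_ends_sub[OF fg e(1)] by (intro image_cong) auto
    then show ?thesis using g[of e] D1(4)[OF e(1,2)] D2(4)[OF e(1,2)] e by simp
  qed
  moreover have "w2 (f u) = w1 u" if u: "u \<in> verts G1" for u
  proof -
    obtain x where x: "x \<in> verts G" "u = p x" using u D1(2) by auto
    have fib: "p y = p x \<longleftrightarrow> q y = q x" if "y \<in> verts G" for y
      using ker12[OF that x(1)] ker21[OF that x(1)] by blast
    have A: "{y \<in> verts G. p y = p x} = {y \<in> verts G. q y = q x}" using fib by auto
    have B: "{e \<in> S. p ` ends G e = {p x}} = {e \<in> S. q ` ends G e = {q x}}"
    proof -
      have "p ` ends G e = {p x} \<longleftrightarrow> q ` ends G e = {q x}" if "e \<in> S" for e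
      proof -
        have "e \<in> edges G" using D1(1) that by blast
        then have "ends G e \<subseteq> verts G" "ends G e \<noteq> {}"
          using finite_graph_ends_sub[OF fg] finite_graph_ends_ne[OF fg] by blast+
        then have "p ` ends G e = {p x} \<longleftrightarrow> (\<forall>z\<in>ends G e. p z = p x)"
          "q ` ends G e = {q x} \<longleftrightarrow> (\<forall>z\<in>ends G e. q z = q x)" by auto
        then show ?thesis using fib \<open>ends G e \<subseteq> verts G\<close> by blast
      qed
      then show ?thesis by auto
    qed
    have "p x \<in> verts G1" "q x \<in> verts G2" using x D1(2) D2(2) by auto
    then show ?thesis using D1(7)[of "p x"] D2(7)[of "q x"] A B f x by simp
  qed
  ultimately have "contracts f g {} G1 w1 G2 w2"
    unfolding contracts_empty_iff[OF fg1] by (auto simp: graph_iso_via_def)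
  then show ?thesis using f g by (intro that)
qed

text \<open>Uniqueness of contractions, applied to the given isomorphism and the identity, which
  both contract nothing.\<close>

lemma contracts_inverse:
  assumes c: "contracts f g {} G w G' w'" and fg: "finite_graph G"
  obtains f' g' where "contracts f' g' {} G' w' G w" "\<And>e. e \<in> edges G \<Longrightarrow> g' (g e) = e"
    "\<And>x. x \<in> verts G \<Longrightarrow> f' (f x) = x"
proof -
  have "contracts id id {} G w G w"
    unfolding contracts_empty_iff[OF fg] by (auto simp: graph_iso_via_def)
  from contracts_unique[OF c this fg] that show ?thesis by auto
qed

text \<open>The weight clause reads \<open>w' a + 1 = w a + 1 + 1\<close> at a contracted loop and
  \<open>w' a + 2 = (w a + w b) + 1 + 1\<close> at a contracted nonloop edge.\<close>

lemma contract_edge_contracts: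
  fixes G :: "(nat, nat) mgraph"
  assumes fg: "finite_graph G" and e: "e \<in> edges G" and G': "contract_edge e (G, w) = (G', w')"
  shows "\<exists>p. contracts p id {e} G w G' w'"
proof -
  obtain x y where xy: "ends G e = {x, y}" "x \<in> verts G" "y \<in> verts G" using fg e by (rule finite_graph_ends)
  show ?thesis
  proof (cases "is_loop G e")
    case True
    then have "ends G e = {x}" using xy by (auto simp: is_loop_def card_insert_if split: if_splits)
    then have G'': "G' = delete_edge G e" "w' = w(x := w x + 1)" using True G' by (auto simp: Let_def)
    have fib: "{z \<in> verts G. id z = v} = {v}" if "v \<in> verts G" for v using that by auto
    have "contracts id id {e} G w G' w'"
      unfolding contracts_def
    proof (intro conjI ballI)
      fix v assume "v \<in> verts G'"
      then have v: "v \<in> verts G" by (simp add: G'' delete_edge_def)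
      show "w' v + card {x \<in> verts G. id x = v} =
        (\<Sum>x\<in>{x \<in> verts G. id x = v}. w x) + card {a \<in> {e}. id ` ends G a = {v}} + 1"
      proof (cases "v = x")
        case True
        then have "{a \<in> {e}. id ` ends G a = {v}} = {e}" using \<open>ends G e = {x}\<close> by auto
        then show ?thesis unfolding fib[OF v] using True by (simp add: G'')
      next
        case False
        then have "{a \<in> {e}. id ` ends G a = {v}} = {}" using \<open>ends G e = {x}\<close> by auto
        then show ?thesis unfolding fib[OF v] using False by (simp add: G'')
      qed
    qed (use e \<open>ends G e = {x}\<close> in \<open>auto simp: G'' delete_edge_def\<close>)
    then show ?thesis by blast
  next
    case False
    define a b where "a = Min (ends G e)" and "b = Max (ends G e)"
    have ab: "a \<noteq> b" "ends G e = {a, b}" "a \<in> verts G" "b \<in> verts G"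
      using False xy by (auto simp: a_def b_def is_loop_def min_def max_def split: if_splits)
    define p where "p = (\<lambda>x. if x = b then a else x)"
    have G'': "G' = \<lparr>verts = verts G - {b}, edges = edges G - {e}, ends = (\<lambda>d. p ` ends G d)\<rparr>"
      "w' = w(a := w a + w b)"
      using False G' by (auto simp: Let_def a_def b_def p_def)
    have fib: "{z \<in> verts G. p z = v} = (if v = a then {a, b} else {v})" if "v \<in> verts G" "v \<noteq> b" for v
      using that ab by (auto simp: p_def)
    have "contracts p id {e} G w G' w'"
      unfolding contracts_def
    proof (intro conjI ballI)
      fix v assume "v \<in> verts G'"
      then have v: "v \<in> verts G" "v \<noteq> b" by (auto simp: G'')
      show "w' v + card {x \<in> verts G. p x = v} =
        (\<Sum>x\<in>{x \<in> verts G. p x = v}. w x) + card {d \<in> {e}. p ` ends G d = {v}} + 1"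
      proof (cases "v = a")
        case True
        then have "{d \<in> {e}. p ` ends G d = {v}} = {e}" using ab by (auto simp: p_def)
        then show ?thesis unfolding fib[OF v] using ab True by (simp add: G'')
      next
        case False
        then have "{d \<in> {e}. p ` ends G d = {v}} = {}" using ab by (auto simp: p_def)
        then show ?thesis unfolding fib[OF v] using ab False by (simp add: G'')
      qed
    next
      show "verts G' = p ` verts G" using ab by (auto simp: G'' p_def image_iff)
      show "\<forall>A\<subseteq>verts G. {e} \<inter> edge_cut G A = {} \<longrightarrow> (\<forall>x\<in>A. \<forall>y\<in>verts G. p x = p y \<longrightarrow> y \<in> A)"
        using e ab by (auto simp: edge_cut_def p_def split: if_splits)
      show "\<exists>v. p ` ends G d = {v}" if "d \<in> {e}" for d using that ab by (auto simp: p_def)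
    qed (use e in \<open>auto simp: G''\<close>)
    then show ?thesis by blast
  qed
qed

lemma fold_contract_edge_contracts:
  fixes G :: "(nat, nat) mgraph"
  assumes "finite_graph G" "set xs \<subseteq> edges G" "distinct xs"
    "fold contract_edge xs (G, w) = (G', w')"
  shows "\<exists>p. contracts p id (set xs) G w G' w'"
  using assms
proof (induction xs arbitrary: G w)
  case Nil
  then have "contracts id id {} G w G' w'"
    unfolding contracts_empty_iff[OF Nil(1)] by (auto simp: graph_iso_via_def)
  then show ?case unfolding list.set(1) by (intro exI[where x = id])
next
  case (Cons e xs)
  obtain G1 w1 where G1: "contract_edge e (G, w) = (G1, w1)" by force
  obtain p where p: "contracts p id {e} G w G1 w1"
    using contract_edge_contracts[OF Cons.prems(1) _ G1] Cons.prems(2) by auto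
  have "edges G1 = edges G - {e}" using contractsD(3)[OF p] by (simp add: bij_betw_def)
  then have "set xs \<subseteq> edges G1" using Cons.prems by auto
  moreover have "fold contract_edge xs (G1, w1) = (G', w')" using Cons.prems(4) G1 by simp
  ultimately have "\<exists>q. contracts q id (set xs) G1 w1 G' w'"
    using Cons.prems(3) by (intro Cons.IH[OF contracts_finite_graph[OF p Cons.prems(1)]]) auto
  then obtain q where q: "contracts q id (set xs) G1 w1 G' w'" ..
  have "{e} \<union> {d \<in> edges G - {e}. id d \<in> set xs} = set (e # xs)" using Cons.prems by auto
  then show ?case using contracts_trans[OF p q Cons.prems(1)] by (metis comp_id)
qed

lemma contract_edges_contracts:
  fixes G :: "(nat, nat) mgraph"
  assumes fg: "finite_graph G" and S: "S \<subseteq> edges G" and G': "contract_edges S (G, w) = (G', w')"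
  obtains p where "contracts p id S G w G' w'"
proof -
  have "finite S" using S fg finite_subset by (auto simp: finite_graph_def)
  then have "set (sorted_list_of_set S) = S" by simp
  then show ?thesis
    using fold_contract_edge_contracts[OF fg, of "sorted_list_of_set S" w G' w'] S G' that
    by (auto simp: contract_edges_def)
qed

section \<open>Hyperelliptic involutions\<close>

text \<open>Burnside's count for a group of order two: a fixed point is counted twice on the right,
  and so are the two elements of a larger orbit together.\<close>

lemma card_involution_orbits:
  assumes fX: "finite X" and f: "\<And>x. x \<in> X \<Longrightarrow> f x \<in> X" and ff: "\<And>x. x \<in> X \<Longrightarrow> f (f x) = x"
  shows "2 * card ((\<lambda>x. {x, f x}) ` X) = card X + card {x \<in> X. f x = x}"
proof -
  define A B where "A = {x \<in> X. f x = x}" and "B = {x \<in> X. f x \<noteq> x}"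
  have fin: "finite A" "finite B" using fX by (auto simp: A_def B_def)
  have X: "X = A \<union> B" "A \<inter> B = {}" by (auto simp: A_def B_def)
  have fB: "f x \<in> B" if "x \<in> B" for x using that f ff by (force simp: B_def)
  let ?o = "\<lambda>x. {x, f x}"
  have disj: "?o ` A \<inter> ?o ` B = {}"
  proof -
    have "?o a \<noteq> ?o b" if "a \<in> A" "b \<in> B" for a b
      using that by (auto simp: A_def B_def doubleton_eq_iff)
    then show ?thesis by blast
  qed
  have "card (?o ` A) = card A"
    by (rule card_image) (auto simp: inj_on_def A_def doubleton_eq_iff)
  moreover have "2 * card (?o ` B) = card (\<Union> (?o ` B))"
  proof (rule card_partition)
    show "finite (?o ` B)" "finite (\<Union> (?o ` B))" using fin by auto
    show "card c = 2" if "c \<in> ?o ` B" for c using that by (auto simp: B_def)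
    show "c1 \<inter> c2 = {}" if c: "c1 \<in> ?o ` B" "c2 \<in> ?o ` B" "c1 \<noteq> c2" for c1 c2
    proof (rule ccontr)
      assume ne: "c1 \<inter> c2 \<noteq> {}"
      obtain x y where xy: "x \<in> B" "y \<in> B" "c1 = {x, f x}" "c2 = {y, f y}" using c by auto
      have "f (f x) = x" "f (f y) = y" using xy ff by (auto simp: B_def)
      moreover have "x = y \<or> x = f y \<or> f x = y \<or> f x = f y" using ne xy by blast
      ultimately have "x = y \<or> x = f y" by metis
      then have "c1 = c2" using xy \<open>f (f y) = y\<close> by auto
      then show False using c by simp
    qed
  qed
  moreover have "\<Union> (?o ` B) = B" using fB by auto
  moreover have "card (?o ` X) = card (?o ` A) + card (?o ` B)"
    unfolding X(1) image_Un using fin disj by (intro card_Un_disjoint) auto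
  moreover have "card X = card A + card B" using X fin by (metis card_Un_disjoint)
  ultimately show ?thesis by (simp add: A_def)
qed

text \<open>In the applications of \<open>collapse_rank\<close> below, the constant map to
  \<open>unit\<close> stands for the partition into a single class.\<close>

lemma card_unit_set_le: "card (X :: unit set) \<le> 1"
  using card_mono[OF finite subset_UNIV, of X] by (simp add: UNIV_unit)

text \<open>The last clause says that the quotient by the involution, with the images of
  the loops and of the flipped edges removed, is a tree: its number of edges is one less than its
  number of vertices.\<close>

definition hyp_involution ::
    "('v, 'e) mgraph \<Rightarrow> ('v \<Rightarrow> nat) \<Rightarrow> ('v \<Rightarrow> 'v) \<Rightarrow> ('e \<Rightarrow> 'e) \<Rightarrow> bool" where
  "hyp_involution G w \<sigma> \<tau> \<longleftrightarrow>
     (\<forall>v\<in>verts G. \<sigma> v \<in> verts G \<and> \<sigma> (\<sigma> v) = v \<and> (0 < w v \<longrightarrow> \<sigma> v = v)) \<and>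
     (\<forall>e\<in>edges G. \<tau> e \<in> edges G \<and> \<tau> (\<tau> e) = e \<and> ends G (\<tau> e) = \<sigma> ` ends G e \<and>
        (is_loop G e \<longrightarrow> \<tau> e = e) \<and>
        (\<tau> e = e \<longrightarrow> \<not> is_loop G e \<longrightarrow> (\<forall>v\<in>ends G e. \<sigma> v \<noteq> v))) \<and>
     card {e \<in> edges G. \<tau> e \<noteq> e} + 2 = card (verts G) + card {v \<in> verts G. \<sigma> v = v}"

definition involution_relation :: "('v, 'e) mgraph \<Rightarrow> ('e \<Rightarrow> 'e) \<Rightarrow> ('e \<times> 'e) set" where
  "involution_relation G \<tau> = {(d, e). d \<in> edges G \<and> (e = d \<or> e = \<tau> d)}"

definition cut_relation :: "('v, 'e) mgraph \<Rightarrow> ('e \<times> 'e) set" where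
  "cut_relation G = {(d, e). d \<in> edges G \<and> e \<in> edges G \<and> (d = e \<or> (\<exists>A\<subseteq>verts G. edge_cut G A = {d, e}))}"

text \<open>Posimodularity of the cut function, checked edge by edge: an edge of either cut on the
  left belongs to a cut on the right, and an edge of both belongs to both.\<close>

lemma card_edge_cut_posimodular:
  assumes fg: "finite_graph G"
  shows "card (edge_cut G (A - B)) + card (edge_cut G (B - A)) \<le> card (edge_cut G A) + card (edge_cut G B)"
proof -
  have e: "\<exists>x y. ends G e = {x, y}" if "e \<in> edges G" for e using finite_graph_ends_pair[OF fg that] .
  have "edge_cut G (A - B) \<union> edge_cut G (B - A) \<subseteq> edge_cut G A \<union> edge_cut G B"
  proof
    fix e assume a: "e \<in> edge_cut G (A - B) \<union> edge_cut G (B - A)"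
    then have "e \<in> edges G" by (auto simp: edge_cut_def)
    then obtain x y where "ends G e = {x, y}" using e by blast
    then show "e \<in> edge_cut G A \<union> edge_cut G B" using a by (auto simp: edge_cut_def)
  qed
  moreover have "edge_cut G (A - B) \<inter> edge_cut G (B - A) \<subseteq> edge_cut G A \<inter> edge_cut G B"
    by (auto simp: edge_cut_def)
  moreover note card_Un_Int[OF finite_edge_cut[OF fg, of "A - B"] finite_edge_cut[OF fg, of "B - A"]]
    card_Un_Int[OF finite_edge_cut[OF fg, of A] finite_edge_cut[OF fg, of B]]
  moreover note fin = finite_edge_cut[OF fg]
  ultimately show ?thesis
    using card_mono[of "edge_cut G A \<union> edge_cut G B" "edge_cut G (A - B) \<union> edge_cut G (B - A)"]
      card_mono[of "edge_cut G A \<inter> edge_cut G B" "edge_cut G (A - B) \<inter> edge_cut G (B - A)"]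
    by simp
qed

section \<open>The quotient tree of a hyperelliptic involution\<close>

locale hyp_inv =
  fixes G :: "('v, 'e) mgraph" and w :: "'v \<Rightarrow> nat" and \<sigma> :: "'v \<Rightarrow> 'v" and \<tau> :: "'e \<Rightarrow> 'e"
  assumes fg: "finite_graph G" and cg: "connected_graph G" and inv: "hyp_involution G w \<sigma> \<tau>"
begin

abbreviation "V \<equiv> verts G"
abbreviation "E \<equiv> edges G"

text \<open>The orbits under \<open>orb\<close> and the classes under \<open>cls\<close> of moved
  edges play the role of vertices and edges of the quotient tree; loops and flipped edges collapse
  to points of it.\<close>

definition "M = {e \<in> E. \<tau> e \<noteq> e}"
definition "orb v = {v, \<sigma> v}"
definition "cls e = {e, \<tau> e}"

lemma fV: "finite V" and fE: "finite E" using fg by (auto simp: finite_graph_def)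
lemma fM: "finite M" using fE by (simp add: M_def)

lemma s_in: "v \<in> V \<Longrightarrow> \<sigma> v \<in> V" and s_s: "v \<in> V \<Longrightarrow> \<sigma> (\<sigma> v) = v"
  and w_s: "v \<in> V \<Longrightarrow> 0 < w v \<Longrightarrow> \<sigma> v = v"
  using inv by (simp_all add: hyp_involution_def)

lemma t_in: "e \<in> E \<Longrightarrow> \<tau> e \<in> E" and t_t: "e \<in> E \<Longrightarrow> \<tau> (\<tau> e) = e"
  and t_ends: "e \<in> E \<Longrightarrow> ends G (\<tau> e) = \<sigma> ` ends G e"
  and loop_fixed: "e \<in> E \<Longrightarrow> is_loop G e \<Longrightarrow> \<tau> e = e"
  and flip: "e \<in> E \<Longrightarrow> \<tau> e = e \<Longrightarrow> \<not> is_loop G e \<Longrightarrow> v \<in> ends G e \<Longrightarrow> \<sigma> v \<noteq> v"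
  using inv by (simp_all add: hyp_involution_def)

lemma count: "card M + 2 = card V + card {v \<in> V. \<sigma> v = v}"
  using inv by (simp add: hyp_involution_def M_def)

lemma t_M: "e \<in> M \<Longrightarrow> \<tau> e \<in> M" using t_in t_t by (force simp: M_def)

lemma ends_V: "e \<in> E \<Longrightarrow> ends G e \<subseteq> V" by (rule finite_graph_ends_sub[OF fg])

lemma flip_ends:
  assumes "e \<in> E" "\<tau> e = e" "\<not> is_loop G e" "x \<in> ends G e"
  shows "ends G e = {x, \<sigma> x}"
proof -
  obtain a b where ab: "ends G e = {a, b}" using finite_graph_ends_pair[OF fg assms(1)] by blast
  have "\<sigma> x \<in> ends G e" using t_ends[OF assms(1)] assms(2,4) by auto
  moreover have "\<sigma> x \<noteq> x" using flip[OF assms] .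
  ultimately show ?thesis using ab assms(4) by auto
qed

lemma card_orb: "2 * card (orb ` V) = card V + card {v \<in> V. \<sigma> v = v}"
  unfolding orb_def by (rule card_involution_orbits) (auto simp: fV s_in s_s)

lemma card_cls:
  assumes "F \<subseteq> M" "\<tau> ` F \<subseteq> F" shows "2 * card (cls ` F) = card F"
proof -
  have "2 * card (cls ` F) = card F + card {e \<in> F. \<tau> e = e}"
    unfolding cls_def
    by (rule card_involution_orbits) (use assms fM finite_subset t_t in \<open>auto simp: M_def\<close>)
  moreover have "{e \<in> F. \<tau> e = e} = {}" using assms by (auto simp: M_def)
  ultimately show ?thesis by (metis add.right_neutral card.empty)
qed

text \<open>The last clause of \<open>hyp_involution\<close>, halved: a tree has one vertex more
  than it has edges.\<close>

lemma orb_count: "card (orb ` V) = card (cls ` M) + 1"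
proof -
  have "2 * card (cls ` M) = card M" by (rule card_cls) (use t_M in auto)
  then show ?thesis using card_orb count by simp
qed

lemma cut_sigma:
  assumes A: "A \<subseteq> V" shows "edge_cut G (\<sigma> ` A) = \<tau> ` edge_cut G A"
proof -
  have sub: "\<tau> e \<in> edge_cut G (\<sigma> ` B)" if B: "B \<subseteq> V" and e: "e \<in> edge_cut G B" for B e
  proof -
    have eE: "e \<in> E" using e by (simp add: edge_cut_def)
    obtain x y where xy: "x \<in> ends G e" "x \<in> B" "y \<in> ends G e" "y \<notin> B" using e by (auto simp: edge_cut_def)
    have "\<sigma> y \<notin> \<sigma> ` B"
    proof
      assume "\<sigma> y \<in> \<sigma> ` B"
      then obtain z where "z \<in> B" "\<sigma> y = \<sigma> z" by blast
      then have "y = z" using s_s[of y] s_s[of z] B ends_V[OF eE] xy by auto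
      then show False using \<open>z \<in> B\<close> xy by simp
    qed
    then show ?thesis using xy t_in[OF eE] t_ends[OF eE] by (auto simp: edge_cut_def)
  qed
  have ss: "\<sigma> ` \<sigma> ` A = A"
    unfolding image_image using s_s A by (metis (no_types, lifting) image_cong image_ident subsetD)
  show ?thesis
  proof (intro subset_antisym subsetI)
    fix e assume e: "e \<in> edge_cut G (\<sigma> ` A)"
    have "\<sigma> ` A \<subseteq> V" using s_in A by auto
    from sub[OF this e] have "\<tau> e \<in> edge_cut G A" using ss by simp
    moreover have "e = \<tau> (\<tau> e)" using t_t e by (simp add: edge_cut_def)
    ultimately show "e \<in> \<tau> ` edge_cut G A" by (rule rev_image_eqI)
  qed (use sub[OF A] in auto)
qed

text \<open>A fixed nonloop edge joins some \<open>x\<close> to \<open>\<sigma> x\<close>, so an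
  invariant set contains both of its ends or neither.\<close>

lemma invariant_cut_moved:
  assumes A: "A \<subseteq> V" and inva: "\<sigma> ` A \<subseteq> A" and e: "e \<in> edge_cut G A"
  shows "e \<in> M"
proof (rule ccontr)
  assume "e \<notin> M"
  have eE: "e \<in> E" using e by (simp add: edge_cut_def)
  obtain x y where xy: "x \<in> ends G e" "x \<in> A" "y \<in> ends G e" "y \<notin> A" using e by (auto simp: edge_cut_def)
  have "\<not> is_loop G e" using xy by (auto simp: is_loop_iff)
  then have "ends G e = {x, \<sigma> x}" using flip_ends[OF eE] \<open>e \<notin> M\<close> eE xy by (auto simp: M_def)
  then show False using xy inva by auto
qed

text \<open>The graph whose vertices are the values of \<open>p\<close> and whose edges are the
  orbits in \<open>F\<close> has, by \<open>sat\<close>, at most as many components as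
  \<open>q\<close> has values; \<open>p\<close> is constant on vertex orbits, so both edges of an
  orbit have the same image. Comparing this bound with \<open>orb_count\<close> replaces arguments
  inside the quotient tree.\<close>

lemma collapse_rank:
  fixes p :: "'v \<Rightarrow> 'c" and q :: "'c \<Rightarrow> 'd"
  assumes ps: "\<And>v. v \<in> V \<Longrightarrow> p (\<sigma> v) = p v" and F: "F \<subseteq> M"
    and sat: "\<And>A x y. A \<subseteq> V \<Longrightarrow> (\<And>x y. x \<in> A \<Longrightarrow> y \<in> V \<Longrightarrow> p x = p y \<Longrightarrow> y \<in> A) \<Longrightarrow>
      F \<inter> edge_cut G A = {} \<Longrightarrow> x \<in> A \<Longrightarrow> y \<in> V \<Longrightarrow> q (p x) = q (p y) \<Longrightarrow> y \<in> A"
  shows "card (p ` V) \<le> card (cls ` F) + card (q ` p ` V)"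
proof (rule card_le_card_connecting_classes[where en = "\<lambda>k. p ` (\<Union>e\<in>k. ends G e)"])
  have FE: "F \<subseteq> E" using F by (auto simp: M_def)
  have en: "p ` (\<Union>d\<in>cls e. ends G d) = p ` ends G e" if "e \<in> F" for e
  proof -
    have e: "e \<in> E" using that FE by auto
    have "(\<Union>d\<in>cls e. ends G d) = ends G e \<union> \<sigma> ` ends G e" using t_ends[OF e] by (simp add: cls_def)
    moreover have "p ` \<sigma> ` ends G e = p ` ends G e"
      unfolding image_image by (rule image_cong) (use ps ends_V[OF e] in auto)
    ultimately show ?thesis by (simp add: image_Un)
  qed
  show "finite (p ` V)" "finite (cls ` F)" using fV F fM finite_subset by auto
  show "\<exists>a b. p ` (\<Union>e\<in>k. ends G e) = {a, b}" if k: "k \<in> cls ` F" for k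
  proof -
    obtain e where e: "e \<in> F" "k = cls e" using k by blast
    obtain x y where "ends G e = {x, y}" using finite_graph_ends_pair[OF fg, of e] e FE by auto
    then have "p ` (\<Union>e\<in>k. ends G e) = {p x, p y}" using en[OF e(1)] e by simp
    then show ?thesis by blast
  qed
  fix B x y assume B: "B \<subseteq> p ` V"
    and nc: "\<And>k. k \<in> cls ` F \<Longrightarrow> p ` (\<Union>e\<in>k. ends G e) \<inter> B = {} \<or> p ` (\<Union>e\<in>k. ends G e) \<inter> (p ` V - B) = {}"
    and xy: "x \<in> B" "y \<in> p ` V" "q x = q y"
  define A where "A = {v \<in> V. p v \<in> B}"
  obtain a b where ab: "a \<in> V" "x = p a" "b \<in> V" "y = p b" using xy B by blast
  have "F \<inter> edge_cut G A = {}"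
  proof (rule ccontr)
    assume "F \<inter> edge_cut G A \<noteq> {}"
    then obtain e where e: "e \<in> F" "e \<in> edge_cut G A" by blast
    then obtain u v where uv: "u \<in> ends G e" "u \<in> A" "v \<in> ends G e" "v \<notin> A" by (auto simp: edge_cut_def)
    have "v \<in> V" using uv ends_V e FE by auto
    then have "p v \<notin> B" "p v \<in> p ` V" "p u \<in> B" using uv by (auto simp: A_def)
    moreover have "p ` ends G e \<inter> B = {} \<or> p ` ends G e \<inter> (p ` V - B) = {}"
      using nc[of "cls e"] e en[OF e(1)] by simp
    ultimately show False using uv by blast
  qed
  then have "b \<in> A" using ab xy by (intro sat[of A a b]) (auto simp: A_def)
  then show "y \<in> B" using ab by (simp add: A_def)
qed

lemma connected_cut: "A \<subseteq> V \<Longrightarrow> A \<noteq> {} \<Longrightarrow> A \<noteq> V \<Longrightarrow> edge_cut G A \<noteq> {}"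
  using cg unfolding connected_graph_iff_edge_cut[OF fg] by simp

lemma orb_saturated_invariant:
  assumes "A \<subseteq> V" "\<And>x y. x \<in> A \<Longrightarrow> y \<in> V \<Longrightarrow> orb x = orb y \<Longrightarrow> y \<in> A"
  shows "\<sigma> ` A \<subseteq> A"
proof
  fix y assume "y \<in> \<sigma> ` A"
  then obtain x where "x \<in> A" "y = \<sigma> x" by blast
  moreover have "x \<in> V" using assms(1) \<open>x \<in> A\<close> by auto
  ultimately show "y \<in> A" using assms(2)[of x y] s_s[of x] s_in[of x] by (auto simp: orb_def)
qed

text \<open>Deleting an edge disconnects a tree, and the two sides pull back from the quotient to
  invariant sets of vertices.\<close>

lemma moved_invariant_cut:
  assumes e: "e \<in> M"
  obtains A where "A \<subseteq> V" "\<sigma> ` A \<subseteq> A" "edge_cut G A = {e, \<tau> e}"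
proof -
  have "\<exists>A\<subseteq>V. \<sigma> ` A \<subseteq> A \<and> A \<noteq> {} \<and> A \<noteq> V \<and> edge_cut G A \<subseteq> {e, \<tau> e}"
  proof (rule ccontr)
    assume no: "\<not> ?thesis"
    let ?F = "M - {e, \<tau> e}"
    \<comment> \<open>If the orbit of \<open>e\<close> separated nothing, the remaining edge classes
      would connect the quotient, and their number would be one too small for
      \<open>orb_count\<close>.\<close>
    have "card (orb ` V) \<le> card (cls ` ?F) + card ((\<lambda>_. ()) ` orb ` V)"
    proof (rule collapse_rank)
      show "orb (\<sigma> v) = orb v" if "v \<in> V" for v using s_s[OF that] by (auto simp: orb_def)
      fix A x y assume A: "A \<subseteq> V" "\<And>x y. x \<in> A \<Longrightarrow> y \<in> V \<Longrightarrow> orb x = orb y \<Longrightarrow> y \<in> A"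
        "?F \<inter> edge_cut G A = {}" and xy: "x \<in> A" "y \<in> V"
      have i: "\<sigma> ` A \<subseteq> A" by (rule orb_saturated_invariant[OF A(1,2)])
      have "edge_cut G A \<subseteq> {e, \<tau> e}" using invariant_cut_moved[OF A(1) i] A(3) by blast
      then have "A = V" using no A(1) i xy by blast
      then show "y \<in> A" using xy by simp
    qed auto
    also have "card ((\<lambda>_. ()) ` orb ` V) \<le> 1" by (rule card_unit_set_le)
    finally have "card (orb ` V) \<le> card (cls ` ?F) + 1" by simp
    moreover have "2 * card (cls ` ?F) = card ?F"
    proof (rule card_cls)
      show "\<tau> ` ?F \<subseteq> ?F"
      proof
        fix d assume "d \<in> \<tau> ` ?F"
        then obtain c where c: "c \<in> M" "c \<noteq> e" "c \<noteq> \<tau> e" "d = \<tau> c" by blast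
        have "\<tau> (\<tau> c) = c" "\<tau> (\<tau> e) = e" using c e t_t by (auto simp: M_def)
        then show "d \<in> ?F" using c t_M[OF c(1)] by auto
      qed
    qed auto
    moreover have "2 * card (cls ` M) = card M" by (rule card_cls) (use t_M in auto)
    moreover have "card ?F + 2 = card M"
    proof -
      have sub: "{e, \<tau> e} \<subseteq> M" and c2: "card {e, \<tau> e} = 2" using e t_M[OF e] by (auto simp: M_def)
      then show ?thesis using card_Diff_subset[of "{e, \<tau> e}" M] card_mono[OF fM sub] by simp
    qed
    ultimately show False using orb_count by simp
  qed
  then obtain A where A: "A \<subseteq> V" "\<sigma> ` A \<subseteq> A" "A \<noteq> {}" "A \<noteq> V" "edge_cut G A \<subseteq> {e, \<tau> e}" by blast
  have eE: "e \<in> E" using e by (simp add: M_def)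
  have sA: "\<sigma> ` A = A"
  proof
    show "A \<subseteq> \<sigma> ` A"
    proof
      fix x assume x: "x \<in> A"
      then have "x = \<sigma> (\<sigma> x)" "\<sigma> x \<in> A" using s_s[of x] A by auto
      then show "x \<in> \<sigma> ` A" by (rule image_eqI)
    qed
  qed (rule A(2))
  have "edge_cut G A \<noteq> {}" by (rule connected_cut[OF A(1,3,4)])
  then obtain d where d: "d \<in> edge_cut G A" by blast
  have "\<tau> d \<in> edge_cut G A" using cut_sigma[OF A(1)] sA d by auto
  then have "edge_cut G A = {e, \<tau> e}" using d A(5) t_t[OF eE] by auto
  then show ?thesis using that A(1,2) by simp
qed

text \<open>Such a set embeds in the quotient tree, where the edges inside it form a forest. In
  numbers: collapsing \<open>C\<close> together with its mirror image to one point leaves |orbits| -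
  |C| + 1 vertices, still connected by the edge classes outside, of which there are |inner edges|
  fewer.\<close>

lemma forest_bound:
  assumes C: "C \<subseteq> V" "C \<noteq> {}" "C \<inter> \<sigma> ` C = {}"
  shows "card (inner_edges G C) + 1 \<le> card C"
proof -
  define D where "D = C \<union> \<sigma> ` C"
  have sD: "\<sigma> v \<in> D \<longleftrightarrow> v \<in> D" if v: "v \<in> V" for v
  proof -
    have "\<sigma> u \<in> D" if "u \<in> D" for u
    proof (cases "u \<in> C")
      case False
      then obtain x where "x \<in> C" "u = \<sigma> x" using \<open>u \<in> D\<close> by (auto simp: D_def)
      then show ?thesis using s_s[of x] C(1) by (auto simp: D_def)
    qed (auto simp: D_def)
    from this[of v] this[of "\<sigma> v"] show ?thesis using s_s[OF v] by auto
  qed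
  let ?I = "inner_edges G C"
  have IM: "?I \<subseteq> M"
  proof
    fix e assume e: "e \<in> ?I"
    then have eE: "e \<in> E" and sub: "ends G e \<subseteq> C" by (auto simp: inner_edges_def)
    obtain x y where xy: "ends G e = {x, y}" using finite_graph_ends_pair[OF fg eE] by blast
    have "\<tau> e \<noteq> e"
    proof
      assume t: "\<tau> e = e"
      then have "\<sigma> x \<in> ends G e" using t_ends[OF eE] xy by auto
      then show False using sub xy C(3) by auto
    qed
    then show "e \<in> M" using eE by (simp add: M_def)
  qed
  have tI: "ends G (\<tau> e) \<subseteq> \<sigma> ` C" if "e \<in> ?I" for e
    using that t_ends by (auto simp: inner_edges_def)
  have nI: "\<tau> e \<notin> ?I" if e: "e \<in> ?I" for e
  proof
    assume "\<tau> e \<in> ?I"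
    then have "ends G (\<tau> e) \<subseteq> C" by (simp add: inner_edges_def)
    moreover have "\<tau> e \<in> E" using e t_in by (simp add: inner_edges_def)
    ultimately show False using tI[OF e] C(3) finite_graph_ends_ne[OF fg, of "\<tau> e"] by auto
  qed
  define J where "J = ?I \<union> \<tau> ` ?I"
  have JM: "J \<subseteq> M" using IM t_M by (auto simp: J_def)
  have tJ: "\<tau> ` J \<subseteq> J"
  proof
    fix d assume "d \<in> \<tau> ` J"
    then obtain c where c: "c \<in> J" "d = \<tau> c" by blast
    show "d \<in> J"
    proof (cases "c \<in> ?I")
      case False
      then obtain b where "b \<in> ?I" "c = \<tau> b" using c by (auto simp: J_def)
      then show ?thesis using c t_t[of b] IM by (auto simp: J_def M_def)
    qed (use c in \<open>auto simp: J_def\<close>)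
  qed
  have cardJ: "card J = 2 * card ?I"
  proof -
    have fI: "finite ?I" using IM fM finite_subset by blast
    have "inj_on \<tau> ?I" by (rule inj_on_inverseI[of _ \<tau>]) (use t_t in \<open>auto simp: inner_edges_def\<close>)
    then have "card (\<tau> ` ?I) = card ?I" by (rule card_image)
    moreover have "?I \<inter> \<tau> ` ?I = {}" using nI by auto
    ultimately show ?thesis using fI by (simp add: J_def card_Un_disjoint)
  qed
  let ?F = "M - J"
  \<comment> \<open>\<open>None\<close> is the point to which \<open>C\<close> and its mirror image
    are collapsed; every other orbit is kept.\<close>
  define p where "p v = (if v \<in> D then None else Some (orb v))" for v
  have "card (p ` V) \<le> card (cls ` ?F) + card ((\<lambda>_. ()) ` p ` V)"
  proof (rule collapse_rank)
    show "p (\<sigma> v) = p v" if "v \<in> V" for v using s_s[OF that] sD[OF that] by (auto simp: p_def orb_def)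
    fix A x y assume A: "A \<subseteq> V" "\<And>x y. x \<in> A \<Longrightarrow> y \<in> V \<Longrightarrow> p x = p y \<Longrightarrow> y \<in> A"
      "?F \<inter> edge_cut G A = {}" and xy: "x \<in> A" "y \<in> V"
    have i: "\<sigma> ` A \<subseteq> A"
    proof (rule orb_saturated_invariant[OF A(1)])
      fix x y assume "x \<in> A" "y \<in> V" and o: "orb x = orb y"
      moreover from o have "y = x \<or> y = \<sigma> x" by (auto simp: orb_def doubleton_eq_iff)
      moreover have "x \<in> V" using A(1) \<open>x \<in> A\<close> by auto
      ultimately show "y \<in> A" using A(2)[of x y] sD[of x] by (auto simp: p_def)
    qed
    have "edge_cut G A = {}"
    proof (rule ccontr)
      assume "edge_cut G A \<noteq> {}"
      then obtain e where e: "e \<in> edge_cut G A" by blast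
      have "e \<in> M" by (rule invariant_cut_moved[OF A(1) i e])
      then have eJ: "e \<in> J" using A(3) e by blast
      have "ends G e \<subseteq> D" using eJ tI by (auto simp: J_def D_def inner_edges_def)
      moreover obtain u v where uv: "u \<in> ends G e" "u \<in> A" "v \<in> ends G e" "v \<notin> A" using e by (auto simp: edge_cut_def)
      moreover have "v \<in> V" using uv ends_V e by (auto simp: edge_cut_def)
      moreover have "p u = p v" using uv \<open>ends G e \<subseteq> D\<close> by (auto simp: p_def)
      ultimately show False using A(2)[of u v] by simp
    qed
    then have "A = V" using connected_cut[OF A(1)] xy by auto
    then show "y \<in> A" using xy by simp
  qed auto
  also have "card ((\<lambda>_. ()) ` p ` V) \<le> 1" by (rule card_unit_set_le)
  finally have "card (p ` V) \<le> card (cls ` ?F) + 1" by simp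
  moreover have "2 * card (cls ` ?F) = card ?F"
  proof (rule card_cls)
    show "\<tau> ` ?F \<subseteq> ?F"
    proof
      fix d assume "d \<in> \<tau> ` ?F"
      then obtain c where c: "c \<in> M" "c \<notin> J" "d = \<tau> c" by blast
      have "\<tau> (\<tau> c) = c" using c t_t by (auto simp: M_def)
      then have "\<tau> c \<notin> J" using tJ c(2) by (metis image_subset_iff)
      then show "d \<in> ?F" using c t_M by auto
    qed
  qed auto
  moreover have "card ?F + 2 * card ?I = card M"
    using cardJ card_Diff_subset[OF finite_subset[OF JM fM] JM] card_mono[OF fM JM] by simp
  moreover have "2 * card (cls ` M) = card M" by (rule card_cls) (use t_M in auto)
  \<comment> \<open>The vertices of \<open>C\<close> lie in distinct orbits, and all these orbits
    become the single value \<open>None\<close>.\<close>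
  moreover have "card (p ` V) + card C = card (orb ` V) + 1"
  proof -
    have CV: "finite C" using C(1) fV finite_subset by blast
    have inj: "inj_on orb C"
    proof (rule inj_onI)
      fix x y assume "x \<in> C" "y \<in> C" "orb x = orb y"
      then show "x = y" using C(3) by (auto simp: orb_def doubleton_eq_iff)
    qed
    have "p ` V = insert None (Some ` (orb ` V - orb ` C))"
    proof (intro subset_antisym subsetI)
      fix z assume "z \<in> p ` V"
      then obtain v where v: "v \<in> V" "z = p v" by blast
      show "z \<in> insert None (Some ` (orb ` V - orb ` C))"
      proof (cases "v \<in> D")
        case False
        have "orb v \<notin> orb ` C"
        proof
          assume "orb v \<in> orb ` C"
          then obtain c where "c \<in> C" "orb v = orb c" by blast
          then have "v = c \<or> v = \<sigma> c" by (auto simp: orb_def doubleton_eq_iff)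
          then show False using False \<open>c \<in> C\<close> by (auto simp: D_def)
        qed
        then show ?thesis using v False by (auto simp: p_def)
      qed (use v in \<open>auto simp: p_def\<close>)
    next
      fix z assume z: "z \<in> insert None (Some ` (orb ` V - orb ` C))"
      show "z \<in> p ` V"
      proof (cases z)
        case None
        obtain c where "c \<in> C" using C(2) by blast
        then have "p c = None" "c \<in> V" using C(1) by (auto simp: p_def D_def)
        then show ?thesis using None by (metis imageI)
      next
        case (Some k)
        then obtain v where v: "v \<in> V" "k = orb v" "orb v \<notin> orb ` C" using z by blast
        have "v \<notin> D"
        proof
          assume "v \<in> D"
          then obtain c where c: "c \<in> C" "v = c \<or> v = \<sigma> c" by (auto simp: D_def)
          then have "orb v = orb c" using s_s[of c] C(1) by (auto simp: orb_def)
          then show False using v c by blast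
        qed
        then have "p v = z" using Some v by (simp add: p_def)
        then show ?thesis using v by (metis imageI)
      qed
    qed
    moreover have "finite (orb ` V)" using fV by simp
    ultimately have "card (p ` V) = card (orb ` V - orb ` C) + 1"
      by (simp add: card_insert_if card_image)
    moreover have "orb ` C \<subseteq> orb ` V" using C(1) by auto
    ultimately show ?thesis
      using card_image[OF inj] card_Diff_subset[of "orb ` C" "orb ` V"] card_mono[of "orb ` V" "orb ` C"] CV fV by simp
  qed
  ultimately show ?thesis using orb_count by linarith
qed

text \<open>Posimodularity for \<open>A\<close> and its mirror image, whose cuts have equal size,
  leaves at most two edges around \<open>C\<close>. The vertices of \<open>C\<close> are moved,
  hence weightless and of valence at least 3, so \<open>sum_valence\<close> and
  \<open>forest_bound\<close> would give 3|C| \<le> 2|C|.\<close>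

lemma small_cut_invariant:
  assumes st: "\<And>v. v \<in> V \<Longrightarrow> w v = 0 \<Longrightarrow> 3 \<le> valence G v"
    and A: "A \<subseteq> V" and c: "card (edge_cut G A) \<le> 2"
  shows "\<sigma> ` A = A"
proof -
  define C where "C = A - \<sigma> ` A"
  have ss: "\<sigma> (\<sigma> x) = x" if "x \<in> A" for x using s_s A that by auto
  have sAV: "\<sigma> ` A \<subseteq> V" using A s_in by auto
  have sC: "\<sigma> ` C = \<sigma> ` A - A"
  proof (intro subset_antisym subsetI)
    fix y assume "y \<in> \<sigma> ` C"
    then obtain x where x: "x \<in> A" "x \<notin> \<sigma> ` A" "y = \<sigma> x" by (auto simp: C_def)
    have "y \<notin> A" using x ss[of x] by (metis imageI)
    then show "y \<in> \<sigma> ` A - A" using x by auto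
  next
    fix y assume "y \<in> \<sigma> ` A - A"
    then obtain x where x: "x \<in> A" "y = \<sigma> x" "y \<notin> A" by auto
    have "x \<notin> \<sigma> ` A"
    proof
      assume "x \<in> \<sigma> ` A"
      then obtain z where "z \<in> A" "x = \<sigma> z" by blast
      then show False using x ss[of z] by simp
    qed
    then show "y \<in> \<sigma> ` C" using x by (auto simp: C_def)
  qed
  have CV: "C \<subseteq> V" using A by (auto simp: C_def)
  have fC: "finite C" using CV fV finite_subset by blast
  have disj: "C \<inter> \<sigma> ` C = {}" using sC by (auto simp: C_def)
  have tinj: "inj_on \<tau> (edge_cut G B)" for B
    by (rule inj_on_inverseI[of _ \<tau>]) (use t_t in \<open>auto simp: edge_cut_def\<close>)
  have "C = {}"
  proof (rule ccontr)
    assume ne: "C \<noteq> {}"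
    have "3 \<le> valence G x" if "x \<in> C" for x
    proof (rule st)
      show "x \<in> V" using CV that by auto
      show "w x = 0" using w_s[OF \<open>x \<in> V\<close>] disj that by (metis IntI empty_iff imageI neq0_conv)
    qed
    then have "(\<Sum>x\<in>C. 3) \<le> (\<Sum>x\<in>C. valence G x)" by (rule sum_mono)
    then have "3 * card C \<le> 2 * card (inner_edges G C) + card (edge_cut G C)"
      using sum_valence[OF fg CV] by simp
    moreover have "card (inner_edges G C) + 1 \<le> card C" by (rule forest_bound[OF CV ne disj])
    moreover have "card (edge_cut G C) + card (edge_cut G (\<sigma> ` C)) \<le> card (edge_cut G A) + card (edge_cut G (\<sigma> ` A))"
      unfolding sC unfolding C_def by (rule card_edge_cut_posimodular[OF fg])
    moreover have "card (edge_cut G (\<sigma> ` C)) = card (edge_cut G C)"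
      unfolding cut_sigma[OF CV] by (rule card_image[OF tinj])
    moreover have "card (edge_cut G (\<sigma> ` A)) = card (edge_cut G A)"
      unfolding cut_sigma[OF A] by (rule card_image[OF tinj])
    ultimately show False using c by linarith
  qed
  then show ?thesis using sC by (auto simp: C_def)
qed

text \<open>A cut with at most one edge is invariant; but an invariant cut contains with each edge
  its image, which is a different edge.\<close>

lemma card_cut_ge_2:
  assumes st: "\<And>v. v \<in> V \<Longrightarrow> w v = 0 \<Longrightarrow> 3 \<le> valence G v"
    and A: "A \<subseteq> V" "A \<noteq> {}" "A \<noteq> V"
  shows "2 \<le> card (edge_cut G A)"
proof (rule ccontr)
  assume "\<not> ?thesis"
  then have c: "card (edge_cut G A) \<le> 1" by simp
  then have s: "\<sigma> ` A = A" using small_cut_invariant[OF st A(1)] by simp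
  obtain e where e: "e \<in> edge_cut G A" using connected_cut[OF A] by blast
  then have "\<tau> e \<in> edge_cut G A" using cut_sigma[OF A(1)] s by auto
  moreover have "\<tau> e \<noteq> e" using invariant_cut_moved[OF A(1) _ e] s by (simp add: M_def)
  ultimately have "{e, \<tau> e} \<subseteq> edge_cut G A" "card {e, \<tau> e} = 2" using e by auto
  then show False using c card_mono[OF finite_edge_cut[OF fg], of "{e, \<tau> e}" A] by simp
qed

lemma two_edge_connected_if_stable:
  assumes st: "\<And>v. v \<in> V \<Longrightarrow> w v = 0 \<Longrightarrow> 3 \<le> valence G v"
  shows "two_edge_connected G"
proof -
  have "connected_graph (delete_edge G e)" if "e \<in> E" for e
  proof -
    have fd: "finite_graph (delete_edge G e)" using fg by (auto simp: finite_graph_def delete_edge_def)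
    have "edge_cut (delete_edge G e) A \<noteq> {}" if A: "A \<subseteq> V" "A \<noteq> {}" "A \<noteq> V" for A
    proof
      assume "edge_cut (delete_edge G e) A = {}"
      then have "edge_cut G A \<subseteq> {e}" by (auto simp: edge_cut_def delete_edge_def)
      then have "card (edge_cut G A) \<le> 1" using card_mono[of "{e}"] by fastforce
      then show False using card_cut_ge_2[OF st A] by simp
    qed
    moreover have "V \<noteq> {}" using cg by (simp add: connected_graph_def)
    ultimately show ?thesis
      unfolding connected_graph_iff_edge_cut[OF fd] by (simp add: delete_edge_def)
  qed
  then show ?thesis using cg by (simp add: two_edge_connected_def)
qed

text \<open>The right-hand side mentions no involution, so isomorphisms of graphs preserve it. A
  two-edge cut is invariant and consists of moved edges, which leaves \<open>\<tau> d\<close> as the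
  only partner of \<open>d\<close>.\<close>

lemma involution_relation_eq_cut_relation:
  assumes st: "\<And>v. v \<in> V \<Longrightarrow> w v = 0 \<Longrightarrow> 3 \<le> valence G v"
  shows "involution_relation G \<tau> = cut_relation G"
proof -
  have "(d, e) \<in> involution_relation G \<tau> \<longleftrightarrow> (d, e) \<in> cut_relation G" for d e
  proof (cases "d \<in> E \<and> e \<in> E \<and> d \<noteq> e")
    case False
    then show ?thesis using t_in by (auto simp: involution_relation_def cut_relation_def)
  next
    case True
    have "e = \<tau> d \<longleftrightarrow> (\<exists>A\<subseteq>V. edge_cut G A = {d, e})"
    proof
      assume "e = \<tau> d"
      then have "d \<in> M" using True by (auto simp: M_def)
      then obtain A where "A \<subseteq> V" "edge_cut G A = {d, \<tau> d}" by (rule moved_invariant_cut)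
      then show "\<exists>A\<subseteq>V. edge_cut G A = {d, e}" using \<open>e = \<tau> d\<close> by auto
    next
      assume "\<exists>A\<subseteq>V. edge_cut G A = {d, e}"
      then obtain A where A: "A \<subseteq> V" "edge_cut G A = {d, e}" by blast
      have s: "\<sigma> ` A = A" using small_cut_invariant[OF st A(1)] A(2) by (simp add: card_insert_if)
      have "d \<in> M" using invariant_cut_moved[OF A(1), of d] s A(2) by simp
      moreover have "\<tau> d \<in> {d, e}" using cut_sigma[OF A(1)] s A(2) by auto
      ultimately show "e = \<tau> d" by (auto simp: M_def)
    qed
    then show ?thesis using True by (auto simp: involution_relation_def cut_relation_def)
  qed
  then show ?thesis by auto
qed

text \<open>The involution descends because \<open>S\<close> is invariant. Three clauses need more
  than transport: the count uses two rank bounds, the weights use \<open>forest_bound\<close>, and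
  the loops use the two-edge cuts through moved edges.\<close>

lemma contracts_hyp_involution:
  assumes c: "contracts p h S G w G' w'" and tS: "\<tau> ` S \<subseteq> S"
  obtains \<sigma>' \<tau>' where "hyp_involution G' w' \<sigma>' \<tau>'" "\<And>e. e \<in> E \<Longrightarrow> e \<notin> S \<Longrightarrow> \<tau>' (h e) = h (\<tau> e)"
    "\<And>v. v \<in> V \<Longrightarrow> \<sigma>' (p v) = p (\<sigma> v)"
proof -
  note D = contractsD[OF c]
  have V': "verts G' = p ` V" by (rule D(2))
  have tS': "\<tau> e \<in> S \<longleftrightarrow> e \<in> S" if "e \<in> E" for e
    using tS t_t[OF that] by (metis image_subset_iff)
  \<comment> \<open>The vertices whose mirror image lies in a given fibre are not separated by edges
    of \<open>S\<close>, because \<open>\<tau>\<close> maps \<open>S\<close> into itself; so they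
    form a union of fibres.\<close>
  have wd: "p (\<sigma> x) = p (\<sigma> y)" if xy: "x \<in> V" "y \<in> V" "p x = p y" for x y
  proof -
    let ?A = "{z \<in> V. p (\<sigma> z) = p (\<sigma> x)}"
    have "S \<inter> edge_cut G ?A = {}"
    proof (rule ccontr)
      assume "S \<inter> edge_cut G ?A \<noteq> {}"
      then obtain e where e: "e \<in> S" "e \<in> edge_cut G ?A" by blast
      then obtain u v where uv: "u \<in> ends G e" "u \<in> ?A" "v \<in> ends G e" "v \<notin> ?A" by (auto simp: edge_cut_def)
      have eE: "e \<in> E" using e D(1) by auto
      have "\<tau> e \<in> S" using e tS by auto
      then obtain z where "p ` ends G (\<tau> e) = {z}" using D(5) by blast
      then have "p ` \<sigma> ` ends G e = {z}" using t_ends[OF eE] by simp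
      then have "p (\<sigma> u) = z" "p (\<sigma> v) = z" using uv by blast+
      then show False using uv ends_V[OF eE] by auto
    qed
    then have "y \<in> ?A" using D(6)[of ?A x y] xy by auto
    then show ?thesis by simp
  qed
  define \<sigma>' where "\<sigma>' u = p (\<sigma> (SOME x. x \<in> V \<and> p x = u))" for u
  define \<tau>' where "\<tau>' d = h (\<tau> (inv_into (E - S) h d))" for d
  have s': "\<sigma>' (p v) = p (\<sigma> v)" if "v \<in> V" for v
  proof -
    have "\<exists>x. x \<in> V \<and> p x = p v" using that by blast
    then have "(SOME x. x \<in> V \<and> p x = p v) \<in> V \<and> p (SOME x. x \<in> V \<and> p x = p v) = p v" by (rule someI_ex)
    then show ?thesis unfolding \<sigma>'_def using wd[of _ v] that by blast
  qed
  have hinj: "inj_on h (E - S)" using D(3) by (simp add: bij_betw_def)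
  have t': "\<tau>' (h e) = h (\<tau> e)" if "e \<in> E" "e \<notin> S" for e
    using hinj that by (simp add: \<tau>'_def)
  have hE: "h e \<in> edges G'" if "e \<in> E" "e \<notin> S" for e using D(3) that unfolding bij_betw_def by blast
  have heq: "h d = h e \<longleftrightarrow> d = e" if "d \<in> E" "d \<notin> S" "e \<in> E" "e \<notin> S" for d e
    using hinj that by (auto simp: inj_on_def)
  \<comment> \<open>The invariant cut through \<open>e\<close> avoids \<open>S\<close>, so it is the
    cut of a union of fibres and still separates the ends of \<open>e\<close> after the
    contraction.\<close>
  have moved_h: "p x \<noteq> p y" if e: "e \<in> M" "e \<notin> S" "ends G e = {x, y}" for e x y
  proof
    assume pxy: "p x = p y"
    obtain A where A: "A \<subseteq> V" "\<sigma> ` A \<subseteq> A" "edge_cut G A = {e, \<tau> e}" using e(1) by (rule moved_invariant_cut)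
    have eE: "e \<in> E" using e by (simp add: M_def)
    have "S \<inter> edge_cut G A = {}" using A(3) e(2) tS'[OF eE] by auto
    moreover have "x \<in> V" "y \<in> V" using ends_V[OF eE] e(3) by auto
    ultimately have "x \<in> A \<longleftrightarrow> y \<in> A" using D(6)[OF A(1), of x y] D(6)[OF A(1), of y x] pxy by auto
    moreover have "e \<in> edge_cut G A" using A(3) by simp
    ultimately show False using e(3) by (auto simp: edge_cut_def)
  qed
  have loop_h: "\<tau> e = e" if e: "e \<in> E" "e \<notin> S" "is_loop G' (h e)" for e
  proof (rule ccontr)
    assume "\<tau> e \<noteq> e"
    then have "e \<in> M" using e by (simp add: M_def)
    obtain x y where xy: "ends G e = {x, y}" using finite_graph_ends_pair[OF fg e(1)] by blast
    have "p x = p y" using e(3) D(4)[OF e(1,2)] xy by (auto simp: is_loop_def card_insert_if split: if_splits)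
    then show False using moved_h[OF \<open>e \<in> M\<close> e(2) xy] by simp
  qed
  have MS: "{d \<in> edges G'. \<tau>' d \<noteq> d} = h ` (M - S)"
  proof (intro subset_antisym subsetI)
    fix d assume d: "d \<in> {d \<in> edges G'. \<tau>' d \<noteq> d}"
    then have "d \<in> edges G'" by simp
    then obtain e where e: "e \<in> E" "e \<notin> S" "d = h e" using contracts_edge[OF c] by metis
    then show "d \<in> h ` (M - S)" using d t' by (auto simp: M_def)
  next
    fix d assume "d \<in> h ` (M - S)"
    then obtain e where e: "e \<in> M" "e \<notin> S" "d = h e" by blast
    then have "e \<in> E" "\<tau> e \<in> E" "\<tau> e \<notin> S" using t_in tS' by (auto simp: M_def)
    then show "d \<in> {d \<in> edges G'. \<tau>' d \<noteq> d}" using e t' hE heq by (auto simp: M_def)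
  qed
  have cMS: "card {d \<in> edges G'. \<tau>' d \<noteq> d} = card (M - S)"
    unfolding MS by (rule card_image, rule inj_on_subset[OF hinj]) (auto simp: M_def)
  have porb: "{p v, \<sigma>' (p v)} = p ` orb v" if "v \<in> V" for v using s'[OF that] by (simp add: orb_def)
  have o': "2 * card ((\<lambda>v. p ` orb v) ` V) = card (verts G') + card {v \<in> verts G'. \<sigma>' v = v}"
  proof -
    have "2 * card ((\<lambda>v. {v, \<sigma>' v}) ` verts G') = card (verts G') + card {v \<in> verts G'. \<sigma>' v = v}"
      by (rule card_involution_orbits) (use V' fV s' s_in s_s in auto)
    moreover have "(\<lambda>v. {v, \<sigma>' v}) ` verts G' = (\<lambda>v. p ` orb v) ` V"
      unfolding V' image_image using porb by (intro image_cong) auto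
    ultimately show ?thesis by simp
  qed
  have inva_S: "S \<inter> edge_cut G A = {}" if "A \<subseteq> V" "\<sigma> ` A \<subseteq> A" "(M \<inter> S) \<inter> edge_cut G A = {}" for A
    using invariant_cut_moved[OF that(1,2)] that(3) by blast
  \<comment> \<open>This bound says that the contraction merges orbits at most once per edge class
    in \<open>S\<close>; the next one says that the remaining classes connect the new orbits.
    Together with \<open>orb_count\<close>, both are equalities.\<close>
  have le1: "card (orb ` V) \<le> card (cls ` (M \<inter> S)) + card ((\<lambda>K. p ` K) ` orb ` V)"
  proof (rule collapse_rank)
    show "orb (\<sigma> v) = orb v" if "v \<in> V" for v using s_s[OF that] by (auto simp: orb_def)
    fix A x y assume A: "A \<subseteq> V" "\<And>x y. x \<in> A \<Longrightarrow> y \<in> V \<Longrightarrow> orb x = orb y \<Longrightarrow> y \<in> A"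
      "(M \<inter> S) \<inter> edge_cut G A = {}" and xy: "x \<in> A" "y \<in> V" "p ` orb x = p ` orb y"
    have i: "\<sigma> ` A \<subseteq> A" by (rule orb_saturated_invariant[OF A(1,2)])
    have nc: "S \<inter> edge_cut G A = {}" by (rule inva_S[OF A(1) i A(3)])
    have "p y \<in> p ` orb x" using xy by (auto simp: orb_def)
    then obtain z where "z \<in> A" "p z = p y" using xy i by (auto simp: orb_def)
    then show "y \<in> A" using D(6)[OF A(1) nc _ xy(2)] by blast
  qed auto
  have le2: "card ((\<lambda>v. p ` orb v) ` V) \<le> card (cls ` (M - S)) + card ((\<lambda>_. ()) ` (\<lambda>v. p ` orb v) ` V)"
  proof (rule collapse_rank)
    show "p ` orb (\<sigma> v) = p ` orb v" if "v \<in> V" for v using s_s[OF that] by (auto simp: orb_def)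
    fix A x y assume A: "A \<subseteq> V" "\<And>x y. x \<in> A \<Longrightarrow> y \<in> V \<Longrightarrow> p ` orb x = p ` orb y \<Longrightarrow> y \<in> A"
      "(M - S) \<inter> edge_cut G A = {}" and xy: "x \<in> A" "y \<in> V"
    have i: "\<sigma> ` A \<subseteq> A" by (rule orb_saturated_invariant[OF A(1)]) (metis A(2))
    have ps: "y \<in> A" if "x \<in> A" "y \<in> V" "p x = p y" for x y
    proof -
      have "p (\<sigma> x) = p (\<sigma> y)" using wd[of x y] that A(1) by auto
      then show ?thesis using A(2)[of x y] that by (simp add: orb_def)
    qed
    have "edge_cut G A = {}"
    proof (rule ccontr)
      assume "edge_cut G A \<noteq> {}"
      then obtain e where e: "e \<in> edge_cut G A" by blast
      then have "e \<in> M" using invariant_cut_moved[OF A(1) i] by blast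
      then have "e \<in> S" using A(3) e by blast
      then obtain z where z: "p ` ends G e = {z}" using D(5) by blast
      obtain u v where uv: "u \<in> ends G e" "u \<in> A" "v \<in> ends G e" "v \<notin> A" using e by (auto simp: edge_cut_def)
      have "p u = z" "p v = z" using z uv by blast+
      moreover have "v \<in> V" using uv ends_V e by (auto simp: edge_cut_def)
      ultimately show False using ps[of u v] uv by simp
    qed
    then have "A = V" using connected_cut[OF A(1)] xy by auto
    then show "y \<in> A" using xy by simp
  qed auto
  also have "card ((\<lambda>_. ()) ` (\<lambda>v. p ` orb v) ` V) \<le> 1" by (rule card_unit_set_le)
  finally have le2': "card ((\<lambda>v. p ` orb v) ` V) \<le> card (cls ` (M - S)) + 1" by simp
  have k1: "2 * card (cls ` (M \<inter> S)) = card (M \<inter> S)" by (rule card_cls) (use t_M tS in auto)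
  have k2: "2 * card (cls ` (M - S)) = card (M - S)"
    by (rule card_cls) (use t_M tS' in \<open>auto simp: M_def\<close>)
  have k3: "2 * card (cls ` M) = card M" by (rule card_cls) (use t_M in auto)
  have k4: "card (M - S) + card (M \<inter> S) = card M"
    using card_Diff_subset_Int[of M S] card_mono[OF fM, of "M \<inter> S"] fM by simp
  have "card ((\<lambda>v. p ` orb v) ` V) = card (cls ` (M - S)) + 1"
    using le1 le2' k1 k2 k3 k4 orb_count unfolding image_image by linarith
  then have cnt: "card {d \<in> edges G'. \<tau>' d \<noteq> d} + 2 = card (verts G') + card {v \<in> verts G'. \<sigma>' v = v}"
    using o' cMS k2 by simp
  \<comment> \<open>The fibre over a moved vertex is disjoint from its mirror image. It therefore
    carries no weight, and \<open>forest_bound\<close> leaves no cycle among its contracted edges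
    that could produce weight.\<close>
  have wt: "\<sigma>' u = u" if u: "u \<in> verts G'" "0 < w' u" for u
  proof (rule ccontr)
    assume ne: "\<sigma>' u \<noteq> u"
    let ?C = "{x \<in> V. p x = u}"
    have disj: "?C \<inter> \<sigma> ` ?C = {}"
    proof -
      have "p (\<sigma> x) \<noteq> u" if "x \<in> ?C" for x using that ne s'[of x] by auto
      then show ?thesis by auto
    qed
    have ne': "?C \<noteq> {}" using u V' by auto
    have "w x = 0" if "x \<in> ?C" for x
      using that w_s[of x] disj by (metis (mono_tags, lifting) IntI empty_iff imageI mem_Collect_eq neq0_conv)
    then have "sum w ?C = 0" by simp
    moreover have "card {e \<in> S. p ` ends G e = {u}} \<le> card (inner_edges G ?C)"
    proof (rule card_mono)
      show "finite (inner_edges G ?C)" using fE by (simp add: inner_edges_def)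
      show "{e \<in> S. p ` ends G e = {u}} \<subseteq> inner_edges G ?C"
      proof
        fix e assume e: "e \<in> {e \<in> S. p ` ends G e = {u}}"
        then have "e \<in> E" using D(1) by auto
        then show "e \<in> inner_edges G ?C" using e ends_V by (auto simp: inner_edges_def)
      qed
    qed
    moreover have "card (inner_edges G ?C) + 1 \<le> card ?C" by (rule forest_bound[OF _ ne' disj]) auto
    ultimately show False using D(7)[OF u(1)] u(2) by simp
  qed
  have "hyp_involution G' w' \<sigma>' \<tau>'"
    unfolding hyp_involution_def
  proof (intro conjI ballI cnt)
    fix u assume u: "u \<in> verts G'"
    then obtain v where v: "v \<in> V" "u = p v" using V' by auto
    show "\<sigma>' u \<in> verts G'" "\<sigma>' (\<sigma>' u) = u" using v s' s_in s_s V' by auto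
    show "0 < w' u \<longrightarrow> \<sigma>' u = u" using wt[OF u] by simp
  next
    fix d assume d: "d \<in> edges G'"
    then obtain e where e: "e \<in> E" "e \<notin> S" "d = h e" using contracts_edge[OF c] by metis
    have te: "\<tau> e \<in> E" "\<tau> e \<notin> S" using t_in e tS' by auto
    show "\<tau>' d \<in> edges G'" "\<tau>' (\<tau>' d) = d" using e te t' hE t_t by auto
    have "p ` \<sigma> ` ends G e = \<sigma>' ` p ` ends G e"
      unfolding image_image using s' ends_V[OF e(1)] by (intro image_cong) auto
    then show "ends G' (\<tau>' d) = \<sigma>' ` ends G' d"
      using e te t' D(4)[OF te] D(4)[OF e(1,2)] t_ends by simp
    show "is_loop G' d \<longrightarrow> \<tau>' d = d" using loop_h[OF e(1,2)] e t' by auto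
    show "\<tau>' d = d \<longrightarrow> \<not> is_loop G' d \<longrightarrow> (\<forall>v\<in>ends G' d. \<sigma>' v \<noteq> v)"
    proof (intro impI ballI)
      fix u assume fx: "\<tau>' d = d" and nl: "\<not> is_loop G' d" and u: "u \<in> ends G' d"
      have tee: "\<tau> e = e" using fx e te t' heq by auto
      have nl': "\<not> is_loop G e" using nl D(4)[OF e(1,2)] e by (auto simp: is_loop_iff)
      obtain x where x: "x \<in> ends G e" "u = p x" using u D(4)[OF e(1,2)] e by auto
      have ee: "ends G e = {x, \<sigma> x}" by (rule flip_ends[OF e(1) tee nl' x(1)])
      have "x \<in> V" using x ends_V[OF e(1)] by auto
      show "\<sigma>' u \<noteq> u"
      proof
        assume "\<sigma>' u = u"
        then have "p (\<sigma> x) = p x" using s'[OF \<open>x \<in> V\<close>] x by simp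
        then have "ends G' d = {p x}" using D(4)[OF e(1,2)] e ee by simp
        then show False using nl by (auto simp: is_loop_iff)
      qed
    qed
  qed
  then show ?thesis using t' s' by (intro that)
qed

end

section \<open>Trees\<close>

lemma reachable_edge_cut:
  assumes "(u, v) \<in> (adjacency G)\<^sup>*" "u \<in> A" "v \<notin> A"
  shows "edge_cut G A \<noteq> {}"
proof
  assume no: "edge_cut G A = {}"
  have "v \<in> A" using assms(1)
  proof (induction rule: rtrancl_induct)
    case (step y z)
    then obtain e where "e \<in> edges G" "ends G e = {y, z}" by (auto simp: adjacency_def)
    then show ?case using no step by (auto simp: edge_cut_def)
  qed (rule assms(2))
  then show False using assms(3) by simp
qed

lemma edge_cut_crossing:
  assumes "finite_graph G"
  shows "e \<in> edge_cut G A \<longleftrightarrow> e \<in> edges G \<and> ends G e \<inter> A \<noteq> {} \<and> ends G e \<inter> (verts G - A) \<noteq> {}"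
  using finite_graph_ends_sub[OF assms, of e] by (auto simp: edge_cut_def)

lemma connected_graph_rank:
  assumes fg: "finite_graph G" and c: "connected_graph G"
  shows "card (verts G) \<le> card (edges G) + 1"
proof (rule card_le_card_connecting[where en = "ends G"])
  fix A assume "A \<subseteq> verts G" "A \<noteq> {}" "A \<noteq> verts G"
  then have "edge_cut G A \<noteq> {}" using c unfolding connected_graph_iff_edge_cut[OF fg] by simp
  then show "\<exists>e\<in>edges G. ends G e \<inter> A \<noteq> {} \<and> ends G e \<inter> (verts G - A) \<noteq> {}"
    using edge_cut_crossing[OF fg] by blast
qed (use fg finite_graph_ends_pair[OF fg] in \<open>auto simp: finite_graph_def\<close>)

text \<open>Forwards, an edge outside a spanning connecting set \<open>F\<close> could be deleted
  without losing connectivity, against acyclicity. Backwards, deleting an edge on a cycle would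
  leave a connected graph with too few edges.\<close>

lemma tree_graph_iff_card:
  assumes fg: "finite_graph G" and c: "connected_graph G"
  shows "tree_graph G \<longleftrightarrow> card (verts G) = card (edges G) + 1"
proof
  assume "tree_graph G"
  then have ac: "acyclic_graph G" by (simp add: tree_graph_def)
  have fE: "finite (edges G)" using fg by (simp add: finite_graph_def)
  have "\<exists>F\<subseteq>edges G. card F + 1 = card (verts G) \<and>
      (\<forall>A\<subseteq>verts G. A \<noteq> {} \<longrightarrow> A \<noteq> verts G \<longrightarrow> (\<exists>e\<in>F. ends G e \<inter> A \<noteq> {} \<and> ends G e \<inter> (verts G - A) \<noteq> {}))"
  proof (rule connecting_subset[where W = "verts G" and F = "edges G" and en = "ends G"])
    fix A assume "A \<subseteq> verts G" "A \<noteq> {}" "A \<noteq> verts G"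
    then have "edge_cut G A \<noteq> {}" using c unfolding connected_graph_iff_edge_cut[OF fg] by simp
    then show "\<exists>e\<in>edges G. ends G e \<inter> A \<noteq> {} \<and> ends G e \<inter> (verts G - A) \<noteq> {}"
      using edge_cut_crossing[OF fg] by blast
  next
    fix F assume "F \<subseteq> edges G" "card F + 1 = card (verts G)"
      "\<And>A. A \<subseteq> verts G \<Longrightarrow> A \<noteq> {} \<Longrightarrow> A \<noteq> verts G \<Longrightarrow> \<exists>e\<in>F. ends G e \<inter> A \<noteq> {} \<and> ends G e \<inter> (verts G - A) \<noteq> {}"
    then show ?thesis by (intro exI[of _ F]) simp
  qed (use fg c finite_graph_ends_pair[OF fg] in \<open>auto simp: finite_graph_def connected_graph_def\<close>)
  then obtain F where F: "F \<subseteq> edges G" "card F + 1 = card (verts G)"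
    "\<And>A. A \<subseteq> verts G \<Longrightarrow> A \<noteq> {} \<Longrightarrow> A \<noteq> verts G \<Longrightarrow> \<exists>e\<in>F. ends G e \<inter> A \<noteq> {} \<and> ends G e \<inter> (verts G - A) \<noteq> {}"
    by auto
  have "F = edges G"
  proof (rule ccontr)
    assume "F \<noteq> edges G"
    then obtain e where e: "e \<in> edges G" "e \<notin> F" using F(1) by blast
    obtain x y where xy: "ends G e = {x, y}" "x \<in> verts G" "y \<in> verts G" using fg e(1) by (rule finite_graph_ends)
    have fd: "finite_graph (delete_edge G e)" using fg by (auto simp: finite_graph_def delete_edge_def)
    have "connected_graph (delete_edge G e)"
      unfolding connected_graph_iff_edge_cut[OF fd]
    proof (intro conjI allI impI)
      show "verts (delete_edge G e) \<noteq> {}" using xy by (auto simp: delete_edge_def)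
      fix A assume "A \<subseteq> verts (delete_edge G e)" "A \<noteq> {}" "A \<noteq> verts (delete_edge G e)"
      then obtain d where d: "d \<in> F" "ends G d \<inter> A \<noteq> {}" "ends G d \<inter> (verts G - A) \<noteq> {}"
        using F(3)[of A] by (auto simp: delete_edge_def)
      moreover have "d \<noteq> e" "d \<in> edges G" using d e F(1) by auto
      ultimately have "d \<in> edge_cut (delete_edge G e) A"
        by (auto simp: edge_cut_def delete_edge_def)
      then show "edge_cut (delete_edge G e) A \<noteq> {}" by blast
    qed
    then have "(x, y) \<in> (adjacency (delete_edge G e))\<^sup>*"
      using xy by (auto simp: connected_graph_def delete_edge_def)
    then show False using ac e xy by (auto simp: acyclic_graph_def)
  qed
  then show "card (verts G) = card (edges G) + 1" using F(2) by simp
next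
  assume k: "card (verts G) = card (edges G) + 1"
  have fE: "finite (edges G)" using fg by (simp add: finite_graph_def)
  have "(u, v) \<notin> (adjacency (delete_edge G e))\<^sup>*" if e: "e \<in> edges G" "ends G e = {u, v}" for e u v
  proof
    assume r: "(u, v) \<in> (adjacency (delete_edge G e))\<^sup>*"
    have fd: "finite_graph (delete_edge G e)" using fg by (auto simp: finite_graph_def delete_edge_def)
    have "edge_cut (delete_edge G e) A \<noteq> {}" if A: "A \<subseteq> verts G" "A \<noteq> {}" "A \<noteq> verts G" for A
    proof
      assume no: "edge_cut (delete_edge G e) A = {}"
      have no': "edge_cut (delete_edge G e) (verts G - A) = {}"
      proof (rule ccontr)
        assume "edge_cut (delete_edge G e) (verts G - A) \<noteq> {}"
        then obtain d where d: "d \<in> edge_cut (delete_edge G e) (verts G - A)" by blast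
        then have "ends G d \<subseteq> verts G" using finite_graph_ends_sub[OF fg, of d] by (auto simp: edge_cut_def delete_edge_def)
        then have "d \<in> edge_cut (delete_edge G e) A" using d by (auto simp: edge_cut_def delete_edge_def)
        then show False using no by blast
      qed
      have uv: "u \<in> verts G" "v \<in> verts G" using finite_graph_ends_sub[OF fg e(1)] e(2) by auto
      have "u \<in> A \<longleftrightarrow> v \<in> A"
        using reachable_edge_cut[OF r, of A] no reachable_edge_cut[OF r, of "verts G - A"] no' uv by auto
      moreover have "edge_cut G A \<noteq> {}" using c A unfolding connected_graph_iff_edge_cut[OF fg] by simp
      then obtain d where d: "d \<in> edge_cut G A" by blast
      moreover have "d = e" using no d by (auto simp: edge_cut_def delete_edge_def)
      ultimately show False using e by (auto simp: edge_cut_def)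
    qed
    then have "connected_graph (delete_edge G e)"
      using c unfolding connected_graph_iff_edge_cut[OF fd] connected_graph_iff_edge_cut[OF fg]
      by (simp add: delete_edge_def)
    from connected_graph_rank[OF fd this] show False
      using k e fE card_Suc_Diff1[OF fE e(1)] by (simp add: delete_edge_def)
  qed
  then show "tree_graph G" using fg c by (simp add: tree_graph_def acyclic_graph_def)
qed

section \<open>Harmonic morphisms and involutions on loopless graphs\<close>

text \<open>The two-edge cut through \<open>e\<close> belongs to an invariant set that contains
  exactly one end of \<open>e\<close>. Hence a moved edge never becomes a loop of the
  quotient.\<close>

lemma (in hyp_inv) moved_ends_distinct_orbits:
  assumes "e \<in> M" "ends G e = {x, y}" shows "orb x \<noteq> orb y"
proof
  assume o: "orb x = orb y"
  obtain A where A: "A \<subseteq> V" "\<sigma> ` A \<subseteq> A" "edge_cut G A = {e, \<tau> e}" using assms(1) by (rule moved_invariant_cut)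
  have "x \<in> V" "y \<in> V" using ends_V[of e] assms by (auto simp: M_def)
  have "y = x \<or> y = \<sigma> x" using o by (auto simp: orb_def doubleton_eq_iff)
  then have "x \<in> A \<longleftrightarrow> y \<in> A" using A(2) s_s[OF \<open>x \<in> V\<close>] by (metis image_subset_iff)
  moreover have "e \<in> edge_cut G A" using A(3) by simp
  ultimately show False using assms(2) by (auto simp: edge_cut_def)
qed

text \<open>The target is the quotient by the involution, its orbits renamed by natural numbers
  because the definition of hyperelliptic types asks for a tree over \<open>nat\<close>. A moved
  edge is required: on a tree without edges the multiplicity is 0 by convention, so no morphism to
  it from a nonempty graph is nondegenerate.\<close>

lemma (in hyp_inv) tree_morphism_exists:
  assumes nl: "\<And>e. e \<in> E \<Longrightarrow> \<not> is_loop G e" and Mne: "M \<noteq> {}"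
  obtains T :: "(nat, nat) mgraph" and p q where "tree_graph T" "harmonic_morphism G T p q"
    "nondegenerate G T p q" "has_degree G T q 2"
    "\<forall>d\<in>E. \<forall>e\<in>E. (\<exists>k. q d = Inr k \<and> q e = Inr k) \<longleftrightarrow> d \<in> M \<and> (d = e \<or> e = \<tau> d)"
proof -
  obtain fv :: "'v set \<Rightarrow> nat" where fv: "inj_on fv (orb ` V)"
    using finite_imp_inj_to_nat_seg[of "orb ` V"] fV by auto
  obtain ge :: "'e set \<Rightarrow> nat" where ge: "inj_on ge (cls ` M)"
    using finite_imp_inj_to_nat_seg[of "cls ` M"] fM by auto
  define p where "p v = fv (orb v)" for v
  \<comment> \<open>A fixed edge is flipped, so both of its ends have the same image, and any end
    may be chosen to name the vertex it is sent to.\<close>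
  define q where "q e = (if e \<in> M then Inr (ge (cls e)) else Inl (p (SOME v. v \<in> ends G e)))" for e
  have p_eq: "p x = p y \<longleftrightarrow> y = x \<or> y = \<sigma> x" if "x \<in> V" "y \<in> V" for x y
  proof -
    have "p x = p y \<longleftrightarrow> orb x = orb y" using fv that by (auto simp: p_def inj_on_def)
    also have "\<dots> \<longleftrightarrow> y = x \<or> y = \<sigma> x" using s_s[of x] that by (auto simp: orb_def doubleton_eq_iff)
    finally show ?thesis .
  qed
  have ps: "p (\<sigma> x) = p x" if "x \<in> V" for x using p_eq[of x "\<sigma> x"] s_in that by auto
  have g_eq: "ge (cls d) = ge (cls e) \<longleftrightarrow> d = e \<or> e = \<tau> d" if "d \<in> M" "e \<in> M" for d e
  proof -
    have "ge (cls d) = ge (cls e) \<longleftrightarrow> cls d = cls e" using ge that by (auto simp: inj_on_def)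
    also have "\<dots> \<longleftrightarrow> d = e \<or> e = \<tau> d" using t_t[of d] that by (auto simp: cls_def doubleton_eq_iff M_def)
    finally show ?thesis .
  qed
  have pt: "p ` ends G (\<tau> e) = p ` ends G e" if "e \<in> E" for e
    unfolding t_ends[OF that] image_image using ps ends_V[OF that] by (intro image_cong) auto
  define T :: "(nat, nat) mgraph" where
    "T = \<lparr>verts = p ` V, edges = (\<lambda>e. ge (cls e)) ` M,
          ends = (\<lambda>d. p ` ends G (SOME e. e \<in> M \<and> ge (cls e) = d))\<rparr>"
  have vT: "verts T = p ` V" and eT: "edges T = (\<lambda>e. ge (cls e)) ` M" by (auto simp: T_def)
  have endsT: "ends T (ge (cls e)) = p ` ends G e" if e: "e \<in> M" for e
  proof -
    let ?d = "SOME d. d \<in> M \<and> ge (cls d) = ge (cls e)"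
    have "\<exists>d. d \<in> M \<and> ge (cls d) = ge (cls e)" using e by blast
    then have d: "?d \<in> M \<and> ge (cls ?d) = ge (cls e)" by (rule someI_ex)
    then have "?d = e \<or> e = \<tau> ?d" using g_eq[of ?d e] e by blast
    then have "p ` ends G ?d = p ` ends G e" using pt[of ?d] d by (auto simp: M_def)
    then show ?thesis by (simp add: T_def)
  qed
  have ne: "p x \<noteq> p y" if "e \<in> M" "ends G e = {x, y}" for e x y
  proof -
    have "x \<in> V" "y \<in> V" using ends_V[of e] that by (auto simp: M_def)
    then show ?thesis using moved_ends_distinct_orbits[OF that] fv by (auto simp: p_def inj_on_def)
  qed
  have fT: "finite_graph T"
  proof -
    have "ends T d \<subseteq> verts T \<and> card (ends T d) = 2" if "d \<in> edges T" for d
    proof -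
      obtain e where e: "e \<in> M" "d = ge (cls e)" using \<open>d \<in> edges T\<close> eT by auto
      have eE: "e \<in> E" using e by (simp add: M_def)
      obtain x y where xy: "ends G e = {x, y}" "x \<in> V" "y \<in> V" using fg eE by (rule finite_graph_ends)
      then show ?thesis using endsT[OF e(1)] e(2) ne[OF e(1) xy(1)] vT by auto
    qed
    then show ?thesis using fV fM vT eT by (auto simp: finite_graph_def)
  qed
  have cT: "connected_graph T"
    unfolding connected_graph_iff_edge_cut[OF fT]
  proof (intro conjI allI impI)
    show "verts T \<noteq> {}" using vT cg by (auto simp: connected_graph_def)
    fix B assume B: "B \<subseteq> verts T" "B \<noteq> {}" "B \<noteq> verts T"
    define A where "A = {v \<in> V. p v \<in> B}"
    have A: "A \<subseteq> V" "A \<noteq> {}" "A \<noteq> V" using B vT by (auto simp: A_def)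
    have "\<sigma> ` A \<subseteq> A" using ps s_in by (auto simp: A_def)
    moreover obtain e where e: "e \<in> edge_cut G A" using connected_cut[OF A] by blast
    ultimately have eM: "e \<in> M" by (rule invariant_cut_moved[OF A(1)])
    then have "ends G e \<subseteq> V" using ends_V by (auto simp: M_def)
    then have "ge (cls e) \<in> edge_cut T B"
      using e eM endsT[OF eM] eT by (auto simp: edge_cut_def A_def)
    then show "edge_cut T B \<noteq> {}" by blast
  qed
  have cardT: "card (verts T) = card (edges T) + 1"
  proof -
    have "verts T = fv ` orb ` V" by (auto simp: vT p_def)
    moreover have "edges T = ge ` cls ` M" using eT by auto
    ultimately show ?thesis using card_image[OF fv] card_image[OF ge] orb_count by simp
  qed
  have tT: "tree_graph T" using tree_graph_iff_card[OF fT cT] cardT by simp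
  have morph: "graph_morphism G T p q"
    unfolding graph_morphism_def
  proof (intro conjI ballI)
    show "p ` V \<subseteq> verts T" by (simp add: vT)
    fix e assume e: "e \<in> E"
    show "case q e of Inl y \<Rightarrow> p ` ends G e = {y} | Inr e' \<Rightarrow> e' \<in> edges T \<and> ends T e' = p ` ends G e"
    proof (cases "e \<in> M")
      case True
      then show ?thesis using endsT eT by (auto simp: q_def)
    next
      case False
      define x where "x = (SOME v. v \<in> ends G e)"
      have x: "x \<in> ends G e" unfolding x_def using finite_graph_ends_ne[OF fg e] by (meson ex_in_conv someI_ex)
      have "\<tau> e = e" using False e by (simp add: M_def)
      then have "ends G e = {x, \<sigma> x}" using flip_ends[OF e _ nl[OF e] x] by simp
      moreover have "x \<in> V" using x ends_V[OF e] by auto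
      ultimately have "p ` ends G e = {p x}" using ps by simp
      moreover have "q e = Inl (p x)" using False by (simp add: q_def x_def)
      ultimately show ?thesis by simp
    qed
  qed
  have fibre: "{f \<in> E. q f = Inr (ge (cls e))} = {e, \<tau> e}" if e: "e \<in> M" for e
  proof (intro subset_antisym subsetI)
    fix f assume "f \<in> {f \<in> E. q f = Inr (ge (cls e))}"
    then have "f \<in> M" "ge (cls e) = ge (cls f)" by (auto simp: q_def split: if_splits)
    then show "f \<in> {e, \<tau> e}" using g_eq[OF e, of f] by auto
  next
    fix f assume "f \<in> {e, \<tau> e}"
    then have "f \<in> M" "ge (cls e) = ge (cls f)" using e t_M[OF e] g_eq[OF e, of f] by auto
    then show "f \<in> {f \<in> E. q f = Inr (ge (cls e))}" by (auto simp: q_def M_def)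
  qed
  \<comment> \<open>Over an edge of \<open>T\<close> lie some \<open>e\<close> and
    \<open>\<tau> e\<close>. A fixed vertex over one of its ends meets both of them, a moved vertex
    exactly one.\<close>
  have local: "local_count G q x d = (if \<sigma> x = x then 2 else 1)"
    if x: "x \<in> V" and d: "d \<in> edges T" "p x \<in> ends T d" for x d
  proof -
    obtain e where e: "e \<in> M" "d = ge (cls e)" using d eT by auto
    have eE: "e \<in> E" and tee: "\<tau> e \<noteq> e" using e by (auto simp: M_def)
    have "{f \<in> E. x \<in> ends G f \<and> q f = Inr d} = {f \<in> {e, \<tau> e}. x \<in> ends G f}"
      using fibre[OF e(1)] e(2) by auto
    then have lc: "local_count G q x d = card {f \<in> {e, \<tau> e}. x \<in> ends G f}" by (simp add: local_count_def)
    obtain y where y: "y \<in> ends G e" "p y = p x" using d(2) endsT[OF e(1)] e(2) by auto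
    have yV: "y \<in> V" using y ends_V[OF eE] by auto
    have xy: "x = y \<or> x = \<sigma> y" using p_eq[OF yV x] y by auto
    obtain z where z: "ends G e = {y, z}"
      using finite_graph_ends_pair[OF fg eE] y(1) by (metis insertE insert_commute singletonD)
    have zV: "z \<in> V" using z ends_V[OF eE] by auto
    have pz: "p z \<noteq> p x" using ne[OF e(1) z] y by auto
    have te: "ends G (\<tau> e) = {\<sigma> y, \<sigma> z}" using t_ends[OF eE] z by simp
    have "x \<noteq> z" "x \<noteq> \<sigma> z" using pz ps[OF zV] by auto
    then have a: "x \<in> ends G e \<longleftrightarrow> x = y" and b: "x \<in> ends G (\<tau> e) \<longleftrightarrow> x = \<sigma> y" using z te by auto
    show ?thesis
    proof (cases "\<sigma> x = x")
      case True
      then have "x = y" "x = \<sigma> y" using xy s_s[OF yV] by auto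
      then have "{f \<in> {e, \<tau> e}. x \<in> ends G f} = {e, \<tau> e}" using a b by auto
      then show ?thesis using lc True tee by simp
    next
      case False
      then have "\<sigma> y \<noteq> y" using xy s_s[OF yV] by auto
      then have "{f \<in> {e, \<tau> e}. x \<in> ends G f} = {e} \<or> {f \<in> {e, \<tau> e}. x \<in> ends G f} = {\<tau> e}"
        using xy a b by auto
      then show ?thesis using lc False by auto
    qed
  qed
  have harm: "harmonic_morphism G T p q"
    using morph local by (simp add: harmonic_morphism_def)
  \<comment> \<open>The orbit of \<open>x\<close> is not all of \<open>V\<close>, since some moved
    edge joins two orbits. An edge leaving an orbit is moved, so it yields an edge of
    \<open>T\<close> at the image of \<open>x\<close>.\<close>
  have incident: "\<exists>d\<in>edges T. p x \<in> ends T d" if x: "x \<in> V" for x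
  proof -
    have "{x, \<sigma> x} \<noteq> V"
    proof
      assume VV: "{x, \<sigma> x} = V"
      obtain e where e: "e \<in> M" using Mne by blast
      then have "e \<in> E" by (simp add: M_def)
      then obtain a b where ab: "ends G e = {a, b}" "a \<in> V" "b \<in> V" by (rule finite_graph_ends[OF fg])
      have "p a = p b" using ab VV p_eq[of a b] ps[OF x] by (metis insertE singletonD)
      then show False using ne[OF e ab(1)] by simp
    qed
    moreover have i: "\<sigma> ` {x, \<sigma> x} \<subseteq> {x, \<sigma> x}" "{x, \<sigma> x} \<subseteq> V" using s_s[OF x] s_in[OF x] x by auto
    ultimately obtain e where e: "e \<in> edge_cut G {x, \<sigma> x}" using connected_cut[of "{x, \<sigma> x}"] by auto
    have eM: "e \<in> M" by (rule invariant_cut_moved[OF i(2) i(1) e])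
    have "p x \<in> p ` ends G e" using e ps[OF x] by (auto simp: edge_cut_def) (metis imageI)
    then show ?thesis using eM endsT[OF eM] eT by auto
  qed
  have nond: "nondegenerate G T p q"
    unfolding nondegenerate_def
  proof
    fix x assume x: "x \<in> V"
    let ?d = "SOME d. d \<in> edges T \<and> p x \<in> ends T d"
    have "\<exists>d. d \<in> edges T \<and> p x \<in> ends T d" using incident[OF x] by blast
    then have "?d \<in> edges T \<and> p x \<in> ends T ?d" by (rule someI_ex)
    then have "0 < local_count G q x ?d" using local[OF x, of ?d] by simp
    then show "0 < horizontal_mult G T p q x" using incident[OF x] by (simp add: horizontal_mult_def)
  qed
  have deg: "has_degree G T q 2"
    unfolding has_degree_def
  proof
    fix d assume "d \<in> edges T"
    then obtain e where e: "e \<in> M" "d = ge (cls e)" using eT by auto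
    moreover have "e \<noteq> \<tau> e" using e(1) by (auto simp: M_def)
    ultimately show "card {f \<in> E. q f = Inr d} = 2" using fibre[OF e(1)] by simp
  qed
  have rel: "(\<exists>k. q d = Inr k \<and> q e = Inr k) \<longleftrightarrow> d \<in> M \<and> (d = e \<or> e = \<tau> d)" if "d \<in> E" "e \<in> E" for d e
  proof (cases "d \<in> M")
    case False
    then show ?thesis by (auto simp: q_def)
  next
    case True
    have "(\<exists>k. q d = Inr k \<and> q e = Inr k) \<longleftrightarrow> e \<in> {f \<in> E. q f = Inr (ge (cls d))}"
      using True that by (auto simp: q_def)
    then show ?thesis unfolding fibre[OF True] using True by auto
  qed
  show ?thesis by (rule that[OF tT harm nond deg]) (intro ballI rel)
qed

text \<open>Degree two and positive multiplicities leave one or two vertices over each vertex of the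
  tree, and exactly two edges over each edge. Exchanging the elements of these fibres defines
  \<open>\<sigma>\<close> and \<open>\<tau>\<close>, where edges sent to a vertex are kept by
  \<open>\<tau>\<close>. The last conclusion records nondegeneracy in the form needed by
  \<open>involution_from_subdivision\<close>.\<close>

lemma tree_morphism_involution:
  fixes K :: "('v, 'e) mgraph" and T :: "('w, 'd) mgraph"
  assumes fg: "finite_graph K" and nl: "\<And>e. e \<in> edges K \<Longrightarrow> \<not> is_loop K e" and Kne: "verts K \<noteq> {}"
    and tT: "tree_graph T" and harm: "harmonic_morphism K T p q" and nond: "nondegenerate K T p q"
    and deg: "has_degree K T q 2"
  obtains \<sigma> \<tau> where "hyp_involution K (\<lambda>_. 0) \<sigma> \<tau>"
    "\<forall>d\<in>edges K. \<forall>e\<in>edges K.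
      (\<exists>k. q d = Inr k \<and> q e = Inr k) \<longleftrightarrow> \<tau> d \<noteq> d \<and> (d = e \<or> e = \<tau> d)"
    "\<forall>x\<in>verts K. \<exists>e\<in>edges K. x \<in> ends K e \<and> \<tau> e \<noteq> e"
proof -
  let ?V = "verts K" and ?E = "edges K"
  have fV: "finite ?V" and fE: "finite ?E" using fg by (auto simp: finite_graph_def)
  have fT: "finite_graph T" and cT: "connected_graph T" and ac: "acyclic_graph T"
    using tT by (auto simp: tree_graph_def)
  have pV: "p x \<in> verts T" if "x \<in> ?V" for x
    using harm that by (auto simp: harmonic_morphism_def graph_morphism_def)
  have qe: "case q e of Inl y \<Rightarrow> p ` ends K e = {y} | Inr e' \<Rightarrow> e' \<in> edges T \<and> ends T e' = p ` ends K e"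
    if "e \<in> ?E" for e using harm that by (auto simp: harmonic_morphism_def graph_morphism_def)
  have qv: "p ` ends K e = {y}" if "e \<in> ?E" "q e = Inl y" for e y using qe[OF that(1)] that(2) by simp
  have qh: "d \<in> edges T" "ends T d = p ` ends K e" if "e \<in> ?E" "q e = Inr d" for e d
    using qe[OF that(1)] that(2) by auto
  have lc: "local_count K q x d = local_count K q x e"
    if "x \<in> ?V" "d \<in> edges T" "e \<in> edges T" "p x \<in> ends T d" "p x \<in> ends T e" for x d e
  proof -
    have "\<forall>x\<in>?V. \<forall>d\<in>edges T. \<forall>e\<in>edges T. p x \<in> ends T d \<longrightarrow> p x \<in> ends T e \<longrightarrow>
        local_count K q x d = local_count K q x e"
      using harm unfolding harmonic_morphism_def by (rule conjunct2)
    from this[rule_format, OF that] show ?thesis .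
  qed
  have endsT: "\<exists>a b. ends T d = {a, b} \<and> a \<noteq> b" if d: "d \<in> edges T" for d
  proof -
    obtain a b where ab: "ends T d = {a, b}" using finite_graph_ends_pair[OF fT d] by blast
    moreover have "a \<noteq> b" using ac d ab by (auto simp: acyclic_graph_def)
    ultimately show ?thesis by blast
  qed
  have ends2: "\<exists>a b. ends K e = {a, b} \<and> a \<noteq> b \<and> a \<in> ?V \<and> b \<in> ?V" if e: "e \<in> ?E" for e
  proof -
    obtain a b where ab: "ends K e = {a, b}" "a \<in> ?V" "b \<in> ?V" using fg e by (rule finite_graph_ends)
    moreover have "a \<noteq> b" using nl[OF e] ab by (auto simp: is_loop_def)
    ultimately show ?thesis by blast
  qed
  have pos: "0 < local_count K q x d" if x: "x \<in> ?V" and d: "d \<in> edges T" "p x \<in> ends T d" for x d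
  proof -
    let ?c = "SOME d. d \<in> edges T \<and> p x \<in> ends T d"
    have "\<exists>d. d \<in> edges T \<and> p x \<in> ends T d" using d by blast
    then have c: "?c \<in> edges T \<and> p x \<in> ends T ?c" by (rule someI_ex)
    have "0 < horizontal_mult K T p q x" using nond x by (simp add: nondegenerate_def)
    then have "0 < local_count K q x ?c" using d by (auto simp: horizontal_mult_def split: if_splits)
    then show ?thesis using lc[OF x d(1) conjunct1[OF c] d(2) conjunct2[OF c]] by simp
  qed
  have inc: "\<exists>d\<in>edges T. p x \<in> ends T d" if x: "x \<in> ?V" for x
  proof (rule ccontr)
    assume "\<not> ?thesis"
    then have "horizontal_mult K T p q x = 0" unfolding horizontal_mult_def by (rule if_not_P)
    then show False using nond x unfolding nondegenerate_def by (metis less_irrefl)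
  qed
  have incT: "\<exists>d\<in>edges T. y \<in> ends T d" if y: "y \<in> verts T" for y
  proof (cases "verts T = {y}")
    case True
    obtain x where "x \<in> ?V" using Kne by blast
    then show ?thesis using inc[of x] pV[of x] True by auto
  next
    case False
    then have "edge_cut T {y} \<noteq> {}" using cT y unfolding connected_graph_iff_edge_cut[OF fT] by auto
    then show ?thesis by (auto simp: edge_cut_def)
  qed
  define fib where "fib y = {x \<in> ?V. p x = y}" for y
  have ffib: "finite (fib y)" for y using fV by (simp add: fib_def)
  \<comment> \<open>Each of the two edges over \<open>d\<close> has exactly one end over
    \<open>y\<close>, because a tree has no loops.\<close>
  have sum2: "(\<Sum>x\<in>fib y. local_count K q x d) = 2" if d: "d \<in> edges T" "y \<in> ends T d" for y d
  proof -
    let ?F = "\<lambda>x. {e \<in> ?E. x \<in> ends K e \<and> q e = Inr d}"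
    have "(\<Sum>x\<in>fib y. local_count K q x d) = (\<Sum>x\<in>fib y. card (?F x))" by (simp add: local_count_def)
    also have "\<dots> = card (\<Union>x\<in>fib y. ?F x)"
    proof (rule card_UN_disjoint[symmetric])
      show "\<forall>x\<in>fib y. \<forall>x'\<in>fib y. x \<noteq> x' \<longrightarrow> ?F x \<inter> ?F x' = {}"
      proof (intro ballI impI)
        fix x x' assume xx: "x \<in> fib y" "x' \<in> fib y" "x \<noteq> x'"
        show "?F x \<inter> ?F x' = {}"
        proof (rule ccontr)
          assume "?F x \<inter> ?F x' \<noteq> {}"
          then obtain e where e: "e \<in> ?E" "x \<in> ends K e" "x' \<in> ends K e" "q e = Inr d" by blast
          then have "ends K e = {x, x'}" using ends2[OF e(1)] xx by auto
          then have "ends T d = {y}" using qh(2)[OF e(1,4)] xx by (auto simp: fib_def)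
          then show False using endsT[OF d(1)] by auto
        qed
      qed
    qed (use ffib fE in auto)
    also have "(\<Union>x\<in>fib y. ?F x) = {e \<in> ?E. q e = Inr d}"
    proof (intro subset_antisym subsetI)
      fix e assume "e \<in> {e \<in> ?E. q e = Inr d}"
      then have e: "e \<in> ?E" "q e = Inr d" by auto
      have "y \<in> p ` ends K e" using d qh(2)[OF e] by simp
      then obtain x where "x \<in> ends K e" "p x = y" by blast
      then show "e \<in> (\<Union>x\<in>fib y. ?F x)" using e finite_graph_ends_sub[OF fg e(1)] by (auto simp: fib_def)
    qed auto
    also have "card {e \<in> ?E. q e = Inr d} = 2" using deg d by (simp add: has_degree_def)
    finally show ?thesis .
  qed
  have fibcard: "card (fib y) = 1 \<or> card (fib y) = 2"
    and fib1: "x \<in> ?V \<Longrightarrow> p x = y \<Longrightarrow> fib y \<noteq> {x} \<Longrightarrow> d \<in> edges T \<Longrightarrow> y \<in> ends T d \<Longrightarrow> local_count K q x d = 1"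
    if y: "y \<in> verts T" for y x d
  proof -
    have ge1: "1 \<le> local_count K q x d" if "x \<in> fib y" "d \<in> edges T" "y \<in> ends T d" for x d
      using pos[of x d] that by (auto simp: fib_def)
    obtain d0 where d0: "d0 \<in> edges T" "y \<in> ends T d0" using incT[OF y] by blast
    have "(\<Sum>x\<in>fib y. 1) \<le> (\<Sum>x\<in>fib y. local_count K q x d0)" by (rule sum_mono) (use ge1 d0 in auto)
    then have le: "card (fib y) \<le> 2" using sum2[OF d0] by simp
    have "fib y \<noteq> {}"
    proof
      assume "fib y = {}"
      then show False using sum2[OF d0] by simp
    qed
    then have "card (fib y) \<noteq> 0" using ffib by simp
    then show c: "card (fib y) = 1 \<or> card (fib y) = 2" using le by linarith
    show "local_count K q x d = 1" if x: "x \<in> ?V" "p x = y" "fib y \<noteq> {x}" "d \<in> edges T" "y \<in> ends T d"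
    proof -
      have xf: "x \<in> fib y" using x by (simp add: fib_def)
      then obtain z where z: "z \<in> fib y" "z \<noteq> x" using x(3) by blast
      have "(\<Sum>x\<in>{x, z}. local_count K q x d) \<le> (\<Sum>x\<in>fib y. local_count K q x d)"
        by (rule sum_mono2) (use ffib xf z in auto)
      then show ?thesis using sum2[OF x(4,5)] ge1[OF xf x(4,5)] ge1[OF z(1) x(4,5)] z(2) by simp
    qed
  qed
  define \<sigma> where "\<sigma> x = (if fib (p x) = {x} then x else (SOME z. z \<in> fib (p x) \<and> z \<noteq> x))" for x
  have sfib: "\<sigma> x \<in> fib (p x)" "fib (p x) = {x, \<sigma> x}" if x: "x \<in> ?V" for x
  proof -
    have xf: "x \<in> fib (p x)" using x by (simp add: fib_def)
    have "\<sigma> x \<in> fib (p x) \<and> fib (p x) = {x, \<sigma> x}"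
    proof (cases "fib (p x) = {x}")
      case False
      let ?z = "SOME z. z \<in> fib (p x) \<and> z \<noteq> x"
      have "\<exists>z. z \<in> fib (p x) \<and> z \<noteq> x" using False xf by blast
      then have z: "?z \<in> fib (p x) \<and> ?z \<noteq> x" by (rule someI_ex)
      have "card (fib (p x)) \<le> 2" using fibcard[OF pV[OF x]] by auto
      moreover have "card {x, ?z} = 2" using z by auto
      moreover have "{x, ?z} \<subseteq> fib (p x)" using z xf by simp
      ultimately have "{x, ?z} = fib (p x)" using card_seteq[OF ffib] by simp
      then show ?thesis using z False by (simp add: \<sigma>_def)
    qed (use xf in \<open>simp add: \<sigma>_def\<close>)
    then show "\<sigma> x \<in> fib (p x)" "fib (p x) = {x, \<sigma> x}" by auto
  qed
  have sV: "\<sigma> x \<in> ?V" and sp: "p (\<sigma> x) = p x" if "x \<in> ?V" for x using sfib(1)[OF that] by (auto simp: fib_def)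
  have sfix: "\<sigma> x = x \<longleftrightarrow> fib (p x) = {x}" if "x \<in> ?V" for x
    using sfib(2)[OF that] by auto
  have ss: "\<sigma> (\<sigma> x) = x" if x: "x \<in> ?V" for x
  proof -
    have a: "fib (p x) = {\<sigma> x, \<sigma> (\<sigma> x)}" using sfib(2)[OF sV[OF x]] sp[OF x] by simp
    have b: "fib (p x) = {x, \<sigma> x}" using sfib(2)[OF x] .
    show ?thesis
    proof (cases "\<sigma> x = x")
      case False
      have "x \<in> {\<sigma> x, \<sigma> (\<sigma> x)}" unfolding a[symmetric] b by simp
      then show ?thesis using False by (metis insertE singletonD)
    qed simp
  qed
  define qf where "qf e = {f \<in> ?E. q f = q e}" for e
  define \<tau> where "\<tau> e = (case q e of Inl _ \<Rightarrow> e | Inr d \<Rightarrow> (SOME f. f \<in> qf e \<and> f \<noteq> e))" for e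
  have tv: "\<tau> e = e" if "q e = Inl y" for e y using that by (simp add: \<tau>_def)
  have th: "\<tau> e \<noteq> e \<and> qf e = {e, \<tau> e}" if e: "e \<in> ?E" "q e = Inr d" for e d
  proof -
    have "d \<in> edges T" using qh(1)[OF e] .
    then have c: "card (qf e) = 2" using deg e by (simp add: has_degree_def qf_def)
    then have fin: "finite (qf e)" by (simp add: card_ge_0_finite)
    have ef: "e \<in> qf e" using e by (simp add: qf_def)
    let ?f = "SOME f. f \<in> qf e \<and> f \<noteq> e"
    have "\<exists>f. f \<in> qf e \<and> f \<noteq> e"
    proof (rule ccontr)
      assume "\<not> ?thesis"
      then have "qf e = {e}" using ef by auto
      then show False using c by simp
    qed
    then have f: "?f \<in> qf e \<and> ?f \<noteq> e" by (rule someI_ex)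
    have te: "\<tau> e = ?f" using e by (simp add: \<tau>_def)
    have "card {e, ?f} = 2" using f by auto
    moreover have "{e, ?f} \<subseteq> qf e" using f ef by simp
    ultimately have "{e, ?f} = qf e" using card_seteq[OF fin] c by simp
    then show ?thesis using f te by simp
  qed
  have tE: "\<tau> e \<in> ?E" and tq: "q (\<tau> e) = q e" if e: "e \<in> ?E" for e
  proof -
    have "\<tau> e \<in> ?E \<and> q (\<tau> e) = q e"
    proof (cases "q e")
      case (Inr d)
      then have "\<tau> e \<in> qf e" using th[OF e] by auto
      then show ?thesis by (simp add: qf_def)
    qed (use tv e in auto)
    then show "\<tau> e \<in> ?E" "q (\<tau> e) = q e" by auto
  qed
  have tt: "\<tau> (\<tau> e) = e" if e: "e \<in> ?E" for e
  proof (cases "q e")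
    case (Inr d)
    have a: "\<tau> e \<noteq> e" "qf e = {e, \<tau> e}" using th[OF e Inr] by auto
    have "q (\<tau> e) = Inr d" using tq[OF e] Inr by simp
    then have b: "\<tau> (\<tau> e) \<noteq> \<tau> e" "qf (\<tau> e) = {\<tau> e, \<tau> (\<tau> e)}" using th[OF tE[OF e]] by auto
    have qq: "qf (\<tau> e) = qf e" using tq[OF e] by (simp add: qf_def)
    have "e \<in> {\<tau> e, \<tau> (\<tau> e)}" unfolding b(2)[symmetric] qq a(2) by simp
    then show ?thesis using a(1) by (metis insertE singletonD)
  qed (use tv in auto)
  have vflip: "ends K e = {x, \<sigma> x} \<and> \<sigma> x \<noteq> x" if e: "e \<in> ?E" "q e = Inl y" "x \<in> ends K e" for e y x
  proof -
    obtain a b where ab: "ends K e = {a, b}" "a \<noteq> b" "a \<in> ?V" "b \<in> ?V" using ends2[OF e(1)] by blast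
    then have "p a = y" "p b = y" using qv[OF e(1,2)] by auto
    then have "b \<in> fib (p a)" "a \<in> fib (p b)" using ab by (auto simp: fib_def)
    then have s: "\<sigma> a = b" "\<sigma> b = a" using sfib(2)[OF ab(3)] sfib(2)[OF ab(4)] ab(2) by (metis insertE singletonD)+
    have "x = a \<or> x = b" using e(3) ab(1) by simp
    then show ?thesis
    proof
      assume "x = a" then show ?thesis using s ab by simp
    next
      assume "x = b" then show ?thesis using s ab by (simp add: insert_commute)
    qed
  qed
  have tends: "ends K (\<tau> e) = \<sigma> ` ends K e" if e: "e \<in> ?E" for e
  proof (cases "q e")
    case (Inl y)
    obtain a b where ab: "ends K e = {a, b}" "a \<in> ?V" using ends2[OF e] by blast
    then have "ends K e = {a, \<sigma> a}" using vflip[OF e Inl, of a] by simp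
    then show ?thesis using tv[OF Inl] ss[OF ab(2)] by auto
  next
    case (Inr d)
    have d: "d \<in> edges T" "ends T d = p ` ends K e" using qh[OF e Inr] by auto
    have qt: "q (\<tau> e) = Inr d" using tq[OF e] Inr by simp
    have dt: "ends T d = p ` ends K (\<tau> e)" using qh(2)[OF tE[OF e] qt] .
    have tne: "\<tau> e \<noteq> e" using th[OF e Inr] by simp
    \<comment> \<open>The other edge over \<open>d\<close> also has an end over the image of
      \<open>a\<close>. If \<open>a\<close> is not fixed, its local count is 1 and already used by
      \<open>e\<close>, so that end must be \<open>\<sigma> a\<close>.\<close>
    have key: "\<sigma> a \<in> ends K (\<tau> e)" if a: "a \<in> ends K e" for a
    proof -
      have aV: "a \<in> ?V" using a finite_graph_ends_sub[OF fg e] by auto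
      have "p a \<in> ends T d" using a d by auto
      then obtain a' where a': "a' \<in> ends K (\<tau> e)" "p a' = p a" using dt by auto
      have "a' \<in> ?V" using a' finite_graph_ends_sub[OF fg tE[OF e]] by auto
      then have "a' \<in> fib (p a)" using a' by (simp add: fib_def)
      then have or: "a' = a \<or> a' = \<sigma> a" using sfib(2)[OF aV] by auto
      show ?thesis
      proof (cases "\<sigma> a = a")
        case False
        have "fib (p a) \<noteq> {a}" using sfix[OF aV] False by simp
        then have "local_count K q a d = 1"
          using fib1[OF pV[OF aV] aV refl _ d(1)] \<open>p a \<in> ends T d\<close> by simp
        then obtain f where f: "{e \<in> ?E. a \<in> ends K e \<and> q e = Inr d} = {f}"
          unfolding local_count_def by (rule card_1_singletonE)
        have "e \<in> {f}" unfolding f[symmetric] using a e Inr by simp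
        moreover have "a \<in> ends K (\<tau> e) \<Longrightarrow> \<tau> e \<in> {f}" unfolding f[symmetric] using tE[OF e] qt by simp
        ultimately have "a \<notin> ends K (\<tau> e)" using tne by auto
        then show ?thesis using or a' by auto
      qed (use or a' in auto)
    qed
    obtain a b where ab: "ends K e = {a, b}" "a \<noteq> b" "a \<in> ?V" "b \<in> ?V" using ends2[OF e] by blast
    have "\<sigma> a \<noteq> \<sigma> b" using ss ab by metis
    moreover obtain u v where "ends K (\<tau> e) = {u, v}" using ends2[OF tE[OF e]] by blast
    ultimately show ?thesis using key[of a] key[of b] ab by auto
  qed
  have moved_iff: "\<tau> e \<noteq> e \<longleftrightarrow> (\<exists>d. q e = Inr d)" if e: "e \<in> ?E" for e
  proof (cases "q e")
    case (Inr d)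
    then show ?thesis using th[OF e Inr] by auto
  qed (use tv in auto)
  \<comment> \<open>Vertex orbits are the fibres over the vertices of \<open>T\<close>, and moved
    edges come in pairs over the edges of \<open>T\<close>, so this is the Euler count of
    \<open>T\<close>.\<close>
  have cnt: "card {e \<in> ?E. \<tau> e \<noteq> e} + 2 = card ?V + card {v \<in> ?V. \<sigma> v = v}"
  proof -
    have surj: "p ` ?V = verts T"
    proof (intro subset_antisym subsetI)
      fix y assume "y \<in> verts T"
      then have "fib y \<noteq> {}" using fibcard[of y] by auto
      then show "y \<in> p ` ?V" by (auto simp: fib_def)
    qed (use pV in auto)
    have "2 * card ((\<lambda>x. {x, \<sigma> x}) ` ?V) = card ?V + card {v \<in> ?V. \<sigma> v = v}"
      by (rule card_involution_orbits) (use fV sV ss in auto)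
    moreover have "(\<lambda>x. {x, \<sigma> x}) ` ?V = fib ` verts T"
      unfolding surj[symmetric] image_image using sfib(2) by (intro image_cong) auto
    moreover have "card (fib ` verts T) = card (verts T)"
    proof (rule card_image, rule inj_onI)
      fix y z assume yz: "y \<in> verts T" "z \<in> verts T" "fib y = fib z"
      then obtain x where "x \<in> fib y" using fibcard[of y] by fastforce
      moreover from this have "x \<in> fib z" using yz by simp
      ultimately show "y = z" by (simp add: fib_def)
    qed
    moreover have "card {e \<in> ?E. \<tau> e \<noteq> e} = 2 * card (edges T)"
    proof -
      have "{e \<in> ?E. \<tau> e \<noteq> e} = (\<Union>d\<in>edges T. {e \<in> ?E. q e = Inr d})"
        using moved_iff qh(1) by auto
      also have "card \<dots> = (\<Sum>d\<in>edges T. card {e \<in> ?E. q e = Inr d})"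
        by (rule card_UN_disjoint) (use fT fE in \<open>auto simp: finite_graph_def\<close>)
      also have "\<dots> = (\<Sum>d\<in>edges T. 2)" by (rule sum.cong) (use deg in \<open>auto simp: has_degree_def\<close>)
      finally show ?thesis by simp
    qed
    moreover have "card (verts T) = card (edges T) + 1" using tree_graph_iff_card[OF fT cT] tT by simp
    ultimately show ?thesis by simp
  qed
  have hyp: "hyp_involution K (\<lambda>_. 0) \<sigma> \<tau>"
    unfolding hyp_involution_def
  proof (intro conjI ballI cnt)
    fix e assume e: "e \<in> ?E"
    show "\<tau> e \<in> ?E" "\<tau> (\<tau> e) = e" "ends K (\<tau> e) = \<sigma> ` ends K e" using tE[OF e] tt[OF e] tends[OF e] by auto
    show "is_loop K e \<longrightarrow> \<tau> e = e" using nl[OF e] by simp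
    show "\<tau> e = e \<longrightarrow> \<not> is_loop K e \<longrightarrow> (\<forall>v\<in>ends K e. \<sigma> v \<noteq> v)"
    proof (intro impI ballI)
      fix v assume "\<tau> e = e" and v: "v \<in> ends K e"
      then obtain y where "q e = Inl y" using moved_iff[OF e] by (cases "q e") auto
      then show "\<sigma> v \<noteq> v" using vflip[OF e _ v] by blast
    qed
  qed (use sV ss in auto)
  have rel: "(\<exists>k. q d = Inr k \<and> q e = Inr k) \<longleftrightarrow> \<tau> d \<noteq> d \<and> (d = e \<or> e = \<tau> d)" if d: "d \<in> ?E" and e: "e \<in> ?E" for d e
  proof (cases "q d")
    case (Inl y)
    then show ?thesis using tv[OF Inl] by auto
  next
    case (Inr k)
    have "(\<exists>k. q d = Inr k \<and> q e = Inr k) \<longleftrightarrow> e \<in> qf d" using Inr e by (auto simp: qf_def)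
    then show ?thesis using th[OF d Inr] by auto
  qed
  have inc': "\<exists>e\<in>?E. x \<in> ends K e \<and> \<tau> e \<noteq> e" if x: "x \<in> ?V" for x
  proof -
    obtain d where d: "d \<in> edges T" "p x \<in> ends T d" using inc[OF x] by blast
    have "{e \<in> ?E. x \<in> ends K e \<and> q e = Inr d} \<noteq> {}"
    proof
      assume "{e \<in> ?E. x \<in> ends K e \<and> q e = Inr d} = {}"
      then have "local_count K q x d = 0" unfolding local_count_def by (simp only: card.empty)
      then show False using pos[OF x d] by simp
    qed
    then obtain e where e: "e \<in> ?E" "x \<in> ends K e" "q e = Inr d" by blast
    then show ?thesis using moved_iff[OF e(1)] by auto
  qed
  show ?thesis by (rule that[OF hyp]; intro ballI) (rule rel inc'; assumption)+
qed

section \<open>Subdividing loops\<close>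

lemma (in hyp_inv) is_loop_tau: "e \<in> E \<Longrightarrow> is_loop G (\<tau> e) \<longleftrightarrow> is_loop G e"
  using loop_fixed[of e] loop_fixed[of "\<tau> e"] t_in[of e] t_t[of e] by auto

lemma verts_subdivide: "verts (subdivide_loops H) = Inl ` verts H \<union> Inr ` {e \<in> edges H. is_loop H e}"
  and edges_subdivide: "(x, b) \<in> edges (subdivide_loops H) \<longleftrightarrow> x \<in> edges H \<and> (b \<longrightarrow> is_loop H x)"
  and ends_subdivide: "ends (subdivide_loops H) (x, b) =
    (if is_loop H x then insert (Inr x) (Inl ` ends H x) else Inl ` ends H x)"
  by (auto simp: subdivide_loops_def)

lemma finite_graph_subdivide:
  assumes fg: "finite_graph H"
  shows "finite_graph (subdivide_loops H)" "e \<in> edges (subdivide_loops H) \<Longrightarrow> \<not> is_loop (subdivide_loops H) e"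
proof -
  let ?K = "subdivide_loops H"
  have "edges ?K \<subseteq> edges H \<times> UNIV" by (auto simp: edges_subdivide)
  then have "finite (edges ?K)" using fg finite_subset by (fastforce simp: finite_graph_def)
  moreover have "finite (verts ?K)" using fg by (auto simp: verts_subdivide finite_graph_def)
  moreover have e: "ends ?K e \<subseteq> verts ?K \<and> card (ends ?K e) = 2" if "e \<in> edges ?K" for e
  proof -
    obtain x b where xb: "e = (x, b)" by (cases e)
    have x: "x \<in> edges H" using that xb by (simp add: edges_subdivide)
    obtain u v where uv: "ends H x = {u, v}" "u \<in> verts H" "v \<in> verts H" using fg x by (rule finite_graph_ends)
    show ?thesis
    proof (cases "is_loop H x")
      case True
      then have "ends H x = {u}" using uv by (auto simp: is_loop_iff)
      then show ?thesis using True x uv by (auto simp: xb ends_subdivide verts_subdivide)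
    next
      case False
      then have "u \<noteq> v" using uv by (auto simp: is_loop_def)
      then show ?thesis using False x uv by (auto simp: xb ends_subdivide verts_subdivide)
    qed
  qed
  ultimately show "finite_graph ?K" by (simp add: finite_graph_def)
  show "\<not> is_loop ?K e" if "e \<in> edges ?K" using e[OF that] by (simp add: is_loop_def)
qed

text \<open>Contracting the half \<open>(x, True)\<close> of every subdivided loop gives back
  \<open>H\<close>, with the midpoint sent to the vertex of the loop. Connectivity of the
  subdivision is then an instance of \<open>contracts_connected\<close>.\<close>

lemma subdivide_contracts:
  assumes fg: "finite_graph H"
  shows "contracts (case_sum id (\<lambda>x. the_elem (ends H x))) fst {(x, True) |x. x \<in> edges H \<and> is_loop H x}
    (subdivide_loops H) (\<lambda>_. 0) H (\<lambda>_. 0)"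
proof -
  let ?K = "subdivide_loops H"
  define p where "p = case_sum id (\<lambda>x. the_elem (ends H x))"
  let ?S = "{(x, True) |x. x \<in> edges H \<and> is_loop H x}"
  have pv: "p (Inl v) = v" for v by (simp add: p_def)
  have px: "ends H x = {p (Inr x)}" "p (Inr x) \<in> verts H" if x: "x \<in> edges H" "is_loop H x" for x
  proof -
    obtain v where v: "ends H x = {v}" using x by (auto simp: is_loop_iff)
    then have "p (Inr x) = v" by (simp add: p_def)
    then show "ends H x = {p (Inr x)}" "p (Inr x) \<in> verts H"
      using v finite_graph_ends_sub[OF fg x(1)] by auto
  qed
  have pends: "p ` ends ?K (x, b) = ends H x" if "x \<in> edges H" for x b
  proof (cases "is_loop H x")
    case True
    then show ?thesis using px[OF that True] by (simp add: ends_subdivide image_image pv)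
  next
    case False
    then show ?thesis by (simp add: ends_subdivide image_image pv)
  qed
  have "contracts p fst ?S ?K (\<lambda>_. 0) H (\<lambda>_. 0)"
    unfolding contracts_def
  proof (intro conjI ballI allI impI)
    show "?S \<subseteq> edges ?K" by (auto simp: edges_subdivide)
    show "verts H = p ` verts ?K"
    proof (intro subset_antisym subsetI)
      fix v assume "v \<in> verts H"
      then show "v \<in> p ` verts ?K" by (intro image_eqI[of _ _ "Inl v"]) (auto simp: pv verts_subdivide)
    next
      fix v assume "v \<in> p ` verts ?K"
      then show "v \<in> verts H" using px(2) by (auto simp: verts_subdivide pv)
    qed
    show "bij_betw fst (edges ?K - ?S) (edges H)"
    proof (rule bij_betwI[where g = "\<lambda>x. (x, False)"])
      show "(fst e, False) = e" if e: "e \<in> edges ?K - ?S" for e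
      proof -
        obtain x b where "e = (x, b)" by (cases e)
        then show ?thesis using e by (auto simp: edges_subdivide)
      qed
    qed (auto simp: edges_subdivide)
    show "ends H (fst e) = p ` ends ?K e" if e: "e \<in> edges ?K - ?S" for e
    proof -
      obtain x b where xb: "e = (x, b)" by (cases e)
      then show ?thesis using e pends[of x b] by (simp add: edges_subdivide)
    qed
    show "\<exists>v. p ` ends ?K e = {v}" if e: "e \<in> ?S" for e
    proof -
      obtain x where x: "e = (x, True)" "x \<in> edges H" "is_loop H x" using e by blast
      then have "p ` ends ?K e = {p (Inr x)}" using pends[of x True] px(1)[of x] by simp
      then show ?thesis by blast
    qed
  next
    fix A y z assume A: "A \<subseteq> verts ?K" "?S \<inter> edge_cut ?K A = {}" and yz: "y \<in> A" "z \<in> verts ?K" "p y = p z"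
    have key: "u \<in> A \<longleftrightarrow> Inl (p u) \<in> A" if u: "u \<in> verts ?K" for u
    proof (cases u)
      case (Inr x)
      then have x: "x \<in> edges H" "is_loop H x" using u by (auto simp: verts_subdivide)
      have "(x, True) \<notin> edge_cut ?K A" using A(2) x by blast
      moreover have "ends ?K (x, True) = {Inr x, Inl (p (Inr x))}" using px(1)[OF x] x by (simp add: ends_subdivide)
      moreover have "(x, True) \<in> edges ?K" using x by (simp add: edges_subdivide)
      ultimately show ?thesis using Inr by (auto simp: edge_cut_def)
    qed (simp add: pv)
    have "Inl (p y) \<in> A" using key[of y] yz A(1) by auto
    then show "z \<in> A" using key[of z] yz by simp
  next
    fix v assume v: "v \<in> verts H"
    define Lv where "Lv = {x \<in> edges H. is_loop H x \<and> ends H x = {v}}"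
    have fL: "finite Lv" using fg by (auto simp: Lv_def finite_graph_def)
    have a: "{u \<in> verts ?K. p u = v} = insert (Inl v) (Inr ` Lv)"
    proof (intro subset_antisym subsetI)
      fix u assume u: "u \<in> {u \<in> verts ?K. p u = v}"
      show "u \<in> insert (Inl v) (Inr ` Lv)"
      proof (cases u)
        case (Inl y)
        then show ?thesis using u pv by simp
      next
        case (Inr x)
        then have x: "x \<in> edges H" "is_loop H x" "p (Inr x) = v" using u by (auto simp: verts_subdivide)
        then show ?thesis using px(1)[OF x(1,2)] Inr by (simp add: Lv_def)
      qed
    next
      fix u assume u: "u \<in> insert (Inl v) (Inr ` Lv)"
      show "u \<in> {u \<in> verts ?K. p u = v}"
      proof (cases "u = Inl v")
        case False
        then obtain x where x: "u = Inr x" "x \<in> edges H" "is_loop H x" "ends H x = {v}" using u by (auto simp: Lv_def)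
        then show ?thesis using px(1)[of x] by (simp add: verts_subdivide)
      qed (use v pv in \<open>simp add: verts_subdivide\<close>)
    qed
    have b: "{e \<in> ?S. p ` ends ?K e = {v}} = (\<lambda>x. (x, True)) ` Lv"
      using pends by (auto simp: Lv_def)
    have "card (insert (Inl v :: 'a + 'b) (Inr ` Lv)) = card Lv + 1"
      using fL by (subst card_insert_disjoint) (auto simp: card_image)
    moreover have "card ((\<lambda>x. (x, True)) ` Lv) = card Lv" by (rule card_image) (auto simp: inj_on_def)
    ultimately show "0 + card {u \<in> verts ?K. p u = v} = (\<Sum>u\<in>{u \<in> verts ?K. p u = v}. 0) +
        card {e \<in> ?S. p ` ends ?K e = {v}} + 1"
      unfolding a b by simp
  qed
  then show ?thesis by (simp add: p_def)
qed

lemma connected_subdivide: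
  assumes "finite_graph H" "connected_graph H" shows "connected_graph (subdivide_loops H)"
  using contracts_connected[OF subdivide_contracts finite_graph_subdivide(1)] assms by blast

lemma card_subdivide_verts:
  assumes fg: "finite_graph H"
  shows "card (verts (subdivide_loops H)) = card (verts H) + card {e \<in> edges H. is_loop H e}"
proof -
  have fin: "finite (verts H)" "finite {e \<in> edges H. is_loop H e}" using fg by (auto simp: finite_graph_def)
  have "card (Inl ` verts H \<union> Inr ` {e \<in> edges H. is_loop H e}) =
      card (Inl ` verts H :: ('a + 'b) set) + card (Inr ` {e \<in> edges H. is_loop H e} :: ('a + 'b) set)"
    by (rule card_Un_disjoint) (use fin in auto)
  then show ?thesis by (simp add: verts_subdivide card_image)
qed

text \<open>Midpoints are fixed and the two halves of a loop are exchanged. Each loop adds two moved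
  edges on one side of the count, and one vertex that is also a fixed vertex on the other.\<close>

lemma involution_on_subdivision:
  fixes H :: "('v, 'e) mgraph"
  assumes fg: "finite_graph H" and cg: "connected_graph H" and inv: "hyp_involution H (\<lambda>_. 0) \<sigma> \<tau>"
  obtains \<sigma>' \<tau>' where "hyp_involution (subdivide_loops H) (\<lambda>_. 0) \<sigma>' \<tau>'"
    "\<forall>x\<in>edges H. \<forall>b. \<tau>' (x, b) = (if is_loop H x then (x, \<not> b) else (\<tau> x, b))"
proof -
  interpret I: hyp_inv H "\<lambda>_. 0" \<sigma> \<tau> using fg cg inv by unfold_locales
  let ?K = "subdivide_loops H"
  let ?L = "{e \<in> edges H. is_loop H e}"
  have fL: "finite ?L" using I.fE by simp
  define \<sigma>' :: "'v + 'e \<Rightarrow> 'v + 'e" where "\<sigma>' = case_sum (Inl \<circ> \<sigma>) Inr"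
  define \<tau>' where "\<tau>' = (\<lambda>(x, b). if is_loop H x then (x, \<not> b) else (\<tau> x, b))"
  have s1: "\<sigma>' (Inl v) = Inl (\<sigma> v)" and s2: "\<sigma>' (Inr x) = Inr x" for v x by (auto simp: \<sigma>'_def)
  have t: "\<tau>' (x, b) = (if is_loop H x then (x, \<not> b) else (\<tau> x, b))" for x b by (simp add: \<tau>'_def)
  have loopv: "\<sigma> ` ends H x = ends H x" if "x \<in> edges H" "is_loop H x" for x
    using I.t_ends[OF that(1)] I.loop_fixed[OF that] by simp
  have M: "{e \<in> edges ?K. \<tau>' e \<noteq> e} = (\<lambda>x. (x, False)) ` I.M \<union> ?L \<times> UNIV"
  proof -
    have "(x, b) \<in> {e \<in> edges ?K. \<tau>' e \<noteq> e} \<longleftrightarrow> (x, b) \<in> (\<lambda>x. (x, False)) ` I.M \<union> ?L \<times> UNIV" for x b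
      using I.loop_fixed[of x] by (auto simp: t edges_subdivide I.M_def)
    then show ?thesis by auto
  qed
  have "card {e \<in> edges ?K. \<tau>' e \<noteq> e} = card ((\<lambda>x. (x, False)) ` I.M) + card (?L \<times> (UNIV :: bool set))"
    unfolding M by (rule card_Un_disjoint) (use I.fM fL I.loop_fixed in \<open>auto simp: I.M_def\<close>)
  then have cM: "card {e \<in> edges ?K. \<tau>' e \<noteq> e} = card I.M + 2 * card ?L"
    by (simp add: card_image inj_on_def card_cartesian_product)
  have F: "{v \<in> verts ?K. \<sigma>' v = v} = Inl ` {v \<in> verts H. \<sigma> v = v} \<union> Inr ` ?L"
    by (auto simp: verts_subdivide s1 s2)
  have "card {v \<in> verts ?K. \<sigma>' v = v} = card (Inl ` {v \<in> verts H. \<sigma> v = v} :: ('v + 'e) set) + card (Inr ` ?L :: ('v + 'e) set)"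
    unfolding F by (rule card_Un_disjoint) (use I.fV fL in auto)
  then have cF: "card {v \<in> verts ?K. \<sigma>' v = v} = card {v \<in> verts H. \<sigma> v = v} + card ?L"
    by (simp add: card_image)
  have "hyp_involution ?K (\<lambda>_. 0) \<sigma>' \<tau>'"
    unfolding hyp_involution_def
  proof (intro conjI ballI)
    show "card {e \<in> edges ?K. \<tau>' e \<noteq> e} + 2 = card (verts ?K) + card {v \<in> verts ?K. \<sigma>' v = v}"
      using cM cF card_subdivide_verts[OF fg] I.count by simp
    fix v assume v: "v \<in> verts ?K"
    show "\<sigma>' v \<in> verts ?K" "\<sigma>' (\<sigma>' v) = v" "0 < (0::nat) \<longrightarrow> \<sigma>' v = v"
      using v I.s_in I.s_s by (auto simp: verts_subdivide s1 s2)
  next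
    fix e assume e: "e \<in> edges ?K"
    obtain x b where xb: "e = (x, b)" by (cases e)
    have x: "x \<in> edges H" using e xb by (simp add: edges_subdivide)
    have lt: "is_loop H (\<tau> x) \<longleftrightarrow> is_loop H x" by (rule I.is_loop_tau[OF x])
    show "\<tau>' e \<in> edges ?K" "\<tau>' (\<tau>' e) = e"
      using e xb x I.t_in[OF x] I.t_t[OF x] lt by (auto simp: t edges_subdivide)
    have img: "\<sigma>' ` Inl ` X = Inl ` \<sigma> ` X" for X by (auto simp: s1 image_image)
    show "ends ?K (\<tau>' e) = \<sigma>' ` ends ?K e"
    proof (cases "is_loop H x")
      case True
      have "\<sigma>' ` ends ?K e = insert (Inr x) (Inl ` \<sigma> ` ends H x)"
        using True by (simp add: xb ends_subdivide s2 img)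
      then show ?thesis using True loopv[OF x True] by (simp add: xb t ends_subdivide)
    next
      case False
      have "\<sigma>' ` ends ?K e = Inl ` \<sigma> ` ends H x" using False by (simp add: xb ends_subdivide img)
      then show ?thesis using False lt I.t_ends[OF x] by (simp add: xb t ends_subdivide)
    qed
    show "is_loop ?K e \<longrightarrow> \<tau>' e = e" using finite_graph_subdivide(2)[OF fg e] by simp
    show "\<tau>' e = e \<longrightarrow> \<not> is_loop ?K e \<longrightarrow> (\<forall>v\<in>ends ?K e. \<sigma>' v \<noteq> v)"
    proof (intro impI ballI)
      fix u assume te: "\<tau>' e = e" and u: "u \<in> ends ?K e"
      have nl: "\<not> is_loop H x" and tx: "\<tau> x = x" using te by (auto simp: xb t split: if_splits)
      obtain v where v: "u = Inl v" "v \<in> ends H x" using u nl by (auto simp: xb ends_subdivide)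
      then show "\<sigma>' u \<noteq> u" using I.flip[OF x tx nl v(2)] by (simp add: s1)
    qed
  qed
  then show ?thesis by (rule that) (simp add: t)
qed

text \<open>By \<open>inc\<close> some half of every loop is moved. This excludes involutions that
  exchange a midpoint with the vertex of its loop and flip both halves; such an involution would not
  come from one of \<open>H\<close>.\<close>

lemma involution_from_subdivision:
  fixes H :: "('v, 'e) mgraph"
  assumes fg: "finite_graph H" and cg: "connected_graph H"
    and inv: "hyp_involution (subdivide_loops H) (\<lambda>_. 0) \<sigma> \<tau>"
    and inc: "\<forall>x\<in>verts (subdivide_loops H).
      \<exists>e\<in>edges (subdivide_loops H). x \<in> ends (subdivide_loops H) e \<and> \<tau> e \<noteq> e"
  obtains \<sigma>' \<tau>' where "hyp_involution H (\<lambda>_. 0) \<sigma>' \<tau>'"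
    "\<forall>x\<in>edges H. \<not> is_loop H x \<longrightarrow> \<tau> (x, False) = (\<tau>' x, False)"
proof -
  let ?K = "subdivide_loops H"
  let ?L = "{e \<in> edges H. is_loop H e}"
  interpret I: hyp_inv ?K "\<lambda>_. 0" \<sigma> \<tau>
    using finite_graph_subdivide(1)[OF fg] connected_subdivide[OF fg cg] inv by unfold_locales
  have fE: "finite (edges H)" and fV: "finite (verts H)" using fg by (auto simp: finite_graph_def)
  have fL: "finite ?L" using fE by simp
  have VK: "Inl v \<in> verts ?K \<longleftrightarrow> v \<in> verts H" "Inr x \<in> verts ?K \<longleftrightarrow> x \<in> edges H \<and> is_loop H x" for v x
    by (auto simp: verts_subdivide)
  have loop: "\<tau> (x, b) = (x, \<not> b) \<and> \<sigma> (Inr x) = Inr x \<and> \<sigma> (Inl v) = Inl v"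
    if x: "x \<in> edges H" "ends H x = {v}" for x v b
  proof -
    have lx: "is_loop H x" using x by (auto simp: is_loop_iff)
    have eK: "(x, c) \<in> edges ?K" for c using x lx by (simp add: edges_subdivide)
    have ends: "ends ?K (x, c) = {Inr x, Inl v}" for c using x lx by (simp add: ends_subdivide)
    have uK: "Inr x \<in> verts ?K" using x lx by (simp add: VK)
    have vK: "Inl v \<in> verts ?K" using x finite_graph_ends_sub[OF fg x(1)] by (simp add: VK)
    have "\<exists>e\<in>edges ?K. Inr x \<in> ends ?K e \<and> \<tau> e \<noteq> e" by (rule bspec[OF inc uK])
    then obtain y c where y: "(y, c) \<in> edges ?K" "Inr x \<in> ends ?K (y, c)" "\<tau> (y, c) \<noteq> (y, c)" by auto
    have "y = x" using y(2) by (auto simp: ends_subdivide split: if_splits)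
    then have "(x, c) \<in> I.M" using y by (simp add: I.M_def)
    \<comment> \<open>The other half of the loop is parallel to \<open>(x, c)\<close>, so it lies in
      every cut through that edge, in particular in the cut consisting of \<open>(x, c)\<close> and
      its image.\<close>
    have one: "\<tau> (x, c) = (x, \<not> c)"
    proof -
      obtain A where A: "A \<subseteq> verts ?K" "edge_cut ?K A = {(x, c), \<tau> (x, c)}"
        using \<open>(x, c) \<in> I.M\<close> by (rule I.moved_invariant_cut)
      have "(x, c) \<in> edge_cut ?K A" using A by simp
      then have "(x, \<not> c) \<in> edge_cut ?K A" using eK[of "\<not> c"] ends by (simp add: edge_cut_def)
      then show ?thesis using A(2) by auto
    qed
    have two: "\<tau> (x, d) = (x, \<not> d)" for d
    proof (cases "d = c")
      case False
      then have "(x, d) = \<tau> (x, c)" using one by auto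
      then have "\<tau> (x, d) = (x, c)" using I.t_t[OF eK[of c]] by simp
      moreover have "c = (\<not> d)" using False by auto
      ultimately show ?thesis by simp
    qed (simp add: one)
    have "\<sigma> ` {Inr x, Inl v} = {Inr x, Inl v}" using I.t_ends[OF eK[of c]] unfolding two ends by (rule sym)
    moreover have no: "I.orb (Inr x) \<noteq> I.orb (Inl v)"
      by (rule I.moved_ends_distinct_orbits[OF \<open>(x, c) \<in> I.M\<close>]) (simp add: ends)
    have "\<sigma> (Inr x) \<noteq> Inl v"
    proof
      assume a: "\<sigma> (Inr x) = Inl v"
      then have "\<sigma> (Inl v) = Inr x" using I.s_s[OF uK] by simp
      then show False using no a by (auto simp: I.orb_def)
    qed
    ultimately have "\<sigma> (Inr x) = Inr x" "\<sigma> (Inl v) = Inl v" by (auto simp: doubleton_eq_iff)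
    then show ?thesis using two by simp
  qed
  have loop2: "\<tau> (x, b) = (x, \<not> b)" "\<sigma> (Inr x) = Inr x" if "x \<in> edges H" "is_loop H x" for x b
    using that loop[of x] by (auto simp: is_loop_iff)
  define \<sigma>' where "\<sigma>' v = projl (\<sigma> (Inl v))" for v
  define \<tau>' where "\<tau>' x = (if is_loop H x then x else fst (\<tau> (x, False)))" for x
  have s: "\<sigma> (Inl v) = Inl (\<sigma>' v)" and sV: "\<sigma>' v \<in> verts H" if v: "v \<in> verts H" for v
  proof -
    have vK: "Inl v \<in> verts ?K" using v by (simp add: VK)
    have "\<sigma> (Inl v) = Inl (\<sigma>' v)"
    proof (cases "\<sigma> (Inl v)")
      case (Inr x)
      then have "x \<in> edges H" "is_loop H x" using I.s_in[OF vK] by (auto simp: VK)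
      then have "\<sigma> (Inr x) = Inr x" by (rule loop2(2))
      then show ?thesis using I.s_s[OF vK] Inr by simp
    qed (simp add: \<sigma>'_def)
    then show "\<sigma> (Inl v) = Inl (\<sigma>' v)" "\<sigma>' v \<in> verts H" using I.s_in[OF vK] by (auto simp: VK)
  qed
  have t: "\<tau> (x, False) = (\<tau>' x, False)" and tE: "\<tau>' x \<in> edges H" and tl: "\<not> is_loop H (\<tau>' x)"
    if x: "x \<in> edges H" "\<not> is_loop H x" for x
  proof -
    have xK: "(x, False) \<in> edges ?K" using x by (simp add: edges_subdivide)
    obtain y b where y: "\<tau> (x, False) = (y, b)" by fastforce
    have yK: "(y, b) \<in> edges ?K" using I.t_in[OF xK] y by simp
    have "\<not> is_loop H y"
    proof
      assume l: "is_loop H y"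
      have "\<tau> (y, b) = (y, \<not> b)" using loop2(1)[OF _ l] yK by (simp add: edges_subdivide)
      then have "(x, False) = (y, \<not> b)" using I.t_t[OF xK] y by simp
      then show False using x l by simp
    qed
    then have "\<not> b" using yK by (simp add: edges_subdivide)
    then show "\<tau> (x, False) = (\<tau>' x, False)" "\<tau>' x \<in> edges H" "\<not> is_loop H (\<tau>' x)"
      using y x yK \<open>\<not> is_loop H y\<close> by (auto simp: \<tau>'_def edges_subdivide)
  qed
  have tloop: "\<tau>' x = x" if "is_loop H x" for x using that by (simp add: \<tau>'_def)
  have M: "I.M = (\<lambda>x. (x, False)) ` {x \<in> edges H. \<tau>' x \<noteq> x} \<union> ?L \<times> UNIV"
  proof -
    have "(x, b) \<in> I.M \<longleftrightarrow> (x, b) \<in> (\<lambda>x. (x, False)) ` {x \<in> edges H. \<tau>' x \<noteq> x} \<union> ?L \<times> UNIV" for x b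
      using loop2(1)[of x b] t[of x] tloop[of x] by (cases b; cases "is_loop H x") (auto simp: I.M_def edges_subdivide)
    then show ?thesis by auto
  qed
  have "card I.M = card ((\<lambda>x. (x, False)) ` {x \<in> edges H. \<tau>' x \<noteq> x}) + card (?L \<times> (UNIV :: bool set))"
    unfolding M by (rule card_Un_disjoint) (use fE fL tloop in auto)
  then have cM: "card I.M = card {x \<in> edges H. \<tau>' x \<noteq> x} + 2 * card ?L"
    by (simp add: card_image inj_on_def card_cartesian_product)
  have F: "{v \<in> verts ?K. \<sigma> v = v} = Inl ` {v \<in> verts H. \<sigma>' v = v} \<union> Inr ` ?L"
    using s loop2(2) by (auto simp: verts_subdivide)
  have "card {v \<in> verts ?K. \<sigma> v = v} = card (Inl ` {v \<in> verts H. \<sigma>' v = v} :: ('v + 'e) set) + card (Inr ` ?L :: ('v + 'e) set)"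
    unfolding F by (rule card_Un_disjoint) (use fV fL in auto)
  then have cF: "card {v \<in> verts ?K. \<sigma> v = v} = card {v \<in> verts H. \<sigma>' v = v} + card ?L"
    by (simp add: card_image)
  have "hyp_involution H (\<lambda>_. 0) \<sigma>' \<tau>'"
    unfolding hyp_involution_def
  proof (intro conjI ballI)
    show "card {e \<in> edges H. \<tau>' e \<noteq> e} + 2 = card (verts H) + card {v \<in> verts H. \<sigma>' v = v}"
      using cM cF card_subdivide_verts[OF fg] I.count by simp
    fix v assume v: "v \<in> verts H"
    show "\<sigma>' v \<in> verts H" by (rule sV[OF v])
    have "\<sigma> (\<sigma> (Inl v)) = Inl v" using I.s_s v by (simp add: VK)
    then show "\<sigma>' (\<sigma>' v) = v" using s[OF v] s[OF sV[OF v]] by simp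
  next
    fix x assume x: "x \<in> edges H"
    show "\<tau>' x \<in> edges H" using tE[OF x] tloop x by (cases "is_loop H x") auto
    show "\<tau>' (\<tau>' x) = x"
    proof (cases "is_loop H x")
      case False
      have "(x, False) \<in> edges ?K" using x by (simp add: edges_subdivide)
      then have "\<tau> (\<tau> (x, False)) = (x, False)" by (rule I.t_t)
      then show ?thesis using t[OF x False] t[OF tE[OF x False] tl[OF x False]] by simp
    qed (simp add: tloop)
    show "is_loop H x \<longrightarrow> \<tau>' x = x" using tloop by simp
    have img: "\<sigma> ` Inl ` ends H x = Inl ` \<sigma>' ` ends H x"
      unfolding image_image using s finite_graph_ends_sub[OF fg x] by (intro image_cong) auto
    show "ends H (\<tau>' x) = \<sigma>' ` ends H x"
    proof (cases "is_loop H x")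
      case True
      then obtain v where v: "ends H x = {v}" by (auto simp: is_loop_iff)
      have "v \<in> verts H" using v finite_graph_ends_sub[OF fg x] by simp
      then have "\<sigma>' v = v" using loop[OF x v] s by auto
      then show ?thesis using tloop[OF True] v by simp
    next
      case False
      have "(x, False) \<in> edges ?K" using x by (simp add: edges_subdivide)
      then have "ends ?K (\<tau> (x, False)) = \<sigma> ` ends ?K (x, False)" by (rule I.t_ends)
      then have "Inl ` ends H (\<tau>' x) = (Inl ` \<sigma>' ` ends H x :: ('v + 'e) set)"
        using False t[OF x False] tl[OF x False] img by (simp add: ends_subdivide)
      then show ?thesis by (simp add: inj_image_eq_iff)
    qed
    show "\<tau>' x = x \<longrightarrow> \<not> is_loop H x \<longrightarrow> (\<forall>v\<in>ends H x. \<sigma>' v \<noteq> v)"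
    proof (intro impI ballI)
      fix v assume tx: "\<tau>' x = x" and nl: "\<not> is_loop H x" and v: "v \<in> ends H x"
      have xK: "(x, False) \<in> edges ?K" using x by (simp add: edges_subdivide)
      have "\<tau> (x, False) = (x, False)" using t[OF x nl] tx by simp
      moreover have "Inl v \<in> ends ?K (x, False)" using v nl by (simp add: ends_subdivide)
      ultimately have "\<sigma> (Inl v) \<noteq> Inl v" by (rule I.flip[OF xK _ finite_graph_subdivide(2)[OF fg xK]])
      moreover have "v \<in> verts H" using v finite_graph_ends_sub[OF fg x] by auto
      ultimately show "\<sigma>' v \<noteq> v" using s by auto
    qed
  qed auto
  then show ?thesis by (rule that) (simp add: t)
qed

section \<open>Weights as loops\<close>

lemma verts_weight_loops: "verts (add_weight_loops G w) = verts G"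
  and edges_weight_loops: "Inl e \<in> edges (add_weight_loops G w) \<longleftrightarrow> e \<in> edges G"
    "Inr (v, k) \<in> edges (add_weight_loops G w) \<longleftrightarrow> v \<in> verts G \<and> k < w v"
  and ends_weight_loops: "ends (add_weight_loops G w) (Inl e) = ends G e"
    "ends (add_weight_loops G w) (Inr (v, k)) = {v}"
  and loop_weight_loops: "is_loop (add_weight_loops G w) (Inl e) \<longleftrightarrow> is_loop G e"
    "is_loop (add_weight_loops G w) (Inr (v, k))"
  by (auto simp: add_weight_loops_def is_loop_def)

lemma edges_weight_loops_eq:
  "edges (add_weight_loops G w) = Inl ` edges G \<union> Inr ` (SIGMA v:verts G. {..<w v})"
  by (auto simp: add_weight_loops_def)

lemma finite_graph_weight_loops:
  assumes "finite_graph G" shows "finite_graph (add_weight_loops G w)"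
proof -
  have "finite (edges (add_weight_loops G w))"
    unfolding edges_weight_loops_eq using assms by (auto simp: finite_graph_def)
  moreover have "ends (add_weight_loops G w) e \<subseteq> verts G \<and>
      (card (ends (add_weight_loops G w) e) = 1 \<or> card (ends (add_weight_loops G w) e) = 2)"
    if "e \<in> edges (add_weight_loops G w)" for e
  proof (cases e)
    case (Inl d)
    then have "d \<in> edges G" using that by (simp add: edges_weight_loops)
    then show ?thesis using assms Inl by (simp add: ends_weight_loops finite_graph_def)
  next
    case (Inr vk)
    then show ?thesis using that by (cases vk) (auto simp: ends_weight_loops edges_weight_loops)
  qed
  ultimately show ?thesis using assms by (simp add: finite_graph_def verts_weight_loops)
qed

lemma connected_graph_weight_loops:
  assumes "finite_graph G" "connected_graph G" shows "connected_graph (add_weight_loops G w)"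
proof -
  have "adjacency G \<subseteq> adjacency (add_weight_loops G w)"
  proof
    fix z assume "z \<in> adjacency G"
    then obtain u v e where "z = (u, v)" "e \<in> edges G" "ends G e = {u, v}" by (auto simp: adjacency_def)
    then have "z = (u, v)" "Inl e \<in> edges (add_weight_loops G w)" "ends (add_weight_loops G w) (Inl e) = {u, v}"
      by (simp_all add: edges_weight_loops ends_weight_loops)
    then show "z \<in> adjacency (add_weight_loops G w)" unfolding adjacency_def by blast
  qed
  then have "(adjacency G)\<^sup>* \<subseteq> (adjacency (add_weight_loops G w))\<^sup>*" by (rule rtrancl_mono)
  then show ?thesis using assms(2) unfolding connected_graph_def verts_weight_loops by blast
qed

lemma type_genus_weight_loops:
  assumes "finite_graph G" shows "type_genus G w = graph_genus (add_weight_loops G w)"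
proof -
  have fin: "finite (edges G)" "finite (verts G)" using assms by (auto simp: finite_graph_def)
  have "card (edges (add_weight_loops G w)) = card (edges G) + (\<Sum>v\<in>verts G. w v)"
    unfolding edges_weight_loops_eq using fin
    by (subst card_Un_disjoint) (auto simp: card_image)
  then show ?thesis by (simp add: type_genus_def graph_genus_def verts_weight_loops)
qed

lemma involution_on_weight_loops:
  assumes fg: "finite_graph G" and cg: "connected_graph G" and inv: "hyp_involution G w \<sigma> \<tau>"
  shows "hyp_involution (add_weight_loops G w) (\<lambda>_. 0) \<sigma> (map_sum \<tau> id)"
proof -
  interpret I: hyp_inv G w \<sigma> \<tau> using fg cg inv by unfold_locales
  let ?H = "add_weight_loops G w"
  have M: "{e \<in> edges ?H. map_sum \<tau> id e \<noteq> e} = Inl ` I.M"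
    by (auto simp: edges_weight_loops_eq I.M_def)
  then have cM: "card {e \<in> edges ?H. map_sum \<tau> id e \<noteq> e} = card I.M" by (simp add: card_image)
  show ?thesis
    unfolding hyp_involution_def verts_weight_loops cM
  proof (intro conjI ballI I.count)
    fix e assume e: "e \<in> edges ?H"
    let ?t = "map_sum \<tau> id"
    have "?t e \<in> edges ?H \<and> ?t (?t e) = e \<and> ends ?H (?t e) = \<sigma> ` ends ?H e \<and>
        (is_loop ?H e \<longrightarrow> ?t e = e) \<and> (?t e = e \<longrightarrow> \<not> is_loop ?H e \<longrightarrow> (\<forall>v\<in>ends ?H e. \<sigma> v \<noteq> v))"
    proof (cases e)
      case (Inl d)
      then have d: "d \<in> edges G" using e by (simp add: edges_weight_loops)
      then show ?thesis using I.t_in[OF d] I.t_t[OF d] I.t_ends[OF d] I.loop_fixed[OF d] I.flip[OF d]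
        by (auto simp: Inl edges_weight_loops ends_weight_loops loop_weight_loops)
    next
      case (Inr vk)
      obtain v k where vk: "vk = (v, k)" by (cases vk)
      then have v: "v \<in> verts G" "k < w v" using e Inr by (auto simp: edges_weight_loops)
      then have "\<sigma> v = v" using I.w_s by auto
      then show ?thesis using v by (simp add: Inr vk edges_weight_loops ends_weight_loops loop_weight_loops)
    qed
    then show "?t e \<in> edges ?H" "?t (?t e) = e" "ends ?H (?t e) = \<sigma> ` ends ?H e" "is_loop ?H e \<longrightarrow> ?t e = e"
      "?t e = e \<longrightarrow> \<not> is_loop ?H e \<longrightarrow> (\<forall>v\<in>ends ?H e. \<sigma> v \<noteq> v)" by blast+
  qed (use I.s_in I.s_s in auto)
qed

text \<open>Every loop is fixed by the involution. Hence the loops that encode weights are not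
  exchanged with edges of \<open>G\<close>, and they force their vertices to be fixed.\<close>

lemma involution_from_weight_loops:
  assumes fg: "finite_graph G" and cg: "connected_graph G"
    and inv: "hyp_involution (add_weight_loops G w) (\<lambda>_. 0) \<sigma> \<tau>"
  obtains \<tau>' where "hyp_involution G w \<sigma> \<tau>'" "\<forall>e\<in>edges G. \<tau> (Inl e) = Inl (\<tau>' e)"
proof -
  let ?H = "add_weight_loops G w"
  interpret I: hyp_inv ?H "\<lambda>_. 0" \<sigma> \<tau>
    using finite_graph_weight_loops[OF fg] connected_graph_weight_loops[OF fg cg] inv by unfold_locales
  define \<tau>' where "\<tau>' e = projl (\<tau> (Inl e))" for e
  have t: "\<tau> (Inl e) = Inl (\<tau>' e)" and tE: "\<tau>' e \<in> edges G" if e: "e \<in> edges G" for e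
  proof -
    have eH: "Inl e \<in> edges ?H" using e by (simp add: edges_weight_loops)
    have "\<tau> (Inl e) = Inl (\<tau>' e)"
    proof (cases "\<tau> (Inl e)")
      case (Inr vk)
      then have "is_loop ?H (\<tau> (Inl e))" by (cases vk) (simp add: loop_weight_loops)
      then have "\<tau> (Inl e) = Inl e" using I.is_loop_tau[OF eH] I.loop_fixed[OF eH] by simp
      then show ?thesis by (simp add: \<tau>'_def)
    qed (simp add: \<tau>'_def)
    then show "\<tau> (Inl e) = Inl (\<tau>' e)" "\<tau>' e \<in> edges G" using I.t_in[OF eH] by (auto simp: edges_weight_loops)
  qed
  have fixR: "\<tau> (Inr (v, k)) = Inr (v, k)" if "v \<in> verts G" "k < w v" for v k
    using that by (intro I.loop_fixed) (auto simp: edges_weight_loops loop_weight_loops)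
  have "I.M = Inl ` {e \<in> edges G. \<tau>' e \<noteq> e}"
    using t fixR by (auto simp: edges_weight_loops_eq I.M_def)
  then have cM: "card I.M = card {e \<in> edges G. \<tau>' e \<noteq> e}" by (simp add: card_image)
  have "hyp_involution G w \<sigma> \<tau>'"
    unfolding hyp_involution_def
  proof (intro conjI ballI)
    show "card {e \<in> edges G. \<tau>' e \<noteq> e} + 2 = card (verts G) + card {v \<in> verts G. \<sigma> v = v}"
      using I.count cM by (simp add: verts_weight_loops)
    fix v assume v: "v \<in> verts G"
    show "\<sigma> v \<in> verts G" "\<sigma> (\<sigma> v) = v" using I.s_in I.s_s v by (auto simp: verts_weight_loops)
    show "0 < w v \<longrightarrow> \<sigma> v = v"
    proof
      assume "0 < w v"
      then have "Inr (v, 0) \<in> edges ?H" using v by (simp add: edges_weight_loops)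
      then have "ends ?H (\<tau> (Inr (v, 0))) = \<sigma> ` ends ?H (Inr (v, 0))" by (rule I.t_ends)
      then show "\<sigma> v = v" using fixR[OF v \<open>0 < w v\<close>] by (simp add: ends_weight_loops)
    qed
  next
    fix e assume e: "e \<in> edges G"
    have eH: "Inl e \<in> edges ?H" using e by (simp add: edges_weight_loops)
    show "\<tau>' e \<in> edges G" by (rule tE[OF e])
    show "\<tau>' (\<tau>' e) = e" using I.t_t[OF eH] t[OF e] t[OF tE[OF e]] by simp
    show "ends G (\<tau>' e) = \<sigma> ` ends G e" using I.t_ends[OF eH] t[OF e] by (simp add: ends_weight_loops)
    show "is_loop G e \<longrightarrow> \<tau>' e = e" using I.loop_fixed[OF eH] t[OF e] by (simp add: loop_weight_loops)
    show "\<tau>' e = e \<longrightarrow> \<not> is_loop G e \<longrightarrow> (\<forall>v\<in>ends G e. \<sigma> v \<noteq> v)"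
      using I.flip[OF eH] t[OF e] by (auto simp: loop_weight_loops ends_weight_loops)
  qed
  then show ?thesis by (rule that) (simp add: t)
qed

section \<open>Hyperelliptic types in terms of involutions\<close>

lemma involution_relation_equiv:
  assumes "\<And>e. e \<in> edges G \<Longrightarrow> \<tau> e \<in> edges G \<and> \<tau> (\<tau> e) = e"
  shows "equiv (edges G) (involution_relation G \<tau>)"
proof (rule equivI)
  show "involution_relation G \<tau> \<subseteq> edges G \<times> edges G" "refl_on (edges G) (involution_relation G \<tau>)"
    using assms by (auto simp: refl_on_def involution_relation_def)
  show "sym (involution_relation G \<tau>)" using assms by (auto simp: sym_def involution_relation_def)
  show "trans (involution_relation G \<tau>)"
    using assms by (auto simp: trans_def involution_relation_def)
qed

text \<open>The exceptional case of the definition is the involution that exchanges two vertices and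
  flips all edges: no edge is moved, so none can lie over an edge of a tree. The bound on
  \<open>g\<close> excludes models reduced to one vertex or to a single subdivided loop.\<close>

lemma hyperelliptic_types_iff:
  assumes g: "3 \<le> g"
  shows "(G, w, r) \<in> hyperelliptic_types g \<longleftrightarrow> combinatorial_type G w \<and> type_genus G w = int g \<and>
    (\<exists>\<sigma> \<tau>. hyp_involution G w \<sigma> \<tau> \<and> r = involution_relation G \<tau>)"
proof
  assume "(G, w, r) \<in> hyperelliptic_types g"
  then have h: "two_edge_connected_hyperelliptic (G, w, r)" and gen: "type_genus G w = int g"
    by (auto simp: hyperelliptic_types_def)
  have ct: "combinatorial_type G w" using h by simp
  then have fg: "finite_graph G" and cg: "connected_graph G" by (auto simp: combinatorial_type_def)
  let ?H = "add_weight_loops G w" and ?K = "loopless_model G w"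
  have fH: "finite_graph ?H" and cH: "connected_graph ?H"
    using finite_graph_weight_loops[OF fg] connected_graph_weight_loops[OF fg cg] by auto
  have genH: "int (card (edges ?H)) = int (card (verts G)) + int g - 1"
    using type_genus_weight_loops[OF fg, of w] gen by (simp add: graph_genus_def verts_weight_loops)
  consider (tree) T :: "(nat, nat) mgraph" and p q where "tree_graph T" "harmonic_morphism ?K T p q"
      "nondegenerate ?K T p q" "has_degree ?K T q 2" "r = fibre_relation G q"
    | (two) "card (verts ?K) = 2" "r = Id_on (edges G)"
    using h by auto
  then have "\<exists>\<sigma> \<tau>. hyp_involution G w \<sigma> \<tau> \<and> r = involution_relation G \<tau>"
  proof cases
    case tree
    have fK: "finite_graph ?K" by (rule finite_graph_subdivide(1)[OF fH])
    have Kne: "verts ?K \<noteq> {}" using connected_subdivide[OF fH cH] by (simp add: connected_graph_def)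
    obtain \<sigma>1 \<tau>1 where 1: "hyp_involution ?K (\<lambda>_. 0) \<sigma>1 \<tau>1"
      and rel: "\<forall>d\<in>edges ?K. \<forall>e\<in>edges ?K.
        (\<exists>k. q d = Inr k \<and> q e = Inr k) \<longleftrightarrow> \<tau>1 d \<noteq> d \<and> (d = e \<or> e = \<tau>1 d)"
      and inc: "\<forall>x\<in>verts ?K. \<exists>e\<in>edges ?K. x \<in> ends ?K e \<and> \<tau>1 e \<noteq> e"
      by (rule tree_morphism_involution[OF fK finite_graph_subdivide(2)[OF fH] Kne tree(1-4)])
    obtain \<sigma>2 \<tau>2 where 2: "hyp_involution ?H (\<lambda>_. 0) \<sigma>2 \<tau>2"
      and t2: "\<forall>x\<in>edges ?H. \<not> is_loop ?H x \<longrightarrow> \<tau>1 (x, False) = (\<tau>2 x, False)"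
      by (rule involution_from_subdivision[OF fH cH 1 inc])
    obtain \<tau>3 where 3: "hyp_involution G w \<sigma>2 \<tau>3" and t3: "\<forall>e\<in>edges G. \<tau>2 (Inl e) = Inl (\<tau>3 e)"
      by (rule involution_from_weight_loops[OF fg cg 2])
    interpret I: hyp_inv G w \<sigma>2 \<tau>3 using fg cg 3 by unfold_locales
    have t: "\<tau>1 (Inl e, False) = (Inl (\<tau>3 e), False)" if "e \<in> edges G" "\<not> is_loop G e" for e
      using bspec[OF t2, of "Inl e"] bspec[OF t3 that(1)] that by (simp add: edges_weight_loops loop_weight_loops)
    have eK: "(Inl e, False) \<in> edges ?K" if "e \<in> edges G" for e
      using that by (simp add: edges_subdivide edges_weight_loops)
    have "(d, e) \<in> fibre_relation G q \<longleftrightarrow> (d, e) \<in> involution_relation G \<tau>3" for d e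
    proof (cases "d \<in> edges G \<and> e \<in> edges G")
      case True
      then have d: "d \<in> edges G" and e: "e \<in> edges G" by auto
      show ?thesis
      proof (cases "is_loop G d")
        case True
        then show ?thesis using I.loop_fixed[OF d True] d e by (auto simp: fibre_relation_def involution_relation_def)
      next
        case nd: False
        have "(\<exists>k. q (Inl d, False) = Inr k \<and> q (Inl e, False) = Inr k) \<longleftrightarrow> \<tau>3 d \<noteq> d \<and> (d = e \<or> e = \<tau>3 d)"
          using rel[rule_format, OF eK[OF d] eK[OF e]] t[OF d nd] by auto
        moreover have "e = \<tau>3 d \<Longrightarrow> \<not> is_loop G e" using I.is_loop_tau[OF d] nd by simp
        ultimately show ?thesis using d e nd by (auto simp: fibre_relation_def involution_relation_def)
      qed
    next
      case False
      then show ?thesis using I.t_in by (auto simp: fibre_relation_def involution_relation_def)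
    qed
    then have "fibre_relation G q = involution_relation G \<tau>3" by auto
    then show ?thesis using 3 tree(5) by blast
  next
    case two
    let ?L = "{e \<in> edges ?H. is_loop ?H e}"
    have VL: "card (verts G) + card ?L = 2"
      using two(1) card_subdivide_verts[OF fH] by (simp add: verts_weight_loops)
    have V0: "verts G \<noteq> {}" "finite (verts G)" using cg fg by (auto simp: connected_graph_def finite_graph_def)
    have fEH: "finite (edges ?H)" using fH by (simp add: finite_graph_def)
    \<comment> \<open>The other way to get two vertices in the model is one vertex with one
      subdivided loop, which has genus 1.\<close>
    have V2: "card (verts G) = 2"
    proof (rule ccontr)
      assume "card (verts G) \<noteq> 2"
      moreover have "0 < card (verts G)" using V0 by (simp add: card_gt_0_iff)
      ultimately have c1: "card (verts G) = 1" and L1: "card ?L = 1" using VL by auto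
      obtain a where a: "verts G = {a}" using c1 by (rule card_1_singletonE)
      have "is_loop ?H e" if e: "e \<in> edges ?H" for e
      proof -
        have "ends ?H e \<subseteq> {a}" "ends ?H e \<noteq> {}"
          using finite_graph_ends_sub[OF fH e] finite_graph_ends_ne[OF fH e] a by (auto simp: verts_weight_loops)
        then show ?thesis by (auto simp: is_loop_iff)
      qed
      then have "?L = edges ?H" by auto
      then show False using L1 genH c1 g by simp
    qed
    then have "?L = {}" using VL fEH by simp
    then have noloop: "\<not> is_loop G e" if "e \<in> edges G" for e
      using that edges_weight_loops(1)[of e G w] loop_weight_loops(1)[of G w e] by blast
    have w0: "w v = 0" if "v \<in> verts G" for v
    proof (rule ccontr)
      assume "w v \<noteq> 0"
      then have "Inr (v, 0) \<in> ?L" using that by (simp add: edges_weight_loops loop_weight_loops)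
      then show False using \<open>?L = {}\<close> by blast
    qed
    obtain a b where ab: "verts G = {a, b}" "a \<noteq> b" using V2 by (meson card_2_iff)
    have ends: "ends G e = {a, b}" if e: "e \<in> edges G" for e
    proof -
      have "card (ends G e) = 2" "ends G e \<subseteq> {a, b}"
        using noloop[OF e] fg e ab by (auto simp: finite_graph_def is_loop_def)
      then show ?thesis using ab by (simp add: card_subset_eq)
    qed
    \<comment> \<open>All edges join \<open>a\<close> and \<open>b\<close>, so exchanging these two
      vertices flips every edge.\<close>
    define \<sigma> where "\<sigma> x = (if x = a then b else a)" for x
    have F: "{v \<in> verts G. \<sigma> v = v} = {}" using ab by (auto simp: \<sigma>_def)
    have "hyp_involution G w \<sigma> id"
      unfolding hyp_involution_def F using ab w0 noloop ends
      by (auto simp: \<sigma>_def)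
    moreover have "r = involution_relation G id" using two(2) by (auto simp: involution_relation_def)
    ultimately show ?thesis by blast
  qed
  then show "combinatorial_type G w \<and> type_genus G w = int g \<and>
    (\<exists>\<sigma> \<tau>. hyp_involution G w \<sigma> \<tau> \<and> r = involution_relation G \<tau>)" using ct gen by blast
next
  assume R: "combinatorial_type G w \<and> type_genus G w = int g \<and>
    (\<exists>\<sigma> \<tau>. hyp_involution G w \<sigma> \<tau> \<and> r = involution_relation G \<tau>)"
  then obtain \<sigma> \<tau> where ct: "combinatorial_type G w" and gen: "type_genus G w = int g"
    and inv: "hyp_involution G w \<sigma> \<tau>" and r: "r = involution_relation G \<tau>" by blast
  have fg: "finite_graph G" and cg: "connected_graph G" using ct by (auto simp: combinatorial_type_def)
  interpret I: hyp_inv G w \<sigma> \<tau> using fg cg inv by unfold_locales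
  let ?H = "add_weight_loops G w" and ?K = "loopless_model G w"
  have fH: "finite_graph ?H" and cH: "connected_graph ?H"
    using finite_graph_weight_loops[OF fg] connected_graph_weight_loops[OF fg cg] by auto
  have genH: "int (card (edges ?H)) = int (card (verts G)) + int g - 1"
    using type_genus_weight_loops[OF fg, of w] gen by (simp add: graph_genus_def verts_weight_loops)
  have 2: "hyp_involution ?H (\<lambda>_. 0) \<sigma> (map_sum \<tau> id)" by (rule involution_on_weight_loops[OF fg cg inv])
  obtain \<sigma>1 \<tau>1 where 1: "hyp_involution ?K (\<lambda>_. 0) \<sigma>1 \<tau>1"
    and t1: "\<forall>x\<in>edges ?H. \<forall>b. \<tau>1 (x, b) = (if is_loop ?H x then (x, \<not> b) else (map_sum \<tau> id x, b))"
    by (rule involution_on_subdivision[OF fH cH 2])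
  have fK: "finite_graph ?K" and cK: "connected_graph ?K"
    using finite_graph_subdivide(1)[OF fH] connected_subdivide[OF fH cH] by auto
  interpret K: hyp_inv ?K "\<lambda>_. 0" \<sigma>1 \<tau>1 using fK cK 1 by unfold_locales
  have nlK: "\<not> is_loop ?K e" if "e \<in> edges ?K" for e using finite_graph_subdivide(2)[OF fH that] .
  have "equiv (edges G) r" unfolding r by (rule involution_relation_equiv) (use I.t_in I.t_t in auto)
  moreover have "two_edge_connected G"
    by (rule I.two_edge_connected_if_stable) (use ct in \<open>auto simp: combinatorial_type_def\<close>)
  moreover have "(\<exists>(T :: (nat, nat) mgraph) p q. tree_graph T \<and> harmonic_morphism ?K T p q \<and>
      nondegenerate ?K T p q \<and> has_degree ?K T q 2 \<and> r = fibre_relation G q) \<or>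
      (card (verts ?K) = 2 \<and> r = Id_on (edges G))"
  proof (cases "K.M = {}")
    case False
    obtain T :: "(nat, nat) mgraph" and p q where T: "tree_graph T" "harmonic_morphism ?K T p q"
      "nondegenerate ?K T p q" "has_degree ?K T q 2"
      and rel: "\<forall>d\<in>edges ?K. \<forall>e\<in>edges ?K. (\<exists>k. q d = Inr k \<and> q e = Inr k) \<longleftrightarrow> d \<in> K.M \<and> (d = e \<or> e = \<tau>1 d)"
      by (rule K.tree_morphism_exists[OF nlK False])
    have eK: "(Inl e, False) \<in> edges ?K" if "e \<in> edges G" for e
      using that by (simp add: edges_subdivide edges_weight_loops)
    have "(d, e) \<in> fibre_relation G q \<longleftrightarrow> (d, e) \<in> involution_relation G \<tau>" for d e
    proof (cases "d \<in> edges G \<and> e \<in> edges G")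
      case True
      then have d: "d \<in> edges G" and e: "e \<in> edges G" by auto
      show ?thesis
      proof (cases "is_loop G d")
        case True
        then show ?thesis using I.loop_fixed[OF d True] d e by (auto simp: fibre_relation_def involution_relation_def)
      next
        case nd: False
        have "\<tau>1 (Inl d, False) = (Inl (\<tau> d), False)"
          using bspec[OF t1, of "Inl d"] d nd by (simp add: edges_weight_loops loop_weight_loops)
        then have "(\<exists>k. q (Inl d, False) = Inr k \<and> q (Inl e, False) = Inr k) \<longleftrightarrow> \<tau> d \<noteq> d \<and> (d = e \<or> e = \<tau> d)"
          using rel[rule_format, OF eK[OF d] eK[OF e]] eK[OF d] by (auto simp: K.M_def)
        moreover have "e = \<tau> d \<Longrightarrow> \<not> is_loop G e" using I.is_loop_tau[OF d] nd by simp
        ultimately show ?thesis using d e nd by (auto simp: fibre_relation_def involution_relation_def)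
      qed
    next
      case False
      then show ?thesis using I.t_in by (auto simp: fibre_relation_def involution_relation_def)
    qed
    then have "r = fibre_relation G q" using r by auto
    then show ?thesis using T by blast
  next
    case True
    then have c: "card (verts ?K) + card {v \<in> verts ?K. \<sigma>1 v = v} = 2" using K.count by simp
    \<comment> \<open>With no moved edge, the count allows only two exchanged vertices or one fixed
      vertex; a loopless graph on one vertex has no edges, hence genus 0.\<close>
    have cK2: "card (verts ?K) = 2"
    proof (rule ccontr)
      assume n2: "card (verts ?K) \<noteq> 2"
      have "0 < card (verts ?K)" using cK K.fV by (auto simp: connected_graph_def card_gt_0_iff)
      moreover have "card {v \<in> verts ?K. \<sigma>1 v = v} \<le> card (verts ?K)" by (rule card_mono) (use K.fV in auto)
      ultimately have "card (verts ?K) = 1" using c n2 by linarith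
      then obtain a where a: "verts ?K = {a}" by (rule card_1_singletonE)
      have "edges ?H = {}"
      proof (rule ccontr)
        assume "edges ?H \<noteq> {}"
        then obtain x where "x \<in> edges ?H" by blast
        then have x: "(x, False) \<in> edges ?K" by (simp add: edges_subdivide)
        have "ends ?K (x, False) \<subseteq> {a}" "ends ?K (x, False) \<noteq> {}"
          using finite_graph_ends_sub[OF fK x] finite_graph_ends_ne[OF fK x] a by auto
        then have "is_loop ?K (x, False)" by (auto simp: is_loop_iff)
        then show False using nlK[OF x] by simp
      qed
      then show False using genH g by simp
    qed
    have "\<tau> e = e" if e: "e \<in> edges G" for e
    proof (cases "is_loop G e")
      case False
      have "(Inl e, False) \<in> edges ?K" using e by (simp add: edges_subdivide edges_weight_loops)
      then have "\<tau>1 (Inl e, False) = (Inl e, False)" using True unfolding K.M_def by blast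
      then show ?thesis using bspec[OF t1, of "Inl e"] e False by (simp add: edges_weight_loops loop_weight_loops)
    qed (rule I.loop_fixed[OF e])
    then have "r = Id_on (edges G)" by (auto simp: r involution_relation_def Id_on_def)
    then show ?thesis using cK2 by blast
  qed
  ultimately show "(G, w, r) \<in> hyperelliptic_types g"
    using ct gen by (simp add: hyperelliptic_types_def)
qed

section \<open>Orthants and reindexing\<close>

lemma closed_orthant_mono: "M \<subseteq> N \<Longrightarrow> closed_orthant M \<subseteq> closed_orthant N"
  by (auto simp: closed_orthant_def coord_space_def)

lemma open_orthant_subset_closed: "open_orthant N \<subseteq> closed_orthant N"
  by (auto simp: open_orthant_def closed_orthant_def intro: less_imp_le)

lemma closed_orthant_subset_coord: "closed_orthant N \<subseteq> coord_space N"
  by (auto simp: closed_orthant_def)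

lemma closed_closed_orthant: "closed (closed_orthant N)"
proof -
  have "closed_orthant N = (\<Inter>i. {x. (if i \<in> N then 0 else x i) = 0}) \<inter> (\<Inter>i\<in>N. {x. 0 \<le> x i})"
    by (auto simp: closed_orthant_def coord_space_def)
  moreover have "closed {x :: 'a \<Rightarrow> real. (if i \<in> N then 0 else x i) = 0}" for i
    by (cases "i \<in> N") (auto intro!: closed_Collect_eq continuous_intros)
  moreover have "closed {x :: 'a \<Rightarrow> real. 0 \<le> x i}" for i
    by (auto intro!: closed_Collect_le continuous_intros)
  ultimately show ?thesis by (simp add: closed_INT closed_Int)
qed

lemma closure_open_orthant: "closure (open_orthant N) = closed_orthant N"
proof (rule subset_antisym)
  show "closure (open_orthant N) \<subseteq> closed_orthant N"
    by (rule closure_minimal[OF open_orthant_subset_closed closed_closed_orthant])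
  show "closed_orthant N \<subseteq> closure (open_orthant N)"
  proof
    fix x assume x: "x \<in> closed_orthant N"
    \<comment> \<open>A point of the closed orthant is the limit of its translates by positive
      multiples of the all-ones vector, which lie in the open orthant.\<close>
    define f where "f s = (\<lambda>i. x i + s * (if i \<in> N then 1 else 0))" for s :: real
    have "continuous_on UNIV f"
      unfolding f_def by (intro continuous_on_coordinatewise_then_product) (auto intro!: continuous_intros)
    then have "isCont f 0" by (simp add: continuous_on_eq_continuous_at)
    then have "(f \<longlongrightarrow> f 0) (at 0)" by (simp add: isCont_def)
    then have "(f \<longlongrightarrow> x) (at_right 0)" by (simp add: f_def filterlim_at_split)
    moreover have "\<forall>\<^sub>F s in at_right 0. f s \<in> closure (open_orthant N)"
    proof -
      have "f s \<in> open_orthant N" if "0 < s" for s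
        using x that by (auto simp: f_def open_orthant_def closed_orthant_def coord_space_def add_nonneg_pos)
      then have "f s \<in> closure (open_orthant N)" if "0 < s" for s using that closure_subset by blast
      then show ?thesis by (simp add: eventually_at_filter)
    qed
    ultimately show "x \<in> closure (open_orthant N)"
      by (intro Lim_in_closed_set[OF closed_closure _ trivial_limit_at_right_real])
  qed
qed

definition unit_vector :: "'n \<Rightarrow> 'n \<Rightarrow> real" where
  "unit_vector i = (\<lambda>j. if j = i then 1 else 0)"

lemma inj_unit_vector: "inj unit_vector"
proof (rule injI)
  fix i j :: 'a assume "unit_vector i = unit_vector j"
  then have "unit_vector i i = unit_vector j i" by simp
  then show "i = j" by (simp add: unit_vector_def split: if_splits)
qed

lemma rational_open_cone_orthant:
  assumes N: "finite N" shows "rational_open_cone N (open_orthant N)"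
proof -
  have comb: "(\<Sum>b\<in>unit_vector ` N. a b * b j) = (if j \<in> N then a (unit_vector j) else 0)"
    for a :: "('a \<Rightarrow> real) \<Rightarrow> real" and j
  proof -
    have "(\<Sum>b\<in>unit_vector ` N. a b * b j) = (\<Sum>i\<in>N. a (unit_vector i) * unit_vector i j)"
      by (subst sum.reindex) (auto intro: inj_on_subset[OF inj_unit_vector])
    also have "\<dots> = (\<Sum>i\<in>N. if i = j then a (unit_vector j) else 0)"
      by (intro sum.cong) (auto simp: unit_vector_def)
    finally show ?thesis using N by simp
  qed
  have "open_orthant N = {(\<lambda>i. \<Sum>b\<in>unit_vector ` N. a b * b i) | a. \<forall>b\<in>unit_vector ` N. 0 < a b}"
  proof (intro subset_antisym subsetI)
    fix x assume x: "x \<in> open_orthant N"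
    define a where "a b = x (inv_into UNIV unit_vector b)" for b
    have "a (unit_vector i) = x i" for i by (simp add: a_def inj_unit_vector)
    then have "x = (\<lambda>i. \<Sum>b\<in>unit_vector ` N. a b * b i)" "\<forall>b\<in>unit_vector ` N. 0 < a b"
      using x by (auto simp: comb open_orthant_def coord_space_def)
    then show "x \<in> {(\<lambda>i. \<Sum>b\<in>unit_vector ` N. a b * b i) | a. \<forall>b\<in>unit_vector ` N. 0 < a b}" by blast
  qed (auto simp: comb open_orthant_def coord_space_def)
  moreover have "unit_vector ` N \<subseteq> int_lattice N"
    by (auto simp: int_lattice_def coord_space_def unit_vector_def)
  ultimately show ?thesis using N unfolding rational_open_cone_def by blast
qed

lemma lin_span_mono: "F \<subseteq> F' \<Longrightarrow> lin_span F \<subseteq> lin_span F'"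
  unfolding lin_span_def by blast

lemma lin_span_subset_coord_space: "F \<subseteq> coord_space N \<Longrightarrow> lin_span F \<subseteq> coord_space N"
  by (auto simp: lin_span_def coord_space_def subset_iff intro!: sum.neutral)

lemma lin_span_open_orthant: "lin_span (open_orthant N) = coord_space N"
proof (rule subset_antisym)
  show "lin_span (open_orthant N) \<subseteq> coord_space N"
    by (rule lin_span_subset_coord_space) (auto simp: open_orthant_def)
  show "coord_space N \<subseteq> lin_span (open_orthant N)"
  proof
    fix x assume x: "x \<in> coord_space N"
    \<comment> \<open>Positive and negative parts of \<open>x\<close>; adding 1 to both makes them
      strictly positive without changing their difference.\<close>
    define u v where "u = (\<lambda>i. if i \<in> N then max (x i) 0 + 1 else 0)"
      and "v = (\<lambda>i. if i \<in> N then max (- x i) 0 + 1 else 0)"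
    have uv: "u \<in> open_orthant N" "v \<in> open_orthant N"
      by (auto simp: u_def v_def open_orthant_def coord_space_def)
    have xuv: "x i = u i - v i" for i using x by (auto simp: u_def v_def coord_space_def)
    define a where "a b = (if b = u then 1 else - 1 :: real)" for b
    \<comment> \<open>If \<open>u = v\<close>, the set \<open>{u, v}\<close> has one element and
      cannot carry both coefficients; then \<open>x\<close> is zero and the empty combination
      serves.\<close>
    define B where "B = (if u = v then {} else {u, v})"
    have "x = (\<lambda>i. \<Sum>b\<in>B. a b * b i)" using xuv by (auto simp: B_def a_def)
    moreover have "finite B" "B \<subseteq> open_orthant N" using uv by (auto simp: B_def)
    ultimately show "x \<in> lin_span (open_orthant N)" unfolding lin_span_def by blast
  qed
qed

lemma lin_span_closed_orthant: "lin_span (closed_orthant N) = coord_space N"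
  using lin_span_mono[OF open_orthant_subset_closed] lin_span_open_orthant[of N]
    lin_span_subset_coord_space[OF closed_orthant_subset_coord, of N] by blast

text \<open>A functional that is nonnegative on the orthant has nonnegative coefficients, as the
  unit vectors show, so it vanishes exactly where the coordinates with positive coefficient
  vanish.\<close>

lemma cone_face_orthant:
  assumes N: "finite N" and F: "cone_face N (closed_orthant N) F"
  obtains Z where "Z \<subseteq> N" "F = closed_orthant (N - Z)"
proof -
  obtain a where a: "\<And>x. x \<in> closed_orthant N \<Longrightarrow> 0 \<le> (\<Sum>i\<in>N. a i * x i)"
    and F': "F = {x \<in> closed_orthant N. (\<Sum>i\<in>N. a i * x i) = 0}"
    using F by (auto simp: cone_face_def)
  have a0: "0 \<le> a i" if "i \<in> N" for i
  proof -
    have "unit_vector i \<in> closed_orthant N" using that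
      by (auto simp: unit_vector_def closed_orthant_def coord_space_def)
    then have "0 \<le> (\<Sum>j\<in>N. a j * unit_vector i j)" by (rule a)
    also have "\<dots> = (\<Sum>j\<in>N. if j = i then a i else 0)" by (intro sum.cong) (auto simp: unit_vector_def)
    finally show ?thesis using N that by simp
  qed
  let ?Z = "{i \<in> N. a i \<noteq> 0}"
  have "(\<Sum>i\<in>N. a i * x i) = 0 \<longleftrightarrow> (\<forall>i\<in>?Z. x i = 0)" if "x \<in> closed_orthant N" for x
  proof -
    have "(\<Sum>i\<in>N. a i * x i) = 0 \<longleftrightarrow> (\<forall>i\<in>N. a i * x i = 0)"
      by (rule sum_nonneg_eq_0_iff) (use N a0 that in \<open>auto simp: closed_orthant_def\<close>)
    then show ?thesis by auto
  qed
  then have "F = {x \<in> closed_orthant N. \<forall>i\<in>?Z. x i = 0}" using F' by auto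
  also have "\<dots> = closed_orthant (N - ?Z)" by (auto simp: closed_orthant_def coord_space_def)
  finally show ?thesis by (intro that[of ?Z]) auto
qed

text \<open>Pull-back of coordinates along \<open>b\<close>. Both the automorphism action and the
  glueing of faces have this form, so linearity, integrality and continuity are shown once for all
  of them.\<close>

definition reindex :: "'m set \<Rightarrow> ('m \<Rightarrow> 'n) \<Rightarrow> ('n \<Rightarrow> real) \<Rightarrow> 'm \<Rightarrow> real" where
  "reindex N b x = (\<lambda>c. if c \<in> N then x (b c) else 0)"

lemma reindex_in:
  shows "reindex N b x \<in> coord_space N"
    and "b ` N \<subseteq> M \<Longrightarrow> x \<in> closed_orthant M \<Longrightarrow> reindex N b x \<in> closed_orthant N"
    and "b ` N \<subseteq> M \<Longrightarrow> x \<in> open_orthant M \<Longrightarrow> reindex N b x \<in> open_orthant N"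
    and "x \<in> int_lattice M \<Longrightarrow> reindex N b x \<in> int_lattice N"
  by (auto simp: reindex_def coord_space_def closed_orthant_def open_orthant_def int_lattice_def)

lemma reindex_inverse:
  assumes "bij_betw b N M" "x \<in> coord_space M"
  shows "reindex M (inv_into N b) (reindex N b x) = x"
proof
  fix c
  show "reindex M (inv_into N b) (reindex N b x) c = x c"
    using assms by (auto simp: reindex_def coord_space_def bij_betw_def inv_into_into f_inv_into_f)
qed

lemma reindex_inverse':
  assumes "bij_betw b N M" "y \<in> coord_space N"
  shows "reindex N b (reindex M (inv_into N b) y) = y"
proof
  fix c
  show "reindex N b (reindex M (inv_into N b) y) c = y c"
    using assms by (auto simp: reindex_def coord_space_def bij_betw_def)
qed

lemma reindex_image:
  assumes b: "bij_betw b N M" and X: "X \<subseteq> coord_space M" and Y: "Y \<subseteq> coord_space N"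
    and XY: "\<And>x. x \<in> X \<Longrightarrow> reindex N b x \<in> Y" and YX: "\<And>y. y \<in> Y \<Longrightarrow> reindex M (inv_into N b) y \<in> X"
  shows "reindex N b ` X = Y" "bij_betw (reindex N b) X Y"
proof -
  show "bij_betw (reindex N b) X Y"
    by (rule bij_betwI[where g = "reindex M (inv_into N b)"])
      (use XY YX X Y reindex_inverse[OF b] reindex_inverse'[OF b] in auto)
  then show "reindex N b ` X = Y" by (simp add: bij_betw_def)
qed

lemma reindex_images:
  assumes b: "bij_betw b N M"
  shows "reindex N b ` closed_orthant M = closed_orthant N"
    and "reindex N b ` open_orthant M = open_orthant N"
    and "reindex N b ` int_lattice M = int_lattice N"
    and "bij_betw (reindex N b) (coord_space M) (coord_space N)"
proof -
  have b1: "b ` N \<subseteq> M" using b by (simp add: bij_betw_def)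
  have b2: "inv_into N b ` M \<subseteq> N" using b by (auto simp: bij_betw_def inv_into_into)
  show "reindex N b ` closed_orthant M = closed_orthant N"
    by (rule reindex_image(1)[OF b]) (use reindex_in(2) b1 b2 in \<open>auto simp: closed_orthant_def\<close>)
  show "reindex N b ` open_orthant M = open_orthant N"
    by (rule reindex_image(1)[OF b]) (use reindex_in(3) b1 b2 in \<open>auto simp: open_orthant_def\<close>)
  show "reindex N b ` int_lattice M = int_lattice N"
    by (rule reindex_image(1)[OF b]) (use reindex_in(4) in \<open>auto simp: int_lattice_def\<close>)
  show "bij_betw (reindex N b) (coord_space M) (coord_space N)"
    by (rule reindex_image(2)[OF b]) (auto simp: reindex_in(1))
qed

lemma reindex_linear: "linear_map_on W (reindex N b)"
  by (auto simp: linear_map_on_def reindex_def)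

lemma reindex_reindex: "c ` N \<subseteq> M \<Longrightarrow> reindex N c (reindex M b x) = reindex N (b \<circ> c) x"
  by (rule ext) (auto simp: reindex_def image_subset_iff)

lemma reindex_cong: "(\<And>i. i \<in> N \<Longrightarrow> b i = c i) \<Longrightarrow> reindex N b x = reindex N c x"
  by (auto simp: reindex_def)

lemma continuous_on_reindex: "continuous_on W (reindex N b)"
proof -
  have "continuous_on W (\<lambda>x. if c \<in> N then x (b c) else (0 :: real))" for c
    by (cases "c \<in> N") (auto intro: continuous_on_subset[OF continuous_on_product_coordinates])
  then show ?thesis unfolding reindex_def by (intro continuous_on_coordinatewise_then_product)
qed

section \<open>Isomorphic tropical curves\<close>

fun zero_edges :: "ctype \<Rightarrow> (nat set \<Rightarrow> real) \<Rightarrow> nat set" where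
  "zero_edges (G, w, r) x = {e \<in> edges G. x (r `` {e}) = 0}"

lemma tcurve_iso_iff_contracts:
  assumes "finite_graph G"
  shows "tcurve_iso ((G, w), l) ((G', w'), l') \<longleftrightarrow>
    (\<exists>f h. contracts f h {} G w G' w' \<and> (\<forall>e\<in>edges G. l' (h e) = l e))"
  unfolding contracts_empty_iff[OF assms] by auto

lemma tcurve_iso_refl: "tcurve_iso c c"
proof -
  obtain G w l where c: "c = ((G, w), l)" by (metis surj_pair)
  have "graph_iso_via id id G G" by (simp add: graph_iso_via_def)
  then show ?thesis unfolding c tcurve_iso.simps by (intro exI[of _ id]) auto
qed

lemma tcurve_iso_sym:
  assumes fg: "finite_graph (fst (fst c))" and i: "tcurve_iso c c'" shows "tcurve_iso c' c"
proof -
  obtain G w l where c: "c = ((G, w), l)" by (metis surj_pair)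
  obtain G' w' l' where c': "c' = ((G', w'), l')" by (metis surj_pair)
  have fG: "finite_graph G" using fg c by simp
  obtain f h where fh: "contracts f h {} G w G' w'" and l: "\<And>e. e \<in> edges G \<Longrightarrow> l' (h e) = l e"
    using i unfolding c c' tcurve_iso_iff_contracts[OF fG] by blast
  obtain f' h' where fh': "contracts f' h' {} G' w' G w" and h': "\<And>e. e \<in> edges G \<Longrightarrow> h' (h e) = e"
    using contracts_inverse[OF fh fG] by metis
  have fG': "finite_graph G'" by (rule contracts_finite_graph[OF fh fG])
  have "l (h' d) = l' d" if d: "d \<in> edges G'" for d
  proof -
    obtain e where e: "e \<in> edges G" "d = h e" using fh d by (rule contracts_edge)
    then show ?thesis using l h' by simp
  qed
  then show ?thesis using fh' unfolding c c' tcurve_iso_iff_contracts[OF fG'] by blast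
qed

lemma tcurve_iso_trans:
  assumes fg: "finite_graph (fst (fst c))" and i: "tcurve_iso c c'" and i': "tcurve_iso c' c''"
  shows "tcurve_iso c c''"
proof -
  obtain G w l where c: "c = ((G, w), l)" by (metis surj_pair)
  obtain G' w' l' where c': "c' = ((G', w'), l')" by (metis surj_pair)
  obtain G'' w'' l'' where c'': "c'' = ((G'', w''), l'')" by (metis surj_pair)
  have fG: "finite_graph G" using fg c by simp
  obtain f h where fh: "contracts f h {} G w G' w'" and l: "\<And>e. e \<in> edges G \<Longrightarrow> l' (h e) = l e"
    using i unfolding c c' tcurve_iso_iff_contracts[OF fG] by blast
  have fG': "finite_graph G'" by (rule contracts_finite_graph[OF fh fG])
  obtain f' h' where fh': "contracts f' h' {} G' w' G'' w''" and l': "\<And>e. e \<in> edges G' \<Longrightarrow> l'' (h' e) = l' e"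
    using i' unfolding c' c'' tcurve_iso_iff_contracts[OF fG'] by blast
  have "contracts (f' \<circ> f) (h' \<circ> h) {} G w G'' w''" using contracts_trans[OF fh fh' fG] by simp
  moreover have "l'' ((h' \<circ> h) e) = l e" if e: "e \<in> edges G" for e
  proof -
    have "h e \<in> edges G'" using contractsD(3)[OF fh] e by (auto simp: bij_betw_def)
    then show ?thesis using l[OF e] l' by simp
  qed
  ultimately show ?thesis unfolding c c'' tcurve_iso_iff_contracts[OF fG] by blast
qed

lemma tcurve_of_contracts:
  assumes "finite_graph G"
  obtains p G' w' where "tcurve_of (G, w, r) x = ((G', w'), \<lambda>e. x (r `` {e}))"
    "contracts p id (zero_edges (G, w, r) x) G w G' w'"
proof -
  obtain G' w' where G': "contract_edges (zero_edges (G, w, r) x) (G, w) = (G', w')" by force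
  obtain p where "contracts p id (zero_edges (G, w, r) x) G w G' w'"
    by (rule contract_edges_contracts[OF assms _ G']) auto
  then show ?thesis using G' by (intro that[of G' w' p]) simp_all
qed

lemma finite_graph_tcurve_of:
  assumes "finite_graph (fst t)" shows "finite_graph (fst (fst (tcurve_of t x)))"
proof -
  obtain G w r where t: "t = (G, w, r)" by (metis surj_pair)
  have fg: "finite_graph G" using assms t by simp
  obtain p G' w' where "tcurve_of (G, w, r) x = ((G', w'), \<lambda>e. x (r `` {e}))"
    and c: "contracts p id (zero_edges (G, w, r) x) G w G' w'"
    using fg by (rule tcurve_of_contracts)
  then show ?thesis using contracts_finite_graph[OF c fg] unfolding t by simp
qed

text \<open>Contracting \<open>S\<close> and then the zero edges of the result contracts exactly the
  zero edges of \<open>x\<close>. By \<open>contracts_unique\<close> the outcome agrees with the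
  direct contraction, and lengths are compared only on the surviving edges.\<close>

lemma tcurve_of_contraction:
  assumes fg: "finite_graph G" and c: "contracts p h S G w G' w'"
    and S: "\<And>e. e \<in> S \<Longrightarrow> x (r `` {e}) = 0"
    and l: "\<And>e. e \<in> edges G \<Longrightarrow> e \<notin> S \<Longrightarrow> y (r' `` {h e}) = x (r `` {e})"
  shows "tcurve_iso (tcurve_of (G, w, r) x) (tcurve_of (G', w', r') y)"
proof -
  have fg': "finite_graph G'" by (rule contracts_finite_graph[OF c fg])
  obtain p1 G1 w1 where 1: "tcurve_of (G, w, r) x = ((G1, w1), \<lambda>e. x (r `` {e}))"
    and c1: "contracts p1 id (zero_edges (G, w, r) x) G w G1 w1"
    using fg by (rule tcurve_of_contracts)
  obtain p2 G2 w2 where 2: "tcurve_of (G', w', r') y = ((G2, w2), \<lambda>e. y (r' `` {e}))"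
    and c2: "contracts p2 id (zero_edges (G', w', r') y) G' w' G2 w2"
    using fg' by (rule tcurve_of_contracts)
  have hE: "h e \<in> edges G'" if "e \<in> edges G" "e \<notin> S" for e
    using contractsD(3)[OF c] that unfolding bij_betw_def by blast
  have "S \<union> {e \<in> edges G - S. h e \<in> zero_edges (G', w', r') y} = zero_edges (G, w, r) x"
    using S l hE contractsD(1)[OF c] by auto
  then have c3: "contracts (p2 \<circ> p) (id \<circ> h) (zero_edges (G, w, r) x) G w G2 w2"
    using contracts_trans[OF c c2 fg] by simp
  obtain f g where fg12: "contracts f g {} G1 w1 G2 w2"
    and g: "\<And>e. e \<in> edges G - zero_edges (G, w, r) x \<Longrightarrow> g (id e) = (id \<circ> h) e"
    using contracts_unique[OF c1 c3 fg] by metis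
  have fG1: "finite_graph G1" by (rule contracts_finite_graph[OF c1 fg])
  have "y (r' `` {g d}) = x (r `` {d})" if d: "d \<in> edges G1" for d
  proof -
    obtain e where e: "e \<in> edges G" "e \<notin> zero_edges (G, w, r) x" "d = id e" using c1 d by (rule contracts_edge)
    then have "e \<notin> S" using S by auto
    then show ?thesis using g[of e] e l[of e] by simp
  qed
  then show ?thesis unfolding 1 2 tcurve_iso_iff_contracts[OF fG1] using fg12 by blast
qed

lemma tcurve_of_positive_iso:
  assumes fg: "finite_graph G" and fg': "finite_graph G'"
    and i: "tcurve_iso (tcurve_of (G, w, r) x) (tcurve_of (G', w', r') y)"
    and x: "zero_edges (G, w, r) x = {}" and y: "zero_edges (G', w', r') y = {}"
  obtains f h where "contracts f h {} G w G' w'" "\<And>e. e \<in> edges G \<Longrightarrow> y (r' `` {h e}) = x (r `` {e})"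
proof -
  have 1: "tcurve_of (G, w, r) x = ((G, w), \<lambda>e. x (r `` {e}))"
    unfolding tcurve_of.simps x[unfolded zero_edges.simps] by (simp add: contract_edges_def)
  have 2: "tcurve_of (G', w', r') y = ((G', w'), \<lambda>e. y (r' `` {e}))"
    unfolding tcurve_of.simps y[unfolded zero_edges.simps] by (simp add: contract_edges_def)
  show ?thesis using i that unfolding 1 2 tcurve_iso_iff_contracts[OF fg] by blast
qed

section \<open>The stacky fan of a family of types\<close>

text \<open>What the fan axioms need from the types. The decisive assumption is
  \<open>iso_unique\<close>: tropical curves do not remember the relation, yet an isomorphism of the
  weighted graphs of two members must force the members to be equal and must respect the
  relation.\<close>

locale type_family =
  fixes R :: "ctype set"
  assumes finR: "finite R"
    and constrained: "\<And>t. t \<in> R \<Longrightarrow> constrained_type t"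
    and contraction_exists: "\<And>G w r S. (G, w, r) \<in> R \<Longrightarrow> S \<subseteq> edges G \<Longrightarrow> r `` S \<subseteq> S \<Longrightarrow>
      \<exists>G' w' r' p h. (G', w', r') \<in> R \<and> contracts p h S G w G' w' \<and>
        (\<forall>d\<in>edges G - S. \<forall>e\<in>edges G - S. (h d, h e) \<in> r' \<longleftrightarrow> (d, e) \<in> r)"
    and iso_unique: "\<And>G w r G' w' r' f h. (G, w, r) \<in> R \<Longrightarrow> (G', w', r') \<in> R \<Longrightarrow>
      contracts f h {} G w G' w' \<Longrightarrow>
      (G', w', r') = (G, w, r) \<and> (\<forall>d\<in>edges G. \<forall>e\<in>edges G. (h d, h e) \<in> r' \<longleftrightarrow> (d, e) \<in> r)"
begin

section \<open>Automorphisms acting on the cones\<close>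

lemma type_facts:
  assumes "(G, w, r) \<in> R"
  shows "finite_graph G" "equiv (edges G) r" "finite (edges G)"
  using constrained[OF assms] by (auto simp: combinatorial_type_def finite_graph_def)

lemma finite_classes: "t \<in> R \<Longrightarrow> finite (edge_classes t)"
proof -
  assume "t \<in> R"
  moreover obtain G w r where t: "t = (G, w, r)" by (metis surj_pair)
  ultimately have "finite (edges G)" "equiv (edges G) r" using type_facts by auto
  then show ?thesis using finite_quotient[of "edges G" r] by (simp add: t equiv_type)
qed

definition point :: "ctype \<Rightarrow> (nat set \<Rightarrow> real) \<Rightarrow> cell_point set" where
  "point t x = same_tcurve_class R (t, orbit_of (aut_action t) x)"

lemma class_image:
  assumes G: "(G, w, r) \<in> R" and f: "contracts f h {} G w G w" and e: "e \<in> edges G"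
  shows "h ` (r `` {e}) = r `` {h e}"
proof -
  have eq: "equiv (edges G) r" and h: "bij_betw h (edges G) (edges G)"
    using type_facts[OF G] contractsD(3)[OF f] by auto
  have rr: "(h d, h c) \<in> r \<longleftrightarrow> (d, c) \<in> r" if "d \<in> edges G" "c \<in> edges G" for d c
    using iso_unique[OF G G f] that by blast
  have sub: "r \<subseteq> edges G \<times> edges G" using eq by (simp add: equiv_type)
  show ?thesis
  proof (intro subset_antisym subsetI)
    fix d assume "d \<in> h ` (r `` {e})"
    then obtain c where "(e, c) \<in> r" "d = h c" by blast
    then show "d \<in> r `` {h e}" using rr[OF e, of c] sub by auto
  next
    fix d assume "d \<in> r `` {h e}"
    then have hd: "(h e, d) \<in> r" by simp
    then have "d \<in> edges G" using sub by auto
    then obtain c where c: "c \<in> edges G" "d = h c" using h unfolding bij_betw_def by blast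
    then have "(e, c) \<in> r" using rr[OF e c(1)] hd by simp
    then show "d \<in> h ` (r `` {e})" using c by blast
  qed
qed

text \<open>By \<open>iso_unique\<close> an automorphism of the weighted graph preserves the
  relation automatically.\<close>

lemma aut_iff:
  assumes G: "(G, w, r) \<in> R"
  shows "ctype_iso_via f h (G, w, r) (G, w, r) \<longleftrightarrow> contracts f h {} G w G w"
  using iso_unique[OF G G, of f h] unfolding contracts_empty_iff[OF type_facts(1)[OF G]] by auto

lemma class_image_bij:
  assumes G: "(G, w, r) \<in> R" and f: "contracts f h {} G w G w"
  shows "bij_betw (image h) (edges G // r) (edges G // r)"
proof (rule bij_betw_imageI)
  have h: "bij_betw h (edges G) (edges G)" using contractsD(3)[OF f] by simp
  have sub: "c \<subseteq> edges G" if "c \<in> edges G // r" for c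
    by (rule in_quotient_imp_subset[OF type_facts(2)[OF G] that])
  show "inj_on (image h) (edges G // r)"
    by (rule inj_onI) (metis sub h bij_betw_imp_inj_on inj_on_image_eq_iff)
  show "image h ` (edges G // r) = edges G // r"
  proof (intro subset_antisym subsetI)
    fix c assume "c \<in> image h ` (edges G // r)"
    then obtain e where e: "e \<in> edges G" "c = h ` (r `` {e})" by (auto simp: quotient_def)
    then have "c = r `` {h e}" "h e \<in> edges G" using class_image[OF G f] h by (auto simp: bij_betw_def)
    then show "c \<in> edges G // r" by (simp add: quotientI)
  next
    fix c assume "c \<in> edges G // r"
    then obtain d where d: "d \<in> edges G" "c = r `` {d}" by (auto simp: quotient_def)
    then obtain e where e: "e \<in> edges G" "d = h e" using h unfolding bij_betw_def by blast
    then have "c = h ` (r `` {e})" using class_image[OF G f] d by simp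
    then show "c \<in> image h ` (edges G // r)" using e by (auto simp: quotientI)
  qed
qed

lemma aut_action_eq:
  assumes G: "(G, w, r) \<in> R"
  shows "aut_action (G, w, r) =
    {restrict (reindex (edges G // r) (image h)) (coord_space (edges G // r)) |f h. contracts f h {} G w G w}"
  unfolding aut_action_def aut_iff[OF G] reindex_def[abs_def] by simp

lemma aut_elem:
  assumes t: "t \<in> R" and a: "a \<in> aut_action t"
  obtains b where "bij_betw b (edge_classes t) (edge_classes t)"
    "a = restrict (reindex (edge_classes t) b) (coord_space (edge_classes t))"
    "\<forall>x. tcurve_iso (tcurve_of t (reindex (edge_classes t) b x)) (tcurve_of t x)"
proof -
  obtain G w r where tt: "t = (G, w, r)" by (metis surj_pair)
  have G: "(G, w, r) \<in> R" using t tt by simp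
  obtain f h where fh: "contracts f h {} G w G w"
    and a': "a = restrict (reindex (edges G // r) (image h)) (coord_space (edges G // r))"
    using a unfolding tt aut_action_eq[OF G] by blast
  have "tcurve_iso (tcurve_of t (reindex (edges G // r) (image h) x)) (tcurve_of t x)" for x
    unfolding tt
  proof (rule tcurve_of_contraction[OF type_facts(1)[OF G] fh])
    fix e assume e: "e \<in> edges G"
    then have "r `` {e} \<in> edges G // r" by (rule quotientI)
    then show "x (r `` {h e}) = reindex (edges G // r) (image h) x (r `` {e})"
      using class_image[OF G fh e] by (simp add: reindex_def)
  qed simp
  then show ?thesis using class_image_bij[OF G fh] a' by (intro that[of "image h"]) (auto simp: tt)
qed

lemma aut_subgroup:
  assumes t: "t \<in> R"
  shows "subgroup (aut_action t) (BijGroup (coord_space (edge_classes t)))"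
proof -
  obtain G w r where tt: "t = (G, w, r)" by (metis surj_pair)
  have G: "(G, w, r) \<in> R" using t tt by simp
  let ?N = "edges G // r"
  let ?A = "\<lambda>h. restrict (reindex ?N (image h)) (coord_space ?N)"
  let ?B = "BijGroup (coord_space ?N)"
  interpret B: group ?B by (rule group_BijGroup)
  have car: "?A h \<in> Bij (coord_space ?N)" if h: "contracts f h {} G w G w" for f h
    using reindex_images(4)[OF class_image_bij[OF G h]] by (auto simp: Bij_def bij_betw_restrict_eq)
  \<comment> \<open>Pull-back of coordinates is contravariant, hence the reversed order on the
    right.\<close>
  have comp: "?A h \<otimes>\<^bsub>?B\<^esub> ?A k = ?A (k \<circ> h)" if h: "contracts f h {} G w G w" and k: "contracts f' k {} G w G w" for f h f' k
  proof -
    have "?A h \<otimes>\<^bsub>?B\<^esub> ?A k = compose (coord_space ?N) (?A h) (?A k)"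
      using car[OF h] car[OF k] by (simp add: BijGroup_def)
    also have "\<dots> = ?A (k \<circ> h)"
    proof (rule ext)
      fix x
      have "image h ` ?N \<subseteq> ?N" using class_image_bij[OF G h] by (simp add: bij_betw_def)
      then have "reindex ?N (image h) (reindex ?N (image k) x) = reindex ?N (image k \<circ> image h) x"
        by (rule reindex_reindex)
      also have "image k \<circ> image h = image (k \<circ> h)" by (auto simp: fun_eq_iff)
      finally show "compose (coord_space ?N) (?A h) (?A k) x = ?A (k \<circ> h) x"
        by (simp add: compose_def restrict_def reindex_in(1) comp_def)
    qed
    finally show ?thesis .
  qed
  have fg: "finite_graph G" by (rule type_facts(1)[OF G])
  have idc: "contracts id id {} G w G w" unfolding contracts_empty_iff[OF fg] by (simp add: graph_iso_via_def)
  have one: "?A h = \<one>\<^bsub>?B\<^esub>" if "\<And>e. e \<in> edges G \<Longrightarrow> h e = e" for h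
  proof -
    have sub: "c \<subseteq> edges G" if "c \<in> ?N" for c
    proof -
      have "r \<subseteq> edges G \<times> edges G" using type_facts(2)[OF G] by (simp add: equiv_type)
      then show ?thesis using that by (auto simp: quotient_def)
    qed
    have "image h c = c" if "c \<in> ?N" for c using sub[OF that] \<open>\<And>e. e \<in> edges G \<Longrightarrow> h e = e\<close> by force
    then have "reindex ?N (image h) x = x" if "x \<in> coord_space ?N" for x
      using that by (auto simp: reindex_def coord_space_def)
    then show ?thesis by (auto simp: BijGroup_def restrict_def)
  qed
  have "subgroup (aut_action t) ?B"
  proof (rule B.subgroupI)
    show "aut_action t \<subseteq> carrier ?B" using car unfolding tt aut_action_eq[OF G] by (auto simp: BijGroup_def)
    show "aut_action t \<noteq> {}" unfolding tt aut_action_eq[OF G] using idc by blast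
    show "a \<otimes>\<^bsub>?B\<^esub> b \<in> aut_action t" if ab: "a \<in> aut_action t" "b \<in> aut_action t" for a b
    proof -
      obtain f h f' k where fh: "contracts f h {} G w G w" "a = ?A h" "contracts f' k {} G w G w" "b = ?A k"
        using ab unfolding tt aut_action_eq[OF G] by blast
      have "contracts (f' \<circ> f) (k \<circ> h) {} G w G w" using contracts_trans[OF fh(1,3) fg] by simp
      then show ?thesis using comp[OF fh(1,3)] fh(2,4) unfolding tt aut_action_eq[OF G] by blast
    qed
    show "inv\<^bsub>?B\<^esub> a \<in> aut_action t" if a: "a \<in> aut_action t" for a
    proof -
      obtain f h where fh: "contracts f h {} G w G w" "a = ?A h"
        using a unfolding tt aut_action_eq[OF G] by blast
      obtain f' h' where fh': "contracts f' h' {} G w G w" and inv: "\<And>e. e \<in> edges G \<Longrightarrow> h' (h e) = e"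
        using contracts_inverse[OF fh(1) fg] by metis
      have "?A h \<otimes>\<^bsub>?B\<^esub> ?A h' = \<one>\<^bsub>?B\<^esub>" unfolding comp[OF fh(1) fh'] by (rule one) (simp add: inv)
      then have "inv\<^bsub>?B\<^esub> (?A h') = ?A h"
        using car[OF fh(1)] car[OF fh'] by (intro B.inv_equality) (auto simp: BijGroup_def)
      then have "inv\<^bsub>?B\<^esub> a = ?A h'" using fh(2) car[OF fh'] B.inv_inv[of "?A h'"] by (simp add: BijGroup_def)
      then show ?thesis using fh' unfolding tt aut_action_eq[OF G] by blast
    qed
  qed
  then show ?thesis by (simp add: tt)
qed

lemma aut_GL:
  assumes t: "t \<in> R" shows "aut_action t \<subseteq> GL_int (edge_classes t)"
proof
  fix a assume a: "a \<in> aut_action t"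
  let ?N = "edge_classes t"
  obtain b where b: "bij_betw b ?N ?N" and a': "a = restrict (reindex ?N b) (coord_space ?N)"
    by (rule aut_elem[OF t a])
  have "a \<in> Bij (coord_space ?N)"
    using reindex_images(4)[OF b] by (auto simp: a' Bij_def bij_betw_restrict_eq)
  moreover have "linear_map_on (coord_space ?N) a"
    using reindex_linear[of "coord_space ?N" ?N b]
    by (auto simp: a' linear_map_on_def coord_space_def)
  moreover have "a ` int_lattice ?N = int_lattice ?N"
  proof -
    have "a ` int_lattice ?N = reindex ?N b ` int_lattice ?N"
      by (rule image_cong) (auto simp: a' int_lattice_def)
    then show ?thesis using reindex_images(3)[OF b] by simp
  qed
  ultimately show "a \<in> GL_int ?N" by (simp add: GL_int_def)
qed

lemma aut_images:
  assumes t: "t \<in> R" and a: "a \<in> aut_action t"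
  shows "a ` open_orthant (edge_classes t) = open_orthant (edge_classes t)"
    "a ` closed_orthant (edge_classes t) = closed_orthant (edge_classes t)"
proof -
  let ?N = "edge_classes t"
  obtain b where b: "bij_betw b ?N ?N" and a': "a = restrict (reindex ?N b) (coord_space ?N)"
    by (rule aut_elem[OF t a])
  have "a ` open_orthant ?N = reindex ?N b ` open_orthant ?N"
    by (rule image_cong) (auto simp: a' open_orthant_def)
  then show "a ` open_orthant ?N = open_orthant ?N" using reindex_images(2)[OF b] by simp
  have "a ` closed_orthant ?N = reindex ?N b ` closed_orthant ?N"
    by (rule image_cong) (auto simp: a' closed_orthant_def)
  then show "a ` closed_orthant ?N = closed_orthant ?N" using reindex_images(1)[OF b] by simp
qed

lemma orbit_self:
  assumes t: "t \<in> R" and x: "x \<in> coord_space (edge_classes t)" shows "x \<in> orbit_of (aut_action t) x"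
proof -
  let ?B = "BijGroup (coord_space (edge_classes t))"
  have "\<one>\<^bsub>?B\<^esub> \<in> aut_action t" by (rule subgroup.one_closed[OF aut_subgroup[OF t]])
  moreover have "\<one>\<^bsub>?B\<^esub> x = x" using x by (simp add: BijGroup_def)
  ultimately show ?thesis unfolding orbit_of_def by (metis imageI)
qed

lemma orbit_eq:
  assumes t: "t \<in> R" and a: "a \<in> aut_action t" and x: "x \<in> coord_space (edge_classes t)"
  shows "orbit_of (aut_action t) (a x) = orbit_of (aut_action t) x"
proof -
  let ?S = "coord_space (edge_classes t)"
  let ?B = "BijGroup ?S"
  interpret B: group ?B by (rule group_BijGroup)
  interpret A: subgroup "aut_action t" ?B by (rule aut_subgroup[OF t])
  have app: "(c \<otimes>\<^bsub>?B\<^esub> b) y = c (b y)" if "c \<in> aut_action t" "b \<in> aut_action t" "y \<in> ?S" for b c y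
  proof -
    have "b \<in> Bij ?S" "c \<in> Bij ?S" using A.subset that by (auto simp: BijGroup_def)
    then show ?thesis using that(3) by (simp add: BijGroup_def compose_def)
  qed
  have sub: "orbit_of (aut_action t) (b y) \<subseteq> orbit_of (aut_action t) y" if "b \<in> aut_action t" "y \<in> ?S" for b y
  proof
    fix z assume "z \<in> orbit_of (aut_action t) (b y)"
    then obtain c where c: "c \<in> aut_action t" "z = c (b y)" by (auto simp: orbit_of_def)
    then have "z = (c \<otimes>\<^bsub>?B\<^esub> b) y" using app that by simp
    then show "z \<in> orbit_of (aut_action t) y" using c(1) that(1) unfolding orbit_of_def by blast
  qed
  have ia: "inv\<^bsub>?B\<^esub> a \<in> aut_action t" using a by simp
  have "a \<in> Bij ?S" using A.subset a by (auto simp: BijGroup_def)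
  then have ax: "a x \<in> ?S" using x by (auto simp: Bij_def bij_betw_def)
  have "inv\<^bsub>?B\<^esub> a \<otimes>\<^bsub>?B\<^esub> a = \<one>\<^bsub>?B\<^esub>" by (rule B.l_inv[OF A.mem_carrier[OF a]])
  moreover have "\<one>\<^bsub>?B\<^esub> x = x" using x by (simp add: BijGroup_def)
  ultimately have "(inv\<^bsub>?B\<^esub> a \<otimes>\<^bsub>?B\<^esub> a) x = x" by simp
  then have "x = (inv\<^bsub>?B\<^esub> a) (a x)" using app[OF ia a x] by simp
  then have "orbit_of (aut_action t) x \<subseteq> orbit_of (aut_action t) (a x)" using sub[OF ia ax] by metis
  then show ?thesis using sub[OF a x] by blast
qed

lemma orbit_tcurve_iso:
  assumes t: "t \<in> R" and x: "x \<in> coord_space (edge_classes t)" and y: "y \<in> orbit_of (aut_action t) x"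
  shows "tcurve_iso (tcurve_of t x) (tcurve_of t y)"
proof -
  obtain a where a: "a \<in> aut_action t" "y = a x" using y by (auto simp: orbit_of_def)
  obtain b where "a = restrict (reindex (edge_classes t) b) (coord_space (edge_classes t))"
    and i: "\<forall>x. tcurve_iso (tcurve_of t (reindex (edge_classes t) b x)) (tcurve_of t x)"
    by (rule aut_elem[OF t a(1)])
  then have "tcurve_iso (tcurve_of t y) (tcurve_of t x)" using a(2) x i by (metis restrict_apply')
  moreover have "finite_graph (fst t)" using t type_facts(1) by (metis prod.collapse)
  ultimately show ?thesis using tcurve_iso_sym finite_graph_tcurve_of by blast
qed

section \<open>Points and open sets of the glued space\<close>

lemma topspace_orbit_space: "topspace (orbit_space S \<Gamma>) = orbit_of \<Gamma> ` S"
  by (simp add: orbit_space_def topspace_quotient_topology)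

lemma topspace_cell_union:
  "(t, A) \<in> topspace (cell_union R) \<longleftrightarrow> t \<in> R \<and> A \<in> orbit_of (aut_action t) ` closed_orthant (edge_classes t)"
  by (auto simp: cell_union_def topspace_orbit_space)

text \<open>All points of an orbit have isomorphic tropical curves, so \<open>same_tcurve\<close>
  can be tested on representatives and is an equivalence; equality of its classes then means being
  related.\<close>

lemma point_eq_iff:
  assumes t: "t \<in> R" "x \<in> closed_orthant (edge_classes t)" and s: "s \<in> R" "y \<in> closed_orthant (edge_classes s)"
  shows "point t x = point s y \<longleftrightarrow> tcurve_iso (tcurve_of t x) (tcurve_of s y)"
proof -
  have fin: "finite_graph (fst (fst (tcurve_of u z)))" if "u \<in> R" for u z
    using finite_graph_tcurve_of type_facts(1) that by (metis prod.collapse)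
  have crd: "z \<in> coord_space (edge_classes u)" if "z \<in> closed_orthant (edge_classes u)" for u z
    using that closed_orthant_subset_coord by blast
  have same: "same_tcurve (u, orbit_of (aut_action u) z) (v, orbit_of (aut_action v) z') \<longleftrightarrow>
      tcurve_iso (tcurve_of u z) (tcurve_of v z')"
    if u: "u \<in> R" "z \<in> closed_orthant (edge_classes u)" and v: "v \<in> R" "z' \<in> closed_orthant (edge_classes v)" for u z v z'
  proof
    assume "same_tcurve (u, orbit_of (aut_action u) z) (v, orbit_of (aut_action v) z')"
    then obtain a b where ab: "a \<in> orbit_of (aut_action u) z" "b \<in> orbit_of (aut_action v) z'"
      "tcurve_iso (tcurve_of u a) (tcurve_of v b)" by auto
    have "tcurve_iso (tcurve_of u z) (tcurve_of u a)" by (rule orbit_tcurve_iso[OF u(1) crd[OF u(2)] ab(1)])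
    moreover have "tcurve_iso (tcurve_of v b) (tcurve_of v z')"
      by (rule tcurve_iso_sym[OF fin[OF v(1)] orbit_tcurve_iso[OF v(1) crd[OF v(2)] ab(2)]])
    ultimately show "tcurve_iso (tcurve_of u z) (tcurve_of v z')"
      using ab(3) tcurve_iso_trans fin u(1) by metis
  next
    assume "tcurve_iso (tcurve_of u z) (tcurve_of v z')"
    then show "same_tcurve (u, orbit_of (aut_action u) z) (v, orbit_of (aut_action v) z')"
      using orbit_self[OF u(1) crd[OF u(2)]] orbit_self[OF v(1) crd[OF v(2)]] by auto
  qed
  show ?thesis
  proof
    assume "point t x = point s y"
    moreover have "(s, orbit_of (aut_action s) y) \<in> point s y"
      using same[OF s s] s tcurve_iso_refl by (auto simp: point_def same_tcurve_class_def topspace_cell_union)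
    ultimately have "(s, orbit_of (aut_action s) y) \<in> point t x" by simp
    then have "same_tcurve (t, orbit_of (aut_action t) x) (s, orbit_of (aut_action s) y)"
      unfolding point_def same_tcurve_class_def by blast
    then show "tcurve_iso (tcurve_of t x) (tcurve_of s y)" using same[OF t s] by simp
  next
    assume i: "tcurve_iso (tcurve_of t x) (tcurve_of s y)"
    have i': "tcurve_iso (tcurve_of s y) (tcurve_of t x)" by (rule tcurve_iso_sym[OF fin[OF t(1)] i])
    have "same_tcurve (t, orbit_of (aut_action t) x) Q \<longleftrightarrow> same_tcurve (s, orbit_of (aut_action s) y) Q"
      if Q: "Q \<in> topspace (cell_union R)" for Q
    proof -
      obtain u A where QA: "Q = (u, A)" by (cases Q)
      then obtain z where z: "u \<in> R" "z \<in> closed_orthant (edge_classes u)" "A = orbit_of (aut_action u) z"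
        using Q by (auto simp: topspace_cell_union)
      show ?thesis unfolding QA z(3) same[OF t z(1,2)] same[OF s z(1,2)]
        using tcurve_iso_trans[OF fin[OF t(1)] i] tcurve_iso_trans[OF fin[OF s(1)] i'] by blast
    qed
    then show "point t x = point s y" by (auto simp: point_def same_tcurve_class_def)
  qed
qed

lemma topspace_H: "topspace (H_trop R) = {point t x |t x. t \<in> R \<and> x \<in> closed_orthant (edge_classes t)}"
proof -
  have "topspace (H_trop R) = same_tcurve_class R ` topspace (cell_union R)"
    by (simp add: H_trop_def topspace_quotient_topology)
  also have "topspace (cell_union R) =
      {(t, orbit_of (aut_action t) x) |t x. t \<in> R \<and> x \<in> closed_orthant (edge_classes t)}"
    using topspace_cell_union by auto
  finally show ?thesis unfolding point_def by blast
qed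

text \<open>The space is a quotient of a sum of quotients. Unwinding all three topologies leaves one
  test on each closed orthant, before dividing by automorphisms.\<close>

lemma openin_H:
  "openin (H_trop R) U \<longleftrightarrow> U \<subseteq> topspace (H_trop R) \<and>
    (\<forall>t\<in>R. openin (top_of_set (closed_orthant (edge_classes t))) {x \<in> closed_orthant (edge_classes t). point t x \<in> U})"
proof -
  let ?P = "{P \<in> topspace (cell_union R). same_tcurve_class R P \<in> U}"
  have "openin (cell_union R) ?P \<longleftrightarrow> (\<forall>t\<in>R. openin (orbit_space (closed_orthant (edge_classes t)) (aut_action t)) {A. (t, A) \<in> ?P})"
  proof -
    have "?P \<subseteq> Sigma R (topspace \<circ> (\<lambda>t. orbit_space (closed_orthant (edge_classes t)) (aut_action t)))"
      by (auto simp: cell_union_def)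
    then show ?thesis unfolding cell_union_def openin_sum_topology by blast
  qed
  also have "\<dots> \<longleftrightarrow> (\<forall>t\<in>R. openin (top_of_set (closed_orthant (edge_classes t))) {x \<in> closed_orthant (edge_classes t). point t x \<in> U})"
  proof (rule ball_cong[OF refl])
    fix t assume t: "t \<in> R"
    let ?C = "closed_orthant (edge_classes t)"
    have "{A. (t, A) \<in> ?P} \<subseteq> orbit_of (aut_action t) ` ?C" by (auto simp: topspace_cell_union)
    moreover have "{x \<in> ?C. orbit_of (aut_action t) x \<in> {A. (t, A) \<in> ?P}} = {x \<in> ?C. point t x \<in> U}"
      using t by (auto simp: topspace_cell_union point_def)
    ultimately show "openin (orbit_space ?C (aut_action t)) {A. (t, A) \<in> ?P} \<longleftrightarrow>
        openin (top_of_set ?C) {x \<in> ?C. point t x \<in> U}"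
      unfolding orbit_space_def openin_quotient_topology by simp
  qed
  finally show ?thesis
    unfolding H_trop_def openin_quotient_topology topspace_quotient_topology by simp
qed

lemma closedin_H:
  assumes W: "W \<subseteq> topspace (H_trop R)"
    and c: "\<And>t. t \<in> R \<Longrightarrow> closed {x \<in> closed_orthant (edge_classes t). point t x \<in> W}"
  shows "closedin (H_trop R) W"
proof -
  have "openin (top_of_set (closed_orthant (edge_classes t)))
      {x \<in> closed_orthant (edge_classes t). point t x \<in> topspace (H_trop R) - W}" if t: "t \<in> R" for t
  proof -
    let ?C = "closed_orthant (edge_classes t)"
    have "{x \<in> ?C. point t x \<in> topspace (H_trop R) - W} = ?C - {x \<in> ?C. point t x \<in> W}"
      using t unfolding topspace_H by blast
    moreover have "closedin (top_of_set ?C) {x \<in> ?C. point t x \<in> W}"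
      using c[OF t] by (auto intro: closed_subset)
    ultimately show ?thesis by (simp add: closedin_def)
  qed
  then have "openin (H_trop R) (topspace (H_trop R) - W)" unfolding openin_H by blast
  then show ?thesis using W by (simp add: closedin_def)
qed

text \<open>The face on which all classes in \<open>S\<close> have length zero is the cone of the
  contracted type: \<open>b\<close> sends a class of the contraction to the class of
  \<open>G\<close> formed by its preimages under \<open>h\<close>.\<close>

lemma contraction_point:
  assumes t: "(G, w, r) \<in> R" and l: "(G', w', r') \<in> R" and c: "contracts p h S G w G' w'"
    and rS: "r `` S \<subseteq> S" and rr: "\<forall>d\<in>edges G - S. \<forall>e\<in>edges G - S. (h d, h e) \<in> r' \<longleftrightarrow> (d, e) \<in> r"
  obtains b where "bij_betw b (edge_classes (G', w', r')) (edge_classes (G, w, r) - S // r)"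
    "\<And>x. x \<in> closed_orthant (edge_classes (G, w, r) - S // r) \<Longrightarrow>
      point (G, w, r) x = point (G', w', r') (reindex (edge_classes (G', w', r')) b x)"
proof -
  have eq: "equiv (edges G) r" and eq': "equiv (edges G') r'" using type_facts(2) t l by auto
  have sub: "r \<subseteq> edges G \<times> edges G" and sub': "r' \<subseteq> edges G' \<times> edges G'" using eq eq' by (auto simp: equiv_type)
  have SE: "S \<subseteq> edges G" by (rule contractsD(1)[OF c])
  have h: "bij_betw h (edges G - S) (edges G')" by (rule contractsD(3)[OF c])
  have sym: "(e, d) \<in> r" if "(d, e) \<in> r" for d e using eq that by (meson equivE symE)
  have rnS: "r `` {e} \<subseteq> edges G - S" if "e \<in> edges G - S" for e
    using that sub sym rS by blast
  define b where "b c = {e \<in> edges G - S. h e \<in> c}" for c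
  have bc: "b (r' `` {h e}) = r `` {e}" if e: "e \<in> edges G - S" for e
    using rr e rnS[OF e] by (auto simp: b_def)
  have N': "edges G' // r' = (\<lambda>e. r' `` {h e}) ` (edges G - S)"
  proof -
    have "edges G' = h ` (edges G - S)" using h by (simp add: bij_betw_def)
    then show ?thesis unfolding quotient_def by (simp add: UNION_singleton_eq_range image_image)
  qed
  have NS: "edges G // r - S // r = (\<lambda>e. r `` {e}) ` (edges G - S)"
  proof -
    have "r `` {e} \<notin> S // r" if e: "e \<in> edges G - S" for e
    proof
      assume "r `` {e} \<in> S // r"
      then obtain d where d: "d \<in> S" "r `` {e} = r `` {d}" by (auto simp: quotient_def)
      have "e \<in> r `` {e}" using eq e by (auto dest: equiv_class_self)
      then show False using d rS e by auto
    qed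
    then show ?thesis by (auto simp: quotient_def)
  qed
  have bb: "bij_betw b (edges G' // r') (edges G // r - S // r)"
  proof (rule bij_betw_imageI)
    show "b ` (edges G' // r') = edges G // r - S // r"
      unfolding N' NS image_image using bc by (intro image_cong) auto
    show "inj_on b (edges G' // r')"
    proof (rule inj_onI)
      fix c1 c2 assume "c1 \<in> edges G' // r'" "c2 \<in> edges G' // r'" and b12: "b c1 = b c2"
      then obtain d e where de: "d \<in> edges G - S" "e \<in> edges G - S" "c1 = r' `` {h d}" "c2 = r' `` {h e}"
        unfolding N' by blast
      then have "r `` {d} = r `` {e}" using b12 bc by simp
      then have "(d, e) \<in> r" using de eq by (meson DiffD1 eq_equiv_class)
      then have "(h d, h e) \<in> r'" using rr de by blast
      then show "c1 = c2" using de eq' by (simp add: equiv_class_eq)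
    qed
  qed
  have "point (G, w, r) x = point (G', w', r') (reindex (edges G' // r') b x)"
    if x: "x \<in> closed_orthant (edges G // r - S // r)" for x
  proof -
    have xN: "x \<in> closed_orthant (edges G // r)" using x closed_orthant_mono[of "edges G // r - S // r" "edges G // r"] by auto
    have y: "reindex (edges G' // r') b x \<in> closed_orthant (edges G' // r')"
      by (rule reindex_in(2)[OF _ x]) (use bb in \<open>simp add: bij_betw_def\<close>)
    have "tcurve_iso (tcurve_of (G, w, r) x) (tcurve_of (G', w', r') (reindex (edges G' // r') b x))"
    proof (rule tcurve_of_contraction[OF type_facts(1)[OF t] c])
      fix e assume "e \<in> S"
      then have "r `` {e} \<in> S // r" by (rule quotientI)
      then show "x (r `` {e}) = 0" using x by (auto simp: closed_orthant_def coord_space_def)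
    next
      fix e assume e: "e \<in> edges G" "e \<notin> S"
      then have "r' `` {h e} \<in> edges G' // r'" unfolding N' by blast
      then show "reindex (edges G' // r') b x (r' `` {h e}) = x (r `` {e})" using bc[of e] e by (simp add: reindex_def)
    qed
    then show ?thesis using point_eq_iff[OF t _ l] xN y by simp
  qed
  then show ?thesis using bb by (intro that[of b]) auto
qed

lemma face_exists:
  assumes t: "t \<in> R" and Z: "Z \<subseteq> edge_classes t"
  obtains l b where "l \<in> R" "bij_betw b (edge_classes l) (edge_classes t - Z)"
    "\<forall>x\<in>closed_orthant (edge_classes t - Z). point t x = point l (reindex (edge_classes l) b x)"
proof -
  obtain G w r where tt: "t = (G, w, r)" by (metis surj_pair)
  have G: "(G, w, r) \<in> R" using t tt by simp
  have eq: "equiv (edges G) r" by (rule type_facts(2)[OF G])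
  let ?S = "\<Union>Z"
  have ZQ: "Z \<subseteq> edges G // r" using Z tt by simp
  have SE: "?S \<subseteq> edges G"
  proof -
    have "\<Union>(edges G // r) = edges G" using eq by (rule Union_quotient)
    then show ?thesis using ZQ by blast
  qed
  have cl: "c = r `` {e}" if "c \<in> edges G // r" "e \<in> c" for c e
    using eq that by (metis equiv_class_eq quotientE ImageE singletonD)
  have rS: "r `` ?S \<subseteq> ?S"
  proof
    fix d assume "d \<in> r `` ?S"
    then obtain e c where "e \<in> c" "c \<in> Z" "(e, d) \<in> r" by blast
    moreover from this have "c = r `` {e}" using cl[of c e] ZQ by blast
    ultimately show "d \<in> ?S" by blast
  qed
  have SZ: "?S // r = Z"
  proof (intro subset_antisym subsetI)
    fix c assume "c \<in> ?S // r"
    then obtain e d where "e \<in> d" "d \<in> Z" "c = r `` {e}" by (auto simp: quotient_def)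
    then show "c \<in> Z" using cl[of d e] ZQ by blast
  next
    fix c assume c: "c \<in> Z"
    then have "c \<noteq> {}" using ZQ in_quotient_imp_non_empty[OF eq] by blast
    then obtain e where "e \<in> c" by blast
    then have "c = r `` {e}" "e \<in> ?S" using cl[of c e] ZQ c by blast+
    then show "c \<in> ?S // r" by (metis quotientI)
  qed
  obtain G' w' r' p h where l: "(G', w', r') \<in> R" and c: "contracts p h ?S G w G' w'"
    and rr: "\<forall>d\<in>edges G - ?S. \<forall>e\<in>edges G - ?S. (h d, h e) \<in> r' \<longleftrightarrow> (d, e) \<in> r"
    using contraction_exists[OF G SE rS] by blast
  obtain b where b: "bij_betw b (edge_classes (G', w', r')) (edge_classes (G, w, r) - ?S // r)"
    and bp: "\<And>x. x \<in> closed_orthant (edge_classes (G, w, r) - ?S // r) \<Longrightarrow>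
      point (G, w, r) x = point (G', w', r') (reindex (edge_classes (G', w', r')) b x)"
    using contraction_point[OF G l c rS rr] by metis
  show ?thesis
  proof (rule that[of "(G', w', r')" b])
    show "bij_betw b (edge_classes (G', w', r')) (edge_classes t - Z)" using b SZ tt by simp
    show "\<forall>x\<in>closed_orthant (edge_classes t - Z). point t x = point (G', w', r') (reindex (edge_classes (G', w', r')) b x)"
      using bp SZ tt by simp
  qed (rule l)
qed

text \<open>With positive lengths nothing is contracted, so an isomorphism of the curves is one of
  the weighted graphs and \<open>iso_unique\<close> applies. This yields both the disjointness of
  the cells and the injectivity of the charts on orbits.\<close>

lemma open_points_eq:
  assumes t: "t \<in> R" "x \<in> open_orthant (edge_classes t)" and s: "s \<in> R" "y \<in> open_orthant (edge_classes s)"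
    and eq: "point t x = point s y"
  shows "t = s" "\<exists>a\<in>aut_action t. x = a y"
proof -
  obtain G w r where tt: "t = (G, w, r)" by (metis surj_pair)
  obtain G' w' r' where ss: "s = (G', w', r')" by (metis surj_pair)
  have G: "(G, w, r) \<in> R" and G': "(G', w', r') \<in> R" using t s tt ss by auto
  have fg: "finite_graph G" "finite_graph G'" using type_facts(1) G G' by auto
  have "x \<in> closed_orthant (edge_classes t)" "y \<in> closed_orthant (edge_classes s)"
    using t s open_orthant_subset_closed by blast+
  then have i: "tcurve_iso (tcurve_of (G, w, r) x) (tcurve_of (G', w', r') y)"
    using point_eq_iff[OF t(1) _ s(1)] eq tt ss by simp
  have zx: "zero_edges (G, w, r) x = {}" "zero_edges (G', w', r') y = {}"
    using t(2) s(2) by (auto simp: tt ss open_orthant_def quotientI) (metis less_irrefl quotientI)+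
  obtain f h where fh: "contracts f h {} G w G' w'" and l: "\<And>e. e \<in> edges G \<Longrightarrow> y (r' `` {h e}) = x (r `` {e})"
    using tcurve_of_positive_iso[OF fg i zx] by metis
  have same: "(G', w', r') = (G, w, r)" using iso_unique[OF G G' fh] by simp
  then show "t = s" using tt ss by simp
  have fh': "contracts f h {} G w G w" using fh same by simp
  let ?N = "edges G // r"
  let ?a = "restrict (reindex ?N (image h)) (coord_space ?N)"
  have "?a \<in> aut_action t" unfolding tt aut_action_eq[OF G] using fh' by blast
  moreover have "x = ?a y"
  proof
    fix c
    have yc: "y \<in> coord_space ?N" using s(2) ss same by (simp add: open_orthant_def)
    show "x c = ?a y c"
    proof (cases "c \<in> ?N")
      case True
      then obtain e where e: "e \<in> edges G" "c = r `` {e}" by (auto simp: quotient_def)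
      then show ?thesis using yc True l[OF e(1)] class_image[OF G fh' e(1)] same by (simp add: reindex_def)
    next
      case False
      then show ?thesis using yc t(2) tt by (simp add: reindex_def open_orthant_def coord_space_def)
    qed
  qed
  ultimately show "\<exists>a\<in>aut_action t. x = a y" by blast
qed

text \<open>The coordinates vanishing at \<open>x\<close> select the face that contains
  \<open>x\<close> in its relative interior; this face is the cone of a contraction.\<close>

lemma point_in_open_cell:
  assumes t: "t \<in> R" "x \<in> closed_orthant (edge_classes t)"
  obtains l b where "l \<in> R" "bij_betw b (edge_classes l) (edge_classes t - {c \<in> edge_classes t. x c = 0})"
    "reindex (edge_classes l) b x \<in> open_orthant (edge_classes l)"
    "\<forall>z\<in>closed_orthant (edge_classes t - {c \<in> edge_classes t. x c = 0}).
      point t z = point l (reindex (edge_classes l) b z)"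
    "x \<in> closed_orthant (edge_classes t - {c \<in> edge_classes t. x c = 0})"
proof -
  let ?Z = "{c \<in> edge_classes t. x c = 0}"
  obtain l b where l: "l \<in> R" "bij_betw b (edge_classes l) (edge_classes t - ?Z)"
    and p: "\<forall>z\<in>closed_orthant (edge_classes t - ?Z). point t z = point l (reindex (edge_classes l) b z)"
    by (rule face_exists[OF t(1) Collect_subset])
  have x: "x \<in> open_orthant (edge_classes t - ?Z)"
    using t(2) by (auto simp: closed_orthant_def open_orthant_def coord_space_def less_le)
  then have "x \<in> closed_orthant (edge_classes t - ?Z)" using open_orthant_subset_closed by blast
  moreover have "reindex (edge_classes l) b x \<in> open_orthant (edge_classes l)"
    by (rule reindex_in(3)[OF _ x]) (use l(2) in \<open>simp add: bij_betw_def\<close>)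
  ultimately show ?thesis using l p by (intro that[of l b])
qed

text \<open>The preimage of the image of a closed set is the union, over the finitely many
  identifications of a face with a face, of closed sets.\<close>

lemma closed_preimage:
  assumes t: "t \<in> R" and s: "s \<in> R" and K: "closed K" "K \<subseteq> closed_orthant (edge_classes t)"
  shows "closed {y \<in> closed_orthant (edge_classes s). point s y \<in> point t ` K}"
proof -
  let ?N = "edge_classes t" and ?M = "edge_classes s"
  \<comment> \<open>A triple in \<open>J\<close> glues the face on \<open>M'\<close> of the cone of
    \<open>s\<close> into the face on \<open>N'\<close> of the cone of \<open>t\<close> by a
    pull-back of coordinates. Extensional functions keep \<open>J\<close> finite.\<close>
  define J where "J = {(N', M', b). N' \<subseteq> ?N \<and> M' \<subseteq> ?M \<and> b \<in> N' \<rightarrow>\<^sub>E M' \<and>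
      (\<forall>y\<in>closed_orthant M'. point s y = point t (reindex N' b y))}"
  have "finite J"
  proof (rule finite_subset)
    show "J \<subseteq> (SIGMA N':Pow ?N. SIGMA M':Pow ?M. N' \<rightarrow>\<^sub>E M')" by (auto simp: J_def)
    show "finite (SIGMA N':Pow ?N. SIGMA M':Pow ?M. N' \<rightarrow>\<^sub>E M')"
      using finite_classes[OF t] finite_classes[OF s]
      by (intro finite_SigmaI) (auto intro!: finite_PiE dest: finite_subset)
  qed
  moreover have "closed {y \<in> closed_orthant M'. reindex N' b y \<in> K}" for N' M' b
  proof -
    have "{y \<in> closed_orthant M'. reindex N' b y \<in> K} = closed_orthant M' \<inter> reindex N' b -` K" by auto
    moreover have "closed (reindex N' b -` K)"
      by (rule closed_vimage[OF K(1) continuous_on_reindex])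
    ultimately show ?thesis using closed_closed_orthant by (metis closed_Int)
  qed
  moreover have "{y \<in> closed_orthant ?M. point s y \<in> point t ` K} =
      (\<Union>(N', M', b)\<in>J. {y \<in> closed_orthant M'. reindex N' b y \<in> K})"
  proof (intro subset_antisym subsetI)
    fix y assume "y \<in> {y \<in> closed_orthant ?M. point s y \<in> point t ` K}"
    then obtain x where y: "y \<in> closed_orthant ?M" and x: "x \<in> K" "point s y = point t x" by auto
    have xc: "x \<in> closed_orthant ?N" using x K by auto
    let ?N' = "?N - {c \<in> ?N. x c = 0}" and ?M' = "?M - {c \<in> ?M. y c = 0}"
    obtain l b where l: "l \<in> R" "bij_betw b (edge_classes l) ?N'" "reindex (edge_classes l) b x \<in> open_orthant (edge_classes l)"
      and pt: "\<forall>z\<in>closed_orthant ?N'. point t z = point l (reindex (edge_classes l) b z)"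
      and x': "x \<in> closed_orthant ?N'"
      by (rule point_in_open_cell[OF t xc])
    obtain k a where k: "k \<in> R" "bij_betw a (edge_classes k) ?M'" "reindex (edge_classes k) a y \<in> open_orthant (edge_classes k)"
      and ps: "\<forall>z\<in>closed_orthant ?M'. point s z = point k (reindex (edge_classes k) a z)"
      and y': "y \<in> closed_orthant ?M'"
      by (rule point_in_open_cell[OF s y])
    have eq: "point l (reindex (edge_classes l) b x) = point k (reindex (edge_classes k) a y)"
      using bspec[OF pt x'] bspec[OF ps y'] x(2) by simp
    have lk: "l = k" by (rule open_points_eq(1)[OF l(1,3) k(1,3) eq])
    obtain g where g: "g \<in> aut_action l" "reindex (edge_classes l) b x = g (reindex (edge_classes k) a y)"
      using open_points_eq(2)[OF l(1,3) k(1,3) eq] by blast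
    let ?L = "edge_classes l"
    obtain d where d: "bij_betw d ?L ?L" "g = restrict (reindex ?L d) (coord_space ?L)"
      and gi: "\<forall>z. tcurve_iso (tcurve_of l (reindex ?L d z)) (tcurve_of l z)"
      by (rule aut_elem[OF l(1) g(1)])
    have ak: "bij_betw a ?L ?M'" using k(2) lk by simp
    \<comment> \<open>Both points lie over the same open cell and differ there by an automorphism
      \<open>d\<close>. The map \<open>c\<close> goes from the classes of the face of
      \<open>t\<close> to that cell, through \<open>d\<close>, and on to the classes of the face of
      \<open>s\<close>.\<close>
    define c where "c = restrict (a \<circ> d \<circ> inv_into ?L b) ?N'"
    have ib: "inv_into ?L b ` ?N' \<subseteq> ?L" using bij_betw_inv_into[OF l(2)] by (simp add: bij_betw_def)
    have dL: "d ` ?L \<subseteq> ?L" and aL: "a ` ?L \<subseteq> ?M'" and bL: "b ` ?L \<subseteq> ?N'"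
      using d(1) ak l(2) by (auto simp: bij_betw_def)
    have comp: "reindex ?N' c z = reindex ?N' (inv_into ?L b) (reindex ?L d (reindex ?L a z))" for z
    proof -
      have "reindex ?N' (inv_into ?L b) (reindex ?L d (reindex ?L a z)) = reindex ?N' (a \<circ> d \<circ> inv_into ?L b) z"
        using reindex_reindex[OF dL, of a z] reindex_reindex[OF ib, of "a \<circ> d" z] by simp
      also have "\<dots> = reindex ?N' c z" by (rule reindex_cong) (simp add: c_def)
      finally show ?thesis by simp
    qed
    have "c \<in> ?N' \<rightarrow>\<^sub>E ?M'" using ib dL aL by (auto simp: c_def image_subset_iff)
    moreover have "point s z = point t (reindex ?N' c z)" if z: "z \<in> closed_orthant ?M'" for z
    proof -
      let ?z1 = "reindex ?L a z" let ?z2 = "reindex ?L d ?z1"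
      have z1: "?z1 \<in> closed_orthant ?L" by (rule reindex_in(2)[OF aL z])
      have z2: "?z2 \<in> closed_orthant ?L" by (rule reindex_in(2)[OF dL z1])
      have z3: "reindex ?N' (inv_into ?L b) ?z2 \<in> closed_orthant ?N'" by (rule reindex_in(2)[OF ib z2])
      have "point s z = point l ?z1" using bspec[OF ps z] lk by simp
      also have "\<dots> = point l ?z2" using point_eq_iff[OF l(1) z2 l(1) z1] gi by simp
      also have "?z2 = reindex ?L b (reindex ?N' (inv_into ?L b) ?z2)"
        using reindex_inverse'[OF l(2), of ?z2] z2 closed_orthant_subset_coord by (metis subsetD)
      also have "point l \<dots> = point t (reindex ?N' (inv_into ?L b) ?z2)" using bspec[OF pt z3] by simp
      finally show ?thesis by (simp add: comp)
    qed
    ultimately have "(?N', ?M', c) \<in> J" by (auto simp: J_def)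
    moreover have "reindex ?N' c y = x"
    proof -
      have "reindex ?L a y \<in> coord_space ?L" by (rule reindex_in(1))
      then have "reindex ?L b x = reindex ?L d (reindex ?L a y)" using g(2) d(2) lk by simp
      then have "reindex ?N' c y = reindex ?N' (inv_into ?L b) (reindex ?L b x)" by (simp add: comp)
      then show ?thesis using reindex_inverse[OF l(2), of x] x' closed_orthant_subset_coord by (metis subsetD)
    qed
    ultimately show "y \<in> (\<Union>(N', M', b)\<in>J. {y \<in> closed_orthant M'. reindex N' b y \<in> K})"
      using y' x(1) by (intro UN_I[of "(?N', ?M', c)"]) auto
  next
    fix y assume "y \<in> (\<Union>(N', M', b)\<in>J. {y \<in> closed_orthant M'. reindex N' b y \<in> K})"
    then obtain N' M' b where J: "(N', M', b) \<in> J" and y: "y \<in> closed_orthant M'" "reindex N' b y \<in> K" by auto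
    then have "y \<in> closed_orthant ?M" "point s y = point t (reindex N' b y)"
      using closed_orthant_mono[of M' ?M] by (auto simp: J_def)
    then show "y \<in> {y \<in> closed_orthant ?M. point s y \<in> point t ` K}" using y by auto
  qed
  ultimately show ?thesis by (auto intro!: closed_UN)
qed

end

section \<open>The axioms of a stacky fan\<close>

context type_family
begin

lemma H_fan_simps:
  "index (H_fan R) = R" "coords (H_fan R) = edge_classes" "cone (H_fan R) t = open_orthant (edge_classes t)"
  "grp (H_fan R) = aut_action" "chart (H_fan R) t A = same_tcurve_class R (t, A)"
  by (simp_all add: H_fan_def)

lemma chart_image_eq: "chart_image (H_fan R) t S = point t ` S"
  by (auto simp: chart_image_def H_fan_simps point_def image_image)

lemma cell_eq: "cell (H_fan R) t = point t ` open_orthant (edge_classes t)"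
  by (simp add: cell_def chart_image_eq H_fan_simps)

lemma closed_cell_eq: "closed_cell (H_fan R) t = point t ` closed_orthant (edge_classes t)"
  by (simp add: closed_cell_def chart_image_eq H_fan_simps closure_open_orthant)

lemma open_orthant_nonempty: "open_orthant N \<noteq> {}"
proof -
  have "(\<lambda>i. if i \<in> N then 1 else 0) \<in> open_orthant N" by (auto simp: open_orthant_def coord_space_def)
  then show ?thesis by blast
qed

text \<open>The face of \<open>t\<close> containing \<open>x\<close> in its relative interior must
  be the cone of \<open>l\<close>, because open cells are disjoint. So the whole closed cell of
  \<open>l\<close> is covered, and \<open>l\<close> has fewer classes unless that face is the entire
  cone.\<close>

lemma face_of_point:
  assumes t: "t \<in> R" "x \<in> closed_orthant (edge_classes t)" and l: "l \<in> R" "y \<in> open_orthant (edge_classes l)"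
    and eq: "point t x = point l y"
  shows "closed_cell (H_fan R) l \<subseteq> closed_cell (H_fan R) t"
    "card (edge_classes l) < card (edge_classes t) \<or> l = t"
proof -
  let ?Z = "{c \<in> edge_classes t. x c = 0}"
  obtain k b where k: "k \<in> R" "bij_betw b (edge_classes k) (edge_classes t - ?Z)"
      "reindex (edge_classes k) b x \<in> open_orthant (edge_classes k)"
    and p: "\<forall>z\<in>closed_orthant (edge_classes t - ?Z). point t z = point k (reindex (edge_classes k) b z)"
    and x: "x \<in> closed_orthant (edge_classes t - ?Z)"
    by (rule point_in_open_cell[OF t])
  have "point k (reindex (edge_classes k) b x) = point l y" using bspec[OF p x] eq by simp
  then have kl: "k = l" by (rule open_points_eq(1)[OF k(1,3) l])
  show "closed_cell (H_fan R) l \<subseteq> closed_cell (H_fan R) t"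
    unfolding closed_cell_eq
  proof
    fix q assume "q \<in> point l ` closed_orthant (edge_classes l)"
    then obtain z where z: "z \<in> closed_orthant (edge_classes k)" "q = point k z" using kl by blast
    then obtain u where u: "u \<in> closed_orthant (edge_classes t - ?Z)" "z = reindex (edge_classes k) b u"
      using reindex_images(1)[OF k(2)] by blast
    then have "q = point t u" using bspec[OF p u(1)] z by simp
    moreover have "u \<in> closed_orthant (edge_classes t)" using closed_orthant_mono[of "edge_classes t - ?Z"] u by blast
    ultimately show "q \<in> point t ` closed_orthant (edge_classes t)" by blast
  qed
  show "card (edge_classes l) < card (edge_classes t) \<or> l = t"
  proof (cases "?Z = {}")
    case True
    then have "x \<in> open_orthant (edge_classes t)"
      using t(2) by (auto simp: closed_orthant_def open_orthant_def less_le)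
    then show ?thesis using open_points_eq(1)[OF t(1) _ l eq] by simp
  next
    case False
    have fin: "finite (edge_classes t)" by (rule finite_classes[OF t(1)])
    have "card (edge_classes l) = card (edge_classes t - ?Z)" using bij_betw_same_card[OF k(2)] kl by simp
    also have "\<dots> < card (edge_classes t)" using False fin by (intro psubset_card_mono) auto
    finally show ?thesis by simp
  qed
qed

lemma cell_subset_closed_cell: "cell (H_fan R) t \<subseteq> closed_cell (H_fan R) t"
  unfolding cell_eq closed_cell_eq using open_orthant_subset_closed by blast

lemma closed_cell_meets_cell:
  assumes t: "t \<in> R" and l: "l \<in> R" and ne: "closed_cell (H_fan R) t \<inter> cell (H_fan R) l \<noteq> {}"
  shows "closed_cell (H_fan R) l \<subseteq> closed_cell (H_fan R) t"
    "card (edge_classes l) < card (edge_classes t) \<or> l = t"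
proof -
  obtain q where "q \<in> closed_cell (H_fan R) t" "q \<in> cell (H_fan R) l" using ne by blast
  then obtain x y where xy: "x \<in> closed_orthant (edge_classes t)" "y \<in> open_orthant (edge_classes l)" "point t x = point l y"
    unfolding cell_eq closed_cell_eq by auto
  show "closed_cell (H_fan R) l \<subseteq> closed_cell (H_fan R) t"
    "card (edge_classes l) < card (edge_classes t) \<or> l = t"
    using face_of_point[OF t xy(1) l xy(2,3)] by auto
qed

lemma topspace_H_cells: "topspace (H_trop R) = (\<Union>t\<in>R. cell (H_fan R) t)"
proof (intro subset_antisym subsetI)
  fix q assume "q \<in> topspace (H_trop R)"
  then obtain t x where t: "t \<in> R" "x \<in> closed_orthant (edge_classes t)" and q: "q = point t x"
    unfolding topspace_H by blast
  obtain k b where k: "k \<in> R" "reindex (edge_classes k) b x \<in> open_orthant (edge_classes k)"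
    and p: "\<forall>z\<in>closed_orthant (edge_classes t - {c \<in> edge_classes t. x c = 0}). point t z = point k (reindex (edge_classes k) b z)"
    and x: "x \<in> closed_orthant (edge_classes t - {c \<in> edge_classes t. x c = 0})"
    by (rule point_in_open_cell[OF t])
  have "q \<in> cell (H_fan R) k" unfolding cell_eq q bspec[OF p x] using k(2) by blast
  then show "q \<in> (\<Union>t\<in>R. cell (H_fan R) t)" using k(1) by blast
next
  fix q assume "q \<in> (\<Union>t\<in>R. cell (H_fan R) t)"
  then obtain t x where "t \<in> R" "x \<in> open_orthant (edge_classes t)" "q = point t x" unfolding cell_eq by blast
  then show "q \<in> topspace (H_trop R)" unfolding topspace_H using open_orthant_subset_closed by blast
qed

lemma chart_continuous:
  assumes t: "t \<in> R"
  shows "continuous_map (orbit_space (closed_orthant (edge_classes t)) (aut_action t)) (H_trop R)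
    (\<lambda>A. same_tcurve_class R (t, A))"
proof -
  have "continuous_map (orbit_space (closed_orthant (edge_classes t)) (aut_action t)) (cell_union R) (\<lambda>A. (t, A))"
    unfolding cell_union_def using continuous_map_component_injection[OF t] .
  moreover have "continuous_map (cell_union R) (H_trop R) (same_tcurve_class R)"
    unfolding H_trop_def by (rule quotient_imp_continuous_map[OF quotient_map_quotient_topology])
  ultimately show ?thesis using continuous_map_compose[of _ "cell_union R" "\<lambda>A. (t, A)" "H_trop R" "same_tcurve_class R"]
    by (simp add: comp_def)
qed

text \<open>The chart is a continuous bijection by the description of open sets and by
  \<open>open_points_eq\<close>. The substance is that it is closed, which uses
  \<open>closed_preimage\<close>.\<close>

lemma open_chart_homeomorphic:
  assumes t: "t \<in> R"
  shows "homeomorphic_map (orbit_space (open_orthant (edge_classes t)) (aut_action t))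
    (subtopology (H_trop R) (cell (H_fan R) t)) (\<lambda>A. same_tcurve_class R (t, A))"
proof (rule bijective_closed_imp_homeomorphic_map)
  let ?O = "open_orthant (edge_classes t)" and ?C = "closed_orthant (edge_classes t)"
  let ?X = "orbit_space ?O (aut_action t)" and ?f = "\<lambda>A. same_tcurve_class R (t, A)"
  have OC: "?O \<subseteq> ?C" by (rule open_orthant_subset_closed)
  have cellsub: "cell (H_fan R) t \<subseteq> topspace (H_trop R)" using t topspace_H_cells by blast
  have fo: "?f (orbit_of (aut_action t) x) = point t x" for x by (simp add: point_def)
  show img: "?f ` topspace ?X = topspace (subtopology (H_trop R) (cell (H_fan R) t))"
    using cellsub by (simp add: topspace_orbit_space image_image fo cell_eq Int_absorb1)
  show "inj_on ?f (topspace ?X)"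
    unfolding topspace_orbit_space
  proof (rule inj_onI)
    fix A B assume "A \<in> orbit_of (aut_action t) ` ?O" "B \<in> orbit_of (aut_action t) ` ?O" and eq: "?f A = ?f B"
    then obtain x y where xy: "x \<in> ?O" "y \<in> ?O" "A = orbit_of (aut_action t) x" "B = orbit_of (aut_action t) y" by blast
    then have "point t x = point t y" using eq fo by simp
    then obtain a where a: "a \<in> aut_action t" "x = a y" using open_points_eq(2)[OF t xy(1) t xy(2)] by blast
    have "y \<in> coord_space (edge_classes t)" using xy by (simp add: open_orthant_def)
    then show "A = B" using orbit_eq[OF t a(1)] a(2) xy by simp
  qed
  show "continuous_map ?X (subtopology (H_trop R) (cell (H_fan R) t)) ?f"
  proof -
    have "continuous_map ?X (H_trop R) ?f"
      unfolding continuous_map_def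
    proof (intro conjI allI impI)
      show "?f \<in> topspace ?X \<rightarrow> topspace (H_trop R)" using img cellsub by auto
      fix U assume "openin (H_trop R) U"
      then have "openin (top_of_set ?C) {x \<in> ?C. point t x \<in> U}" using t unfolding openin_H by blast
      then obtain W where W: "open W" "{x \<in> ?C. point t x \<in> U} = ?C \<inter> W" by (auto simp: openin_open)
      have "{x \<in> ?O. point t x \<in> U} = ?O \<inter> W"
        using W(2) OC by blast
      then have "openin (top_of_set ?O) {x \<in> ?O. point t x \<in> U}" using W(1) by (auto simp: openin_open)
      moreover have "{x \<in> ?O. orbit_of (aut_action t) x \<in> {A \<in> topspace ?X. ?f A \<in> U}} = {x \<in> ?O. point t x \<in> U}"
        by (auto simp: topspace_orbit_space fo)
      ultimately show "openin ?X {A \<in> topspace ?X. ?f A \<in> U}"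
        unfolding orbit_space_def openin_quotient_topology topspace_quotient_topology by auto
    qed
    then show ?thesis using img by (auto simp: continuous_map_in_subtopology)
  qed
  show "closed_map ?X (subtopology (H_trop R) (cell (H_fan R) t)) ?f"
    unfolding closed_map_def
  proof (intro allI impI)
    fix A assume A: "closedin ?X A"
    have sub: "A \<subseteq> orbit_of (aut_action t) ` ?O" using closedin_subset[OF A] by (simp add: topspace_orbit_space)
    define D where "D = {x \<in> ?O. orbit_of (aut_action t) x \<in> A}"
    have "openin (top_of_set ?O) {x \<in> ?O. orbit_of (aut_action t) x \<in> topspace ?X - A}"
      using A unfolding closedin_def orbit_space_def openin_quotient_topology by simp
    moreover have "{x \<in> ?O. orbit_of (aut_action t) x \<in> topspace ?X - A} = ?O - D"
      by (auto simp: D_def topspace_orbit_space)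
    ultimately have "closedin (top_of_set ?O) D" unfolding closedin_def by (auto simp: D_def)
    then obtain K' where K': "closed K'" "D = ?O \<inter> K'" by (auto simp: closedin_closed)
    \<comment> \<open>A closed subset of the open orthant need not be closed in the closed orthant,
      but it is the trace of some closed \<open>K\<close>; the image of \<open>K\<close> is closed
      in the whole space.\<close>
    define K where "K = ?C \<inter> K'"
    have K: "closed K" "K \<subseteq> ?C" using K'(1) closed_closed_orthant by (auto simp: K_def)
    have W: "closedin (H_trop R) (point t ` K)"
    proof (rule closedin_H)
      show "point t ` K \<subseteq> topspace (H_trop R)" using K(2) t unfolding topspace_H by blast
      show "closed {x \<in> closed_orthant (edge_classes s). point s x \<in> point t ` K}" if "s \<in> R" for s
        by (rule closed_preimage[OF t that K])
    qed
    have "?f ` A = point t ` D"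
    proof (intro subset_antisym subsetI)
      fix q assume "q \<in> ?f ` A"
      then obtain x where x: "x \<in> ?O" "orbit_of (aut_action t) x \<in> A" "q = ?f (orbit_of (aut_action t) x)" using sub by blast
      then show "q \<in> point t ` D" by (auto simp: D_def fo)
    next
      fix q assume "q \<in> point t ` D"
      then obtain x where "x \<in> D" "q = point t x" by blast
      then show "q \<in> ?f ` A" using fo[of x] by (auto simp: D_def)
    qed
    also have "\<dots> = cell (H_fan R) t \<inter> point t ` K"
    proof (intro subset_antisym subsetI)
      fix q assume "q \<in> point t ` D"
      then show "q \<in> cell (H_fan R) t \<inter> point t ` K" using K'(2) OC by (auto simp: K_def cell_eq)
    next
      fix q assume "q \<in> cell (H_fan R) t \<inter> point t ` K"
      then obtain y x where y: "y \<in> ?O" "q = point t y" and x: "x \<in> K" "q = point t x" unfolding cell_eq by blast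
      have xC: "x \<in> ?C" using x K by blast
      \<comment> \<open>Otherwise \<open>x\<close> lies in a proper face, whose type has fewer
        classes than \<open>t\<close>, whereas its image lies in the open cell of
        \<open>t\<close>.\<close>
      have "x \<in> ?O"
      proof (rule ccontr)
        assume "x \<notin> ?O"
        let ?Z = "{c \<in> edge_classes t. x c = 0}"
        have Z: "?Z \<noteq> {}" using \<open>x \<notin> ?O\<close> xC by (auto simp: open_orthant_def closed_orthant_def less_le)
        obtain k b where k: "k \<in> R" "bij_betw b (edge_classes k) (edge_classes t - ?Z)"
            "reindex (edge_classes k) b x \<in> open_orthant (edge_classes k)"
          and p: "\<forall>z\<in>closed_orthant (edge_classes t - ?Z). point t z = point k (reindex (edge_classes k) b z)"
          and x': "x \<in> closed_orthant (edge_classes t - ?Z)"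
          by (rule point_in_open_cell[OF t xC])
        have "point k (reindex (edge_classes k) b x) = point t y" using bspec[OF p x'] x y by simp
        then have "k = t" by (rule open_points_eq(1)[OF k(1,3) t y(1)])
        then have "card (edge_classes t) = card (edge_classes t - ?Z)" using bij_betw_same_card[OF k(2)] by simp
        moreover have "card (edge_classes t - ?Z) < card (edge_classes t)"
          using Z finite_classes[OF t] by (intro psubset_card_mono) auto
        ultimately show False by simp
      qed
      then show "q \<in> point t ` D" using x K'(2) by (auto simp: K_def)
    qed
    finally show "closedin (subtopology (H_trop R) (cell (H_fan R) t)) (?f ` A)"
      using W unfolding closedin_subtopology by (auto simp: Int_commute)
  qed
qed

theorem stacky_fan_H: "stacky_fan (H_trop R) (H_fan R)"
  unfolding stacky_fan_def H_fan_simps closure_open_orthant chart_image_eq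
proof (intro conjI ballI allI impI)
  show "finite R" by (rule finR)
  fix t assume t: "t \<in> R"
  have fin: "finite (edge_classes t)" by (rule finite_classes[OF t])
  show "finite (edge_classes t)" by (rule fin)
  show "rational_open_cone (edge_classes t) (open_orthant (edge_classes t))" by (rule rational_open_cone_orthant[OF fin])
  show "lin_span (open_orthant (edge_classes t)) = coord_space (edge_classes t)" by (rule lin_span_open_orthant)
  show "subgroup (aut_action t) (BijGroup (coord_space (edge_classes t)))" by (rule aut_subgroup[OF t])
  show "aut_action t \<subseteq> GL_int (edge_classes t)" by (rule aut_GL[OF t])
  show "h ` open_orthant (edge_classes t) = open_orthant (edge_classes t)" if "h \<in> aut_action t" for h
    by (rule aut_images(1)[OF t that])
  show "continuous_map (orbit_space (closed_orthant (edge_classes t)) (aut_action t)) (H_trop R)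
      (\<lambda>A. same_tcurve_class R (t, A))"
    by (rule chart_continuous[OF t])
  show "homeomorphic_map (orbit_space (open_orthant (edge_classes t)) (aut_action t))
      (subtopology (H_trop R) (cell (H_fan R) t)) (\<lambda>A. same_tcurve_class R (t, A))"
    by (rule open_chart_homeomorphic[OF t])
next
  show "topspace (H_trop R) = (\<Union>t\<in>R. cell (H_fan R) t)" by (rule topspace_H_cells)
  show "disjoint_family_on (cell (H_fan R)) R"
    unfolding disjoint_family_on_def
  proof (intro ballI impI)
    fix t s assume t: "t \<in> R" and s: "s \<in> R" and ne: "t \<noteq> s"
    show "cell (H_fan R) t \<inter> cell (H_fan R) s = {}"
    proof (rule ccontr)
      assume "cell (H_fan R) t \<inter> cell (H_fan R) s \<noteq> {}"
      then obtain x y where "x \<in> open_orthant (edge_classes t)" "y \<in> open_orthant (edge_classes s)" "point t x = point s y"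
        unfolding cell_eq by auto
      then show False using open_points_eq(1)[OF t _ s] ne by blast
    qed
  qed
next
  fix t F assume t: "t \<in> R" and F: "cone_face (edge_classes t) (closed_orthant (edge_classes t)) F"
  obtain Z where Z: "Z \<subseteq> edge_classes t" "F = closed_orthant (edge_classes t - Z)"
    by (rule cone_face_orthant[OF finite_classes[OF t] F])
  obtain l b where l: "l \<in> R" and b: "bij_betw b (edge_classes l) (edge_classes t - Z)"
    and p: "\<forall>x\<in>closed_orthant (edge_classes t - Z). point t x = point l (reindex (edge_classes l) b x)"
    by (rule face_exists[OF t Z(1)])
  let ?L = "reindex (edge_classes l) b"
  have im: "?L ` F = closed_orthant (edge_classes l)" unfolding Z(2) by (rule reindex_images(1)[OF b])
  have span: "lin_span F = coord_space (edge_classes t - Z)" unfolding Z(2) by (rule lin_span_closed_orthant)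
  have lat: "coord_space (edge_classes t - Z) \<inter> int_lattice (edge_classes t) = int_lattice (edge_classes t - Z)"
    by (auto simp: int_lattice_def coord_space_def)
  have "point t ` F = closed_cell (H_fan R) l"
  proof -
    have "point t ` F = point l ` ?L ` F" unfolding image_image Z(2) using p by (intro image_cong) auto
    then show ?thesis unfolding im closed_cell_eq .
  qed
  moreover have "linear_map_on (lin_span F) ?L" by (rule reindex_linear)
  moreover have "bij_betw ?L (lin_span F) (coord_space (edge_classes l))" unfolding span by (rule reindex_images(4)[OF b])
  moreover have "?L ` (lin_span F \<inter> int_lattice (edge_classes t)) = int_lattice (edge_classes l)"
    unfolding span lat by (rule reindex_images(3)[OF b])
  moreover have "\<forall>x\<in>F. same_tcurve_class R (t, orbit_of (aut_action t) x) =
      same_tcurve_class R (l, orbit_of (aut_action l) (?L x))"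
    using p unfolding Z(2) point_def .
  ultimately show "\<exists>l\<in>R. point t ` F = closed_cell (H_fan R) l \<and>
      (\<exists>L. linear_map_on (lin_span F) L \<and> bij_betw L (lin_span F) (coord_space (edge_classes l)) \<and>
        L ` F = closed_orthant (edge_classes l) \<and>
        L ` (lin_span F \<inter> int_lattice (edge_classes t)) = int_lattice (edge_classes l) \<and>
        (\<forall>x\<in>F. same_tcurve_class R (t, orbit_of (aut_action t) x) = same_tcurve_class R (l, orbit_of (aut_action l) (L x))))"
    using l im by blast
next
  fix t s assume t: "t \<in> R" and s: "s \<in> R"
  let ?I = "closed_cell (H_fan R) t \<inter> closed_cell (H_fan R) s"
  \<comment> \<open>A closed cell that meets an open cell contains it, so the intersection is the
    union of the open cells it contains.\<close>
  let ?J = "{l \<in> R. cell (H_fan R) l \<subseteq> ?I}"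
  have "?I \<subseteq> (\<Union>l\<in>?J. cell (H_fan R) l)"
  proof
    fix q assume q: "q \<in> ?I"
    then have "q \<in> topspace (H_trop R)" using t unfolding closed_cell_eq topspace_H by blast
    then obtain l where l: "l \<in> R" "q \<in> cell (H_fan R) l" unfolding topspace_H_cells by blast
    have "closed_cell (H_fan R) l \<subseteq> closed_cell (H_fan R) t" "closed_cell (H_fan R) l \<subseteq> closed_cell (H_fan R) s"
      using closed_cell_meets_cell(1)[OF t l(1)] closed_cell_meets_cell(1)[OF s l(1)] q l(2) by blast+
    then have "l \<in> ?J" using l(1) cell_subset_closed_cell by blast
    then show "q \<in> (\<Union>l\<in>?J. cell (H_fan R) l)" using l(2) by blast
  qed
  then have "?I = (\<Union>l\<in>?J. cell (H_fan R) l)" by blast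
  then show "\<exists>J\<subseteq>R. ?I = (\<Union>l\<in>J. cell (H_fan R) l)" by (intro exI[of _ ?J]) auto
qed

lemma cell_dim_eq: "cell_dim (H_fan R) t = card (edge_classes t)"
  by (simp add: cell_dim_def H_fan_simps)

text \<open>The member of the family that \<open>contraction_exists\<close> provides for
  \<open>S\<close> is isomorphic to the given contraction by uniqueness, hence equal to it by
  \<open>iso_unique\<close>. A nonempty \<open>S\<close> removes at least one class.\<close>

lemma contraction_closed_cell:
  assumes t: "(G, w, r) \<in> R" and l: "(G', w', r') \<in> R" and c: "contracts p h S G w G' w'" and rS: "r `` S \<subseteq> S"
    and S: "S \<noteq> {}"
  shows "closed_cell (H_fan R) (G', w', r') \<subseteq> closed_cell (H_fan R) (G, w, r)"
    "card (edge_classes (G', w', r')) < card (edge_classes (G, w, r))"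
proof -
  have fg: "finite_graph G" by (rule type_facts(1)[OF t])
  obtain G1 w1 r1 q k where 1: "(G1, w1, r1) \<in> R" and c1: "contracts q k S G w G1 w1"
    and rr: "\<forall>d\<in>edges G - S. \<forall>e\<in>edges G - S. (k d, k e) \<in> r1 \<longleftrightarrow> (d, e) \<in> r"
    using contraction_exists[OF t contractsD(1)[OF c] rS] by blast
  obtain f g where "contracts f g {} G1 w1 G' w'" using contracts_unique[OF c1 c fg] by metis
  then have eq: "(G', w', r') = (G1, w1, r1)" using iso_unique[OF 1 l] by simp
  obtain b where b: "bij_betw b (edge_classes (G1, w1, r1)) (edge_classes (G, w, r) - S // r)"
    and bp: "\<And>x. x \<in> closed_orthant (edge_classes (G, w, r) - S // r) \<Longrightarrow>
      point (G, w, r) x = point (G1, w1, r1) (reindex (edge_classes (G1, w1, r1)) b x)"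
    using contraction_point[OF t 1 c1 rS rr] by metis
  show "closed_cell (H_fan R) (G', w', r') \<subseteq> closed_cell (H_fan R) (G, w, r)"
    unfolding closed_cell_eq eq
  proof
    fix q assume "q \<in> point (G1, w1, r1) ` closed_orthant (edge_classes (G1, w1, r1))"
    then obtain z where z: "z \<in> closed_orthant (edge_classes (G1, w1, r1))" "q = point (G1, w1, r1) z" by blast
    then obtain u where u: "u \<in> closed_orthant (edge_classes (G, w, r) - S // r)" "z = reindex (edge_classes (G1, w1, r1)) b u"
      using reindex_images(1)[OF b] by blast
    moreover have "u \<in> closed_orthant (edge_classes (G, w, r))"
      using closed_orthant_mono[OF Diff_subset] u(1) by blast
    ultimately show "q \<in> point (G, w, r) ` closed_orthant (edge_classes (G, w, r))" using bp[OF u(1)] z by blast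
  qed
  obtain e where "e \<in> S" using S by blast
  then have "r `` {e} \<in> S // r" "r `` {e} \<in> edges G // r" using contractsD(1)[OF c] by (auto intro: quotientI)
  then have "edge_classes (G, w, r) - S // r \<subset> edge_classes (G, w, r)" by auto
  then have "card (edge_classes (G, w, r) - S // r) < card (edge_classes (G, w, r))"
    by (rule psubset_card_mono[OF finite_classes[OF t]])
  then show "card (edge_classes (G', w', r')) < card (edge_classes (G, w, r))"
    using bij_betw_same_card[OF b] eq by simp
qed

end

section \<open>Expansions\<close>

lemma (in hyp_inv) valence_sigma:
  assumes v: "v \<in> V" shows "valence G (\<sigma> v) = valence G v"
proof -
  have "(\<Sum>e\<in>{e \<in> E. \<sigma> v \<in> ends G e}. if is_loop G e then 2 else 1) = (\<Sum>e\<in>{e \<in> E. v \<in> ends G e}. if is_loop G e then 2 else 1 :: nat)"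
  proof (rule sum.reindex_bij_witness[of _ \<tau> \<tau>])
    have mem: "\<sigma> u \<in> ends G (\<tau> e)" if "e \<in> E" "u \<in> ends G e" for e u using t_ends[OF that(1)] that(2) by simp
    show "\<tau> e \<in> {e \<in> E. v \<in> ends G e}" if "e \<in> {e \<in> E. \<sigma> v \<in> ends G e}" for e
      using that mem[of e "\<sigma> v"] s_s[OF v] t_in by auto
    show "\<tau> e \<in> {e \<in> E. \<sigma> v \<in> ends G e}" if "e \<in> {e \<in> E. v \<in> ends G e}" for e
      using that mem[of e v] t_in by auto
  qed (auto simp: t_t is_loop_tau)
  then show ?thesis by (simp add: valence_def)
qed

text \<open>Positive weight and positive valence already give 1 + 2. A vertex of valence 0 is the
  whole connected graph, so its weight is the genus.\<close>

lemma valence_weight_ge: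
  assumes ct: "combinatorial_type G w" and g: "3 \<le> g" "type_genus G w = int g" and v: "v \<in> verts G"
  shows "3 \<le> valence G v + 2 * w v"
proof (cases "w v = 0 \<or> 0 < valence G v")
  case True
  then show ?thesis using ct v by (auto simp: combinatorial_type_def)
next
  case False
  have fg: "finite_graph G" and cg: "connected_graph G" using ct by (auto simp: combinatorial_type_def)
  have fin: "finite (edges G)" using fg by (simp add: finite_graph_def)
  have "2 * card (inner_edges G {v}) + card (edge_cut G {v}) = 0"
    using sum_valence[OF fg, of "{v}"] v False by simp
  then have "inner_edges G {v} = {}" "edge_cut G {v} = {}"
    using fin finite_edge_cut[OF fg, of "{v}"] by (auto simp: inner_edges_def)
  then have V: "verts G = {v}" using cg v unfolding connected_graph_iff_edge_cut[OF fg] by auto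
  have "edges G = {}"
  proof (rule ccontr)
    assume "edges G \<noteq> {}"
    then obtain e where "e \<in> edges G" by blast
    then have "e \<in> inner_edges G {v}" using finite_graph_ends_sub[OF fg] V by (auto simp: inner_edges_def)
    then show False using \<open>inner_edges G {v} = {}\<close> by blast
  qed
  then have "int (w v) = int g" using g(2) V by (simp add: type_genus_def graph_genus_def)
  then show ?thesis using g(1) by simp
qed

lemma (in hyp_inv) invariant_cut_even:
  assumes A: "A \<subseteq> V" "\<sigma> ` A = A" shows "even (card (edge_cut G A))"
proof -
  have "edge_cut G A \<subseteq> M" using invariant_cut_moved[OF A(1)] A(2) by blast
  moreover have "\<tau> ` edge_cut G A \<subseteq> edge_cut G A" using cut_sigma[OF A(1)] A(2) by simp
  ultimately have "2 * card (cls ` edge_cut G A) = card (edge_cut G A)" by (rule card_cls)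
  then show ?thesis by (metis dvd_triv_left)
qed

text \<open>The vertex \<open>v\<close> is doubled into the exchanged pair \<open>v\<close>,
  \<open>s\<close>. Joining them by \<open>w v + 1\<close> flipped edges returns genus
  \<open>w v\<close> on contraction; loops at \<open>v\<close> become further flipped edges between
  them, and of two exchanged edges at \<open>v\<close> one moves to \<open>s\<close>. One vertex
  more and one fixed vertex fewer keep the count. By symmetry each copy has half the valence of
  \<open>v\<close> plus \<open>w v + 1\<close>.\<close>

lemma (in hyp_inv) split_fixed_vertex:
  fixes s :: 'v and S :: "'e set" and lt :: "'e \<Rightarrow> 'e \<Rightarrow> bool"
  assumes st: "\<And>u. u \<in> V \<Longrightarrow> w u = 0 \<Longrightarrow> 3 \<le> valence G u"
    and v: "v \<in> V" "\<sigma> v = v" "3 \<le> valence G v + 2 * w v"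
    and s: "s \<notin> V" and S: "finite S" "card S = w v + 1" "S \<inter> E = {}"
    and lt: "\<And>d e. d \<noteq> e \<Longrightarrow> lt d e \<longleftrightarrow> \<not> lt e d"
  obtains G1 :: "('v, 'e) mgraph" and w1 \<sigma>1 \<tau>1 p where
    "combinatorial_type G1 w1" "hyp_involution G1 w1 \<sigma>1 \<tau>1" "contracts p id S G1 w1 G w" "\<tau>1 ` S \<subseteq> S"
proof -
  define L where "L = {e \<in> E. ends G e = {v}}"
  \<comment> \<open>\<open>lt\<close> selects one edge of each exchanged pair at \<open>v\<close>;
    both edges of the pair meet \<open>v\<close> because \<open>v\<close> is fixed.\<close>
  define J where "J = {e \<in> M. v \<in> ends G e \<and> lt (\<tau> e) e}"
  define \<rho> where "\<rho> z = (if z = v then s else z)" for z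
  define en where "en e = (if e \<in> S \<or> e \<in> L then {v, s} else if e \<in> J then \<rho> ` ends G e else ends G e)" for e
  define G1 :: "('v, 'e) mgraph" where "G1 = \<lparr>verts = insert s V, edges = E \<union> S, ends = en\<rparr>"
  define w1 where "w1 = w(v := 0, s := 0)"
  define \<sigma>1 where "\<sigma>1 = \<sigma>(v := s, s := v)"
  define \<tau>1 where "\<tau>1 e = (if e \<in> S then e else \<tau> e)" for e
  define p where "p z = (if z = s then v else z)" for z
  have G1: "verts G1 = insert s V" "edges G1 = E \<union> S" "ends G1 = en" by (simp_all add: G1_def)
  have sv: "s \<noteq> v" using s v by auto
  have Sne: "S \<noteq> {}" using S by auto
  have nS: "e \<notin> S" if "e \<in> E" for e using S(3) that by blast
  have moved: "e \<in> M" if e: "e \<in> E" "v \<in> ends G e" "e \<notin> L" for e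
  proof (rule ccontr)
    assume "e \<notin> M"
    then have te: "\<tau> e = e" using e by (simp add: M_def)
    have "\<not> is_loop G e" using e by (auto simp: is_loop_iff L_def)
    then show False using flip[OF e(1) te _ e(2)] v(2) by simp
  qed
  have pairv: "\<exists>y. ends G e = {v, y} \<and> y \<noteq> v \<and> y \<in> V" if e: "e \<in> E" "v \<in> ends G e" "e \<notin> L" for e
  proof -
    obtain a b where ab: "ends G e = {a, b}" "a \<in> V" "b \<in> V" using fg e(1) by (rule finite_graph_ends)
    then show ?thesis using e by (cases "a = v") (auto simp: L_def)
  qed
  have en_loop: "en e = {v, s}" if "e \<in> S \<or> e \<in> L" for e using that by (simp add: en_def)
  have en_out: "en e = ends G e" if "e \<in> E" "v \<notin> ends G e" for e
    using that nS by (auto simp: en_def L_def J_def)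
  have en_J: "en e = {s, y}" if "e \<in> J" "ends G e = {v, y}" "y \<noteq> v" for e y
    using that nS[of e] by (auto simp: en_def L_def J_def M_def \<rho>_def)
  have en_nJ: "en e = {v, y}" if "e \<in> E" "e \<notin> J" "ends G e = {v, y}" "y \<noteq> v" for e y
    using that nS[of e] by (auto simp: en_def L_def)
  have pen: "p ` en e = ends G e" if e: "e \<in> E" for e
  proof (cases "v \<in> ends G e")
    case False
    have "s \<notin> ends G e" using ends_V[OF e] s by blast
    then show ?thesis using en_out[OF e False] by (auto simp: p_def)
  next
    case True
    show ?thesis
    proof (cases "e \<in> L")
      case True
      then show ?thesis using en_loop sv by (auto simp: p_def L_def)
    next
      case False
      then obtain y where y: "ends G e = {v, y}" "y \<noteq> v" "y \<in> V" using pairv[OF e True] by blast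
      have "y \<noteq> s" using y s by auto
      then show ?thesis using en_J[of e y] en_nJ[OF e, of y] y sv by (cases "e \<in> J") (auto simp: p_def)
    qed
  qed
  have pS: "p ` en e = {v}" if "e \<in> S" for e using that en_loop[of e] sv by (auto simp: p_def)
  have ensub: "en e \<subseteq> insert s V \<and> (card (en e) = 1 \<or> card (en e) = 2)" if e: "e \<in> E \<union> S" for e
  proof (cases "e \<in> S \<or> e \<in> L")
    case True
    then show ?thesis using en_loop v sv by auto
  next
    case False
    then have eE: "e \<in> E" using e by blast
    show ?thesis
    proof (cases "v \<in> ends G e")
      case True
      then obtain y where y: "ends G e = {v, y}" "y \<noteq> v" "y \<in> V" using pairv[OF eE] False by blast
      have "y \<noteq> s" using y s by auto
      then show ?thesis using en_J[of e y] en_nJ[OF eE, of y] y v sv by (cases "e \<in> J") auto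
    next
      case False
      have "card (ends G e) = 1 \<or> card (ends G e) = 2" using fg eE by (auto simp: finite_graph_def)
      then show ?thesis using en_out[OF eE False] ends_V[OF eE] by auto
    qed
  qed
  have fg1: "finite_graph G1" using ensub fV fE S(1) by (auto simp: finite_graph_def G1)
  have fib: "{x \<in> verts G1. p x = u} = (if u = v then {v, s} else {u})" if "u \<in> V" for u
    using that s v by (auto simp: G1 p_def)
  have Sfib: "{e \<in> S. p ` ends G1 e = {u}} = (if u = v then S else {})" for u
    using pS by (auto simp: G1)
  have con: "contracts p id S G1 w1 G w"
    unfolding contracts_def
  proof (intro conjI ballI allI impI)
    show "S \<subseteq> edges G1" by (simp add: G1)
    show "V = p ` verts G1" using s v by (auto simp: G1 p_def image_iff)
    show "bij_betw id (edges G1 - S) E" using S(3) by (auto simp: G1 bij_betw_def)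
    show "ends G (id e) = p ` ends G1 e" if "e \<in> edges G1 - S" for e using that pen by (auto simp: G1)
    show "\<exists>u. p ` ends G1 e = {u}" if "e \<in> S" for e using pS[OF that] by (auto simp: G1)
  next
    fix A x y assume A: "A \<subseteq> verts G1" "S \<inter> edge_cut G1 A = {}" and xy: "x \<in> A" "y \<in> verts G1" "p x = p y"
    obtain d where d: "d \<in> S" using Sne by blast
    then have "d \<notin> edge_cut G1 A" using A(2) by blast
    then have "v \<in> A \<longleftrightarrow> s \<in> A" using d en_loop[of d] by (auto simp: edge_cut_def G1)
    then show "y \<in> A" using xy by (auto simp: p_def split: if_splits)
  next
    fix u assume u: "u \<in> V"
    have "u \<noteq> s" using u s by auto
    show "w u + card {x \<in> verts G1. p x = u} = (\<Sum>x\<in>{x \<in> verts G1. p x = u}. w1 x) + card {e \<in> S. p ` ends G1 e = {u}} + 1"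
      unfolding fib[OF u] Sfib using S sv \<open>u \<noteq> s\<close> by (cases "u = v") (auto simp: w1_def)
  qed
  have cg1: "connected_graph G1" using contracts_connected[OF con fg1] cg by simp
  have sz: "\<sigma> z \<noteq> v" "\<sigma> z \<noteq> s" "\<sigma>1 z = \<sigma> z" if "z \<in> V" "z \<noteq> v" for z
  proof -
    show "\<sigma> z \<noteq> v" using s_s[OF that(1)] v(2) that(2) by auto
    show "\<sigma> z \<noteq> s" using s_in[OF that(1)] s by auto
    show "\<sigma>1 z = \<sigma> z" using that s by (auto simp: \<sigma>1_def)
  qed
  have s1v: "\<sigma>1 v = s" and s1s: "\<sigma>1 s = v" using sv by (auto simp: \<sigma>1_def)
  have tends: "en (\<tau> e) = \<sigma>1 ` en e" if e: "e \<in> E" for e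
  proof (cases "v \<in> ends G e")
    case False
    have z: "z \<in> V" "z \<noteq> v" if "z \<in> ends G e" for z using that ends_V[OF e] False by auto
    then have "v \<notin> ends G (\<tau> e)" using t_ends[OF e] sz(1) by auto
    then have "en (\<tau> e) = \<sigma> ` ends G e" using en_out[OF t_in[OF e]] t_ends[OF e] by simp
    also have "\<dots> = \<sigma>1 ` ends G e" using z sz(3) by (intro image_cong) auto
    finally show ?thesis using en_out[OF e False] by simp
  next
    case True
    show ?thesis
    proof (cases "e \<in> L")
      case True
      then have "is_loop G e" by (auto simp: L_def is_loop_iff)
      then have "\<tau> e = e" using loop_fixed e by simp
      then show ?thesis using True en_loop s1v s1s by auto
    next
      case False
      then obtain y where y: "ends G e = {v, y}" "y \<noteq> v" "y \<in> V" using pairv[OF e True] by blast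
      have eM: "e \<in> M" by (rule moved[OF e True False])
      have tM: "\<tau> e \<in> M" "\<tau> e \<noteq> e" "\<tau> e \<in> E" using t_M[OF eM] eM t_in[OF e] by (auto simp: M_def)
      have te: "ends G (\<tau> e) = {v, \<sigma> y}" using t_ends[OF e] y v(2) by simp
      have y': "\<sigma> y \<noteq> v" "\<sigma>1 y = \<sigma> y" using sz y by auto
      show ?thesis
      proof (cases "lt (\<tau> e) e")
        case True
        then have "e \<in> J" "\<tau> e \<notin> J" using eM y tM lt[of e "\<tau> e"] t_t[OF e] by (auto simp: J_def)
        then show ?thesis using en_J[of e y] en_nJ[OF tM(3), of "\<sigma> y"] y y' te s1s by simp
      next
        case False
        then have "e \<notin> J" "\<tau> e \<in> J" using te tM lt[of e "\<tau> e"] t_t[OF e] by (auto simp: J_def)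
        then show ?thesis using en_nJ[OF e, of y] en_J[of "\<tau> e" "\<sigma> y"] y y' te s1v by simp
      qed
    qed
  qed
  have hyp: "hyp_involution G1 w1 \<sigma>1 \<tau>1"
    unfolding hyp_involution_def
  proof (intro conjI ballI)
    fix u assume u: "u \<in> verts G1"
    consider "u = v" | "u = s" | "u \<in> V" "u \<noteq> v" "u \<noteq> s" using u s by (auto simp: G1)
    then have "\<sigma>1 u \<in> verts G1 \<and> \<sigma>1 (\<sigma>1 u) = u \<and> (0 < w1 u \<longrightarrow> \<sigma>1 u = u)"
    proof cases
      case 3
      have "\<sigma>1 (\<sigma> u) = \<sigma> (\<sigma> u)" using sz(3)[of "\<sigma> u"] s_in 3 sz(1) by simp
      then show ?thesis using 3 sz(3)[of u] s_in s_s w_s by (auto simp: G1 w1_def)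
    qed (use v sv s1v s1s in \<open>auto simp: G1 w1_def\<close>)
    then show "\<sigma>1 u \<in> verts G1" "\<sigma>1 (\<sigma>1 u) = u" "0 < w1 u \<longrightarrow> \<sigma>1 u = u" by auto
  next
    fix e assume e: "e \<in> edges G1"
    show "\<tau>1 e \<in> edges G1" "\<tau>1 (\<tau>1 e) = e" using e t_in t_t nS by (auto simp: G1 \<tau>1_def)
    show "ends G1 (\<tau>1 e) = \<sigma>1 ` ends G1 e"
    proof (cases "e \<in> S")
      case True
      then show ?thesis using en_loop s1v s1s by (auto simp: G1 \<tau>1_def)
    next
      case False
      then show ?thesis using e tends by (simp add: G1 \<tau>1_def)
    qed
    show "is_loop G1 e \<longrightarrow> \<tau>1 e = e"
    proof
      assume l: "is_loop G1 e"
      show "\<tau>1 e = e"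
      proof (cases "e \<in> S")
        case False
        then have eE: "e \<in> E" using e by (simp add: G1)
        obtain z where "en e = {z}" using l by (auto simp: is_loop_iff G1)
        then have "ends G e = {p z}" using pen[OF eE] by simp
        then have "is_loop G e" by (auto simp: is_loop_iff)
        then show ?thesis using loop_fixed[OF eE] False by (simp add: \<tau>1_def)
      qed (simp add: \<tau>1_def)
    qed
    show "\<tau>1 e = e \<longrightarrow> \<not> is_loop G1 e \<longrightarrow> (\<forall>z\<in>ends G1 e. \<sigma>1 z \<noteq> z)"
    proof (intro impI ballI)
      fix z assume te: "\<tau>1 e = e" and nl: "\<not> is_loop G1 e" and z: "z \<in> ends G1 e"
      show "\<sigma>1 z \<noteq> z"
      proof (cases "e \<in> S \<or> e \<in> L")
        case True
        then show ?thesis using z en_loop s1v s1s sv by (auto simp: G1)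
      next
        case False
        then have eE: "e \<in> E" and tee: "\<tau> e = e" using e te by (auto simp: G1 \<tau>1_def)
        have nv: "v \<notin> ends G e" using moved[OF eE] False tee by (auto simp: M_def)
        then have ee: "ends G1 e = ends G e" using en_out[OF eE] by (simp add: G1)
        then have "\<not> is_loop G e" using nl by (simp add: is_loop_def)
        then have "\<sigma> z \<noteq> z" using flip[OF eE tee] z ee by simp
        moreover have "z \<in> V" "z \<noteq> v" using z ee ends_V[OF eE] nv by auto
        ultimately show ?thesis using sz(3) by simp
      qed
    qed
  next
    have "{e \<in> edges G1. \<tau>1 e \<noteq> e} = M" using nS by (auto simp: G1 \<tau>1_def M_def)
    moreover have "{u \<in> verts G1. \<sigma>1 u = u} = {u \<in> V. \<sigma> u = u} - {v}"
    proof -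
      have "\<sigma>1 u = u \<longleftrightarrow> u \<in> V \<and> \<sigma> u = u \<and> u \<noteq> v" if u: "u \<in> insert s V" for u
      proof -
        consider "u = v" | "u = s" | "u \<in> V" "u \<noteq> v" using u by auto
        then show ?thesis using s1v s1s sv s sz(3)[of u] by cases simp_all
      qed
      then show ?thesis unfolding G1 by blast
    qed
    moreover have "card ({u \<in> V. \<sigma> u = u} - {v}) + 1 = card {u \<in> V. \<sigma> u = u}"
      using card_Suc_Diff1[of "{u \<in> V. \<sigma> u = u}" v] fV v by simp
    moreover have "card (verts G1) = card V + 1" using fV s by (simp add: G1)
    ultimately show "card {e \<in> edges G1. \<tau>1 e \<noteq> e} + 2 = card (verts G1) + card {u \<in> verts G1. \<sigma>1 u = u}"
      using count by simp
  qed
  interpret I: hyp_inv G1 w1 \<sigma>1 \<tau>1 using fg1 cg1 hyp by unfold_locales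
  have "3 \<le> valence G1 u" if u: "u \<in> verts G1" "w1 u = 0" for u
  proof (cases "u = v \<or> u = s")
    case False
    then have uV: "u \<in> V" and w0: "w u = 0" using u by (auto simp: G1 w1_def)
    have "valence G1 u = valence G u"
      using contracts_valence[OF con fg1 uV] False unfolding fib[OF uV] Sfib by simp
    then show ?thesis using st[OF uV w0] by simp
  next
    case True
    have "valence G1 v + valence G1 s = valence G v + 2 * card S"
      using contracts_valence[OF con fg1 v(1)] sv unfolding fib[OF v(1)] Sfib by simp
    moreover have "valence G1 s = valence G1 v" using I.valence_sigma[of v] s1v v by (simp add: G1)
    ultimately have 2: "2 * valence G1 v = valence G v + 2 * (w v + 1)" using S(2) by simp
    \<comment> \<open>Moved edges leave the invariant set \<open>{v}\<close> in pairs and loops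
      count twice, so the valence is even. Parity raises the bound 3 to 4, which is what valence 3
      at both copies requires.\<close>
    have "even (card (edge_cut G {v}))" using invariant_cut_even[of "{v}"] v by simp
    then have "even (valence G v)" using sum_valence[OF fg, of "{v}"] v by simp
    then have "4 \<le> valence G v + 2 * w v" using v(3) by presburger
    then have "3 \<le> valence G1 v" using 2 by simp
    then show ?thesis using True \<open>valence G1 s = valence G1 v\<close> by auto
  qed
  then have "combinatorial_type G1 w1" using fg1 cg1 by (simp add: combinatorial_type_def)
  then show ?thesis using hyp con by (rule that) (auto simp: \<tau>1_def)
qed

lemma valence_no_loops:
  assumes "\<And>e. e \<in> edges G \<Longrightarrow> \<not> is_loop G e"
  shows "valence G x = card {e \<in> edges G. x \<in> ends G e}"
  unfolding valence_def using assms by simp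

text \<open>A free involution leaves neither loops nor weights. Two edges at \<open>x\<close> are
  moved to a new vertex \<open>x2\<close> joined to \<open>x\<close> by \<open>n1\<close>, and
  symmetrically at the image of \<open>x\<close>. Then \<open>x2\<close> has valence 3 and
  \<open>x\<close> loses one from at least 4; two new moved edges balance two new vertices in the
  count.\<close>

lemma (in hyp_inv) split_vertex_pair:
  fixes x2 y2 :: 'v and n1 n2 :: 'e
  assumes st: "\<And>u. u \<in> V \<Longrightarrow> w u = 0 \<Longrightarrow> 3 \<le> valence G u"
    and free: "\<And>u. u \<in> V \<Longrightarrow> \<sigma> u \<noteq> u" and x: "x \<in> V" "4 \<le> valence G x"
    and x2: "x2 \<notin> V" "y2 \<notin> V" "x2 \<noteq> y2" and n: "n1 \<notin> E" "n2 \<notin> E" "n1 \<noteq> n2"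
  obtains G1 :: "('v, 'e) mgraph" and w1 \<sigma>1 \<tau>1 p where
    "combinatorial_type G1 w1" "hyp_involution G1 w1 \<sigma>1 \<tau>1" "contracts p id {n1, n2} G1 w1 G w" "\<tau>1 ` {n1, n2} \<subseteq> {n1, n2}"
proof -
  have noloop: "\<not> is_loop G e" if e: "e \<in> E" for e
  proof
    assume l: "is_loop G e"
    then obtain z where z: "ends G e = {z}" by (auto simp: is_loop_iff)
    have "\<sigma> z = z" using t_ends[OF e] loop_fixed[OF e l] z by simp
    then show False using free[of z] ends_V[OF e] z by auto
  qed
  have w0: "w u = 0" if "u \<in> V" for u using w_s[OF that] free[OF that] by auto
  define y where "y = \<sigma> x"
  have y: "y \<in> V" "y \<noteq> x" "\<sigma> y = x" using x free s_in s_s by (auto simp: y_def)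
  define I where "I = {e \<in> E. x \<in> ends G e}"
  have cI: "card I = valence G x" using valence_no_loops[OF noloop] by (simp add: I_def)
  then obtain I2 where I2: "I2 \<subseteq> I" "card I2 = 2" using x(2) obtain_subset_with_card_n[of 2 I] by auto
  have fI2: "finite I2" using I2(2) by (simp add: card_ge_0_finite)
  \<comment> \<open>Closing the two chosen edges under \<open>\<tau>\<close> makes the change of
    ends commute with the involution. An edge joining \<open>x\<close> to its image has both ends
    moved.\<close>
  define J where "J = I2 \<union> \<tau> ` I2"
  have JE: "J \<subseteq> E" using I2 t_in by (auto simp: J_def I_def)
  have tJ: "\<tau> e \<in> J \<longleftrightarrow> e \<in> J" if e: "e \<in> E" for e
  proof -
    have "\<tau> d \<in> J" if d: "d \<in> J" for d
    proof (cases "d \<in> I2")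
      case False
      then obtain c where "c \<in> I2" "d = \<tau> c" using d by (auto simp: J_def)
      then show ?thesis using t_t[of c] I2(1) by (auto simp: J_def I_def)
    qed (simp add: J_def)
    from this[of e] this[of "\<tau> e"] show ?thesis using t_t[OF e] by auto
  qed
  \<comment> \<open>If the image of a chosen edge \<open>c\<close> also meets \<open>x\<close>, then
    \<open>c\<close> joins \<open>x\<close> to its image; a moved edge cannot do that, so
    \<open>c\<close> is fixed and its image is \<open>c\<close> itself. Hence only the two chosen
    edges leave \<open>x\<close>.\<close>
  have JI: "e \<in> I2" if e: "e \<in> J" "x \<in> ends G e" for e
  proof (cases "e \<in> I2")
    case False
    then obtain c where c: "c \<in> I2" "e = \<tau> c" using e by (auto simp: J_def)
    have cE: "c \<in> E" "x \<in> ends G c" using c I2 by (auto simp: I_def)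
    obtain z where z: "z \<in> ends G c" "x = \<sigma> z" using e(2) c t_ends[OF cE(1)] by auto
    have "z \<in> V" using z ends_V[OF cE(1)] by auto
    then have "z = y" using z s_s by (auto simp: y_def)
    then have "ends G c = {x, y}"
      using finite_graph_ends_pair[OF fg cE(1)] cE(2) z(1) y(2) by auto
    then have "c \<notin> M" using moved_ends_distinct_orbits[of c x y] y by (auto simp: orb_def y_def)
    then have "\<tau> c = c" using cE by (simp add: M_def)
    then show ?thesis using c by simp
  qed simp
  define \<rho> where "\<rho> z = (if z = x then x2 else if z = y then y2 else z)" for z
  define en where "en e = (if e = n1 then {x, x2} else if e = n2 then {y, y2} else if e \<in> J then \<rho> ` ends G e else ends G e)" for e
  define G1 :: "('v, 'e) mgraph" where "G1 = \<lparr>verts = V \<union> {x2, y2}, edges = E \<union> {n1, n2}, ends = en\<rparr>"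
  define w1 :: "'v \<Rightarrow> nat" where "w1 = (\<lambda>_. 0)"
  define \<sigma>1 where "\<sigma>1 z = (if z = x2 then y2 else if z = y2 then x2 else \<sigma> z)" for z
  define \<tau>1 where "\<tau>1 e = (if e = n1 then n2 else if e = n2 then n1 else \<tau> e)" for e
  define p where "p z = (if z = x2 then x else if z = y2 then y else z)" for z
  have G1: "verts G1 = V \<union> {x2, y2}" "edges G1 = E \<union> {n1, n2}" "ends G1 = en" by (simp_all add: G1_def)
  have ne: "x \<noteq> x2" "x \<noteq> y2" "y \<noteq> x2" "y \<noteq> y2" using x y x2 by auto
  have enE: "en e = (if e \<in> J then \<rho> ` ends G e else ends G e)" if "e \<in> E" for e using that n by (auto simp: en_def)
  have en1: "en n1 = {x, x2}" and en2: "en n2 = {y, y2}" using n by (auto simp: en_def)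
  have pr: "p (\<rho> z) = z" "p z = z" if "z \<in> V" for z using that x2 by (auto simp: p_def \<rho>_def)
  have rV: "\<rho> z \<in> V \<union> {x2, y2}" if "z \<in> V" for z using that by (simp add: \<rho>_def)
  have pen: "p ` en e = ends G e" if e: "e \<in> E" for e
  proof -
    have "p ` \<rho> ` ends G e = ends G e" "p ` ends G e = ends G e"
      using pr ends_V[OF e] by (force simp: image_image)+
    then show ?thesis using enE[OF e] by simp
  qed
  have noloop1: "\<exists>a b. en e = {a, b} \<and> a \<noteq> b \<and> a \<in> verts G1 \<and> b \<in> verts G1" if e: "e \<in> edges G1" for e
  proof (cases "e \<in> E")
    case True
    obtain a b where ab: "ends G e = {a, b}" "a \<in> V" "b \<in> V" using fg True by (rule finite_graph_ends)
    have "a \<noteq> b" using noloop[OF True] ab by (auto simp: is_loop_def)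
    moreover from this have "\<rho> a \<noteq> \<rho> b" using pr(1)[OF ab(2)] pr(1)[OF ab(3)] by metis
    ultimately show ?thesis
    proof (cases "e \<in> J")
      case True
      then show ?thesis using enE[OF \<open>e \<in> E\<close>] ab rV \<open>\<rho> a \<noteq> \<rho> b\<close>
        by (intro exI[of _ "\<rho> a"] exI[of _ "\<rho> b"]) (simp add: G1)
    next
      case False
      then show ?thesis using enE[OF \<open>e \<in> E\<close>] ab \<open>a \<noteq> b\<close>
        by (intro exI[of _ a] exI[of _ b]) (simp add: G1)
    qed
  next
    case False
    then show ?thesis using e en1 en2 ne x y by (auto simp: G1)
  qed
  have fg1: "finite_graph G1"
  proof -
    have "en e \<subseteq> verts G1 \<and> card (en e) = 2" if e: "e \<in> edges G1" for e using noloop1[OF e] by auto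
    then show ?thesis using fV fE by (simp add: finite_graph_def G1)
  qed
  have nl1: "\<not> is_loop G1 e" if e: "e \<in> edges G1" for e
  proof -
    obtain a b where "en e = {a, b}" "a \<noteq> b" using noloop1[OF e] by blast
    then show ?thesis by (simp add: is_loop_def G1)
  qed
  have fib: "{z \<in> verts G1. p z = u} = (if u = x then {x, x2} else if u = y then {y, y2} else {u})" if "u \<in> V" for u
    using that x y x2 by (auto simp: G1 p_def)
  have Sfib: "{e \<in> {n1, n2}. p ` ends G1 e = {u}} = (if u = x then {n1} else if u = y then {n2} else {})" for u
  proof -
    have "p ` ends G1 n1 = {x}" "p ` ends G1 n2 = {y}" using en1 en2 ne x2 by (auto simp: G1 p_def)
    then show ?thesis using y by auto
  qed
  have con: "contracts p id {n1, n2} G1 w1 G w"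
    unfolding contracts_def
  proof (intro conjI ballI allI impI)
    show "{n1, n2} \<subseteq> edges G1" by (simp add: G1)
    show "V = p ` verts G1" using x y x2 by (auto simp: G1 p_def image_iff)
    show "bij_betw id (edges G1 - {n1, n2}) E" using n by (auto simp: G1 bij_betw_def)
    show "ends G (id e) = p ` ends G1 e" if "e \<in> edges G1 - {n1, n2}" for e using that pen by (auto simp: G1)
    show "\<exists>u. p ` ends G1 e = {u}" if "e \<in> {n1, n2}" for e using that en1 en2 ne x2 by (auto simp: G1 p_def)
  next
    fix A a b assume A: "A \<subseteq> verts G1" "{n1, n2} \<inter> edge_cut G1 A = {}" and ab: "a \<in> A" "b \<in> verts G1" "p a = p b"
    have "n1 \<notin> edge_cut G1 A" "n2 \<notin> edge_cut G1 A" using A(2) by blast+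
    then have "x \<in> A \<longleftrightarrow> x2 \<in> A" "y \<in> A \<longleftrightarrow> y2 \<in> A" using en1 en2 by (auto simp: edge_cut_def G1)
    then show "b \<in> A" using ab y by (auto simp: p_def split: if_splits)
  next
    fix u assume u: "u \<in> V"
    show "w u + card {z \<in> verts G1. p z = u} = (\<Sum>z\<in>{z \<in> verts G1. p z = u}. w1 z) + card {e \<in> {n1, n2}. p ` ends G1 e = {u}} + 1"
      unfolding fib[OF u] Sfib using ne y w0[OF u] by (auto simp: w1_def)
  qed
  have cg1: "connected_graph G1" using contracts_connected[OF con fg1] cg by simp
  have s1V: "\<sigma>1 z = \<sigma> z" if "z \<in> V" for z using that x2 by (auto simp: \<sigma>1_def)
  have sr: "\<sigma>1 (\<rho> z) = \<rho> (\<sigma> z)" if z: "z \<in> V" for z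
  proof -
    consider "z = x" | "z = y" | "z \<noteq> x" "z \<noteq> y" by blast
    then show ?thesis
    proof cases
      case 3
      have "\<sigma> z \<noteq> x" "\<sigma> z \<noteq> y" using 3 s_s[OF z] y by (auto simp: y_def)
      then show ?thesis using 3 s1V[OF z] by (simp add: \<rho>_def)
    qed (use y x2 in \<open>auto simp: \<rho>_def \<sigma>1_def y_def\<close>)
  qed
  have hyp: "hyp_involution G1 w1 \<sigma>1 \<tau>1"
    unfolding hyp_involution_def
  proof (intro conjI ballI)
    fix u assume u: "u \<in> verts G1"
    show "\<sigma>1 u \<in> verts G1" "\<sigma>1 (\<sigma>1 u) = u" using u s_in s_s x2 by (auto simp: G1 \<sigma>1_def)
    show "0 < w1 u \<longrightarrow> \<sigma>1 u = u" by (simp add: w1_def)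
  next
    fix e assume e: "e \<in> edges G1"
    show "\<tau>1 e \<in> edges G1" "\<tau>1 (\<tau>1 e) = e" using e t_in t_t n by (auto simp: G1 \<tau>1_def)
    show "is_loop G1 e \<longrightarrow> \<tau>1 e = e" using nl1[OF e] by simp
    show "ends G1 (\<tau>1 e) = \<sigma>1 ` ends G1 e"
    proof (cases "e \<in> E")
      case True
      have "\<tau>1 e = \<tau> e" using True n by (auto simp: \<tau>1_def)
      moreover have "\<rho> ` \<sigma> ` ends G e = \<sigma>1 ` \<rho> ` ends G e" "\<sigma> ` ends G e = \<sigma>1 ` ends G e"
        using sr s1V ends_V[OF True] by (auto simp: image_image intro!: image_cong)
      ultimately show ?thesis using enE[OF True] enE[OF t_in[OF True]] tJ[OF True] t_ends[OF True] by (simp add: G1)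
    next
      case False
      have "\<sigma>1 x = y" "\<sigma>1 y = x" "\<sigma>1 x2 = y2" "\<sigma>1 y2 = x2" using s1V x y x2 by (auto simp: y_def \<sigma>1_def)
      then show ?thesis using False e en1 en2 n by (auto simp: G1 \<tau>1_def)
    qed
    show "\<tau>1 e = e \<longrightarrow> \<not> is_loop G1 e \<longrightarrow> (\<forall>z\<in>ends G1 e. \<sigma>1 z \<noteq> z)"
    proof (intro impI ballI)
      fix z assume "z \<in> ends G1 e"
      then have "z \<in> verts G1" using finite_graph_ends_sub[OF fg1 e] by blast
      then show "\<sigma>1 z \<noteq> z" using free x2 by (auto simp: G1 \<sigma>1_def)
    qed
  next
    have "{e \<in> edges G1. \<tau>1 e \<noteq> e} = M \<union> {n1, n2}" using n by (auto simp: G1 \<tau>1_def M_def)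
    moreover have "card (M \<union> {n1, n2}) = card M + 2"
      using n fM by (subst card_Un_disjoint) (auto simp: M_def)
    moreover have e1: "{u \<in> verts G1. \<sigma>1 u = u} = {}" using free x2 by (auto simp: G1 \<sigma>1_def)
    moreover have e2: "{u \<in> V. \<sigma> u = u} = {}" using free by auto
    moreover have "card (verts G1) = card V + 2" unfolding G1 using fV x2 by (subst card_Un_disjoint) auto
    ultimately show "card {e \<in> edges G1. \<tau>1 e \<noteq> e} + 2 = card (verts G1) + card {u \<in> verts G1. \<sigma>1 u = u}"
      using count unfolding e1 e2 by simp
  qed
  interpret I: hyp_inv G1 w1 \<sigma>1 \<tau>1 using fg1 cg1 hyp by unfold_locales
  have vx2: "valence G1 x2 = 3"
  proof -
    have x2en: "x2 \<in> en e \<longleftrightarrow> e \<in> J \<and> x \<in> ends G e" if e: "e \<in> E" for e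
    proof -
      have "x2 \<notin> ends G e" "\<And>z. z \<in> ends G e \<Longrightarrow> z \<noteq> x2" using ends_V[OF e] x2 by auto
      then show ?thesis using enE[OF e] x2 by (auto simp: \<rho>_def image_iff)
    qed
    have "{e \<in> edges G1. x2 \<in> ends G1 e} = insert n1 I2"
    proof (intro subset_antisym subsetI)
      fix e assume "e \<in> {e \<in> edges G1. x2 \<in> ends G1 e}"
      then show "e \<in> insert n1 I2" using x2en[of e] JI[of e] en2 ne x2 by (auto simp: G1)
    next
      fix e assume "e \<in> insert n1 I2"
      then show "e \<in> {e \<in> edges G1. x2 \<in> ends G1 e}" using x2en[of e] I2(1) en1 by (auto simp: G1 I_def J_def)
    qed
    moreover have "n1 \<notin> I2" using I2 n by (auto simp: I_def)
    ultimately show ?thesis using valence_no_loops[OF nl1, of x2] I2(2) fI2 by simp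
  qed
  have "valence G1 x + valence G1 x2 = valence G x + 2"
    using contracts_valence[OF con fg1 x(1)] ne unfolding fib[OF x(1)] Sfib by simp
  then have vx: "3 \<le> valence G1 x" using vx2 x(2) by simp
  have "3 \<le> valence G1 u" if u: "u \<in> verts G1" for u
  proof -
    consider "u = x" | "u = y" | "u = x2" | "u = y2" | "u \<in> V" "u \<noteq> x" "u \<noteq> y" using u by (auto simp: G1)
    then show ?thesis
    proof cases
      case 2
      have "valence G1 (\<sigma>1 x) = valence G1 x" by (rule I.valence_sigma) (use x in \<open>simp add: G1\<close>)
      then show ?thesis using 2 vx s1V[OF x(1)] by (simp add: y_def)
    next
      case 4
      have "valence G1 (\<sigma>1 x2) = valence G1 x2" by (rule I.valence_sigma) (simp add: G1)
      then show ?thesis using 4 vx2 by (simp add: \<sigma>1_def)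
    next
      case 5
      have "valence G1 u = valence G u"
        using contracts_valence[OF con fg1 5(1)] 5 unfolding fib[OF 5(1)] Sfib by simp
      then show ?thesis using st[OF 5(1) w0[OF 5(1)]] by simp
    qed (use vx vx2 in auto)
  qed
  then have "combinatorial_type G1 w1" using fg1 cg1 by (simp add: combinatorial_type_def)
  then show ?thesis using hyp con by (rule that) (auto simp: \<tau>1_def)
qed

lemma expansion_exists:
  fixes G :: "(nat, nat) mgraph"
  assumes ct: "combinatorial_type G w" and inv: "hyp_involution G w \<sigma> \<tau>"
    and g: "3 \<le> g" "type_genus G w = int g"
    and ng: "\<not> (\<forall>v\<in>verts G. \<sigma> v \<noteq> v \<and> valence G v = 3)"
  obtains G1 :: "(nat, nat) mgraph" and w1 \<sigma>1 \<tau>1 p S where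
    "combinatorial_type G1 w1" "hyp_involution G1 w1 \<sigma>1 \<tau>1" "contracts p id S G1 w1 G w" "\<tau>1 ` S \<subseteq> S" "S \<noteq> {}"
proof -
  have fg: "finite_graph G" and cg: "connected_graph G" using ct by (auto simp: combinatorial_type_def)
  interpret I: hyp_inv G w \<sigma> \<tau> using fg cg inv by unfold_locales
  have st: "3 \<le> valence G v" if "v \<in> verts G" "w v = 0" for v using ct that by (simp add: combinatorial_type_def)
  show ?thesis
  proof (cases "\<exists>v\<in>verts G. \<sigma> v = v")
    case True
    then obtain v where v: "v \<in> verts G" "\<sigma> v = v" by blast
    obtain s where s: "s \<notin> verts G" using ex_new_if_finite[OF infinite_UNIV_nat I.fV] by blast
    have "infinite (- edges G)" using I.fE by (simp add: finite_compl)
    then obtain S where S: "finite S" "card S = w v + 1" "S \<subseteq> - edges G" using infinite_arbitrarily_large by blast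
    have S3: "S \<inter> edges G = {}" "S \<noteq> {}" using S by auto
    show ?thesis
      by (rule I.split_fixed_vertex[of v s S "(<)", OF st v valence_weight_ge[OF ct g v(1)] s S(1,2) S3(1)])
        (use that S3(2) in auto)
  next
    case False
    then have free: "\<sigma> v \<noteq> v" if "v \<in> verts G" for v using that by blast
    have w0: "w v = 0" if "v \<in> verts G" for v using I.w_s[OF that] free[OF that] by auto
    obtain x where x: "x \<in> verts G" "valence G x \<noteq> 3" using ng free by blast
    then have x4: "4 \<le> valence G x" using st[OF x(1) w0[OF x(1)]] by simp
    have "infinite (- verts G)" "infinite (- edges G)" using I.fV I.fE by (simp_all add: finite_compl)
    then obtain X N where X: "X \<subseteq> - verts G" "card X = 2" and N: "N \<subseteq> - edges G" "card N = 2"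
      using infinite_arbitrarily_large by metis
    obtain x2 y2 where xy: "X = {x2, y2}" "x2 \<noteq> y2" using X(2) by (meson card_2_iff)
    obtain n1 n2 where n: "N = {n1, n2}" "n1 \<noteq> n2" using N(2) by (meson card_2_iff)
    show ?thesis
      by (rule I.split_vertex_pair[OF st free x(1) x4, of x2 y2 n1 n2]) (use that X N xy n in auto)
  qed
qed

section \<open>Ladders\<close>

text \<open>A tree vertex of valence 1, 2 or 3 gets two, one or no rungs, indexed by booleans, which
  completes it to valence 3.\<close>

lemma card_rungs:
  assumes "1 \<le> n" "n \<le> 3" shows "n + card {b. n = 1 \<or> n = (2 :: nat) \<and> \<not> b} = 3"
proof -
  have f: "{b. \<not> b} = {False}" by auto
  consider "n = 1" | "n = 2" | "n = 3" using assms by linarith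
  then show ?thesis by cases (simp_all add: f card_UNIV_bool)
qed

lemma edge_cut_Int_uncrossed:
  "F \<inter> edge_cut G A = {} \<Longrightarrow> F \<inter> edge_cut G B = {} \<Longrightarrow> F \<inter> edge_cut G (A \<inter> B) = {}"
  by (auto simp: edge_cut_def)

lemma edge_cut_Diff_uncrossed:
  "F \<inter> edge_cut G A = {} \<Longrightarrow> F \<inter> edge_cut G B = {} \<Longrightarrow> F \<inter> edge_cut G (A - B) = {}"
  by (fastforce simp: edge_cut_def)

text \<open>The vertices reachable from a vertex by moved edges form one of two sheets exchanged by
  the involution, and the subgraph on this sheet is the quotient tree.\<close>

lemma (in hyp_inv) sheet_exists:
  assumes free: "\<And>v. v \<in> V \<Longrightarrow> \<sigma> v \<noteq> v"
  obtains A where "A \<subseteq> V" "A \<inter> \<sigma> ` A = {}" "V = A \<union> \<sigma> ` A" "M = inner_edges G A \<union> \<tau> ` inner_edges G A"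
    "tree_graph \<lparr>verts = A, edges = inner_edges G A, ends = ends G\<rparr>"
proof -
  have "V \<noteq> {}" using cg by (simp add: connected_graph_def)
  then obtain x0 where x0: "x0 \<in> V" by blast
  \<comment> \<open>The least set containing \<open>x0\<close> that no moved edge crosses, that is,
    the component of \<open>x0\<close> under the moved edges.\<close>
  define A where "A = \<Inter>{B. B \<subseteq> V \<and> x0 \<in> B \<and> M \<inter> edge_cut G B = {}}"
  have VV: "V \<in> {B. B \<subseteq> V \<and> x0 \<in> B \<and> M \<inter> edge_cut G B = {}}"
    using x0 ends_V by (auto simp: edge_cut_def)
  have AV: "A \<subseteq> V" using VV by (auto simp: A_def)
  have xA: "x0 \<in> A" by (auto simp: A_def)
  have Amin: "A \<subseteq> B" if "B \<subseteq> V" "x0 \<in> B" "M \<inter> edge_cut G B = {}" for B using that by (auto simp: A_def)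
  have Aun: "M \<inter> edge_cut G A = {}"
  proof (rule ccontr)
    assume "M \<inter> edge_cut G A \<noteq> {}"
    then obtain e u v where e: "e \<in> M" "u \<in> ends G e" "u \<in> A" "v \<in> ends G e" "v \<notin> A" by (auto simp: edge_cut_def)
    then obtain B where B: "B \<subseteq> V" "x0 \<in> B" "M \<inter> edge_cut G B = {}" "v \<notin> B" by (auto simp: A_def)
    have "u \<in> B" using Amin[OF B(1-3)] e(3) by blast
    then have "e \<in> edge_cut G B" using e B(4) by (auto simp: edge_cut_def M_def)
    then show False using B(3) e(1) by blast
  qed
  have sAV: "\<sigma> ` A \<subseteq> V" using AV s_in by auto
  have sAun: "M \<inter> edge_cut G (\<sigma> ` A) = {}"
  proof (rule ccontr)
    assume "M \<inter> edge_cut G (\<sigma> ` A) \<noteq> {}"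
    then obtain e where e: "e \<in> M" "e \<in> \<tau> ` edge_cut G A" using cut_sigma[OF AV] by blast
    then obtain d where d: "d \<in> edge_cut G A" "e = \<tau> d" by blast
    then have "d \<in> M" using e(1) t_t[of d] by (auto simp: M_def edge_cut_def)
    then show False using d(1) Aun by blast
  qed
  have ssA: "\<sigma> ` \<sigma> ` A = A"
    unfolding image_image using s_s AV by (metis (no_types, lifting) image_cong image_ident subsetD)
  have disj: "A \<inter> \<sigma> ` A = {}"
  proof (cases "x0 \<in> \<sigma> ` A")
    case False
    have "A \<subseteq> A - \<sigma> ` A"
      using edge_cut_Diff_uncrossed[OF Aun sAun] AV xA False by (intro Amin) auto
    then show ?thesis by blast
  next
    case True
    have "A \<subseteq> A \<inter> \<sigma> ` A"
      using edge_cut_Int_uncrossed[OF Aun sAun] AV xA True by (intro Amin) auto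
    then have sub: "A \<subseteq> \<sigma> ` A" by blast
    then have "\<sigma> ` A \<subseteq> A" using image_mono[of A "\<sigma> ` A" \<sigma>] ssA by simp
    then have "edge_cut G A = {}" using invariant_cut_moved[OF AV] Aun by blast
    then have "A = V" using connected_cut[OF AV] xA by auto
    \<comment> \<open>If \<open>x0\<close> lay in the mirror image of its component, that component
      would be invariant and therefore all of \<open>V\<close>, so moved edges alone would connect
      \<open>V\<close>. Without fixed vertices, however, |V| = |M| + 2.\<close>
    have "card V \<le> card M + 1"
    proof (rule card_le_card_connecting[where en = "ends G"])
      fix B assume B: "B \<subseteq> V" "B \<noteq> {}" "B \<noteq> V"
      have "M \<inter> edge_cut G B \<noteq> {}"
      proof
        assume no: "M \<inter> edge_cut G B = {}"
        have no': "M \<inter> edge_cut G (A - B) = {}" by (rule edge_cut_Diff_uncrossed[OF Aun no])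
        show False
        proof (cases "x0 \<in> B")
          case True
          then show False using Amin[OF B(1) _ no] B \<open>A = V\<close> by blast
        next
          case False
          then show False using Amin[of "A - B"] no' AV xA B \<open>A = V\<close> by blast
        qed
      qed
      then obtain e where "e \<in> M" "e \<in> edge_cut G B" by blast
      then show "\<exists>e\<in>M. ends G e \<inter> B \<noteq> {} \<and> ends G e \<inter> (V - B) \<noteq> {}"
        using edge_cut_crossing[OF fg] by blast
    next
      show "\<exists>a b. ends G e = {a, b}" if "e \<in> M" for e
        using finite_graph_ends_pair[OF fg, of e] that by (simp add: M_def)
    qed (use fV fM in auto)
    moreover have e0: "{v \<in> V. \<sigma> v = v} = {}" using free by auto
    ultimately show ?thesis using count unfolding e0 by simp
  qed
  have un: "V = A \<union> \<sigma> ` A"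
  proof -
    have sub: "A \<union> \<sigma> ` A \<subseteq> V" using AV sAV by blast
    have "\<sigma> ` (A \<union> \<sigma> ` A) \<subseteq> A \<union> \<sigma> ` A" using ssA by (auto simp: image_Un)
    then have "edge_cut G (A \<union> \<sigma> ` A) \<subseteq> M" using invariant_cut_moved[OF sub] by blast
    moreover have "M \<inter> edge_cut G (A \<union> \<sigma> ` A) = {}"
    proof (rule ccontr)
      assume "M \<inter> edge_cut G (A \<union> \<sigma> ` A) \<noteq> {}"
      then obtain e where "e \<in> M" "e \<in> edge_cut G A \<or> e \<in> edge_cut G (\<sigma> ` A)" by (auto simp: edge_cut_def)
      then show False using Aun sAun by blast
    qed
    ultimately have "edge_cut G (A \<union> \<sigma> ` A) = {}" by blast
    then show ?thesis using connected_cut[OF sub] xA by auto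
  qed
  let ?I = "inner_edges G A"
  have IM: "?I \<subseteq> M"
  proof
    fix e assume "e \<in> ?I"
    then have e: "e \<in> E" "ends G e \<subseteq> A" by (auto simp: inner_edges_def)
    obtain x y where xy: "ends G e = {x, y}" using finite_graph_ends_pair[OF fg e(1)] by blast
    have "\<tau> e \<noteq> e"
    proof
      assume "\<tau> e = e"
      then have "\<sigma> x \<in> ends G e" using t_ends[OF e(1)] xy by auto
      then show False using e(2) xy disj by auto
    qed
    then show "e \<in> M" using e by (simp add: M_def)
  qed
  have M: "M = ?I \<union> \<tau> ` ?I"
  proof (intro subset_antisym subsetI)
    fix e assume e: "e \<in> M"
    have eE: "e \<in> E" using e by (simp add: M_def)
    have c: "ends G e \<inter> A = {} \<or> ends G e \<subseteq> A" using Aun e by (auto simp: edge_cut_def M_def)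
    show "e \<in> ?I \<union> \<tau> ` ?I"
    proof (cases "ends G e \<subseteq> A")
      case True
      then show ?thesis using eE by (simp add: inner_edges_def)
    next
      case False
      then have "ends G e \<subseteq> \<sigma> ` A" using c ends_V[OF eE] un by blast
      then have "ends G (\<tau> e) \<subseteq> A" using t_ends[OF eE] ssA by (metis image_mono)
      then have "\<tau> e \<in> ?I" using t_in[OF eE] by (simp add: inner_edges_def)
      moreover have "e = \<tau> (\<tau> e)" using t_t[OF eE] by simp
      ultimately show ?thesis by blast
    qed
  qed (use IM t_M in auto)
  let ?T = "\<lparr>verts = A, edges = ?I, ends = ends G\<rparr>"
  have fA: "finite A" using AV fV finite_subset by blast
  have fI: "finite ?I" using IM fM finite_subset by blast
  have fT: "finite_graph ?T" using fA fI fg by (auto simp: finite_graph_def inner_edges_def)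
  have cT: "connected_graph ?T"
    unfolding connected_graph_iff_edge_cut[OF fT]
  proof (intro conjI allI impI)
    show "verts ?T \<noteq> {}" using xA by auto
    fix B assume B': "B \<subseteq> verts ?T" "B \<noteq> {}" "B \<noteq> verts ?T"
    then have B: "B \<subseteq> A" "B \<noteq> {}" "B \<noteq> A" by auto
    show "edge_cut ?T B \<noteq> {}"
    proof
      assume no: "edge_cut ?T B = {}"
      have un: "M \<inter> edge_cut G B = {}"
      proof (rule ccontr)
        assume "M \<inter> edge_cut G B \<noteq> {}"
        then obtain e where e: "e \<in> M" "e \<in> edge_cut G B" by blast
        then have "ends G e \<subseteq> A" using B(1) Aun by (auto simp: edge_cut_def M_def)
        then have "e \<in> edge_cut ?T B" using e by (auto simp: edge_cut_def inner_edges_def)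
        then show False using no by blast
      qed
      show False
      proof (cases "x0 \<in> B")
        case True
        then show False using Amin[OF _ _ un] B AV by blast
      next
        case False
        then show False using Amin[of "A - B"] edge_cut_Diff_uncrossed[OF Aun un] B AV xA by blast
      qed
    qed
  qed
  \<comment> \<open>Two disjoint sheets give |V| = 2|A| and |M| is at most twice the number of inner
    edges. With |M| + 2 = |V| and \<open>forest_bound\<close>, the sheet has exactly one vertex more
    than it has edges.\<close>
  have "card V = 2 * card A"
  proof -
    have "inj_on \<sigma> A" by (rule inj_on_inverseI[of _ \<sigma>]) (use s_s AV in auto)
    then have "card (\<sigma> ` A) = card A" by (rule card_image)
    then show ?thesis using card_Un_disjoint[of A "\<sigma> ` A"] disj fA un by simp
  qed
  moreover have "card M \<le> 2 * card ?I"
    unfolding M using card_Un_le[of ?I "\<tau> ` ?I"] card_image_le[OF fI, of \<tau>] by simp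
  moreover have e0: "{v \<in> V. \<sigma> v = v} = {}" using free by auto
  moreover have "card ?I + 1 \<le> card A" using forest_bound[OF AV _ disj] xA by blast
  ultimately have "card A = card ?I + 1" using count unfolding e0 by simp
  then have "tree_graph ?T" using tree_graph_iff_card[OF fT cT] by simp
  then show ?thesis using AV disj un M by (intro that[of A])
qed

text \<open>The sheet is the tree of the ladder, its mirror image the second copy, and the flipped
  edges are the rungs. Cubicity leaves 3 minus the tree valence for the number of rungs at a vertex,
  and \<open>big\<close> gives the tree at least two vertices.\<close>

lemma cubic_is_ladder:
  fixes G :: "(nat, nat) mgraph"
  assumes ct: "combinatorial_type G w" and inv: "hyp_involution G w \<sigma> \<tau>"
    and gen: "\<forall>v\<in>verts G. \<sigma> v \<noteq> v \<and> valence G v = 3" and big: "2 < card (verts G)"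
  shows "is_ladder G"
proof -
  have fg: "finite_graph G" and cg: "connected_graph G" using ct by (auto simp: combinatorial_type_def)
  interpret hyp_inv G w \<sigma> \<tau> using fg cg inv by unfold_locales
  have free: "\<sigma> v \<noteq> v" if "v \<in> V" for v using gen that by blast
  obtain A where A: "A \<subseteq> V" "A \<inter> \<sigma> ` A = {}" "V = A \<union> \<sigma> ` A" "M = inner_edges G A \<union> \<tau> ` inner_edges G A"
    and T: "tree_graph \<lparr>verts = A, edges = inner_edges G A, ends = ends G\<rparr>"
    using sheet_exists[OF free] by blast
  let ?I = "inner_edges G A"
  define T where "T = \<lparr>verts = A, edges = ?I, ends = ends G\<rparr>"
  have vT: "verts T = A" and eT: "edges T = ?I" and enT: "ends T = ends G" by (simp_all add: T_def)
  have fA: "finite A" using A(1) fV finite_subset by blast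
  have noloop: "\<not> is_loop G e" if e: "e \<in> E" for e
  proof
    assume l: "is_loop G e"
    then obtain z where z: "ends G e = {z}" by (auto simp: is_loop_iff)
    have "\<sigma> z = z" using t_ends[OF e] loop_fixed[OF e l] z by simp
    then show False using free[of z] ends_V[OF e] z by auto
  qed
  have IM: "?I \<subseteq> M" using A(4) by blast
  have IE: "?I \<subseteq> E" by (auto simp: inner_edges_def)
  have tI: "ends G (\<tau> e) \<subseteq> \<sigma> ` A" if "e \<in> ?I" for e using that t_ends by (auto simp: inner_edges_def)
  define K where "K v = {e \<in> E - M. v \<in> ends G e}" for v
  have fK: "finite (K v)" for v using fE by (simp add: K_def)
  have endK: "ends G e = {v, \<sigma> v}" if "e \<in> K v" for e v
    using that flip_ends[of e v] noloop[of e] by (auto simp: K_def M_def)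
  have val: "valence T v + card (K v) = 3" if v: "v \<in> A" for v
  proof -
    have "\<not> is_loop T e" if "e \<in> edges T" for e using noloop[of e] that IE by (auto simp: eT enT is_loop_def)
    then have "valence T v = card {e \<in> ?I. v \<in> ends G e}" using valence_no_loops[of T v] by (simp add: eT enT)
    moreover have "valence G v = card {e \<in> E. v \<in> ends G e}" using valence_no_loops[OF noloop] by simp
    moreover have "{e \<in> E. v \<in> ends G e} = {e \<in> ?I. v \<in> ends G e} \<union> K v"
    proof -
      have "v \<notin> ends G (\<tau> e)" if "e \<in> ?I" for e using tI[OF that] v A(2) by blast
      then show ?thesis using IE A(4) by (auto simp: K_def)
    qed
    moreover have "card ({e \<in> ?I. v \<in> ends G e} \<union> K v) = card {e \<in> ?I. v \<in> ends G e} + card (K v)"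
      by (rule card_Un_disjoint) (use finite_subset[OF IE fE] IM fK in \<open>auto simp: K_def\<close>)
    moreover have "valence G v = 3" using gen v A(1) by blast
    ultimately show ?thesis by simp
  qed
  have cV: "card V = 2 * card A"
  proof -
    have "inj_on \<sigma> A" by (rule inj_on_inverseI[of _ \<sigma>]) (use s_s A(1) in auto)
    then have "card (\<sigma> ` A) = card A" by (rule card_image)
    moreover have "card V = card A + card (\<sigma> ` A)"
      using card_Un_disjoint[of A "\<sigma> ` A"] A(2,3) fA by (metis finite_imageI)
    ultimately show ?thesis by simp
  qed
  have A2: "2 \<le> card A" using cV big by simp
  have fT: "finite_graph T" and cT: "connected_graph T" using T by (auto simp: tree_graph_def T_def)
  have val1: "1 \<le> valence T v" if v: "v \<in> A" for v
  proof -
    have "A \<noteq> {v}" using A2 by auto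
    then have "edge_cut T {v} \<noteq> {}" using cT v unfolding connected_graph_iff_edge_cut[OF fT] vT by auto
    then have "card (edge_cut T {v}) \<noteq> 0" using finite_edge_cut[OF fT] by simp
    then show ?thesis using sum_valence[OF fT, of "{v}"] v by (simp add: vT)
  qed
  define B where "B v = {b. valence T v = 1 \<or> (valence T v = 2 \<and> \<not> b)}" for v
  have cB: "card (B v) = card (K v)" if v: "v \<in> A" for v
  proof -
    have "valence T v + card (B v) = 3"
      unfolding B_def using val[OF v] val1[OF v] by (intro card_rungs) linarith+
    then show ?thesis using val[OF v] by linarith
  qed
  \<comment> \<open>Any bijection will do, since all flipped edges at \<open>v\<close> have the same
    ends \<open>v\<close> and \<open>\<sigma> v\<close>.\<close>
  have "\<exists>k. bij_betw k (B v) (K v)" if "v \<in> A" for v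
    by (rule finite_same_card_bij[OF finite fK cB[OF that]])
  then obtain k where k: "\<And>v. v \<in> A \<Longrightarrow> bij_betw (k v) (B v) (K v)" by metis
  define f where "f = (\<lambda>(v, b). if b then \<sigma> v else v)"
  define h where "h x = (case x of Inl (e, b) \<Rightarrow> if b then \<tau> e else e | Inr (v, b) \<Rightarrow> k v b)" for x
  have kK: "k v b \<in> K v" if "v \<in> A" "b \<in> B v" for v b using k[OF that(1)] that(2) by (auto simp: bij_betw_def)
  have Kdisj: "K u \<inter> K v = {}" if uv: "u \<in> A" "v \<in> A" "u \<noteq> v" for u v
  proof (rule ccontr)
    assume "K u \<inter> K v \<noteq> {}"
    then obtain e where "e \<in> K u" "e \<in> K v" by blast
    then have "{u, \<sigma> u} = {v, \<sigma> v}" using endK by metis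
    then show False using uv A(2) by (auto simp: doubleton_eq_iff)
  qed
  have edL: "edges (ladder T) = Inl ` (?I \<times> UNIV) \<union> Inr ` (SIGMA v:A. B v)"
    by (auto simp: ladder_def eT vT B_def)
  have EM: "E = M \<union> (\<Union>v\<in>A. K v)"
  proof (intro subset_antisym subsetI)
    fix e assume e: "e \<in> E"
    show "e \<in> M \<union> (\<Union>v\<in>A. K v)"
    proof (cases "e \<in> M")
      case False
      obtain x where x: "x \<in> ends G e" using finite_graph_ends_ne[OF fg e] by blast
      have ee: "ends G e = {x, \<sigma> x}" using flip_ends[OF e _ noloop[OF e] x] False e by (simp add: M_def)
      have "x \<in> V" using x ends_V[OF e] by auto
      then obtain v where v: "v \<in> A" "x = v \<or> x = \<sigma> v" using A(3) by blast
      then have "v \<in> ends G e" using ee s_s[of v] A(1) by auto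
      then show ?thesis using v e False by (auto simp: K_def)
    qed simp
  qed (auto simp: M_def K_def)
  have bf: "bij_betw f (verts (ladder T)) V"
  proof (rule bij_betw_imageI)
    have vL: "verts (ladder T) = A \<times> UNIV" by (simp add: ladder_def vT)
    show "inj_on f (verts (ladder T))"
    proof (rule inj_onI)
      fix a b assume ab: "a \<in> verts (ladder T)" "b \<in> verts (ladder T)" "f a = f b"
      obtain u c v d where uv: "a = (u, c)" "b = (v, d)" "u \<in> A" "v \<in> A" using ab vL by (cases a; cases b) auto
      have ss: "\<sigma> (\<sigma> u) = u" "\<sigma> (\<sigma> v) = v" using uv s_s A(1) by auto
      have nA: "\<sigma> u \<notin> A" "\<sigma> v \<notin> A" using uv A(2) by auto
      have ff: "(if c then \<sigma> u else u) = (if d then \<sigma> v else v)" using ab(3) uv by (simp add: f_def)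
      have "c = d"
      proof (rule ccontr)
        assume "c \<noteq> d"
        then have "\<sigma> u = v \<or> u = \<sigma> v" using ff by (cases c) simp_all
        then show False using nA uv(3,4) by blast
      qed
      then have "u = v" using ff ss by (cases c) (metis, simp)
      then show "a = b" using \<open>c = d\<close> uv by simp
    qed
    show "f ` verts (ladder T) = V"
    proof (intro subset_antisym subsetI)
      fix x assume "x \<in> V"
      then consider "x \<in> A" | v where "v \<in> A" "x = \<sigma> v" using A(3) by blast
      then show "x \<in> f ` verts (ladder T)"
      proof cases
        case 1
        then show ?thesis unfolding vL by (intro image_eqI[of _ _ "(x, False)"]) (auto simp: f_def)
      next
        case 2
        then show ?thesis unfolding vL by (intro image_eqI[of _ _ "(v, True)"]) (auto simp: f_def)
      qed
    qed (use A s_in in \<open>auto simp: vL f_def\<close>)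
  qed
  have bh: "bij_betw h (edges (ladder T)) E"
  proof (rule bij_betw_imageI)
    show "h ` edges (ladder T) = E"
    proof -
      have 1: "h ` Inl ` (?I \<times> UNIV) = M"
      proof (intro subset_antisym subsetI)
        fix e assume "e \<in> M"
        then consider "e \<in> ?I" | d where "d \<in> ?I" "e = \<tau> d" using A(4) by blast
        then show "e \<in> h ` Inl ` (?I \<times> UNIV)"
        proof cases
          case 1
          then show ?thesis by (intro image_eqI[of _ _ "Inl (e, False)"]) (auto simp: h_def)
        next
          case 2
          then show ?thesis by (intro image_eqI[of _ _ "Inl (d, True)"]) (auto simp: h_def)
        qed
      qed (use A(4) in \<open>auto simp: h_def\<close>)
      have 2: "h ` Inr ` (SIGMA v:A. B v) = (\<Union>v\<in>A. K v)"
      proof (intro subset_antisym subsetI)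
        fix e assume "e \<in> (\<Union>v\<in>A. K v)"
        then obtain v where v: "v \<in> A" "e \<in> K v" by blast
        then obtain b where "b \<in> B v" "e = k v b" using k[OF v(1)] unfolding bij_betw_def by blast
        then show "e \<in> h ` Inr ` (SIGMA v:A. B v)" using v(1)
          by (intro image_eqI[of _ _ "Inr (v, b)"]) (auto simp: h_def)
      next
        fix e assume "e \<in> h ` Inr ` (SIGMA v:A. B v)"
        then obtain v b where v: "v \<in> A" "b \<in> B v" "e = k v b" by (auto simp: h_def)
        then show "e \<in> (\<Union>v\<in>A. K v)" using kK[OF v(1,2)] by blast
      qed
      show ?thesis unfolding edL image_Un 1 2 using EM by simp
    qed
    show "inj_on h (edges (ladder T))"
    proof (rule inj_onI)
      fix a b assume a: "a \<in> edges (ladder T)" and b: "b \<in> edges (ladder T)" and ab: "h a = h b"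
      have MK1: "h (Inl (e, c)) \<in> M" if "e \<in> ?I" for e c using that IM t_M by (auto simp: h_def)
      have MK2: "h (Inr (v, d)) \<in> K v" if "v \<in> A" "d \<in> B v" for v d using kK[OF that] by (simp add: h_def)
      have KM: "K v \<inter> M = {}" for v by (auto simp: K_def)
      consider (ll) e c e' c' where "a = Inl (e, c)" "b = Inl (e', c')" "e \<in> ?I" "e' \<in> ?I"
        | (rr) v d v' d' where "a = Inr (v, d)" "b = Inr (v', d')" "v \<in> A" "d \<in> B v" "v' \<in> A" "d' \<in> B v'"
        | (lr) e c v d where "a = Inl (e, c)" "b = Inr (v, d)" "e \<in> ?I" "v \<in> A" "d \<in> B v"
        | (rl) e c v d where "b = Inl (e, c)" "a = Inr (v, d)" "e \<in> ?I" "v \<in> A" "d \<in> B v"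
        using a b unfolding edL by auto
      then show "a = b"
      proof cases
        case ll
        have nt: "\<tau> x \<notin> ?I" if "x \<in> ?I" for x
        proof
          assume "\<tau> x \<in> ?I"
          then have "ends G (\<tau> x) \<subseteq> A" "\<tau> x \<in> E" by (auto simp: inner_edges_def)
          then show False using tI[OF that] A(2) finite_graph_ends_ne[OF fg, of "\<tau> x"] by blast
        qed
        have tt: "\<tau> (\<tau> e) = e" "\<tau> (\<tau> e') = e'" using ll IE t_t by auto
        have hh: "(if c then \<tau> e else e) = (if c' then \<tau> e' else e')" using ab ll(1,2) by (simp add: h_def)
        have "c = c'"
        proof (rule ccontr)
          assume "c \<noteq> c'"
          then have "\<tau> e = e' \<or> e = \<tau> e'" using hh by (cases c) simp_all
          then show False using nt[OF ll(3)] nt[OF ll(4)] ll(3,4) by auto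
        qed
        then have "e = e'" using hh tt by (cases c) (metis, simp)
        then show ?thesis using \<open>c = c'\<close> ll(1,2) by simp
      next
        case rr
        have "v = v'"
        proof (rule ccontr)
          assume "v \<noteq> v'"
          then show False using Kdisj[OF rr(3,5)] MK2[OF rr(3,4)] MK2[OF rr(5,6)] ab rr(1,2) by auto
        qed
        then have kk: "k v d = k v d'" and dB: "d' \<in> B v" using ab rr(1,2,6) by (simp_all add: h_def)
        have "d = d'" by (rule inj_onD[OF bij_betw_imp_inj_on[OF k[OF rr(3)]] kk rr(4) dB])
        then show ?thesis using \<open>v = v'\<close> rr(1,2) by simp
      next
        case lr
        then show ?thesis using MK1[OF lr(3), of c] MK2[OF lr(4,5)] KM[of v] ab by auto
      next
        case rl
        then show ?thesis using MK1[OF rl(3), of c] MK2[OF rl(4,5)] KM[of v] ab by auto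
      qed
    qed
  qed
  have "ends G (h x) = f ` ends (ladder T) x" if x: "x \<in> edges (ladder T)" for x
  proof -
    consider (l) e b where "x = Inl (e, b)" "e \<in> ?I" | (r) v b where "x = Inr (v, b)" "v \<in> A" "b \<in> B v"
      using x unfolding edL by auto
    then show ?thesis
    proof cases
      case l
      have "e \<in> E" using l IE by auto
      then show ?thesis using l t_ends by (cases b) (auto simp: ladder_def h_def f_def enT image_image)
    next
      case r
      then show ?thesis using endK[OF kK[OF r(2,3)]] by (simp add: ladder_def h_def f_def)
    qed
  qed
  then have "graph_iso (ladder T) G" using bf bh unfolding graph_iso_def graph_iso_via_def by blast
  moreover have "valence T v \<le> 3" if "v \<in> verts T" for v using val[of v] that by (simp add: vT)
  moreover have "tree_graph T" "2 \<le> card (verts T)" using T A2 by (auto simp: T_def)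
  ultimately show ?thesis unfolding is_ladder_def by blast
qed

lemma ladder_simps:
  "verts (ladder T) = verts T \<times> UNIV"
  "Inl (e, b) \<in> edges (ladder T) \<longleftrightarrow> e \<in> edges T"
  "Inr (v, b) \<in> edges (ladder T) \<longleftrightarrow> v \<in> verts T \<and> (valence T v = 1 \<or> valence T v = 2 \<and> \<not> b)"
  "ends (ladder T) (Inl (e, b)) = (\<lambda>v. (v, b)) ` ends T e"
  "ends (ladder T) (Inr (v, b)) = {(v, False), (v, True)}"
  by (auto simp: ladder_def)

text \<open>The involution exchanges the two copies of the tree and flips every rung. It moves
  exactly the copies of tree edges and fixes no vertex, so the count is twice the Euler count of the
  tree.\<close>

lemma ladder_involution:
  assumes T: "tree_graph T" and n: "2 \<le> card (verts T)" and val3: "\<forall>v\<in>verts T. valence T v \<le> 3"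
  obtains \<sigma> \<tau> where "combinatorial_type (ladder T) (\<lambda>_. 0)" "hyp_involution (ladder T) (\<lambda>_. 0) \<sigma> \<tau>"
    "\<forall>x\<in>verts (ladder T). \<sigma> x \<noteq> x \<and> valence (ladder T) x = 3"
proof -
  let ?L = "ladder T"
  have fT: "finite_graph T" and cT: "connected_graph T" using T by (auto simp: tree_graph_def)
  have fV: "finite (verts T)" and fE: "finite (edges T)" using fT by (auto simp: finite_graph_def)
  have cardT: "card (verts T) = card (edges T) + 1" using tree_graph_iff_card[OF fT cT] T by simp
  have nlT: "\<not> is_loop T e" if e: "e \<in> edges T" for e
  proof
    assume "is_loop T e"
    then obtain x where "ends T e = {x, x}" by (auto simp: is_loop_iff)
    then show False using T e unfolding tree_graph_def acyclic_graph_def by blast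
  qed
  have fEL: "finite (edges ?L)"
  proof -
    have "edges ?L \<subseteq> Inl ` (edges T \<times> UNIV) \<union> Inr ` (verts T \<times> UNIV)" by (auto simp: ladder_def)
    then show ?thesis by (rule finite_subset) (use fV fE in auto)
  qed
  have endL: "ends ?L x \<subseteq> verts ?L \<and> card (ends ?L x) = 2" if x: "x \<in> edges ?L" for x
  proof (cases x)
    case (Inl eb)
    obtain e b where eb: "eb = (e, b)" by (cases eb)
    have e: "e \<in> edges T" using x Inl eb by (simp add: ladder_simps)
    obtain u v where uv: "ends T e = {u, v}" "u \<in> verts T" "v \<in> verts T" using fT e by (rule finite_graph_ends)
    then have "u \<noteq> v" using nlT[OF e] by (auto simp: is_loop_def)
    then show ?thesis using uv by (auto simp: Inl eb ladder_simps)
  next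
    case (Inr vb)
    then show ?thesis using x by (cases vb) (auto simp: ladder_simps)
  qed
  have fL: "finite_graph ?L" using endL fEL fV by (simp add: finite_graph_def ladder_simps)
  have nlL: "\<not> is_loop ?L x" if "x \<in> edges ?L" for x using endL[OF that] by (simp add: is_loop_def)
  have val1: "1 \<le> valence T v" if v: "v \<in> verts T" for v
  proof -
    have "verts T \<noteq> {v}" using n by auto
    then have "edge_cut T {v} \<noteq> {}" using cT v unfolding connected_graph_iff_edge_cut[OF fT] by auto
    then have "card (edge_cut T {v}) \<noteq> 0" using finite_edge_cut[OF fT] by simp
    then show ?thesis using sum_valence[OF fT, of "{v}"] v by simp
  qed
  have valL: "valence ?L (v, c) = 3" if v: "v \<in> verts T" for v c
  proof -
    let ?D = "{e \<in> edges T. v \<in> ends T e}" and ?B = "{b. valence T v = 1 \<or> valence T v = 2 \<and> \<not> b}"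
    have "{x \<in> edges ?L. (v, c) \<in> ends ?L x} = (\<lambda>e. Inl (e, c)) ` ?D \<union> (\<lambda>b. Inr (v, b)) ` ?B"
    proof (intro subset_antisym subsetI)
      fix x assume x: "x \<in> {x \<in> edges ?L. (v, c) \<in> ends ?L x}"
      show "x \<in> (\<lambda>e. Inl (e, c)) ` ?D \<union> (\<lambda>b. Inr (v, b)) ` ?B"
      proof (cases x)
        case (Inl eb)
        then show ?thesis using x by (cases eb) (auto simp: ladder_simps)
      next
        case (Inr ub)
        then show ?thesis using x by (cases ub) (auto simp: ladder_simps)
      qed
    next
      fix x assume "x \<in> (\<lambda>e. Inl (e, c)) ` ?D \<union> (\<lambda>b. Inr (v, b)) ` ?B"
      then show "x \<in> {x \<in> edges ?L. (v, c) \<in> ends ?L x}" using v by (cases c) (auto simp: ladder_simps)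
    qed
    then have "valence ?L (v, c) = card ((\<lambda>e. Inl (e, c)) ` ?D \<union> (\<lambda>b. Inr (v, b)) ` ?B)"
      using valence_no_loops[OF nlL] by simp
    also have "\<dots> = card ?D + card ?B"
      by (subst card_Un_disjoint) (use fE in \<open>auto simp: card_image inj_on_def\<close>)
    also have "card ?D = valence T v" using valence_no_loops[OF nlT] by simp
    also have "valence T v + card ?B = 3"
      by (rule card_rungs[OF val1[OF v] bspec[OF val3 v]])
    finally show ?thesis .
  qed
  have cL: "connected_graph ?L"
    unfolding connected_graph_iff_edge_cut[OF fL]
  proof (intro conjI allI impI)
    show "verts ?L \<noteq> {}" using cT by (auto simp: ladder_simps connected_graph_def)
    fix A assume A: "A \<subseteq> verts ?L" "A \<noteq> {}" "A \<noteq> verts ?L"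
    show "edge_cut ?L A \<noteq> {}"
    proof
      assume no: "edge_cut ?L A = {}"
      define P where "P b = {v \<in> verts T. (v, b) \<in> A}" for b
      have Pb: "P b = {} \<or> P b = verts T" for b
      proof (rule ccontr)
        assume "\<not> ?thesis"
        then have "edge_cut T (P b) \<noteq> {}"
          using cT unfolding connected_graph_iff_edge_cut[OF fT] by (auto simp: P_def)
        then obtain e where e: "e \<in> edge_cut T (P b)" by blast
        have "ends T e \<subseteq> verts T" using finite_graph_ends_sub[OF fT] e by (auto simp: edge_cut_def)
        then have "Inl (e, b) \<in> edge_cut ?L A" using e by (auto simp: edge_cut_def ladder_simps P_def)
        then show False using no by blast
      qed
      \<comment> \<open>The valences of a tree on n vertices sum to 2(n - 1) < 3n, so some vertex
        carries a rung, and this rung connects the two copies.\<close>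
      have "\<exists>v\<in>verts T. valence T v \<le> 2"
      proof (rule ccontr)
        assume "\<not> ?thesis"
        then have "(\<Sum>v\<in>verts T. 3) \<le> (\<Sum>v\<in>verts T. valence T v)" by (intro sum_mono) force
        also have "\<dots> = 2 * card (inner_edges T (verts T)) + card (edge_cut T (verts T))"
          by (rule sum_valence[OF fT]) simp
        also have "inner_edges T (verts T) = edges T" using finite_graph_ends_sub[OF fT] by (auto simp: inner_edges_def)
        also have "edge_cut T (verts T) = {}" using finite_graph_ends_sub[OF fT] by (auto simp: edge_cut_def)
        finally show False using cardT by simp
      qed
      then obtain v where v: "v \<in> verts T" "valence T v \<le> 2" by blast
      have "valence T v = 1 \<or> valence T v = 2" using val1[OF v(1)] v(2) by linarith
      then have "Inr (v, False) \<in> edges ?L" using v(1) by (simp add: ladder_simps)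
      moreover have "Inr (v, False) \<notin> edge_cut ?L A" using no by blast
      ultimately have "(v, False) \<in> A \<longleftrightarrow> (v, True) \<in> A" by (auto simp: edge_cut_def ladder_simps)
      then have "v \<in> P False \<longleftrightarrow> v \<in> P True" by (simp add: P_def)
      then have PP: "P False = P True" using Pb[of False] Pb[of True] v(1) by auto
      have mem: "(u, b) \<in> A \<longleftrightarrow> u \<in> P b" if "u \<in> verts T" for u b using that by (simp add: P_def)
      have PT: "P b = P True" for b using PP by (cases b) auto
      have mem': "(u, b) \<in> A \<longleftrightarrow> u \<in> P True" if "u \<in> verts T" for u b
        using mem[OF that, of b] unfolding PT[of b] .
      show False
      proof (cases "P True = {}")
        case True
        then have "A = {}" using mem' A(1) by (auto simp: ladder_simps)
        then show False using A(2) by simp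
      next
        case False
        then have "P True = verts T" using Pb by blast
        then have "A = verts ?L" using mem' A(1) by (auto simp: ladder_simps)
        then show False using A(3) by simp
      qed
    qed
  qed
  define \<sigma> :: "'a \<times> bool \<Rightarrow> 'a \<times> bool" where "\<sigma> = (\<lambda>(v, b). (v, \<not> b))"
  define \<tau> :: "'b \<times> bool + 'a \<times> bool \<Rightarrow> 'b \<times> bool + 'a \<times> bool" where "\<tau> = map_sum (\<lambda>(e, b). (e, \<not> b)) id"
  have s: "\<sigma> (v, b) = (v, \<not> b)" for v b by (simp add: \<sigma>_def)
  have t1: "\<tau> (Inl (e, b)) = Inl (e, \<not> b)" and t2: "\<tau> (Inr z) = Inr z" for e b z by (simp_all add: \<tau>_def)
  have hyp: "hyp_involution ?L (\<lambda>_. 0) \<sigma> \<tau>"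
    unfolding hyp_involution_def
  proof (intro conjI ballI)
    fix x assume "x \<in> verts ?L"
    then show "\<sigma> x \<in> verts ?L" "\<sigma> (\<sigma> x) = x" by (auto simp: ladder_simps s)
  next
    fix x assume x: "x \<in> edges ?L"
    have "\<tau> x \<in> edges ?L \<and> \<tau> (\<tau> x) = x \<and> ends ?L (\<tau> x) = \<sigma> ` ends ?L x"
    proof (cases x)
      case (Inl eb)
      then show ?thesis using x by (cases eb) (auto simp: ladder_simps t1 s image_image)
    next
      case (Inr vb)
      then show ?thesis using x by (cases vb) (auto simp: ladder_simps t2 s)
    qed
    then show "\<tau> x \<in> edges ?L" "\<tau> (\<tau> x) = x" "ends ?L (\<tau> x) = \<sigma> ` ends ?L x" by auto
    show "is_loop ?L x \<longrightarrow> \<tau> x = x" using nlL[OF x] by simp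
    show "\<tau> x = x \<longrightarrow> \<not> is_loop ?L x \<longrightarrow> (\<forall>v\<in>ends ?L x. \<sigma> v \<noteq> v)" by (auto simp: \<sigma>_def)
  next
    have "{x \<in> edges ?L. \<tau> x \<noteq> x} = Inl ` (edges T \<times> UNIV)"
    proof (intro subset_antisym subsetI)
      fix x assume x: "x \<in> {x \<in> edges ?L. \<tau> x \<noteq> x}"
      show "x \<in> Inl ` (edges T \<times> UNIV)"
      proof (cases x)
        case (Inl eb)
        then show ?thesis using x by (cases eb) (auto simp: ladder_simps)
      qed (use x t2 in auto)
    qed (auto simp: ladder_simps t1)
    then have "card {x \<in> edges ?L. \<tau> x \<noteq> x} = 2 * card (edges T)"
      by (simp add: card_image card_cartesian_product)
    moreover have e0: "{x \<in> verts ?L. \<sigma> x = x} = {}" by (auto simp: \<sigma>_def)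
    moreover have "card (verts ?L) = 2 * card (verts T)" by (simp add: ladder_simps card_cartesian_product)
    ultimately show "card {x \<in> edges ?L. \<tau> x \<noteq> x} + 2 = card (verts ?L) + card {x \<in> verts ?L. \<sigma> x = x}"
      using cardT unfolding e0 by simp
  qed simp
  have "combinatorial_type ?L (\<lambda>_. 0)"
    using fL cL valL by (auto simp: combinatorial_type_def ladder_simps)
  moreover have "\<forall>x\<in>verts ?L. \<sigma> x \<noteq> x \<and> valence ?L x = 3" using valL by (auto simp: ladder_simps s)
  ultimately show ?thesis using hyp by (intro that)
qed

lemma is_ladder_involution:
  assumes L: "is_ladder G" and w: "\<forall>v\<in>verts G. w v = 0"
  obtains \<sigma> \<tau> where "combinatorial_type G w" "hyp_involution G w \<sigma> \<tau>"
    "\<forall>v\<in>verts G. \<sigma> v \<noteq> v \<and> valence G v = 3"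
proof -
  obtain T :: "(nat, nat) mgraph" where T: "tree_graph T" "2 \<le> card (verts T)" "\<forall>v\<in>verts T. valence T v \<le> 3"
    and iso: "graph_iso (ladder T) G" using L unfolding is_ladder_def by blast
  obtain \<sigma> \<tau> where ct: "combinatorial_type (ladder T) (\<lambda>_. 0)" and hyp: "hyp_involution (ladder T) (\<lambda>_. 0) \<sigma> \<tau>"
    and cub: "\<forall>x\<in>verts (ladder T). \<sigma> x \<noteq> x \<and> valence (ladder T) x = 3"
    by (rule ladder_involution[OF T])
  have fL: "finite_graph (ladder T)" and cL: "connected_graph (ladder T)" using ct by (auto simp: combinatorial_type_def)
  interpret hyp_inv "ladder T" "\<lambda>_. 0" \<sigma> \<tau> using fL cL hyp by unfold_locales
  obtain f h where fh: "graph_iso_via f h (ladder T) G" using iso by (auto simp: graph_iso_def)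
  have inj: "inj_on f (verts (ladder T))" using fh by (simp add: graph_iso_via_def bij_betw_def)
  have "f v \<in> verts G" if "v \<in> verts (ladder T)" for v using fh that by (auto simp: graph_iso_via_def bij_betw_def)
  then have c: "contracts f h {} (ladder T) (\<lambda>_. 0) G w"
    unfolding contracts_empty_iff[OF fL] using fh w by simp
  obtain \<sigma>' \<tau>' where h': "hyp_involution G w \<sigma>' \<tau>'" and s': "\<And>v. v \<in> verts (ladder T) \<Longrightarrow> \<sigma>' (f v) = f (\<sigma> v)"
    using contracts_hyp_involution[OF c] by (metis image_empty order_refl)
  have "\<sigma>' u \<noteq> u \<and> valence G u = 3" if u: "u \<in> verts G" for u
  proof -
    obtain v where v: "v \<in> verts (ladder T)" "u = f v" using u contractsD(2)[OF c] by blast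
    have "\<sigma>' u \<noteq> u" using s'[OF v(1)] v inj s_in[OF v(1)] cub by (auto simp: inj_on_def)
    moreover have "{x \<in> verts (ladder T). f x = u} = {v}" using v inj by (auto simp: inj_on_def)
    then have "valence G u = 3" using contracts_valence[OF c fL u] cub v(1) by simp
    ultimately show ?thesis by simp
  qed
  then show ?thesis using contracts_stable[OF c ct] h' by (intro that) auto
qed

section \<open>The family of hyperelliptic types\<close>

lemma contracts_cut_relation:
  assumes c: "contracts f h {} G w G' w'" and fg: "finite_graph G" and d: "d \<in> edges G" and e: "e \<in> edges G"
  shows "(h d, h e) \<in> cut_relation G' \<longleftrightarrow> (d, e) \<in> cut_relation G"
proof -
  have h: "bij_betw h (edges G) (edges G')" using contractsD(3)[OF c] by simp
  have hin: "inj_on h (edges G)" using h by (simp add: bij_betw_def)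
  have hE: "h x \<in> edges G'" if "x \<in> edges G" for x using h that by (auto simp: bij_betw_def)
  have heq: "h x = h y \<longleftrightarrow> x = y" if "x \<in> edges G" "y \<in> edges G" for x y using hin that by (auto simp: inj_on_def)
  have "(\<exists>B\<subseteq>verts G'. edge_cut G' B = {h d, h e}) \<longleftrightarrow> (\<exists>A\<subseteq>verts G. edge_cut G A = {d, e})"
  proof
    assume "\<exists>B\<subseteq>verts G'. edge_cut G' B = {h d, h e}"
    then obtain B where B: "B \<subseteq> verts G'" "edge_cut G' B = {h d, h e}" by blast
    have "edge_cut G {x \<in> verts G. f x \<in> B} = {x \<in> edges G - {}. h x \<in> edge_cut G' B}"
      by (rule contracts_cut[OF c fg B(1)])
    also have "\<dots> = {d, e}" using B(2) heq d e by auto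
    finally show "\<exists>A\<subseteq>verts G. edge_cut G A = {d, e}" by (intro exI[of _ "{x \<in> verts G. f x \<in> B}"]) auto
  next
    assume "\<exists>A\<subseteq>verts G. edge_cut G A = {d, e}"
    then obtain A where A: "A \<subseteq> verts G" "edge_cut G A = {d, e}" by blast
    have fA: "f ` A \<subseteq> verts G'" using A(1) contractsD(2)[OF c] by blast
    have "{x \<in> verts G. f x \<in> f ` A} = A"
    proof (rule saturated_eq[OF A(1)])
      show "y \<in> A" if "x \<in> A" "y \<in> verts G" "f x = f y" for x y
        using contractsD(6)[OF c A(1) _ that] by simp
    qed
    then have pre: "{x \<in> edges G - {}. h x \<in> edge_cut G' (f ` A)} = {d, e}"
      using contracts_cut[OF c fg fA] A(2) by simp
    have "edge_cut G' (f ` A) = {h d, h e}"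
    proof (intro subset_antisym subsetI)
      fix y assume y: "y \<in> edge_cut G' (f ` A)"
      then have "y \<in> edges G'" by (simp add: edge_cut_def)
      then obtain x where x: "x \<in> edges G" "y = h x" using h by (auto simp: bij_betw_def)
      then have "x \<in> {d, e}" using pre y by blast
      then show "y \<in> {h d, h e}" using x by blast
    next
      fix y assume "y \<in> {h d, h e}"
      then show "y \<in> edge_cut G' (f ` A)" using pre by blast
    qed
    then show "\<exists>B\<subseteq>verts G'. edge_cut G' B = {h d, h e}" using fA by blast
  qed
  then show ?thesis using d e hE heq[OF d e] by (simp add: cut_relation_def)
qed

lemma hyperelliptic_relation:
  assumes "3 \<le> g" "(G, w, r) \<in> hyperelliptic_types g" shows "r = cut_relation G"
proof -
  obtain \<sigma> \<tau> where ct: "combinatorial_type G w" and inv: "hyp_involution G w \<sigma> \<tau>" and r: "r = involution_relation G \<tau>"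
    using assms hyperelliptic_types_iff by blast
  interpret hyp_inv G w \<sigma> \<tau> using ct inv by unfold_locales (auto simp: combinatorial_type_def)
  show ?thesis unfolding r
    by (rule involution_relation_eq_cut_relation) (use ct in \<open>auto simp: combinatorial_type_def\<close>)
qed

lemma contracts_iso_ctype:
  assumes g: "3 \<le> g" and t: "(G, w, r) \<in> hyperelliptic_types g" and t': "(G', w', r') \<in> hyperelliptic_types g"
    and c: "contracts f h {} G w G' w'"
  shows "ctype_iso (G, w, r) (G', w', r')" "\<forall>d\<in>edges G. \<forall>e\<in>edges G. (h d, h e) \<in> r' \<longleftrightarrow> (d, e) \<in> r"
proof -
  have fg: "finite_graph G" using t hyperelliptic_types_iff[OF g] by (auto simp: combinatorial_type_def)
  show rr: "\<forall>d\<in>edges G. \<forall>e\<in>edges G. (h d, h e) \<in> r' \<longleftrightarrow> (d, e) \<in> r"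
    using contracts_cut_relation[OF c fg] hyperelliptic_relation[OF g t] hyperelliptic_relation[OF g t'] by simp
  have "ctype_iso_via f h (G, w, r) (G', w', r')" using c rr unfolding contracts_empty_iff[OF fg] by simp
  then show "ctype_iso (G, w, r) (G', w', r')" unfolding ctype_iso_def by blast
qed

text \<open>Summing \<open>valence_weight_ge\<close> gives 3|V| \<le> 2|E| + 2W, where W is the
  total weight. With |E| - |V| + 1 + W = g this yields |V| \<le> 2g - 2 and |E| + W \<le> 3g - 3.
  One common bound is enough for finiteness.\<close>

lemma type_card_bounds:
  assumes ct: "combinatorial_type G w" and g: "3 \<le> g" "type_genus G w = int g"
  shows "card (verts G) \<le> 3 * g" "card (edges G) \<le> 3 * g" "v \<in> verts G \<Longrightarrow> w v \<le> 3 * g"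
proof -
  have fg: "finite_graph G" using ct by (simp add: combinatorial_type_def)
  have fV: "finite (verts G)" using fg by (simp add: finite_graph_def)
  have "(\<Sum>v\<in>verts G. 3) \<le> (\<Sum>v\<in>verts G. valence G v + 2 * w v)"
    by (rule sum_mono) (rule valence_weight_ge[OF ct g])
  also have "\<dots> = (\<Sum>v\<in>verts G. valence G v) + 2 * sum w (verts G)" by (simp add: sum.distrib sum_distrib_left)
  also have "(\<Sum>v\<in>verts G. valence G v) = 2 * card (inner_edges G (verts G)) + card (edge_cut G (verts G))"
    by (rule sum_valence[OF fg]) simp
  also have "inner_edges G (verts G) = edges G" using finite_graph_ends_sub[OF fg] by (auto simp: inner_edges_def)
  also have "edge_cut G (verts G) = {}" using finite_graph_ends_sub[OF fg] by (auto simp: edge_cut_def)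
  finally have a: "3 * card (verts G) \<le> 2 * card (edges G) + 2 * sum w (verts G)" by simp
  have b: "int (card (edges G)) - int (card (verts G)) + 1 + int (sum w (verts G)) = int g"
    using g(2) by (simp add: type_genus_def graph_genus_def)
  have V: "card (verts G) + 2 \<le> 2 * g" using a b by linarith
  then show "card (verts G) \<le> 3 * g" by linarith
  show "card (edges G) \<le> 3 * g" using b V by linarith
  have "sum w (verts G) \<le> 3 * g" using b V by linarith
  then show "w v \<le> 3 * g" if "v \<in> verts G" using member_le_sum[OF that, of w] fV by simp
qed

text \<open>Isomorphic members of \<open>R\<close> coincide, so choosing an isomorphic normal form
  for each member is injective into a finite set.\<close>

lemma finite_representatives:
  assumes g: "3 \<le> g" and R: "iso_representatives (hyperelliptic_types g) R"
  shows "finite R"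
proof -
  let ?C = "hyperelliptic_types g" and ?B = "3 * g"
  have RC: "R \<subseteq> ?C" and uniq: "\<And>t. t \<in> ?C \<Longrightarrow> \<exists>!s. s \<in> R \<and> ctype_iso t s"
    using R by (auto simp: iso_representatives_def)
  \<comment> \<open>Normal forms: vertices and edges are initial segments of the naturals, and all
    functions are fixed outside them so that finitely many remain.\<close>
  define X :: "ctype set" where "X = (\<lambda>(n, m, F, W, Q). (\<lparr>verts = {..<n}, edges = {..<m}, ends = F\<rparr>, W, Q)) `
    (SIGMA n:{..?B}. SIGMA m:{..?B}. ({..<m} \<rightarrow>\<^sub>E Pow {..<n}) \<times> ({..<n} \<rightarrow>\<^sub>E {..?B}) \<times> Pow ({..<m} \<times> {..<m}))"
  have "finite X"
    unfolding X_def by (intro finite_imageI finite_SigmaI finite_cartesian_product finite_PiE) auto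
  have ex: "\<exists>c\<in>X. ctype_iso t c" if t: "t \<in> ?C" for t
  proof -
    obtain G w r where tt: "t = (G, w, r)" by (metis surj_pair)
    have ct: "combinatorial_type G w" and gen: "type_genus G w = int g" using t tt hyperelliptic_types_iff[OF g] by auto
    have eq: "equiv (edges G) r" using t tt by (simp add: hyperelliptic_types_def)
    then have rsub: "r \<subseteq> edges G \<times> edges G" by (simp add: equiv_type)
    have fg: "finite_graph G" using ct by (simp add: combinatorial_type_def)
    have fV: "finite (verts G)" and fE: "finite (edges G)" using fg by (auto simp: finite_graph_def)
    obtain f where f: "bij_betw f (verts G) {0..<card (verts G)}" using ex_bij_betw_finite_nat[OF fV] by blast
    obtain h where h: "bij_betw h (edges G) {0..<card (edges G)}" using ex_bij_betw_finite_nat[OF fE] by blast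
    let ?n = "card (verts G)" and ?m = "card (edges G)"
    have f': "f ` verts G = {..<?n}" "inj_on f (verts G)" using f by (auto simp: bij_betw_def atLeast0LessThan)
    have h': "h ` edges G = {..<?m}" "inj_on h (edges G)" using h by (auto simp: bij_betw_def atLeast0LessThan)
    define F where "F = restrict (\<lambda>i. f ` ends G (inv_into (edges G) h i)) {..<?m}"
    define W where "W = restrict (\<lambda>i. w (inv_into (verts G) f i)) {..<?n}"
    define Q where "Q = (\<lambda>(d, e). (h d, h e)) ` r"
    let ?G = "\<lparr>verts = {..<?n}, edges = {..<?m}, ends = F\<rparr>"
    have hm: "h e < ?m" if "e \<in> edges G" for e using h'(1) that by auto
    have fn: "f v < ?n" if "v \<in> verts G" for v using f'(1) that by auto
    have Fh: "F (h e) = f ` ends G e" if "e \<in> edges G" for e using that hm[OF that] h'(2) by (simp add: F_def)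
    have Wf: "W (f v) = w v" if "v \<in> verts G" for v using that fn[OF that] f'(2) by (simp add: W_def)
    have Qh: "(h d, h e) \<in> Q \<longleftrightarrow> (d, e) \<in> r" if de: "d \<in> edges G" "e \<in> edges G" for d e
    proof
      assume "(h d, h e) \<in> Q"
      then obtain a b where ab: "(a, b) \<in> r" "h a = h d" "h b = h e" by (auto simp: Q_def)
      then have "a = d" "b = e" using h'(2) rsub de by (auto simp: inj_on_def)
      then show "(d, e) \<in> r" using ab by simp
    qed (auto simp: Q_def)
    have iE: "inv_into (edges G) h i \<in> edges G" if "i < ?m" for i
      using inv_into_into[of i h "edges G"] h'(1) that by auto
    have iV: "inv_into (verts G) f i \<in> verts G" if "i < ?n" for i
      using inv_into_into[of i f "verts G"] f'(1) that by auto
    have "graph_iso_via f h G ?G" using f' h' Fh by (auto simp: graph_iso_via_def bij_betw_def)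
    then have "ctype_iso_via f h t (?G, W, Q)" using Wf Qh by (simp add: tt)
    moreover have "(?G, W, Q) \<in> X"
    proof -
      note bd = type_card_bounds[OF ct g gen]
      have "F \<in> {..<?m} \<rightarrow>\<^sub>E Pow {..<?n}"
      proof -
        have "f ` ends G (inv_into (edges G) h i) \<subseteq> {..<?n}" if "i < ?m" for i
          using finite_graph_ends_sub[OF fg iE[OF that]] f'(1) by blast
        then show ?thesis by (auto simp: F_def)
      qed
      moreover have "W \<in> {..<?n} \<rightarrow>\<^sub>E {..?B}" using bd(3) iV by (auto simp: W_def)
      moreover have "Q \<in> Pow ({..<?m} \<times> {..<?m})" using rsub hm by (auto simp: Q_def)
      ultimately have "(?n, ?m, F, W, Q) \<in> (SIGMA n:{..?B}. SIGMA m:{..?B}.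
          ({..<m} \<rightarrow>\<^sub>E Pow {..<n}) \<times> ({..<n} \<rightarrow>\<^sub>E {..?B}) \<times> Pow ({..<m} \<times> {..<m}))"
        using bd(1,2) by blast
      then show ?thesis unfolding X_def by (rule rev_image_eqI) simp
    qed
    ultimately show ?thesis unfolding ctype_iso_def by blast
  qed
  define c where "c t = (SOME c. c \<in> X \<and> ctype_iso t c)" for t
  have c: "c t \<in> X \<and> ctype_iso t (c t)" if "t \<in> ?C" for t
    unfolding c_def by (rule someI_ex) (use ex[OF that] in blast)
  have "inj_on c R"
  proof (rule inj_onI)
    fix t s assume ts: "t \<in> R" "s \<in> R" "c t = c s"
    have tC: "t \<in> ?C" and sC: "s \<in> ?C" using ts RC by auto
    have "constrained_type s" using sC by (cases s) (simp add: hyperelliptic_types_def)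
    then have "ctype_iso (c s) s" using c[OF sC] ctype_iso_sym by blast
    then have "ctype_iso t s" using c[OF tC] ts(3) ctype_iso_trans by metis
    moreover have "ctype_iso t t" by (rule ctype_iso_refl)
    ultimately show "t = s" using uniq[OF tC] ts by blast
  qed
  moreover have "c ` R \<subseteq> X" using c RC by blast
  ultimately show ?thesis using \<open>finite X\<close> by (meson finite_imageD finite_subset)
qed

lemma representative_exists:
  assumes g: "3 \<le> g" and R: "iso_representatives (hyperelliptic_types g) R" and t: "(G, w, r) \<in> hyperelliptic_types g"
  obtains G' w' r' f h where "(G', w', r') \<in> R" "contracts f h {} G w G' w'"
    "\<forall>d\<in>edges G. \<forall>e\<in>edges G. (h d, h e) \<in> r' \<longleftrightarrow> (d, e) \<in> r"
proof -
  have fg: "finite_graph G" using t hyperelliptic_types_iff[OF g] by (auto simp: combinatorial_type_def)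
  obtain s where s: "s \<in> R" "ctype_iso (G, w, r) s" using R t unfolding iso_representatives_def by blast
  obtain G' w' r' where ss: "s = (G', w', r')" by (metis surj_pair)
  obtain f h where fh: "ctype_iso_via f h (G, w, r) (G', w', r')" using s(2) unfolding ss ctype_iso_def by blast
  then have "contracts f h {} G w G' w'" unfolding contracts_empty_iff[OF fg] by simp
  then show ?thesis using that s(1) ss fh by auto
qed

text \<open>The classes of \<open>r\<close> are the orbits of \<open>\<tau>\<close>, so an
  \<open>r\<close>-closed set is invariant and the involution descends along its contraction.
  \<open>iso_unique\<close> holds because the relation is the intrinsic cut relation.\<close>

lemma type_family_hyperelliptic:
  assumes g: "3 \<le> g" and R: "iso_representatives (hyperelliptic_types g) R"
  shows "type_family R"
proof
  have RC: "R \<subseteq> hyperelliptic_types g" using R by (simp add: iso_representatives_def)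
  show "finite R" by (rule finite_representatives[OF g R])
  show "constrained_type t" if "t \<in> R" for t using that RC by (cases t) (auto simp: hyperelliptic_types_def)
  fix G w r assume t: "(G, w, r) \<in> R"
  have tC: "(G, w, r) \<in> hyperelliptic_types g" using t RC by blast
  obtain \<sigma> \<tau> where ct: "combinatorial_type G w" and gen: "type_genus G w = int g"
    and inv: "hyp_involution G w \<sigma> \<tau>" and r: "r = involution_relation G \<tau>"
    using tC hyperelliptic_types_iff[OF g] by blast
  have fg: "finite_graph G" using ct by (simp add: combinatorial_type_def)
  interpret hyp_inv G w \<sigma> \<tau> using ct inv by unfold_locales (auto simp: combinatorial_type_def)
  show "\<exists>G' w' r' p h. (G', w', r') \<in> R \<and> contracts p h S G w G' w' \<and>
      (\<forall>d\<in>edges G - S. \<forall>e\<in>edges G - S. (h d, h e) \<in> r' \<longleftrightarrow> (d, e) \<in> r)"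
    if S: "S \<subseteq> edges G" "r `` S \<subseteq> S" for S
  proof -
    have tS: "\<tau> ` S \<subseteq> S" using S by (auto simp: r involution_relation_def)
    obtain G1 w1 where G1: "contract_edges S (G, w) = (G1, w1)" by force
    obtain p where p: "contracts p id S G w G1 w1" by (rule contract_edges_contracts[OF fg S(1) G1])
    obtain \<sigma>1 \<tau>1 where inv1: "hyp_involution G1 w1 \<sigma>1 \<tau>1"
      and t1: "\<And>e. e \<in> edges G \<Longrightarrow> e \<notin> S \<Longrightarrow> \<tau>1 (id e) = id (\<tau> e)"
      using contracts_hyp_involution[OF p tS] by metis
    have t1C: "(G1, w1, involution_relation G1 \<tau>1) \<in> hyperelliptic_types g"
      unfolding hyperelliptic_types_iff[OF g]
      using contracts_stable[OF p ct] contracts_genus[OF p fg] gen inv1 by auto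
    obtain G' w' r' f h where G': "(G', w', r') \<in> R" "contracts f h {} G1 w1 G' w'"
      and rr: "\<forall>d\<in>edges G1. \<forall>e\<in>edges G1. (h d, h e) \<in> r' \<longleftrightarrow> (d, e) \<in> involution_relation G1 \<tau>1"
      by (rule representative_exists[OF g R t1C])
    have "contracts (f \<circ> p) (h \<circ> id) S G w G' w'" using contracts_trans[OF p G'(2) fg] by simp
    moreover have E1: "edges G1 = edges G - S" using contractsD(3)[OF p] by (simp add: bij_betw_def)
    have "(h d, h e) \<in> r' \<longleftrightarrow> (d, e) \<in> r" if d: "d \<in> edges G - S" and e: "e \<in> edges G - S" for d e
    proof -
      have "(h d, h e) \<in> r' \<longleftrightarrow> (d, e) \<in> involution_relation G1 \<tau>1" using rr d e E1 by blast
      then show ?thesis using t1[of d] d E1 by (auto simp: r involution_relation_def)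
    qed
    ultimately show ?thesis using G'(1) by (intro exI[of _ G'] exI[of _ w'] exI[of _ r'] exI[of _ "f \<circ> p"] exI[of _ "h \<circ> id"]) auto
  qed
  show "(G', w', r') = (G, w, r) \<and> (\<forall>d\<in>edges G. \<forall>e\<in>edges G. (h d, h e) \<in> r' \<longleftrightarrow> (d, e) \<in> r)"
    if s: "(G', w', r') \<in> R" and c: "contracts f h {} G w G' w'" for G' w' r' f h
  proof -
    have sC: "(G', w', r') \<in> hyperelliptic_types g" using s RC by blast
    note iso = contracts_iso_ctype[OF g tC sC c]
    have "\<exists>!u. u \<in> R \<and> ctype_iso (G, w, r) u" using R tC by (simp add: iso_representatives_def)
    then have "(G', w', r') = (G, w, r)" using s t iso(1) ctype_iso_refl by blast
    then show ?thesis using iso(2) by blast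
  qed
qed

text \<open>From 3|V| = 2|E| and |E| - |V| + 1 = g follow |V| = 2g - 2 and |E| = 3g - 3. Without
  fixed vertices the count gives 2g - 4 moved edges; each of the g - 2 exchanged pairs saves one
  class, which leaves 3g - 3 - (g - 2) = 2g - 1.\<close>

lemma cubic_type_dim:
  fixes G :: "(nat, nat) mgraph"
  assumes ct: "combinatorial_type G w" and inv: "hyp_involution G w \<sigma> \<tau>" and gen: "type_genus G w = int g" and g: "3 \<le> g"
    and cub: "\<forall>v\<in>verts G. \<sigma> v \<noteq> v \<and> valence G v = 3"
  shows "card (edge_classes (G, w, involution_relation G \<tau>)) = 2 * g - 1" "graph_genus G = int g" "2 < card (verts G)"
proof -
  interpret hyp_inv G w \<sigma> \<tau> using ct inv by unfold_locales (auto simp: combinatorial_type_def)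
  have w0: "w v = 0" if "v \<in> V" for v using w_s[OF that] cub that by auto
  then show gg: "graph_genus G = int g" using gen by (simp add: type_genus_def)
  have "(\<Sum>v\<in>V. valence G v) = 2 * card (inner_edges G V) + card (edge_cut G V)"
    by (rule sum_valence[OF fg]) simp
  also have "inner_edges G V = E" using ends_V by (auto simp: inner_edges_def)
  also have "edge_cut G V = {}" using ends_V by (auto simp: edge_cut_def)
  finally have "3 * card V = 2 * card E" using cub by simp
  moreover have e0: "{v \<in> V. \<sigma> v = v} = {}" using cub by auto
  moreover have m: "card M + 2 = card V" using count unfolding e0 by simp
  moreover have "int (card E) - int (card V) + 1 = int g" using gg by (simp add: graph_genus_def)
  ultimately have nums: "card V + 2 = 2 * g" "card E + 3 = 3 * g" "card M + 4 = 2 * g" by linarith+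
  then show "2 < card V" using g by linarith
  have ec: "edge_classes (G, w, involution_relation G \<tau>) = cls ` E"
    by (auto simp: quotient_def involution_relation_def cls_def)
  have "2 * card (cls ` E) = card E + card {e \<in> E. \<tau> e = e}"
    unfolding cls_def by (rule card_involution_orbits) (auto simp: fE t_in t_t)
  moreover have "card {e \<in> E. \<tau> e = e} + card M = card E"
  proof -
    have "E = {e \<in> E. \<tau> e = e} \<union> M" by (auto simp: M_def)
    then have "card E = card ({e \<in> E. \<tau> e = e} \<union> M)" by simp
    also have "\<dots> = card {e \<in> E. \<tau> e = e} + card M" by (rule card_Un_disjoint) (use fE fM in \<open>auto simp: M_def\<close>)
    finally show ?thesis by simp
  qed
  ultimately show "card (edge_classes (G, w, involution_relation G \<tau>)) = 2 * g - 1"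
    unfolding ec using nums g by linarith
qed

section \<open>Maximal cells, their dimension and the ladders\<close>

theorem theorem4p9:
  fixes g :: nat and R :: "ctype set"
  assumes "3 \<le> g"
    and "iso_representatives (hyperelliptic_types g) R"
  shows "stacky_fan (H_trop R) (H_fan R) \<and>
         pure_of_dim (H_fan R) (2 * g - 1) \<and>
         (\<forall>G w r. (G, w, r) \<in> R \<longrightarrow>
            (maximal_cell (H_fan R) (G, w, r) \<longleftrightarrow> is_ladder G \<and> graph_genus G = int g)) \<and>
         (\<forall>L :: (nat, nat) mgraph. is_ladder L \<and> graph_genus L = int g \<longrightarrow>
            (\<exists>!t. maximal_cell (H_fan R) t \<and> graph_iso L (fst t)))"
proof -
  note g = assms(1) and R = assms(2)
  interpret type_family R by (rule type_family_hyperelliptic[OF g R])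
  let ?D = "H_fan R"
  have RC: "R \<subseteq> hyperelliptic_types g" using R by (simp add: iso_representatives_def)
  define cubic where "cubic t \<longleftrightarrow> (\<exists>\<sigma> \<tau>. hyp_involution (fst t) (fst (snd t)) \<sigma> \<tau> \<and>
      snd (snd t) = involution_relation (fst t) \<tau> \<and> (\<forall>v\<in>verts (fst t). \<sigma> v \<noteq> v \<and> valence (fst t) v = 3))" for t :: ctype
  have type: "combinatorial_type G w" "type_genus G w = int g" if "(G, w, r) \<in> R" for G w r
    using that RC hyperelliptic_types_iff[OF g] by auto
  have cubic_facts: "card (edge_classes (G, w, r)) = 2 * g - 1" "is_ladder G" "graph_genus G = int g"
    if t: "(G, w, r) \<in> R" and c: "cubic (G, w, r)" for G w r
  proof -
    obtain \<sigma> \<tau> where inv: "hyp_involution G w \<sigma> \<tau>" and r: "r = involution_relation G \<tau>"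
      and cub: "\<forall>v\<in>verts G. \<sigma> v \<noteq> v \<and> valence G v = 3" using c by (auto simp: cubic_def)
    note dim = cubic_type_dim[OF type(1)[OF t] inv type(2)[OF t] g cub]
    show "card (edge_classes (G, w, r)) = 2 * g - 1" using dim(1) r by simp
    show "graph_genus G = int g" by (rule dim(2))
    show "is_ladder G" by (rule cubic_is_ladder[OF type(1)[OF t] inv cub dim(3)])
  qed
  have grow: "\<exists>s\<in>R. closed_cell ?D t \<subseteq> closed_cell ?D s \<and> card (edge_classes t) < card (edge_classes s)"
    if t: "t \<in> R" and nc: "\<not> cubic t" for t
  proof -
    obtain G w r where tt: "t = (G, w, r)" by (metis surj_pair)
    have tR: "(G, w, r) \<in> R" using t tt by simp
    then obtain \<sigma> \<tau> where inv: "hyp_involution G w \<sigma> \<tau>" and r: "r = involution_relation G \<tau>"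
      using RC hyperelliptic_types_iff[OF g] by blast
    have ng: "\<not> (\<forall>v\<in>verts G. \<sigma> v \<noteq> v \<and> valence G v = 3)" using nc inv r by (auto simp: cubic_def tt)
    obtain G1 :: "(nat, nat) mgraph" and w1 \<sigma>1 \<tau>1 p S where
      1: "combinatorial_type G1 w1" "hyp_involution G1 w1 \<sigma>1 \<tau>1" "contracts p id S G1 w1 G w" "\<tau>1 ` S \<subseteq> S" "S \<noteq> {}"
      by (rule expansion_exists[OF type(1)[OF tR] inv g type(2)[OF tR] ng])
    have fg1: "finite_graph G1" using 1(1) by (simp add: combinatorial_type_def)
    have "type_genus G1 w1 = int g" using contracts_genus[OF 1(3) fg1] type(2)[OF tR] by simp
    then have "(G1, w1, involution_relation G1 \<tau>1) \<in> hyperelliptic_types g"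
      unfolding hyperelliptic_types_iff[OF g] using 1(1,2) by blast
    then obtain G2 w2 r2 f h where G2: "(G2, w2, r2) \<in> R" "contracts f h {} G1 w1 G2 w2"
      and rr: "\<forall>d\<in>edges G1. \<forall>e\<in>edges G1. (h d, h e) \<in> r2 \<longleftrightarrow> (d, e) \<in> involution_relation G1 \<tau>1"
      by (rule representative_exists[OF g R])
    obtain f' h' where inv2: "contracts f' h' {} G2 w2 G1 w1" and h': "\<And>e. e \<in> edges G1 \<Longrightarrow> h' (h e) = e"
      using contracts_inverse[OF G2(2) fg1] by metis
    have fg2: "finite_graph G2" by (rule contracts_finite_graph[OF G2(2) fg1])
    \<comment> \<open>The expansion is replaced by its representative in \<open>R\<close>, so the
      contracted edges are pulled back along the inverse isomorphism.\<close>
    let ?S = "{e \<in> edges G2. h' e \<in> S}"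
    have c2: "contracts (p \<circ> f') (id \<circ> h') ?S G2 w2 G w" using contracts_trans[OF inv2 1(3) fg2] by simp
    have SE: "S \<subseteq> edges G1" by (rule contractsD(1)[OF 1(3)])
    have hb: "bij_betw h (edges G1) (edges G2)" using contractsD(3)[OF G2(2)] by simp
    have "?S \<noteq> {}"
    proof -
      obtain e where "e \<in> S" using 1(5) by blast
      then have "h e \<in> ?S" using SE h' hb by (auto simp: bij_betw_def)
      then show ?thesis by blast
    qed
    moreover have "r2 `` ?S \<subseteq> ?S"
    proof
      fix y assume "y \<in> r2 `` ?S"
      then obtain x where x: "x \<in> edges G2" "h' x \<in> S" "(x, y) \<in> r2" by blast
      have "r2 \<subseteq> edges G2 \<times> edges G2" using type_facts(2)[OF G2(1)] by (simp add: equiv_type)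
      then have "y \<in> edges G2" using x(3) by blast
      then obtain a b where ab: "a \<in> edges G1" "b \<in> edges G1" "x = h a" "y = h b"
        using x(1) hb unfolding bij_betw_def by blast
      then have "(a, b) \<in> involution_relation G1 \<tau>1" using rr x(3) by blast
      then have "b \<in> S" using x(2) ab h' 1(4) by (auto simp: involution_relation_def)
      then show "y \<in> ?S" using ab h' \<open>y \<in> edges G2\<close> by simp
    qed
    ultimately show ?thesis
      using contraction_closed_cell[OF G2(1) tR c2] G2(1) unfolding tt by blast
  qed
  \<comment> \<open>Among the finitely many cells whose closure contains that of \<open>t\<close>,
    one of largest dimension cannot be expanded further, so it is cubic.\<close>
  have cover: "\<exists>s\<in>R. cubic s \<and> closed_cell ?D t \<subseteq> closed_cell ?D s" if t: "t \<in> R" for t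
  proof -
    let ?A = "{s \<in> R. closed_cell ?D t \<subseteq> closed_cell ?D s}"
    let ?c = "\<lambda>u. card (edge_classes u)"
    have fA: "finite (?c ` ?A)" using finR by simp
    have "t \<in> ?A" using t by simp
    then have "?c ` ?A \<noteq> {}" by blast
    then have "Max (?c ` ?A) \<in> ?c ` ?A" by (rule Max_in[OF fA])
    then obtain s where s: "s \<in> ?A" "Max (?c ` ?A) = ?c s" by blast
    have max: "?c u \<le> ?c s" if "u \<in> ?A" for u
      unfolding s(2)[symmetric] by (rule Max_ge[OF fA imageI[OF that]])
    have "cubic s"
    proof (rule ccontr)
      assume "\<not> cubic s"
      then obtain u where u: "u \<in> R" "closed_cell ?D s \<subseteq> closed_cell ?D u" "card (edge_classes s) < card (edge_classes u)"
        using grow[of s] s(1) by blast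
      then have "u \<in> ?A" using s(1) by blast
      then show False using max[of u] u(3) by simp
    qed
    then show ?thesis using s(1) by blast
  qed
  have sub_dim: "card (edge_classes t) < card (edge_classes s) \<or> t = s"
    if t: "t \<in> R" and s: "s \<in> R" and sub: "cell ?D t \<subseteq> closed_cell ?D s" for t s
  proof -
    have "cell ?D t \<noteq> {}" unfolding cell_eq using open_orthant_nonempty by blast
    then have "closed_cell ?D s \<inter> cell ?D t \<noteq> {}" using sub by blast
    then show ?thesis by (rule closed_cell_meets_cell(2)[OF s t])
  qed
  have dim_cubic: "card (edge_classes s) = 2 * g - 1" if "s \<in> R" "cubic s" for s
    using cubic_facts(1) that by (cases s) auto
  have dim_le: "card (edge_classes t) \<le> 2 * g - 1" if t: "t \<in> R" for t
  proof -
    obtain s where s: "s \<in> R" "cubic s" "closed_cell ?D t \<subseteq> closed_cell ?D s" using cover[OF t] by blast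
    then have "card (edge_classes t) \<le> card (edge_classes s)"
      using sub_dim[OF t s(1)] cell_subset_closed_cell by fastforce
    then show ?thesis using dim_cubic[OF s(1,2)] by simp
  qed
  have max_iff: "maximal_cell ?D t \<longleftrightarrow> t \<in> R \<and> cubic t" for t
  proof
    assume m: "maximal_cell ?D t"
    then have t: "t \<in> R" by (simp add: maximal_cell_def H_fan_simps)
    obtain s where s: "s \<in> R" "cubic s" "closed_cell ?D t \<subseteq> closed_cell ?D s" using cover[OF t] by blast
    then have "s = t" using m cell_subset_closed_cell unfolding maximal_cell_def H_fan_simps by blast
    then show "t \<in> R \<and> cubic t" using s by simp
  next
    assume t: "t \<in> R \<and> cubic t"
    \<comment> \<open>A cubic cell has the largest dimension, and a cell inside the closure of a
      different cell has smaller dimension than it.\<close>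
    have "s = t" if s: "s \<in> R" "cell ?D t \<subseteq> closed_cell ?D s" for s
      using sub_dim[OF _ s] dim_le[OF s(1)] dim_cubic t by fastforce
    then show "maximal_cell ?D t" using t by (simp add: maximal_cell_def H_fan_simps)
  qed
  have ladder_type: "\<exists>\<sigma> \<tau>. combinatorial_type G w \<and> hyp_involution G w \<sigma> \<tau> \<and> (\<forall>v\<in>verts G. \<sigma> v \<noteq> v \<and> valence G v = 3)"
    if "is_ladder G" "\<forall>v\<in>verts G. w v = 0" for G w
    using is_ladder_involution[OF that] by blast
  \<comment> \<open>The underlying graph already accounts for the whole genus, so nothing is left
    for the weights.\<close>
  have w0: "\<forall>v\<in>verts G. w v = 0" if t: "(G, w, r) \<in> R" and gg: "graph_genus G = int g" for G w r
  proof -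
    have "finite (verts G)" using type_facts(1)[OF t] by (simp add: finite_graph_def)
    moreover have "(\<Sum>v\<in>verts G. int (w v)) = 0" using type(2)[OF t] gg by (simp add: type_genus_def)
    ultimately show ?thesis by (simp add: sum_nonneg_eq_0_iff)
  qed
  have ladder_cubic: "cubic (G, w, r)" if t: "(G, w, r) \<in> R" and L: "is_ladder G" "graph_genus G = int g" for G w r
  proof -
    obtain \<sigma> \<tau> where st: "combinatorial_type G w" "hyp_involution G w \<sigma> \<tau>" "\<forall>v\<in>verts G. \<sigma> v \<noteq> v \<and> valence G v = 3"
      using ladder_type[OF L(1) w0[OF t L(2)]] by blast
    have "(G, w, involution_relation G \<tau>) \<in> hyperelliptic_types g"
      unfolding hyperelliptic_types_iff[OF g] using st(1,2) type(2)[OF t] by blast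
    \<comment> \<open>The exchange of the two copies of the tree gives some hyperelliptic relation
      on \<open>G\<close>; both it and \<open>r\<close> are the cut relation, so \<open>r\<close>
      comes from a free involution.\<close>
    then have "involution_relation G \<tau> = cut_relation G" by (rule hyperelliptic_relation[OF g])
    also have "\<dots> = r" using hyperelliptic_relation[OF g, of G w r] t RC by auto
    finally show ?thesis using st(2,3) by (auto simp: cubic_def)
  qed
  \<comment> \<open>The fan dimension is a maximum, so a member is needed: a single vertex of weight
    \<open>g\<close> is hyperelliptic with the identity as its involution.\<close>
  have R0: "R \<noteq> {}"
  proof -
    let ?G = "\<lparr>verts = {0}, edges = {}, ends = \<lambda>_. {}\<rparr> :: (nat, nat) mgraph"
    have "combinatorial_type ?G (\<lambda>_. g)" using g
      by (simp add: combinatorial_type_def finite_graph_def connected_graph_def)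
    moreover have "type_genus ?G (\<lambda>_. g) = int g" by (simp add: type_genus_def graph_genus_def)
    moreover have "hyp_involution ?G (\<lambda>_. g) id id" by (simp add: hyp_involution_def)
    ultimately have "(?G, \<lambda>_. g, involution_relation ?G id) \<in> hyperelliptic_types g"
      unfolding hyperelliptic_types_iff[OF g] by blast
    then show ?thesis using R unfolding iso_representatives_def by blast
  qed
  have pure: "pure_of_dim ?D (2 * g - 1)"
  proof -
    obtain s where s: "s \<in> R" "cubic s" using R0 cover by blast
    have "fan_dim ?D = 2 * g - 1"
      unfolding fan_dim_def H_fan_simps
    proof (rule Max_eqI)
      show "finite (cell_dim ?D ` R)" using finR by simp
      show "y \<le> 2 * g - 1" if "y \<in> cell_dim ?D ` R" for y using that dim_le by (auto simp: cell_dim_eq)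
      show "2 * g - 1 \<in> cell_dim ?D ` R" using s dim_cubic[OF s] by (intro image_eqI[of _ _ s]) (simp_all add: cell_dim_eq)
    qed
    then show ?thesis using max_iff dim_cubic by (simp add: pure_of_dim_def cell_dim_eq)
  qed
  have third: "maximal_cell ?D (G, w, r) \<longleftrightarrow> is_ladder G \<and> graph_genus G = int g" if t: "(G, w, r) \<in> R" for G w r
    using max_iff t cubic_facts(2,3)[OF t] ladder_cubic[OF t] by blast
  have fourth: "\<exists>!t. maximal_cell ?D t \<and> graph_iso L (fst t)"
    if L: "is_ladder L" "graph_genus L = int g" for L :: "(nat, nat) mgraph"
  proof -
    obtain \<sigma> \<tau> where st: "combinatorial_type L (\<lambda>_. 0)" "hyp_involution L (\<lambda>_. 0) \<sigma> \<tau>" "\<forall>v\<in>verts L. \<sigma> v \<noteq> v \<and> valence L v = 3"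
      using ladder_type[OF L(1), of "\<lambda>_. 0"] by blast
    have fL: "finite_graph L" using st(1) by (simp add: combinatorial_type_def)
    have "(L, \<lambda>_. 0, involution_relation L \<tau>) \<in> hyperelliptic_types g"
      unfolding hyperelliptic_types_iff[OF g] using st(1,2) L(2) by (auto simp: type_genus_def)
    then obtain G w r f h where G: "(G, w, r) \<in> R" "contracts f h {} L (\<lambda>_. 0) G w"
      by (rule representative_exists[OF g R])
    have iso: "graph_iso L G" using G(2) unfolding contracts_empty_iff[OF fL] graph_iso_def by blast
    have genus: "graph_genus G = int g"
    proof -
      have "bij_betw f (verts L) (verts G)" "bij_betw h (edges L) (edges G)"
        using G(2) unfolding contracts_empty_iff[OF fL] by (auto simp: graph_iso_via_def)
      then show ?thesis using L(2) by (simp add: graph_genus_def bij_betw_same_card)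
    qed
    have lad: "is_ladder G"
    proof -
      obtain T :: "(nat, nat) mgraph" and a b where T: "tree_graph T" "2 \<le> card (verts T)" "\<forall>v\<in>verts T. valence T v \<le> 3"
        and ab: "graph_iso_via a b (ladder T) L" using L(1) unfolding is_ladder_def graph_iso_def by blast
      obtain c d where cd: "graph_iso_via c d L G" using iso by (auto simp: graph_iso_def)
      have "b e \<in> edges L" if "e \<in> edges (ladder T)" for e using ab that by (auto simp: graph_iso_via_def bij_betw_def)
      then have "graph_iso_via (c \<circ> a) (d \<circ> b) (ladder T) G"
        using ab cd unfolding graph_iso_via_def by (auto simp: image_comp intro: bij_betw_trans)
      then show ?thesis using T unfolding is_ladder_def graph_iso_def by blast
    qed
    show ?thesis
    proof (rule ex1I[of _ "(G, w, r)"])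
      show "maximal_cell ?D (G, w, r) \<and> graph_iso L (fst (G, w, r))" using third[OF G(1)] lad genus iso by simp
      fix t assume t: "maximal_cell ?D t \<and> graph_iso L (fst t)"
      obtain G' w' r' where tt: "t = (G', w', r')" by (metis surj_pair)
      have t': "(G', w', r') \<in> R" "cubic (G', w', r')" using t max_iff tt by auto
      \<comment> \<open>Vanishing weights turn an isomorphism of the underlying graphs into one of
        weighted graphs, so \<open>iso_unique\<close> decides uniqueness.\<close>
      have w': "\<forall>v\<in>verts G'. w' v = 0" by (rule w0[OF t'(1) cubic_facts(3)[OF t']])
      obtain f' h' where fh': "graph_iso_via f' h' L G'" using t tt by (auto simp: graph_iso_def)
      have "f' v \<in> verts G'" if "v \<in> verts L" for v using fh' that by (auto simp: graph_iso_via_def bij_betw_def)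
      then have c': "contracts f' h' {} L (\<lambda>_. 0) G' w'" unfolding contracts_empty_iff[OF fL] using fh' w' by simp
      obtain a b where "contracts a b {} G w G' w'" using contracts_unique[OF G(2) c' fL] by metis
      then show "t = (G, w, r)" using iso_unique[OF G(1) t'(1)] tt by simp
    qed
  qed
  show ?thesis using stacky_fan_H pure third fourth by blast
qed

end
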